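(* Let $k$ be a field of characteristic $p>0$, $G$ a finite diagonalizable group scheme over $k$ with character group $\Lambda$, $Y$ a normal variety, and $X$ a $G$-variety over $Y$ with quotient $\pi: X\to Y$. Let $D$ be a prime divisor on $X$ with generic point $x$, and let $y=\pi(x)$. Let $X_y$ be the fibre of $\pi$ at $y$, $\bar{A}=\mathcal{O}(X_y)$, and $\bar{I}$ the largest proper $\Lambda$-graded ideal of $\bar A$. (i) There exists a unique subgroup scheme $H\subset G$ such that $\bar{A}=\bar{A}^{H_{\kappa(y)}}\oplus\bar{I}$. (ii) The morphism $X_y/H_{\kappa(y)}=\mathrm{Spec}(\bar{A}^{H_{\kappa(y)}})\to\mathrm{Spec}(\kappa(y))$ is a torsor under $(G/H)_{\kappa(y)}$. (iii) We have $H_{\kappa(y)}=C_{G_{\kappa(y)}}(x)$ and $\mathrm{Spec}(\bar{A}^{H_{\kappa(y)}})\simeq G_{\kappa(y)}\cdot x$ as $(G/H)_{\kappa(y)}$-schemes.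
   Context: Schemes are separated and of finite type over $k$ unless mentioned otherwise; a variety is a geometrically integral scheme. A $G$-variety over $Y$ is a variety $X$ with a faithful $G$-action (every nontrivial subgroup scheme acts nontrivially), covered by open affine $G$-stable subsets, whose quotient $X/G$ is identified with $Y$; the quotient morphism $\pi$ is finite and surjective. $\Lambda=\mathrm{Hom}_{\mathrm{gp}}(G,\mathbb{G}_m)$, and $G$-actions on algebras correspond to $\Lambda$-gradings. $E=\pi(D)$ is a prime divisor on $Y$ with generic point $y$, $B=\mathcal{O}_{Y,y}$ is a discrete valuation ring with maximal ideal $\mathfrak{n}$ and residue field $\kappa(y)$, $A=\mathcal{O}_{X,G\cdot D}$ is the semi-local ring of $X$ at the generic points of $G\cdot D$ (the smallest closed $G$-stable subscheme containing $D$), and $\bar{A}=A/\mathfrak{n}A=\mathcal{O}(X_y)$ is an artinian $\kappa(y)$-algebra with an action of $G_{\kappa(y)}$, hence a $\Lambda$-grading $\bar{A}=\bigoplus_\lambda\bar{A}_\lambda$. Here $x$ is viewed as a closed point of the finite $\kappa(y)$-scheme $X_y$; $G_{\kappa(y)}\cdot x$ is the smallest closed $G_{\kappa(y)}$-stable subscheme of $X_y$ containing $x$, and $C_{G_{\kappa(y)}}(x)$ is the largest subgroup scheme of $G_{\kappa(y)}$ acting trivially on the closed subscheme $x=\mathrm{Spec}\,\kappa(x)$. *)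

theory Defs
  imports "HOL-Algebra.Algebra" "HOL-Analysis.Abstract_Topology" "HOL-Analysis.Function_Topology"
begin

section \<open>Algebras and tensor products of algebras\<close>

definition fin_gen_algebra ::
  "('r, 'x) ring_scheme \<Rightarrow> ('a, 'y) ring_scheme \<Rightarrow> ('r \<Rightarrow> 'a) \<Rightarrow> bool" where
  "fin_gen_algebra R A \<phi> \<longleftrightarrow>
     (\<exists>E. finite E \<and> E \<subseteq> carrier A \<and> generate_ring A (\<phi> ` carrier R \<union> E) = carrier A)"

definition fin_gen_module ::
  "('r, 'x) ring_scheme \<Rightarrow> ('a, 'y) ring_scheme \<Rightarrow> ('r \<Rightarrow> 'a) \<Rightarrow> bool" where
  "fin_gen_module R A \<phi> \<longleftrightarrow>
     (\<exists>E. finite E \<and> E \<subseteq> carrier A \<and>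
        (\<forall>a\<in>carrier A. \<exists>c\<in>E \<rightarrow> carrier R. a = finsum A (\<lambda>e. \<phi> (c e) \<otimes>\<^bsub>A\<^esub> e) E))"

text \<open>The monoid ring \<open>\<int>[A \<times> B]\<close> of the multiplicative monoid \<open>A \<times> B\<close>. Its quotient by the
  bilinearity and \<open>R\<close>-balancedness relations is \<open>A \<otimes>\<^sub>R B\<close>: these relations are stable under
  multiplication by basis elements, so the ideal they generate is the additive subgroup they generate.\<close>

definition free_pair_ring ::
  "('a, 'x) ring_scheme \<Rightarrow> ('b, 'y) ring_scheme \<Rightarrow> (('a \<times> 'b) \<Rightarrow>\<^sub>0 int) ring" where
  "free_pair_ring A B =
     \<lparr>carrier = {c. Poly_Mapping.keys c \<subseteq> carrier A \<times> carrier B},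
      monoid.mult = (\<lambda>p q. frag_extend (\<lambda>(a, b).
                frag_extend (\<lambda>(a', b'). frag_of (a \<otimes>\<^bsub>A\<^esub> a', b \<otimes>\<^bsub>B\<^esub> b')) q) p),
      monoid.one = frag_of (\<one>\<^bsub>A\<^esub>, \<one>\<^bsub>B\<^esub>),
      ring.zero = 0,
      ring.add = (+)\<rparr>"

definition tensor_relations ::
  "('r, 'z) ring_scheme \<Rightarrow> ('a, 'x) ring_scheme \<Rightarrow> ('r \<Rightarrow> 'a) \<Rightarrow>
   ('b, 'y) ring_scheme \<Rightarrow> ('r \<Rightarrow> 'b) \<Rightarrow> (('a \<times> 'b) \<Rightarrow>\<^sub>0 int) set" where
  "tensor_relations R A \<phi> B \<psi> =
     {frag_of (a \<oplus>\<^bsub>A\<^esub> a', b) - frag_of (a, b) - frag_of (a', b) | a a' b.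
        a \<in> carrier A \<and> a' \<in> carrier A \<and> b \<in> carrier B} \<union>
     {frag_of (a, b \<oplus>\<^bsub>B\<^esub> b') - frag_of (a, b) - frag_of (a, b') | a b b'.
        a \<in> carrier A \<and> b \<in> carrier B \<and> b' \<in> carrier B} \<union>
     {frag_of (\<phi> r \<otimes>\<^bsub>A\<^esub> a, b) - frag_of (a, \<psi> r \<otimes>\<^bsub>B\<^esub> b) | r a b.
        r \<in> carrier R \<and> a \<in> carrier A \<and> b \<in> carrier B}"

definition tensor_ideal ::
  "('r, 'z) ring_scheme \<Rightarrow> ('a, 'x) ring_scheme \<Rightarrow> ('r \<Rightarrow> 'a) \<Rightarrow>
   ('b, 'y) ring_scheme \<Rightarrow> ('r \<Rightarrow> 'b) \<Rightarrow> (('a \<times> 'b) \<Rightarrow>\<^sub>0 int) set" where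
  "tensor_ideal R A \<phi> B \<psi> = genideal (free_pair_ring A B) (tensor_relations R A \<phi> B \<psi>)"

definition tensor_ring ::
  "('r, 'z) ring_scheme \<Rightarrow> ('a, 'x) ring_scheme \<Rightarrow> ('r \<Rightarrow> 'a) \<Rightarrow>
   ('b, 'y) ring_scheme \<Rightarrow> ('r \<Rightarrow> 'b) \<Rightarrow> (('a \<times> 'b) \<Rightarrow>\<^sub>0 int) set ring" where
  "tensor_ring R A \<phi> B \<psi> = free_pair_ring A B Quot tensor_ideal R A \<phi> B \<psi>"

definition pure_tensor ::
  "('r, 'z) ring_scheme \<Rightarrow> ('a, 'x) ring_scheme \<Rightarrow> ('r \<Rightarrow> 'a) \<Rightarrow>
   ('b, 'y) ring_scheme \<Rightarrow> ('r \<Rightarrow> 'b) \<Rightarrow> 'a \<Rightarrow> 'b \<Rightarrow> (('a \<times> 'b) \<Rightarrow>\<^sub>0 int) set" where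
  "pure_tensor R A \<phi> B \<psi> a b =
     a_r_coset (free_pair_ring A B) (tensor_ideal R A \<phi> B \<psi>) (frag_of (a, b))"

text \<open>Integrally closed in the fraction field: a fraction \<open>a / b\<close> that is a root of a monic
  polynomial (with denominators cleared) lies in the ring.\<close>

definition integrally_closed :: "('a, 'x) ring_scheme \<Rightarrow> bool" where
  "integrally_closed R \<longleftrightarrow>
     (\<forall>a\<in>carrier R. \<forall>b\<in>carrier R - {\<zero>\<^bsub>R\<^esub>}.
        (\<exists>(n::nat) c. c \<in> {..<n} \<rightarrow> carrier R \<and>
           a [^]\<^bsub>R\<^esub> n \<oplus>\<^bsub>R\<^esub>
             finsum R (\<lambda>i. c i \<otimes>\<^bsub>R\<^esub> (a [^]\<^bsub>R\<^esub> i \<otimes>\<^bsub>R\<^esub> b [^]\<^bsub>R\<^esub> (n - i))) {..<n} = \<zero>\<^bsub>R\<^esub>)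
        \<longrightarrow> (\<exists>q\<in>carrier R. a = q \<otimes>\<^bsub>R\<^esub> b))"


section \<open>Schemes over a field\<close>

record ('p, 'a) ringed_space =
  top_of :: "'p topology"
  sec :: "'p set \<Rightarrow> 'a ring"
  res :: "'p set \<Rightarrow> 'p set \<Rightarrow> 'a \<Rightarrow> 'a"

definition sheaf_of_rings :: "('p, 'a, 'm) ringed_space_scheme \<Rightarrow> bool" where
  "sheaf_of_rings XX \<longleftrightarrow>
     (\<forall>U. openin (top_of XX) U \<longrightarrow> cring (sec XX U)) \<and>
     (\<forall>U V. openin (top_of XX) U \<and> openin (top_of XX) V \<and> V \<subseteq> U \<longrightarrow>
        res XX U V \<in> ring_hom (sec XX U) (sec XX V)) \<and>
     (\<forall>U. openin (top_of XX) U \<longrightarrow> (\<forall>f\<in>carrier (sec XX U). res XX U U f = f)) \<and>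
     (\<forall>U V W. openin (top_of XX) U \<and> openin (top_of XX) V \<and> openin (top_of XX) W \<and> W \<subseteq> V \<and> V \<subseteq> U \<longrightarrow>
        (\<forall>f\<in>carrier (sec XX U). res XX V W (res XX U V f) = res XX U W f)) \<and>
     (\<forall>\<U>. (\<forall>V\<in>\<U>. openin (top_of XX) V) \<longrightarrow>
        (\<forall>f\<in>carrier (sec XX (\<Union>\<U>)). \<forall>g\<in>carrier (sec XX (\<Union>\<U>)).
           (\<forall>V\<in>\<U>. res XX (\<Union>\<U>) V f = res XX (\<Union>\<U>) V g) \<longrightarrow> f = g) \<and>
        (\<forall>s. (\<forall>V\<in>\<U>. s V \<in> carrier (sec XX V)) \<and>
             (\<forall>V\<in>\<U>. \<forall>W\<in>\<U>. res XX V (V \<inter> W) (s V) = res XX W (V \<inter> W) (s W)) \<longrightarrow>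
             (\<exists>f\<in>carrier (sec XX (\<Union>\<U>)). \<forall>V\<in>\<U>. res XX (\<Union>\<U>) V f = s V)))"

definition basic_open :: "('a, 'm) ring_scheme \<Rightarrow> 'a \<Rightarrow> 'a set set" where
  "basic_open R f = {P. primeideal P R \<and> f \<notin> P}"

definition Spec_top :: "('a, 'm) ring_scheme \<Rightarrow> 'a set topology" where
  "Spec_top R = topology_generated_by (basic_open R ` carrier R)"

text \<open>\<open>\<phi>\<close> identifies \<open>S\<close> with the localization of \<open>R\<close> at the powers of \<open>f\<close>.\<close>

definition localization_away ::
  "('a, 'm) ring_scheme \<Rightarrow> 'a \<Rightarrow> ('b, 'n) ring_scheme \<Rightarrow> ('a \<Rightarrow> 'b) \<Rightarrow> bool" where
  "localization_away R f S \<phi> \<longleftrightarrow>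
     \<phi> \<in> ring_hom R S \<and> \<phi> f \<in> Units S \<and>
     (\<forall>s\<in>carrier S. \<exists>a\<in>carrier R. \<exists>n::nat. s \<otimes>\<^bsub>S\<^esub> \<phi> f [^]\<^bsub>S\<^esub> n = \<phi> a) \<and>
     (\<forall>a\<in>carrier R. \<phi> a = \<zero>\<^bsub>S\<^esub> \<longrightarrow> (\<exists>n::nat. f [^]\<^bsub>R\<^esub> n \<otimes>\<^bsub>R\<^esub> a = \<zero>\<^bsub>R\<^esub>))"

text \<open>The structure sheaf of \<open>Spec R\<close> is the sheaf with \<open>D(f) \<mapsto> R\<^sub>f\<close> on the basis of the \<open>D(f)\<close>,
  so \<open>(U, \<O>\<^sub>U) \<cong> Spec \<O>(U)\<close> means: a homeomorphism onto \<open>Spec \<O>(U)\<close> under which each restriction to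
  \<open>D(f)\<close> is localization at \<open>f\<close>.\<close>

definition affine_open :: "('p, 'a, 'm) ringed_space_scheme \<Rightarrow> 'p set \<Rightarrow> bool" where
  "affine_open XX U \<longleftrightarrow> openin (top_of XX) U \<and>
     (\<exists>h. homeomorphic_map (subtopology (top_of XX) U) (Spec_top (sec XX U)) h \<and>
        (\<forall>f\<in>carrier (sec XX U).
           localization_away (sec XX U) f (sec XX {x\<in>U. f \<notin> h x}) (res XX U {x\<in>U. f \<notin> h x})))"

definition is_scheme :: "('p, 'a, 'm) ringed_space_scheme \<Rightarrow> bool" where
  "is_scheme XX \<longleftrightarrow> sheaf_of_rings XX \<and> (\<forall>x\<in>topspace (top_of XX). \<exists>U. x \<in> U \<and> affine_open XX U)"

text \<open>A morphism to \<open>Spec k\<close> is a ring homomorphism from \<open>k\<close> to the global sections.\<close>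

record ('p, 'a, 'k) kscheme = "('p, 'a) ringed_space" +
  struct_map :: "'k \<Rightarrow> 'a"

definition struct_on :: "('p, 'a, 'k) kscheme \<Rightarrow> 'p set \<Rightarrow> 'k \<Rightarrow> 'a" where
  "struct_on XX U r = res XX (topspace (top_of XX)) U (struct_map XX r)"

definition scheme_over :: "'k ring \<Rightarrow> ('p, 'a, 'k) kscheme \<Rightarrow> bool" where
  "scheme_over k XX \<longleftrightarrow> is_scheme XX \<and> struct_map XX \<in> ring_hom k (sec XX (topspace (top_of XX)))"

definition finite_type :: "'k ring \<Rightarrow> ('p, 'a, 'k) kscheme \<Rightarrow> bool" where
  "finite_type k XX \<longleftrightarrow>
     (\<exists>\<U>. finite \<U> \<and> \<Union>\<U> = topspace (top_of XX) \<and>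
        (\<forall>U\<in>\<U>. affine_open XX U \<and> fin_gen_algebra k (sec XX U) (struct_on XX U)))"

text \<open>The diagonal is a closed immersion iff for affine opens \<open>U\<close>, \<open>V\<close> the intersection is affine
  and \<open>\<O>(U) \<otimes> \<O>(V) \<rightarrow> \<O>(U \<inter> V)\<close> is surjective.\<close>

definition separated_scheme :: "('p, 'a, 'm) ringed_space_scheme \<Rightarrow> bool" where
  "separated_scheme XX \<longleftrightarrow>
     (\<forall>U V. affine_open XX U \<and> affine_open XX V \<longrightarrow>
        affine_open XX (U \<inter> V) \<and>
        generate_ring (sec XX (U \<inter> V))
          (res XX U (U \<inter> V) ` carrier (sec XX U) \<union> res XX V (U \<inter> V) ` carrier (sec XX V))
        = carrier (sec XX (U \<inter> V)))"

definition integral_scheme :: "('p, 'a, 'm) ringed_space_scheme \<Rightarrow> bool" where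
  "integral_scheme XX \<longleftrightarrow> topspace (top_of XX) \<noteq> {} \<and>
     (\<forall>U. openin (top_of XX) U \<and> U \<noteq> {} \<longrightarrow> domain (sec XX U))"

text \<open>\<open>X\<close> and its base change to an algebraic closure are integral. Given that \<open>X\<close> is integral, the
  latter is covered by pairwise intersecting opens \<open>Spec (\<O>(U) \<otimes>\<^sub>k \<k>)\<close>, with \<open>U\<close> affine and
  nonempty and \<open>\<k>\<close> the algebraic closure, hence is integral iff these rings are domains.\<close>

definition geometrically_integral :: "'k ring \<Rightarrow> ('p, 'a, 'k) kscheme \<Rightarrow> bool" where
  "geometrically_integral k XX \<longleftrightarrow> integral_scheme XX \<and>
     (\<forall>U. affine_open XX U \<and> U \<noteq> {} \<longrightarrow>
        domain (tensor_ring k (sec XX U) (struct_on XX U) (field.alg_closure k) (ring.indexed_const k)))"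

definition is_variety :: "'k ring \<Rightarrow> ('p, 'a, 'k) kscheme \<Rightarrow> bool" where
  "is_variety k XX \<longleftrightarrow> scheme_over k XX \<and> separated_scheme XX \<and> finite_type k XX \<and>
     geometrically_integral k XX"


subsection \<open>Stalks\<close>

definition germ ::
  "('p, 'a, 'm) ringed_space_scheme \<Rightarrow> 'p \<Rightarrow> 'p set \<Rightarrow> 'a \<Rightarrow> ('p set \<times> 'a) set" where
  "germ XX x U f =
     {(V, g). openin (top_of XX) V \<and> x \<in> V \<and> g \<in> carrier (sec XX V) \<and>
        (\<exists>W. openin (top_of XX) W \<and> x \<in> W \<and> W \<subseteq> U \<inter> V \<and> res XX U W f = res XX V W g)}"

definition stalk ::
  "('p, 'a, 'm) ringed_space_scheme \<Rightarrow> 'p \<Rightarrow> ('p set \<times> 'a) set ring" where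
  "stalk XX x =
     \<lparr>carrier = {germ XX x U f | U f. openin (top_of XX) U \<and> x \<in> U \<and> f \<in> carrier (sec XX U)},
      monoid.mult = (\<lambda>C D. \<Union>(U, f)\<in>C. \<Union>(V, g)\<in>D. germ XX x (U \<inter> V)
                (res XX U (U \<inter> V) f \<otimes>\<^bsub>sec XX (U \<inter> V)\<^esub> res XX V (U \<inter> V) g)),
      monoid.one = germ XX x (topspace (top_of XX)) \<one>\<^bsub>sec XX (topspace (top_of XX))\<^esub>,
      ring.zero = germ XX x (topspace (top_of XX)) \<zero>\<^bsub>sec XX (topspace (top_of XX))\<^esub>,
      ring.add = (\<lambda>C D. \<Union>(U, f)\<in>C. \<Union>(V, g)\<in>D. germ XX x (U \<inter> V)
                (res XX U (U \<inter> V) f \<oplus>\<^bsub>sec XX (U \<inter> V)\<^esub> res XX V (U \<inter> V) g))\<rparr>"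

text \<open>The map into the stalk at \<open>x\<close> of \<open>Z\<close> induced by a map \<open>\<theta>\<close> of sheaves with target \<open>Z\<close>.\<close>

definition stalk_map ::
  "('p, 'b, 'm) ringed_space_scheme \<Rightarrow> 'p \<Rightarrow> ('p set \<Rightarrow> 'a \<Rightarrow> 'b) \<Rightarrow>
   ('p set \<times> 'a) set \<Rightarrow> ('p set \<times> 'b) set" where
  "stalk_map Z x \<theta> C = (\<Union>(V, g)\<in>C. germ Z x V (\<theta> V g))"

definition stalk_max_ideal ::
  "('p, 'a, 'm) ringed_space_scheme \<Rightarrow> 'p \<Rightarrow> ('p set \<times> 'a) set set" where
  "stalk_max_ideal XX x = carrier (stalk XX x) - Units (stalk XX x)"

definition residue_field ::
  "('p, 'a, 'm) ringed_space_scheme \<Rightarrow> 'p \<Rightarrow> ('p set \<times> 'a) set set ring" where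
  "residue_field XX x = stalk XX x Quot stalk_max_ideal XX x"

definition residue_struct ::
  "('p, 'a, 'k) kscheme \<Rightarrow> 'p \<Rightarrow> 'k \<Rightarrow> ('p set \<times> 'a) set set" where
  "residue_struct XX x r =
     a_r_coset (stalk XX x) (stalk_max_ideal XX x) (germ XX x (topspace (top_of XX)) (struct_map XX r))"

definition normal_scheme :: "('p, 'a, 'm) ringed_space_scheme \<Rightarrow> bool" where
  "normal_scheme XX \<longleftrightarrow>
     (\<forall>x\<in>topspace (top_of XX). domain (stalk XX x) \<and> integrally_closed (stalk XX x))"


subsection \<open>Morphisms\<close>

definition preim :: "('p, 'a, 'm) ringed_space_scheme \<Rightarrow> ('p \<Rightarrow> 'q) \<Rightarrow> 'q set \<Rightarrow> 'p set" where
  "preim XX \<pi> V = {x \<in> topspace (top_of XX). \<pi> x \<in> V}"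

text \<open>The ringed space \<open>(Y, \<pi>\<^sub>*\<O>\<^sub>X)\<close>.\<close>

definition pushforward ::
  "('p, 'a, 'm) ringed_space_scheme \<Rightarrow> ('q, 'b, 'n) ringed_space_scheme \<Rightarrow> ('p \<Rightarrow> 'q) \<Rightarrow>
   ('q, 'a) ringed_space" where
  "pushforward XX YY \<pi> =
     \<lparr>top_of = top_of YY,
      sec = (\<lambda>V. sec XX (preim XX \<pi> V)),
      res = (\<lambda>V W. res XX (preim XX \<pi> V) (preim XX \<pi> W))\<rparr>"

definition scheme_morphism_over ::
  "'k ring \<Rightarrow> ('p, 'a, 'k) kscheme \<Rightarrow> ('q, 'b, 'k) kscheme \<Rightarrow> ('p \<Rightarrow> 'q) \<Rightarrow>
   ('q set \<Rightarrow> 'b \<Rightarrow> 'a) \<Rightarrow> bool" where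
  "scheme_morphism_over k XX YY \<pi> \<pi>s \<longleftrightarrow>
     continuous_map (top_of XX) (top_of YY) \<pi> \<and>
     (\<forall>V. openin (top_of YY) V \<longrightarrow> \<pi>s V \<in> ring_hom (sec YY V) (sec XX (preim XX \<pi> V))) \<and>
     (\<forall>V W. openin (top_of YY) V \<and> openin (top_of YY) W \<and> W \<subseteq> V \<longrightarrow>
        (\<forall>g\<in>carrier (sec YY V).
           \<pi>s W (res YY V W g) = res XX (preim XX \<pi> V) (preim XX \<pi> W) (\<pi>s V g))) \<and>
     (\<forall>x\<in>topspace (top_of XX). \<forall>V. openin (top_of YY) V \<and> \<pi> x \<in> V \<longrightarrow>
        (\<forall>g\<in>carrier (sec YY V).
           germ XX x (preim XX \<pi> V) (\<pi>s V g) \<in> Units (stalk XX x) \<longrightarrow>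
           germ YY (\<pi> x) V g \<in> Units (stalk YY (\<pi> x)))) \<and>
     (\<forall>r\<in>carrier k. \<pi>s (topspace (top_of YY)) (struct_map YY r) = struct_map XX r)"

definition finite_morphism ::
  "('p, 'a, 'm) ringed_space_scheme \<Rightarrow> ('q, 'b, 'n) ringed_space_scheme \<Rightarrow> ('p \<Rightarrow> 'q) \<Rightarrow>
   ('q set \<Rightarrow> 'b \<Rightarrow> 'a) \<Rightarrow> bool" where
  "finite_morphism XX YY \<pi> \<pi>s \<longleftrightarrow>
     (\<forall>y\<in>topspace (top_of YY). \<exists>V. y \<in> V \<and> affine_open YY V \<and> affine_open XX (preim XX \<pi> V) \<and>
        fin_gen_module (sec YY V) (sec XX (preim XX \<pi> V)) (\<pi>s V))"


subsection \<open>Prime divisors\<close>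

definition irreducible_closed :: "'p topology \<Rightarrow> 'p set \<Rightarrow> bool" where
  "irreducible_closed T Z \<longleftrightarrow> closedin T Z \<and> Z \<noteq> {} \<and>
     (\<forall>Z1 Z2. closedin T Z1 \<and> closedin T Z2 \<and> Z = Z1 \<union> Z2 \<longrightarrow> Z = Z1 \<or> Z = Z2)"

text \<open>A prime divisor is identified with its underlying irreducible closed subset of codimension one
  (to be used on integral schemes only).\<close>

definition prime_divisor :: "('p, 'a, 'm) ringed_space_scheme \<Rightarrow> 'p set \<Rightarrow> bool" where
  "prime_divisor XX D \<longleftrightarrow> irreducible_closed (top_of XX) D \<and> D \<noteq> topspace (top_of XX) \<and>
     (\<forall>Z. irreducible_closed (top_of XX) Z \<and> D \<subseteq> Z \<longrightarrow> Z = D \<or> Z = topspace (top_of XX))"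

definition generic_point :: "('p, 'a, 'm) ringed_space_scheme \<Rightarrow> 'p set \<Rightarrow> 'p \<Rightarrow> bool" where
  "generic_point XX D x \<longleftrightarrow> x \<in> topspace (top_of XX) \<and> D = top_of XX closure_of {x}"


section \<open>Diagonalizable group schemes and their actions\<close>

text \<open>For a finite commutative group \<open>\<Lambda>\<close> and a ring \<open>A\<close>, the group algebra \<open>A[\<Lambda>]\<close> is realised on
  the functions \<open>\<Lambda> \<rightarrow> A\<close>. The finite diagonalizable group scheme over \<open>k\<close> with character group \<open>\<Lambda>\<close>
  is \<open>G = Spec k[\<Lambda>]\<close>, with comultiplication \<open>\<lambda> \<mapsto> \<lambda> \<otimes> \<lambda>\<close>, counit \<open>\<lambda> \<mapsto> 1\<close> and antipode
  \<open>\<lambda> \<mapsto> \<lambda>\<inverse>\<close>; for a \<open>k\<close>-algebra \<open>A\<close> one has \<open>A \<otimes>\<^sub>k k[\<Lambda>] = A[\<Lambda>]\<close>, and in particular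
  \<open>k[\<Lambda>] \<otimes>\<^sub>k k[\<Lambda>] = (k[\<Lambda>])[\<Lambda>]\<close>.\<close>

definition group_algebra ::
  "('l, 'n) monoid_scheme \<Rightarrow> ('a, 'm) ring_scheme \<Rightarrow> ('l \<Rightarrow> 'a) ring" where
  "group_algebra \<Lambda> A =
     \<lparr>carrier = carrier \<Lambda> \<rightarrow>\<^sub>E carrier A,
      monoid.mult = (\<lambda>f g. \<lambda>l\<in>carrier \<Lambda>.
                finsum A (\<lambda>m. f m \<otimes>\<^bsub>A\<^esub> g (inv\<^bsub>\<Lambda>\<^esub> m \<otimes>\<^bsub>\<Lambda>\<^esub> l)) (carrier \<Lambda>)),
      monoid.one = (\<lambda>l\<in>carrier \<Lambda>. if l = \<one>\<^bsub>\<Lambda>\<^esub> then \<one>\<^bsub>A\<^esub> else \<zero>\<^bsub>A\<^esub>),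
      ring.zero = (\<lambda>l\<in>carrier \<Lambda>. \<zero>\<^bsub>A\<^esub>),
      ring.add = (\<lambda>f g. \<lambda>l\<in>carrier \<Lambda>. f l \<oplus>\<^bsub>A\<^esub> g l)\<rparr>"

definition ga_const ::
  "('l, 'n) monoid_scheme \<Rightarrow> ('a, 'm) ring_scheme \<Rightarrow> 'a \<Rightarrow> 'l \<Rightarrow> 'a" where
  "ga_const \<Lambda> A a = (\<lambda>l\<in>carrier \<Lambda>. if l = \<one>\<^bsub>\<Lambda>\<^esub> then a else \<zero>\<^bsub>A\<^esub>)"

definition ga_map :: "('l, 'n) monoid_scheme \<Rightarrow> ('a \<Rightarrow> 'b) \<Rightarrow> ('l \<Rightarrow> 'a) \<Rightarrow> 'l \<Rightarrow> 'b" where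
  "ga_map \<Lambda> \<phi> f = (\<lambda>l\<in>carrier \<Lambda>. \<phi> (f l))"

definition ga_comult ::
  "('l, 'n) monoid_scheme \<Rightarrow> ('a, 'm) ring_scheme \<Rightarrow> ('l \<Rightarrow> 'a) \<Rightarrow> 'l \<Rightarrow> 'l \<Rightarrow> 'a" where
  "ga_comult \<Lambda> A f = (\<lambda>l\<in>carrier \<Lambda>. \<lambda>m\<in>carrier \<Lambda>. if m = l then f l else \<zero>\<^bsub>A\<^esub>)"

text \<open>Closed subgroup schemes of \<open>Spec K[\<Lambda>]\<close> are given by Hopf ideals; in \<open>K[\<Lambda>] \<otimes> K[\<Lambda>]\<close> the ideal
  \<open>I \<otimes> K[\<Lambda>] + K[\<Lambda>] \<otimes> I\<close> is generated by the \<open>f \<otimes> 1\<close> and \<open>1 \<otimes> f\<close> with \<open>f \<in> I\<close>.\<close>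

definition subgroup_scheme ::
  "('k, 'm) ring_scheme \<Rightarrow> ('l, 'n) monoid_scheme \<Rightarrow> ('l \<Rightarrow> 'k) set \<Rightarrow> bool" where
  "subgroup_scheme K \<Lambda> I \<longleftrightarrow> ideal I (group_algebra \<Lambda> K) \<and>
     (\<forall>f\<in>I. finsum K f (carrier \<Lambda>) = \<zero>\<^bsub>K\<^esub> \<and>
        (\<lambda>l\<in>carrier \<Lambda>. f (inv\<^bsub>\<Lambda>\<^esub> l)) \<in> I \<and>
        ga_comult \<Lambda> K f \<in> genideal (group_algebra \<Lambda> (group_algebra \<Lambda> K))
          (ga_const \<Lambda> (group_algebra \<Lambda> K) ` I \<union> ga_map \<Lambda> (ga_const \<Lambda> K) ` I))"

text \<open>The trivial subgroup scheme is cut out by the augmentation ideal.\<close>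

definition trivial_subgroup_scheme ::
  "('k, 'm) ring_scheme \<Rightarrow> ('l, 'n) monoid_scheme \<Rightarrow> ('l \<Rightarrow> 'k) set" where
  "trivial_subgroup_scheme K \<Lambda> =
     {f \<in> carrier (group_algebra \<Lambda> K). finsum K f (carrier \<Lambda>) = \<zero>\<^bsub>K\<^esub>}"

text \<open>Base change of the subgroup scheme cut out by \<open>I\<close> along \<open>\<kappa> : k \<rightarrow> K\<close>.\<close>

definition subgroup_base_change ::
  "('k \<Rightarrow> 'c) \<Rightarrow> ('c, 'm) ring_scheme \<Rightarrow> ('l, 'n) monoid_scheme \<Rightarrow> ('l \<Rightarrow> 'k) set \<Rightarrow> ('l \<Rightarrow> 'c) set"
  where
  "subgroup_base_change \<kappa> K \<Lambda> I = genideal (group_algebra \<Lambda> K) (ga_map \<Lambda> \<kappa> ` I)"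

text \<open>An action of \<open>Spec R[\<Lambda>]\<close> on \<open>Spec A\<close> over \<open>Spec R\<close>, where \<open>\<phi> : R \<rightarrow> A\<close>. The function \<open>\<rho> a\<close> is
  the family of homogeneous components of \<open>a\<close> in the associated \<open>\<Lambda>\<close>-grading.\<close>

definition coaction ::
  "('r, 'x) ring_scheme \<Rightarrow> ('l, 'n) monoid_scheme \<Rightarrow> ('a, 'y) ring_scheme \<Rightarrow> ('r \<Rightarrow> 'a) \<Rightarrow>
   ('a \<Rightarrow> 'l \<Rightarrow> 'a) \<Rightarrow> bool" where
  "coaction R \<Lambda> A \<phi> \<rho> \<longleftrightarrow>
     \<phi> \<in> ring_hom R A \<and>
     \<rho> \<in> ring_hom A (group_algebra \<Lambda> A) \<and>
     (\<forall>r\<in>carrier R. \<rho> (\<phi> r) = ga_const \<Lambda> A (\<phi> r)) \<and>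
     (\<forall>a\<in>carrier A. finsum A (\<rho> a) (carrier \<Lambda>) = a) \<and>
     (\<forall>a\<in>carrier A. \<forall>l\<in>carrier \<Lambda>. \<forall>m\<in>carrier \<Lambda>.
        \<rho> (\<rho> a l) m = (if m = l then \<rho> a l else \<zero>\<^bsub>A\<^esub>))"

text \<open>The subgroup scheme \<open>V(I)\<close> of \<open>Spec R[\<Lambda>]\<close> acts trivially on the closed subscheme \<open>V(J)\<close> of
  \<open>Spec A\<close>: the action and the projection agree as morphisms \<open>V(I) \<times> V(J) \<rightarrow> Spec A\<close>.\<close>

definition acts_trivially_on ::
  "('l, 'n) monoid_scheme \<Rightarrow> ('a, 'y) ring_scheme \<Rightarrow> ('r \<Rightarrow> 'a) \<Rightarrow> ('a \<Rightarrow> 'l \<Rightarrow> 'a) \<Rightarrow>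
   'a set \<Rightarrow> ('l \<Rightarrow> 'r) set \<Rightarrow> bool" where
  "acts_trivially_on \<Lambda> A \<phi> \<rho> J I \<longleftrightarrow>
     (\<forall>a\<in>carrier A. \<rho> a \<ominus>\<^bsub>group_algebra \<Lambda> A\<^esub> ga_const \<Lambda> A a
        \<in> genideal (group_algebra \<Lambda> A) (ga_const \<Lambda> A ` J \<union> ga_map \<Lambda> \<phi> ` I))"

text \<open>The invariants of the subgroup scheme \<open>V(I)\<close> of \<open>Spec R[\<Lambda>]\<close>: the \<open>a\<close> whose coaction is
  \<open>a \<otimes> 1\<close> in \<open>A \<otimes>\<^sub>R R[\<Lambda>]/I\<close>.\<close>

definition invariants ::
  "('l, 'n) monoid_scheme \<Rightarrow> ('a, 'y) ring_scheme \<Rightarrow> ('r \<Rightarrow> 'a) \<Rightarrow> ('a \<Rightarrow> 'l \<Rightarrow> 'a) \<Rightarrow>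
   ('l \<Rightarrow> 'r) set \<Rightarrow> 'a set" where
  "invariants \<Lambda> A \<phi> \<rho> I =
     {a \<in> carrier A. \<rho> a \<ominus>\<^bsub>group_algebra \<Lambda> A\<^esub> ga_const \<Lambda> A a
        \<in> genideal (group_algebra \<Lambda> A) (ga_map \<Lambda> \<phi> ` I)}"

definition graded_ideal ::
  "('l, 'n) monoid_scheme \<Rightarrow> ('a, 'y) ring_scheme \<Rightarrow> ('a \<Rightarrow> 'l \<Rightarrow> 'a) \<Rightarrow> 'a set \<Rightarrow> bool" where
  "graded_ideal \<Lambda> A \<rho> J \<longleftrightarrow> ideal J A \<and> (\<forall>a\<in>J. \<forall>l\<in>carrier \<Lambda>. \<rho> a l \<in> J)"

definition largest_proper_graded_ideal ::
  "('l, 'n) monoid_scheme \<Rightarrow> ('a, 'y) ring_scheme \<Rightarrow> ('a \<Rightarrow> 'l \<Rightarrow> 'a) \<Rightarrow> 'a set \<Rightarrow> bool" where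
  "largest_proper_graded_ideal \<Lambda> A \<rho> J \<longleftrightarrow> graded_ideal \<Lambda> A \<rho> J \<and> J \<noteq> carrier A \<and>
     (\<forall>J'. graded_ideal \<Lambda> A \<rho> J' \<and> J' \<noteq> carrier A \<longrightarrow> J' \<subseteq> J)"

text \<open>\<open>V(J)\<close> is the smallest closed stable subscheme of \<open>Spec A\<close> containing \<open>V(\<m>)\<close>; stable closed
  subschemes correspond to graded ideals.\<close>

definition orbit_ideal ::
  "('l, 'n) monoid_scheme \<Rightarrow> ('a, 'y) ring_scheme \<Rightarrow> ('a \<Rightarrow> 'l \<Rightarrow> 'a) \<Rightarrow> 'a set \<Rightarrow> 'a set \<Rightarrow> bool" where
  "orbit_ideal \<Lambda> A \<rho> \<m> J \<longleftrightarrow> graded_ideal \<Lambda> A \<rho> J \<and> J \<subseteq> \<m> \<and>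
     (\<forall>J'. graded_ideal \<Lambda> A \<rho> J' \<and> J' \<subseteq> \<m> \<longrightarrow> J' \<subseteq> J)"

text \<open>\<open>V(I)\<close> is the largest subgroup scheme of \<open>Spec K[\<Lambda>]\<close> acting trivially on \<open>V(\<m>)\<close>.\<close>

definition is_centralizer ::
  "('c, 'm) ring_scheme \<Rightarrow> ('l, 'n) monoid_scheme \<Rightarrow> ('a, 'y) ring_scheme \<Rightarrow> ('c \<Rightarrow> 'a) \<Rightarrow>
   ('a \<Rightarrow> 'l \<Rightarrow> 'a) \<Rightarrow> 'a set \<Rightarrow> ('l \<Rightarrow> 'c) set \<Rightarrow> bool" where
  "is_centralizer K \<Lambda> A \<phi> \<rho> \<m> I \<longleftrightarrow>
     subgroup_scheme K \<Lambda> I \<and> acts_trivially_on \<Lambda> A \<phi> \<rho> \<m> I \<and>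
     (\<forall>I'. subgroup_scheme K \<Lambda> I' \<and> acts_trivially_on \<Lambda> A \<phi> \<rho> \<m> I' \<longrightarrow> I \<subseteq> I')"

text \<open>\<open>\<O>(G/H) = k[\<Lambda>]\<^sup>H\<close>, where \<open>H = V(I)\<close> acts on \<open>G = Spec k[\<Lambda>]\<close> by translations.\<close>

definition quotient_group_coords ::
  "('k, 'm) ring_scheme \<Rightarrow> ('l, 'n) monoid_scheme \<Rightarrow> ('l \<Rightarrow> 'k) set \<Rightarrow> ('l \<Rightarrow> 'k) set" where
  "quotient_group_coords k \<Lambda> I =
     invariants \<Lambda> (group_algebra \<Lambda> k) (ga_const \<Lambda> k) (ga_comult \<Lambda> k) I"

text \<open>For a field \<open>k\<close>, \<open>\<phi> : k \<rightarrow> A\<close> and a \<open>k\<close>-subalgebra \<open>C\<close> of \<open>k[\<Lambda>]\<close>, this is \<open>A \<otimes>\<^sub>k C\<close> as a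
  subalgebra of \<open>A \<otimes>\<^sub>k k[\<Lambda>] = A[\<Lambda>]\<close>.\<close>

definition extend_coords ::
  "('l, 'n) monoid_scheme \<Rightarrow> ('a, 'y) ring_scheme \<Rightarrow> ('k \<Rightarrow> 'a) \<Rightarrow> ('l \<Rightarrow> 'k) set \<Rightarrow> ('l \<Rightarrow> 'a) set" where
  "extend_coords \<Lambda> A \<phi> C =
     generate_ring (group_algebra \<Lambda> A) (ga_const \<Lambda> A ` carrier A \<union> ga_map \<Lambda> \<phi> ` C)"

text \<open>In the next two definitions \<open>K\<close> is a field and \<open>C \<subseteq> K[\<Lambda>]\<close> is the coordinate ring of a quotient
  \<open>Q\<close> of \<open>Spec K[\<Lambda>]\<close>; an action of \<open>Q\<close> on \<open>Spec A\<close> is a coaction of \<open>K[\<Lambda>]\<close> with values in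
  \<open>A \<otimes>\<^sub>K C\<close>.\<close>

definition quotient_coaction ::
  "('c, 'm) ring_scheme \<Rightarrow> ('l, 'n) monoid_scheme \<Rightarrow> ('l \<Rightarrow> 'c) set \<Rightarrow> ('a, 'y) ring_scheme \<Rightarrow>
   ('c \<Rightarrow> 'a) \<Rightarrow> ('a \<Rightarrow> 'l \<Rightarrow> 'a) \<Rightarrow> bool" where
  "quotient_coaction K \<Lambda> C A \<phi> \<rho> \<longleftrightarrow>
     coaction K \<Lambda> A \<phi> \<rho> \<and> (\<forall>a\<in>carrier A. \<rho> a \<in> extend_coords \<Lambda> A \<phi> C)"

text \<open>\<open>Spec A \<rightarrow> Spec K\<close> is a \<open>Q\<close>-torsor: it is faithfully flat (over the field \<open>K\<close>, this means
  \<open>A \<noteq> 0\<close>) of finite type, and \<open>Q \<times> Spec A \<rightarrow> Spec A \<times> Spec A\<close>, which on coordinate rings is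
  \<open>a \<otimes> b \<mapsto> a \<rho>(b)\<close>, is an isomorphism.\<close>

definition is_torsor ::
  "('c, 'm) ring_scheme \<Rightarrow> ('l, 'n) monoid_scheme \<Rightarrow> ('l \<Rightarrow> 'c) set \<Rightarrow> ('a, 'y) ring_scheme \<Rightarrow>
   ('c \<Rightarrow> 'a) \<Rightarrow> ('a \<Rightarrow> 'l \<Rightarrow> 'a) \<Rightarrow> bool" where
  "is_torsor K \<Lambda> C A \<phi> \<rho> \<longleftrightarrow>
     quotient_coaction K \<Lambda> C A \<phi> \<rho> \<and> \<one>\<^bsub>A\<^esub> \<noteq> \<zero>\<^bsub>A\<^esub> \<and> fin_gen_algebra K A \<phi> \<and>
     (\<exists>h \<in> ring_iso (tensor_ring K A \<phi> A \<phi>)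
             ((group_algebra \<Lambda> A)\<lparr>carrier := extend_coords \<Lambda> A \<phi> C\<rparr>).
        \<forall>a\<in>carrier A. \<forall>b\<in>carrier A.
          h (pure_tensor K A \<phi> A \<phi> a b) = ga_const \<Lambda> A a \<otimes>\<^bsub>group_algebra \<Lambda> A\<^esub> \<rho> b)"

definition equivariantly_isomorphic ::
  "('c, 'm) ring_scheme \<Rightarrow> ('l, 'n) monoid_scheme \<Rightarrow> ('l \<Rightarrow> 'c) set \<Rightarrow>
   ('a, 'y) ring_scheme \<Rightarrow> ('c \<Rightarrow> 'a) \<Rightarrow> ('a \<Rightarrow> 'l \<Rightarrow> 'a) \<Rightarrow>
   ('b, 'z) ring_scheme \<Rightarrow> ('c \<Rightarrow> 'b) \<Rightarrow> ('b \<Rightarrow> 'l \<Rightarrow> 'b) \<Rightarrow> bool" where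
  "equivariantly_isomorphic K \<Lambda> C A \<phi> \<rho> A' \<phi>' \<rho>' \<longleftrightarrow>
     quotient_coaction K \<Lambda> C A \<phi> \<rho> \<and> quotient_coaction K \<Lambda> C A' \<phi>' \<rho>' \<and>
     (\<exists>h \<in> ring_iso A' A.
        (\<forall>r\<in>carrier K. h (\<phi>' r) = \<phi> r) \<and>
        (\<forall>a\<in>carrier A'. \<rho> (h a) = ga_map \<Lambda> h (\<rho>' a)))"

definition factor_coaction ::
  "('l, 'n) monoid_scheme \<Rightarrow> ('a, 'y) ring_scheme \<Rightarrow> ('a \<Rightarrow> 'l \<Rightarrow> 'a) \<Rightarrow> 'a set \<Rightarrow>
   'a set \<Rightarrow> 'l \<Rightarrow> 'a set" where
  "factor_coaction \<Lambda> A \<rho> J c = (\<lambda>l\<in>carrier \<Lambda>. \<Union>a\<in>c. a_r_coset A J (\<rho> a l))"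


section \<open>\<open>G\<close>-varieties\<close>

text \<open>A \<open>G\<close>-variety \<open>X\<close> over \<open>Y\<close>, for \<open>G = Spec k[\<Lambda>]\<close>. The quotient morphism \<open>\<pi>\<close> is invariant and
  affine (\<open>X\<close> is covered by stable affine opens \<open>U\<close>, and \<open>X/G\<close> is glued from the \<open>Spec \<O>(U)\<^sup>G\<close>).
  Hence an action \<open>G \<times> X \<rightarrow> X\<close> is a coaction of \<open>k[\<Lambda>]\<close> on the sheaf of algebras
  \<open>\<pi>\<^sub>*\<O>\<^sub>X\<close>, the preimages of affine opens of \<open>Y\<close> are stable affine opens, and \<open>Y = X/G\<close> means
  \<open>\<O>\<^sub>Y = (\<pi>\<^sub>*\<O>\<^sub>X)\<^sup>G\<close>. Faithfulness: only the trivial subgroup scheme acts trivially.\<close>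

definition G_variety_over ::
  "'k ring \<Rightarrow> ('l, 'n) monoid_scheme \<Rightarrow> ('p, 'a, 'k) kscheme \<Rightarrow> ('q, 'b, 'k) kscheme \<Rightarrow>
   ('p \<Rightarrow> 'q) \<Rightarrow> ('q set \<Rightarrow> 'b \<Rightarrow> 'a) \<Rightarrow> ('q set \<Rightarrow> 'a \<Rightarrow> 'l \<Rightarrow> 'a) \<Rightarrow> bool" where
  "G_variety_over k \<Lambda> XX YY \<pi> \<pi>s act \<longleftrightarrow>
     is_variety k XX \<and>
     scheme_morphism_over k XX YY \<pi> \<pi>s \<and>
     finite_morphism XX YY \<pi> \<pi>s \<and>
     \<pi> ` topspace (top_of XX) = topspace (top_of YY) \<and>
     (\<forall>V. openin (top_of YY) V \<longrightarrow>
        coaction k \<Lambda> (sec XX (preim XX \<pi> V)) (struct_on XX (preim XX \<pi> V)) (act V)) \<and>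
     (\<forall>V W. openin (top_of YY) V \<and> openin (top_of YY) W \<and> W \<subseteq> V \<longrightarrow>
        (\<forall>a\<in>carrier (sec XX (preim XX \<pi> V)).
           act W (res XX (preim XX \<pi> V) (preim XX \<pi> W) a)
           = ga_map \<Lambda> (res XX (preim XX \<pi> V) (preim XX \<pi> W)) (act V a))) \<and>
     (\<forall>V. openin (top_of YY) V \<longrightarrow>
        bij_betw (\<pi>s V) (carrier (sec YY V))
          {a \<in> carrier (sec XX (preim XX \<pi> V)). act V a = ga_const \<Lambda> (sec XX (preim XX \<pi> V)) a}) \<and>
     (\<forall>I. subgroup_scheme k \<Lambda> I \<and>
        (\<forall>V. openin (top_of YY) V \<longrightarrow>
           acts_trivially_on \<Lambda> (sec XX (preim XX \<pi> V)) (struct_on XX (preim XX \<pi> V)) (act V)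
             {\<zero>\<^bsub>sec XX (preim XX \<pi> V)\<^esub>} I)
        \<longrightarrow> I = trivial_subgroup_scheme k \<Lambda>)"


subsection \<open>The fibre over a point\<close>

text \<open>As \<open>\<pi>\<close> is affine, \<open>X\<^sub>y\<close> is affine with coordinate ring \<open>(\<pi>\<^sub>*\<O>\<^sub>X)\<^sub>y \<otimes> \<kappa>(y) = A / \<n>A\<close>,
  where \<open>A = (\<pi>\<^sub>*\<O>\<^sub>X)\<^sub>y\<close>, which is the semi-local ring of \<open>X\<close> at the points over \<open>y\<close>.\<close>

definition fibre_local_ring ::
  "('p, 'a, 'm) ringed_space_scheme \<Rightarrow> ('q, 'b, 'n) ringed_space_scheme \<Rightarrow> ('p \<Rightarrow> 'q) \<Rightarrow> 'q \<Rightarrow>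
   ('q set \<times> 'a) set ring" where
  "fibre_local_ring XX YY \<pi> y = stalk (pushforward XX YY \<pi>) y"

definition fibre_local_ideal ::
  "('p, 'a, 'm) ringed_space_scheme \<Rightarrow> ('q, 'b, 'n) ringed_space_scheme \<Rightarrow> ('p \<Rightarrow> 'q) \<Rightarrow>
   ('q set \<Rightarrow> 'b \<Rightarrow> 'a) \<Rightarrow> 'q \<Rightarrow> ('q set \<times> 'a) set set" where
  "fibre_local_ideal XX YY \<pi> \<pi>s y = genideal (fibre_local_ring XX YY \<pi> y)
     (stalk_map (pushforward XX YY \<pi>) y \<pi>s ` stalk_max_ideal YY y)"

definition fibre_ring ::
  "('p, 'a, 'm) ringed_space_scheme \<Rightarrow> ('q, 'b, 'n) ringed_space_scheme \<Rightarrow> ('p \<Rightarrow> 'q) \<Rightarrow>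
   ('q set \<Rightarrow> 'b \<Rightarrow> 'a) \<Rightarrow> 'q \<Rightarrow> ('q set \<times> 'a) set set ring" where
  "fibre_ring XX YY \<pi> \<pi>s y = fibre_local_ring XX YY \<pi> y Quot fibre_local_ideal XX YY \<pi> \<pi>s y"

text \<open>The structure map \<open>\<kappa>(y) \<rightarrow> \<O>(X\<^sub>y)\<close>.\<close>

definition fibre_struct ::
  "('p, 'a, 'm) ringed_space_scheme \<Rightarrow> ('q, 'b, 'n) ringed_space_scheme \<Rightarrow> ('p \<Rightarrow> 'q) \<Rightarrow>
   ('q set \<Rightarrow> 'b \<Rightarrow> 'a) \<Rightarrow> 'q \<Rightarrow> ('q set \<times> 'b) set set \<Rightarrow> ('q set \<times> 'a) set set" where
  "fibre_struct XX YY \<pi> \<pi>s y c =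
     (\<Union>b\<in>c. a_r_coset (fibre_local_ring XX YY \<pi> y) (fibre_local_ideal XX YY \<pi> \<pi>s y)
              (stalk_map (pushforward XX YY \<pi>) y \<pi>s b))"

definition fibre_coaction ::
  "('l, 'x) monoid_scheme \<Rightarrow> ('p, 'a, 'm) ringed_space_scheme \<Rightarrow> ('q, 'b, 'n) ringed_space_scheme \<Rightarrow>
   ('p \<Rightarrow> 'q) \<Rightarrow> ('q set \<Rightarrow> 'b \<Rightarrow> 'a) \<Rightarrow> ('q set \<Rightarrow> 'a \<Rightarrow> 'l \<Rightarrow> 'a) \<Rightarrow> 'q \<Rightarrow>
   ('q set \<times> 'a) set set \<Rightarrow> 'l \<Rightarrow> ('q set \<times> 'a) set set" where
  "fibre_coaction \<Lambda> XX YY \<pi> \<pi>s act y =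
     factor_coaction \<Lambda> (fibre_local_ring XX YY \<pi> y)
       (\<lambda>C l. stalk_map (pushforward XX YY \<pi>) y (\<lambda>V s. act V s l) C)
       (fibre_local_ideal XX YY \<pi> \<pi>s y)"

text \<open>The ideal of \<open>\<O>(X\<^sub>y)\<close> of the closed point \<open>x\<close> of \<open>X\<^sub>y\<close> (with \<open>y = \<pi> x\<close>): the classes of the
  functions, defined on some \<open>\<pi>\<inverse>(V)\<close> with \<open>y \<in> V\<close>, that vanish at \<open>x\<close>.\<close>

definition fibre_point_ideal ::
  "('p, 'a, 'm) ringed_space_scheme \<Rightarrow> ('q, 'b, 'n) ringed_space_scheme \<Rightarrow> ('p \<Rightarrow> 'q) \<Rightarrow>
   ('q set \<Rightarrow> 'b \<Rightarrow> 'a) \<Rightarrow> 'p \<Rightarrow> ('q set \<times> 'a) set set set" where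
  "fibre_point_ideal XX YY \<pi> \<pi>s x =
     {a_r_coset (fibre_local_ring XX YY \<pi> (\<pi> x)) (fibre_local_ideal XX YY \<pi> \<pi>s (\<pi> x))
        (germ (pushforward XX YY \<pi>) (\<pi> x) V f) | V f.
        openin (top_of YY) V \<and> \<pi> x \<in> V \<and> f \<in> carrier (sec XX (preim XX \<pi> V)) \<and>
        germ XX x (preim XX \<pi> V) f \<in> stalk_max_ideal XX x}"

end

theory Submission
  imports Defs
begin

text \<open>The fibre algebra \<open>A\<close> is a finite \<open>\<Lambda>\<close>-graded algebra over the field \<open>K = \<kappa>(y)\<close> with \<open>A\<^sub>1 = K\<close>.
  A homogeneous \<open>a\<close> of degree \<open>l\<close> satisfies \<open>a ^ |\<Lambda>| \<in> A\<^sub>1 = K\<close>, hence is nilpotent or a unit. The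
  degrees of homogeneous units form a subgroup \<open>\<Gamma>\<close> of \<open>\<Lambda>\<close>; the elements whose components of degree in
  \<open>\<Gamma>\<close> vanish form the largest proper graded ideal \<open>I\<close>, and it lies in every prime ideal. Subgroup schemes of
  \<open>Spec k[\<Lambda>]\<close> correspond to subgroups of \<open>\<Lambda>\<close>, and the one belonging to \<open>\<Gamma>\<close>, whose invariants are
  \<open>\<Oplus>\<^bsub>l\<in>\<Gamma>\<^esub> A\<^sub>l\<close>, is the required \<open>H\<close>: this algebra is spanned over \<open>K\<close> by one unit in each degree, which
  makes it a torsor. For uniqueness every \<open>A\<^sub>l\<close> has to be nonzero. Faithfulness of the action and integrality
  of \<open>X\<close> yield nonzero sections of every degree over every open set, and by Nakayama's lemma they do not
  all vanish on the fibre.\<close>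

section \<open>Group algebras\<close>

text \<open>The order of \<Lambda> may be divisible by the characteristic, so the group scheme may
  be non-reduced and its subgroup schemes are not visible on points. They are classified by linear
  duality instead. A subgroup \<Gamma> stands for the subgroup scheme on which the characters in
  \<Gamma> become trivial, so a larger \<Gamma> means a smaller subgroup scheme. Its ideal is
  described by sums over cosets, which makes base change and invariants computable without forming
  \<Lambda>/\<Gamma>. A degree with zero component leaves no trace in any ring of invariants, hence
  the condition on all degrees. Nonzero sections of given degrees arise over different open sets;
  multiplying or localizing them is possible because restriction maps on X are injective and
  nonempty open subsets of Y meet. The residue field of x never has to be computed: modulo the prime
  of x, homogeneous elements of degree outside \<Gamma> vanish, while a unit in each degree of
  \<Gamma> stays nonzero, and this is all that the centralizer detects.\<close>

lemma (in abelian_monoid) finsum_swap: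
  assumes "finite S" "finite T" "\<And>s t. s \<in> S \<Longrightarrow> t \<in> T \<Longrightarrow> f s t \<in> carrier G"
  shows "(\<Oplus>s\<in>S. \<Oplus>t\<in>T. f s t) = (\<Oplus>t\<in>T. \<Oplus>s\<in>S. f s t)"
  using assms(1,3)
proof (induction S rule: finite_induct)
  case (insert s S)
  then have "(\<Oplus>s\<in>insert s S. \<Oplus>t\<in>T. f s t) = (\<Oplus>t\<in>T. f s t) \<oplus> (\<Oplus>t\<in>T. \<Oplus>s\<in>S. f s t)"
    by (subst finsum_insert) (auto intro!: finsum_closed)
  also have "\<dots> = (\<Oplus>t\<in>T. f s t \<oplus> (\<Oplus>s\<in>S. f s t))"
    using insert by (intro finsum_addf[symmetric]) (auto intro!: finsum_closed)
  also have "\<dots> = (\<Oplus>t\<in>T. \<Oplus>s\<in>insert s S. f s t)"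
    using insert by (intro finsum_cong') (auto intro!: finsum_closed)
  finally show ?case .
qed simp

lemma (in abelian_monoid) finsum_delta:
  assumes "finite S" "t \<in> S \<Longrightarrow> f t \<in> carrier G"
  shows "(\<Oplus>s\<in>S. if s = t then f s else \<zero>) = (if t \<in> S then f t else \<zero>)"
proof -
  have "(\<Oplus>s\<in>S. if s = t then f s else \<zero>) = (\<Oplus>s\<in>S. if t = s then f t else \<zero>)"
    using assms by (intro finsum_cong') auto
  also have "\<dots> = (if t \<in> S then f t else \<zero>)"
  proof (cases "t \<in> S")
    case True
    with assms finsum_singleton[of t S "\<lambda>_. f t"] show ?thesis by auto
  next
    case False
    then have "(\<Oplus>s\<in>S. if t = s then f t else \<zero>) = (\<Oplus>s\<in>S. \<zero>)"
      by (intro finsum_cong') auto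
    with False show ?thesis by (simp add: finsum_zero)
  qed
  finally show ?thesis .
qed

lemma (in abelian_group) finsum_uminus:
  assumes "finite S" "f \<in> S \<rightarrow> carrier G"
  shows "(\<Oplus>s\<in>S. \<ominus> f s) = \<ominus> (\<Oplus>s\<in>S. f s)"
  using assms
proof (induction S rule: finite_induct)
  case (insert s S)
  then have "(\<Oplus>s\<in>S. f s) \<in> carrier G" "f s \<in> carrier G" "(\<Oplus>s\<in>S. \<ominus> f s) = \<ominus> (\<Oplus>s\<in>S. f s)"
    by (auto intro!: finsum_closed)
  with insert show ?case by (subst finsum_insert) (auto simp: minus_add Pi_iff)
qed (metis finsum_empty l_zero minus_equality zero_closed)

lemma (in abelian_group) finsum_diff:
  assumes "finite S" "f \<in> S \<rightarrow> carrier G" "g \<in> S \<rightarrow> carrier G"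
  shows "(\<Oplus>s\<in>S. f s \<ominus> g s) = (\<Oplus>s\<in>S. f s) \<ominus> (\<Oplus>s\<in>S. g s)"
  using assms unfolding minus_eq
  by (subst finsum_addf) (auto simp: finsum_uminus Pi_iff)

lemma ga_simps [simp]:
  "carrier (group_algebra \<Lambda> A) = carrier \<Lambda> \<rightarrow>\<^sub>E carrier A"
  "\<zero>\<^bsub>group_algebra \<Lambda> A\<^esub> = (\<lambda>l\<in>carrier \<Lambda>. \<zero>\<^bsub>A\<^esub>)"
  by (simp_all add: group_algebra_def)

lemma ga_add: "f \<oplus>\<^bsub>group_algebra \<Lambda> A\<^esub> g = (\<lambda>l\<in>carrier \<Lambda>. f l \<oplus>\<^bsub>A\<^esub> g l)"
  by (simp add: group_algebra_def)

lemma ga_mult: "f \<otimes>\<^bsub>group_algebra \<Lambda> A\<^esub> g =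
    (\<lambda>l\<in>carrier \<Lambda>. finsum A (\<lambda>m. f m \<otimes>\<^bsub>A\<^esub> g (inv\<^bsub>\<Lambda>\<^esub> m \<otimes>\<^bsub>\<Lambda>\<^esub> l)) (carrier \<Lambda>))"
  by (simp add: group_algebra_def)

lemma ga_one: "\<one>\<^bsub>group_algebra \<Lambda> A\<^esub> = ga_const \<Lambda> A \<one>\<^bsub>A\<^esub>"
  by (simp add: group_algebra_def ga_const_def)

text \<open>The single term \<open>a\<close> times the character \<open>l\<close>. Every element is
  a finite sum of such terms (\<open>ga_expand\<close>), so membership in an ideal or a subring is
  checked term by term.\<close>

definition ga_monom ::
  "('l, 'n) monoid_scheme \<Rightarrow> ('a, 'm) ring_scheme \<Rightarrow> 'l \<Rightarrow> 'a \<Rightarrow> 'l \<Rightarrow> 'a" where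
  "ga_monom \<Lambda> A l a = (\<lambda>m\<in>carrier \<Lambda>. if m = l then a else \<zero>\<^bsub>A\<^esub>)"

lemma ga_const_monom: "ga_const \<Lambda> A a = ga_monom \<Lambda> A \<one>\<^bsub>\<Lambda>\<^esub> a"
  by (simp add: ga_const_def ga_monom_def)

section \<open>Convolution of functions on a finite commutative group\<close>

locale finite_comm_group = comm_group \<Lambda> for \<Lambda> :: "('l, 'n) monoid_scheme" (structure) +
  assumes fin: "finite (carrier \<Lambda>)"
begin

lemma bij_mult: "g \<in> carrier \<Lambda> \<Longrightarrow> bij_betw (\<lambda>l. g \<otimes> l) (carrier \<Lambda>) (carrier \<Lambda>)"
  by (rule bij_betwI[where g = "\<lambda>l. inv g \<otimes> l"]) (auto simp: m_assoc[symmetric])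

lemma bij_inv: "bij_betw (\<lambda>l. inv l) (carrier \<Lambda>) (carrier \<Lambda>)"
  by (rule bij_betwI[where g = "\<lambda>l. inv l"]) auto

end

locale group_ring = L: finite_comm_group \<Lambda> + R: cring A
  for \<Lambda> :: "('l, 'n) monoid_scheme" and A :: "('a, 'm) ring_scheme"
begin

abbreviation "GA \<equiv> group_algebra \<Lambda> A"

lemma finsum_shift:
  assumes "g \<in> carrier \<Lambda>" "f \<in> carrier \<Lambda> \<rightarrow> carrier A"
  shows "finsum A (\<lambda>l. f (g \<otimes>\<^bsub>\<Lambda>\<^esub> l)) (carrier \<Lambda>) = finsum A f (carrier \<Lambda>)"
proof -
  have "finsum A f ((\<lambda>l. g \<otimes>\<^bsub>\<Lambda>\<^esub> l) ` carrier \<Lambda>) = finsum A (\<lambda>l. f (g \<otimes>\<^bsub>\<Lambda>\<^esub> l)) (carrier \<Lambda>)"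
    using L.bij_mult[OF assms(1)] assms by (intro R.finsum_reindex) (auto simp: bij_betw_def)
  then show ?thesis using L.bij_mult[OF assms(1)] by (simp add: bij_betw_def)
qed

lemma finsum_inv:
  assumes "f \<in> carrier \<Lambda> \<rightarrow> carrier A"
  shows "finsum A (\<lambda>l. f (inv\<^bsub>\<Lambda>\<^esub> l)) (carrier \<Lambda>) = finsum A f (carrier \<Lambda>)"
proof -
  have "finsum A f ((\<lambda>l. inv\<^bsub>\<Lambda>\<^esub> l) ` carrier \<Lambda>) = finsum A (\<lambda>l. f (inv\<^bsub>\<Lambda>\<^esub> l)) (carrier \<Lambda>)"
    using L.bij_inv assms by (intro R.finsum_reindex) (auto simp: bij_betw_def)
  then show ?thesis using L.bij_inv by (simp add: bij_betw_def)
qed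

lemma gaD [simp]: "f \<in> carrier \<Lambda> \<rightarrow>\<^sub>E carrier A \<Longrightarrow> l \<in> carrier \<Lambda> \<Longrightarrow> f l \<in> carrier A"
  by auto

lemma ga_eqI:
  assumes "f \<in> carrier \<Lambda> \<rightarrow>\<^sub>E carrier A" "g \<in> carrier \<Lambda> \<rightarrow>\<^sub>E carrier A"
    "\<And>l. l \<in> carrier \<Lambda> \<Longrightarrow> f l = g l"
  shows "f = g"
  using assms by (auto simp: PiE_def intro!: extensionalityI[where A="carrier \<Lambda>"])

lemma ga_add_closed:
  "f \<in> carrier GA \<Longrightarrow> g \<in> carrier GA \<Longrightarrow> f \<oplus>\<^bsub>GA\<^esub> g \<in> carrier GA"
  by (auto simp: ga_add)

lemma ga_mult_closed:
  "f \<in> carrier GA \<Longrightarrow> g \<in> carrier GA \<Longrightarrow> f \<otimes>\<^bsub>GA\<^esub> g \<in> carrier GA"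
  by (auto simp: ga_mult intro!: R.finsum_closed)

lemma ga_monom_closed [simp]: "a \<in> carrier A \<Longrightarrow> ga_monom \<Lambda> A l a \<in> carrier \<Lambda> \<rightarrow>\<^sub>E carrier A"
  by (auto simp: ga_monom_def)

lemma ga_const_closed [simp]: "a \<in> carrier A \<Longrightarrow> ga_const \<Lambda> A a \<in> carrier \<Lambda> \<rightarrow>\<^sub>E carrier A"
  by (auto simp: ga_const_monom)

lemma ga_monom_mult:
  assumes "g \<in> carrier \<Lambda>" "a \<in> carrier A" "f \<in> carrier GA"
  shows "ga_monom \<Lambda> A g a \<otimes>\<^bsub>GA\<^esub> f = (\<lambda>l\<in>carrier \<Lambda>. a \<otimes>\<^bsub>A\<^esub> f (inv\<^bsub>\<Lambda>\<^esub> g \<otimes>\<^bsub>\<Lambda>\<^esub> l))"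
  unfolding ga_mult
proof (rule restrict_ext)
  fix l assume l: "l \<in> carrier \<Lambda>"
  have "finsum A (\<lambda>m. ga_monom \<Lambda> A g a m \<otimes>\<^bsub>A\<^esub> f (inv\<^bsub>\<Lambda>\<^esub> m \<otimes>\<^bsub>\<Lambda>\<^esub> l)) (carrier \<Lambda>)
    = finsum A (\<lambda>m. if m = g then a \<otimes>\<^bsub>A\<^esub> f (inv\<^bsub>\<Lambda>\<^esub> m \<otimes>\<^bsub>\<Lambda>\<^esub> l) else \<zero>\<^bsub>A\<^esub>) (carrier \<Lambda>)"
    using assms l by (intro R.finsum_cong') (auto simp: ga_monom_def)
  also have "\<dots> = a \<otimes>\<^bsub>A\<^esub> f (inv\<^bsub>\<Lambda>\<^esub> g \<otimes>\<^bsub>\<Lambda>\<^esub> l)"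
    using assms l by (subst R.finsum_delta) (auto simp: L.fin)
  finally show "finsum A (\<lambda>m. ga_monom \<Lambda> A g a m \<otimes>\<^bsub>A\<^esub> f (inv\<^bsub>\<Lambda>\<^esub> m \<otimes>\<^bsub>\<Lambda>\<^esub> l)) (carrier \<Lambda>)
    = a \<otimes>\<^bsub>A\<^esub> f (inv\<^bsub>\<Lambda>\<^esub> g \<otimes>\<^bsub>\<Lambda>\<^esub> l)" .
qed

lemma ga_const_mult:
  assumes "a \<in> carrier A" "f \<in> carrier GA"
  shows "ga_const \<Lambda> A a \<otimes>\<^bsub>GA\<^esub> f = (\<lambda>l\<in>carrier \<Lambda>. a \<otimes>\<^bsub>A\<^esub> f l)"
  using ga_monom_mult[OF L.one_closed assms] by (auto simp: ga_const_monom cong: restrict_cong)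

lemma ga_mult_comm:
  assumes "f \<in> carrier GA" "g \<in> carrier GA"
  shows "f \<otimes>\<^bsub>GA\<^esub> g = g \<otimes>\<^bsub>GA\<^esub> f"
  unfolding ga_mult
proof (rule restrict_ext)
  fix l assume l: "l \<in> carrier \<Lambda>"
  let ?h = "\<lambda>m. f m \<otimes>\<^bsub>A\<^esub> g (inv\<^bsub>\<Lambda>\<^esub> m \<otimes>\<^bsub>\<Lambda>\<^esub> l)"
  have h: "?h \<in> carrier \<Lambda> \<rightarrow> carrier A" using assms l by auto
  \<comment> \<open>The substitution that exchanges the two factors of the convolution sends
    \<open>m\<close> to \<open>l\<close> times the inverse of \<open>m\<close>; it is made as a
    translation by \<open>l\<close> followed by inversion.\<close>
  have "finsum A ?h (carrier \<Lambda>) = finsum A (\<lambda>m. ?h (l \<otimes>\<^bsub>\<Lambda>\<^esub> m)) (carrier \<Lambda>)"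
    using finsum_shift[OF l h] by simp
  also have "\<dots> = finsum A (\<lambda>m. ?h (l \<otimes>\<^bsub>\<Lambda>\<^esub> inv\<^bsub>\<Lambda>\<^esub> m)) (carrier \<Lambda>)"
    using assms l by (intro finsum_inv[symmetric, of "\<lambda>m. ?h (l \<otimes>\<^bsub>\<Lambda>\<^esub> m)"]) auto
  also have "\<dots> = finsum A (\<lambda>m. g m \<otimes>\<^bsub>A\<^esub> f (inv\<^bsub>\<Lambda>\<^esub> m \<otimes>\<^bsub>\<Lambda>\<^esub> l)) (carrier \<Lambda>)"
  proof (rule R.finsum_cong')
    fix m assume m: "m \<in> carrier \<Lambda>"
    have "inv\<^bsub>\<Lambda>\<^esub> (l \<otimes>\<^bsub>\<Lambda>\<^esub> inv\<^bsub>\<Lambda>\<^esub> m) \<otimes>\<^bsub>\<Lambda>\<^esub> l = m"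
      using l m by (simp add: L.inv_mult_group L.m_assoc)
    moreover have "l \<otimes>\<^bsub>\<Lambda>\<^esub> inv\<^bsub>\<Lambda>\<^esub> m = inv\<^bsub>\<Lambda>\<^esub> m \<otimes>\<^bsub>\<Lambda>\<^esub> l" using l m by (simp add: L.m_comm)
    ultimately show "?h (l \<otimes>\<^bsub>\<Lambda>\<^esub> inv\<^bsub>\<Lambda>\<^esub> m) = g m \<otimes>\<^bsub>A\<^esub> f (inv\<^bsub>\<Lambda>\<^esub> m \<otimes>\<^bsub>\<Lambda>\<^esub> l)"
      using assms l m by (simp add: R.m_comm)
  qed (use assms l in auto)
  finally show "finsum A ?h (carrier \<Lambda>) =
      finsum A (\<lambda>m. g m \<otimes>\<^bsub>A\<^esub> f (inv\<^bsub>\<Lambda>\<^esub> m \<otimes>\<^bsub>\<Lambda>\<^esub> l)) (carrier \<Lambda>)" .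
qed

lemma ga_mult_assoc:
  assumes "f \<in> carrier GA" "g \<in> carrier GA" "h \<in> carrier GA"
  shows "f \<otimes>\<^bsub>GA\<^esub> g \<otimes>\<^bsub>GA\<^esub> h = f \<otimes>\<^bsub>GA\<^esub> (g \<otimes>\<^bsub>GA\<^esub> h)"
proof (rule ga_eqI)
  fix l assume l: "l \<in> carrier \<Lambda>"
  note c = gaD[OF assms(1)[simplified]] gaD[OF assms(2)[simplified]] gaD[OF assms(3)[simplified]]
  let ?L = "carrier \<Lambda>"
  let ?t = "\<lambda>n m. f n \<otimes>\<^bsub>A\<^esub> (g (inv\<^bsub>\<Lambda>\<^esub> n \<otimes>\<^bsub>\<Lambda>\<^esub> m) \<otimes>\<^bsub>A\<^esub> h (inv\<^bsub>\<Lambda>\<^esub> m \<otimes>\<^bsub>\<Lambda>\<^esub> l))"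
  have "(f \<otimes>\<^bsub>GA\<^esub> g \<otimes>\<^bsub>GA\<^esub> h) l = finsum A (\<lambda>m. finsum A (\<lambda>n. ?t n m) ?L) ?L"
    unfolding ga_mult using l c
    by (auto simp: R.finsum_ldistr L.fin R.m_assoc intro!: R.finsum_cong' R.finsum_closed)
  also have "\<dots> = finsum A (\<lambda>n. finsum A (\<lambda>m. ?t n m) ?L) ?L"
    using l c by (intro R.finsum_swap) (auto simp: L.fin)
  also have "\<dots> = finsum A (\<lambda>n. f n \<otimes>\<^bsub>A\<^esub> finsum A (\<lambda>m. g (inv\<^bsub>\<Lambda>\<^esub> n \<otimes>\<^bsub>\<Lambda>\<^esub> m) \<otimes>\<^bsub>A\<^esub> h (inv\<^bsub>\<Lambda>\<^esub> m \<otimes>\<^bsub>\<Lambda>\<^esub> l)) ?L) ?L"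
    using l c by (intro R.finsum_cong' R.finsum_rdistr[symmetric]) (auto simp: L.fin intro!: R.finsum_closed)
  also have "\<dots> = finsum A (\<lambda>n. f n \<otimes>\<^bsub>A\<^esub> (g \<otimes>\<^bsub>GA\<^esub> h) (inv\<^bsub>\<Lambda>\<^esub> n \<otimes>\<^bsub>\<Lambda>\<^esub> l)) ?L"
  proof (rule R.finsum_cong')
    fix n assume n: "n \<in> ?L"
    let ?u = "\<lambda>m. g (inv\<^bsub>\<Lambda>\<^esub> n \<otimes>\<^bsub>\<Lambda>\<^esub> m) \<otimes>\<^bsub>A\<^esub> h (inv\<^bsub>\<Lambda>\<^esub> m \<otimes>\<^bsub>\<Lambda>\<^esub> l)"
    \<comment> \<open>Translating the summation variable by \<open>n\<close> turns the inner sum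
      into a value of the product of \<open>g\<close> and \<open>h\<close>.\<close>
    have "finsum A ?u ?L = finsum A (\<lambda>m. ?u (n \<otimes>\<^bsub>\<Lambda>\<^esub> m)) ?L"
      using l n c by (intro finsum_shift[symmetric]) auto
    also have "\<dots> = finsum A (\<lambda>m. g m \<otimes>\<^bsub>A\<^esub> h (inv\<^bsub>\<Lambda>\<^esub> m \<otimes>\<^bsub>\<Lambda>\<^esub> (inv\<^bsub>\<Lambda>\<^esub> n \<otimes>\<^bsub>\<Lambda>\<^esub> l))) ?L"
    proof (rule R.finsum_cong')
      fix m assume m: "m \<in> ?L"
      have "inv\<^bsub>\<Lambda>\<^esub> n \<otimes>\<^bsub>\<Lambda>\<^esub> (n \<otimes>\<^bsub>\<Lambda>\<^esub> m) = m"
        using m n by (simp add: L.m_assoc[symmetric])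
      then show "?u (n \<otimes>\<^bsub>\<Lambda>\<^esub> m) = g m \<otimes>\<^bsub>A\<^esub> h (inv\<^bsub>\<Lambda>\<^esub> m \<otimes>\<^bsub>\<Lambda>\<^esub> (inv\<^bsub>\<Lambda>\<^esub> n \<otimes>\<^bsub>\<Lambda>\<^esub> l))"
        using l m n by (simp add: L.inv_mult_group L.m_assoc)
    qed (use l n c in auto)
    finally show "f n \<otimes>\<^bsub>A\<^esub> finsum A ?u ?L = f n \<otimes>\<^bsub>A\<^esub> (g \<otimes>\<^bsub>GA\<^esub> h) (inv\<^bsub>\<Lambda>\<^esub> n \<otimes>\<^bsub>\<Lambda>\<^esub> l)"
      using l n by (simp add: ga_mult)
  qed (use l c assms in \<open>auto intro!: R.finsum_closed simp: ga_mult\<close>)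
  also have "\<dots> = (f \<otimes>\<^bsub>GA\<^esub> (g \<otimes>\<^bsub>GA\<^esub> h)) l"
    using l by (simp only: ga_mult[of \<Lambda> A f] restrict_apply if_True)
  finally show "(f \<otimes>\<^bsub>GA\<^esub> g \<otimes>\<^bsub>GA\<^esub> h) l = (f \<otimes>\<^bsub>GA\<^esub> (g \<otimes>\<^bsub>GA\<^esub> h)) l" .
qed (use ga_mult_closed assms in \<open>auto simp del: PiE_iff simp flip: ga_simps\<close>)

lemma ga_abelian_group: "abelian_group GA"
proof (rule abelian_groupI)
  fix f assume f: "f \<in> carrier GA"
  then show "\<exists>g\<in>carrier GA. g \<oplus>\<^bsub>GA\<^esub> f = \<zero>\<^bsub>GA\<^esub>"
    by (intro bexI[of _ "\<lambda>l\<in>carrier \<Lambda>. \<ominus>\<^bsub>A\<^esub> f l"]) (auto simp: ga_add R.l_neg intro!: restrict_ext)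
  show "\<zero>\<^bsub>GA\<^esub> \<oplus>\<^bsub>GA\<^esub> f = f"
    by (rule ga_eqI) (use f in \<open>auto simp: ga_add\<close>)
qed (auto simp: ga_add R.a_ac intro!: restrict_ext)

sublocale G: cring GA
proof (rule cringI)
  show "abelian_group GA" by (rule ga_abelian_group)
  show "comm_monoid GA"
  proof (rule comm_monoidI)
    fix f assume f: "f \<in> carrier GA"
    show "\<one>\<^bsub>GA\<^esub> \<otimes>\<^bsub>GA\<^esub> f = f"
      by (rule ga_eqI) (use f in \<open>auto simp: ga_one ga_const_mult\<close>)
  qed (use ga_mult_closed ga_mult_comm ga_mult_assoc in \<open>auto simp: ga_one simp del: PiE_iff\<close>)
  fix f g h assume "f \<in> carrier GA" "g \<in> carrier GA" "h \<in> carrier GA"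
  then show "(f \<oplus>\<^bsub>GA\<^esub> g) \<otimes>\<^bsub>GA\<^esub> h = f \<otimes>\<^bsub>GA\<^esub> h \<oplus>\<^bsub>GA\<^esub> g \<otimes>\<^bsub>GA\<^esub> h"
    by (auto simp: ga_mult ga_add R.l_distr simp flip: R.finsum_addf intro!: restrict_ext R.finsum_cong')
qed

lemma ga_minus:
  assumes "f \<in> carrier GA" "g \<in> carrier GA"
  shows "f \<ominus>\<^bsub>GA\<^esub> g = (\<lambda>l\<in>carrier \<Lambda>. f l \<ominus>\<^bsub>A\<^esub> g l)"
proof -
  have "\<ominus>\<^bsub>GA\<^esub> g = (\<lambda>l\<in>carrier \<Lambda>. \<ominus>\<^bsub>A\<^esub> g l)"
    by (rule G.minus_equality) (use assms in \<open>auto simp: ga_add R.l_neg intro!: restrict_ext\<close>)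
  then show ?thesis unfolding a_minus_def by (auto simp: ga_add intro!: restrict_ext)
qed

lemma gaI: "(\<And>l. l \<in> carrier \<Lambda> \<Longrightarrow> f l \<in> carrier A) \<Longrightarrow> (\<lambda>l\<in>carrier \<Lambda>. f l) \<in> carrier GA"
  by auto

lemma ga_memD: "f \<in> carrier GA \<Longrightarrow> l \<in> carrier \<Lambda> \<Longrightarrow> f l \<in> carrier A"
  by auto

lemma ga_closed [simp]:
  "a \<in> carrier A \<Longrightarrow> ga_monom \<Lambda> A l a \<in> carrier GA"
  "a \<in> carrier A \<Longrightarrow> ga_const \<Lambda> A a \<in> carrier GA"
  by auto

lemma ga_ext:
  assumes "f \<in> carrier GA" "g \<in> carrier GA" "\<And>l. l \<in> carrier \<Lambda> \<Longrightarrow> f l = g l"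
  shows "f = g"
  using assms ga_eqI by simp

lemma ga_finsum:
  assumes "finite S" "f \<in> S \<rightarrow> carrier GA" "l \<in> carrier \<Lambda>"
  shows "finsum GA f S l = finsum A (\<lambda>s. f s l) S"
  using assms
proof (induction S rule: finite_induct)
  case (insert s S)
  then have "finsum GA f (insert s S) l = (f s \<oplus>\<^bsub>GA\<^esub> finsum GA f S) l"
    by (subst G.finsum_insert) auto
  also have "\<dots> = f s l \<oplus>\<^bsub>A\<^esub> finsum A (\<lambda>s. f s l) S"
    using insert by (simp add: ga_add)
  also have "\<dots> = finsum A (\<lambda>s. f s l) (insert s S)"
    using insert by (subst R.finsum_insert) (auto simp: Pi_iff)
  finally show ?case .
qed simp

lemma ga_expand:
  assumes "f \<in> carrier GA"
  shows "f = finsum GA (\<lambda>l. ga_monom \<Lambda> A l (f l)) (carrier \<Lambda>)"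
proof (rule ga_eqI)
  have c: "(\<lambda>l. ga_monom \<Lambda> A l (f l)) \<in> carrier \<Lambda> \<rightarrow> carrier GA"
    using assms by auto
  show "finsum GA (\<lambda>l. ga_monom \<Lambda> A l (f l)) (carrier \<Lambda>) \<in> carrier \<Lambda> \<rightarrow>\<^sub>E carrier A"
    using G.finsum_closed[OF c] by simp
  fix m assume m: "m \<in> carrier \<Lambda>"
  have "finsum GA (\<lambda>l. ga_monom \<Lambda> A l (f l)) (carrier \<Lambda>) m
      = finsum A (\<lambda>l. ga_monom \<Lambda> A l (f l) m) (carrier \<Lambda>)"
    using c m by (intro ga_finsum L.fin)
  also have "\<dots> = finsum A (\<lambda>l. if l = m then f l else \<zero>\<^bsub>A\<^esub>) (carrier \<Lambda>)"
    using assms m by (intro R.finsum_cong') (auto simp: ga_monom_def)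
  also have "\<dots> = f m" using assms m by (subst R.finsum_delta) (auto simp: L.fin)
  finally show "f m = finsum GA (\<lambda>l. ga_monom \<Lambda> A l (f l)) (carrier \<Lambda>) m" ..
qed (use assms in simp)

lemma ga_monom_split:
  assumes "l \<in> carrier \<Lambda>" "m \<in> carrier \<Lambda>" "a \<in> carrier A" "b \<in> carrier A"
  shows "ga_monom \<Lambda> A l a \<otimes>\<^bsub>GA\<^esub> ga_monom \<Lambda> A m b = ga_monom \<Lambda> A (l \<otimes>\<^bsub>\<Lambda>\<^esub> m) (a \<otimes>\<^bsub>A\<^esub> b)"
proof -
  have "inv\<^bsub>\<Lambda>\<^esub> l \<otimes>\<^bsub>\<Lambda>\<^esub> n = m \<longleftrightarrow> n = l \<otimes>\<^bsub>\<Lambda>\<^esub> m" if "n \<in> carrier \<Lambda>" for n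
    using assms that by (metis L.inv_solve_left')
  then show ?thesis
    using assms by (subst ga_monom_mult) (auto simp: ga_monom_def intro!: restrict_ext)
qed

lemma ga_const_hom: "ga_const \<Lambda> A \<in> ring_hom A GA"
proof (rule ring_hom_memI)
  fix a b assume ab: "a \<in> carrier A" "b \<in> carrier A"
  then show "ga_const \<Lambda> A (a \<otimes>\<^bsub>A\<^esub> b) = ga_const \<Lambda> A a \<otimes>\<^bsub>GA\<^esub> ga_const \<Lambda> A b"
    by (simp add: ga_const_monom ga_monom_split)
  show "ga_const \<Lambda> A (a \<oplus>\<^bsub>A\<^esub> b) = ga_const \<Lambda> A a \<oplus>\<^bsub>GA\<^esub> ga_const \<Lambda> A b"
    using ab by (auto simp: ga_const_def ga_add intro!: restrict_ext)
qed (auto simp: ga_one)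

end

declare ga_simps [simp del]

declare (in group_ring) gaD [simp del]

lemmas ga_zero = ga_simps(2)

section \<open>Subgroup schemes of diagonalizable group schemes\<close>

text \<open>Closure under negation follows from absorption, with \<open>\<ominus> \<one>\<close> as
  the multiplier, and commutativity makes one-sided absorption enough.\<close>

lemma (in cring) idealI':
  assumes "I \<subseteq> carrier R" "\<zero> \<in> I" "\<And>a b. a \<in> I \<Longrightarrow> b \<in> I \<Longrightarrow> a \<oplus> b \<in> I"
    "\<And>a b. a \<in> I \<Longrightarrow> b \<in> carrier R \<Longrightarrow> b \<otimes> a \<in> I"
  shows "ideal I R"
proof (rule idealI)
  show "subgroup I (add_monoid R)"
  proof (rule add.subgroupI)
    fix a assume "a \<in> I"
    with assms(4)[of a "\<ominus> \<one>"] assms(1) show "\<ominus> a \<in> I" by (auto simp: l_minus subset_iff)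
  qed (use assms in auto)
  fix a b assume "a \<in> I" "b \<in> carrier R"
  with assms(1) assms(4)[of a b] show "b \<otimes> a \<in> I" "a \<otimes> b \<in> I" by (auto simp: m_comm subset_iff)
qed (rule ring_axioms)

lemma (in ideal) finsum_mem:
  assumes "finite S" "\<And>s. s \<in> S \<Longrightarrow> f s \<in> I"
  shows "(\<Oplus>s\<in>S. f s) \<in> I"
  using assms
proof (induction S rule: finite_induct)
  case (insert s S)
  then show ?case by (subst finsum_insert) (auto intro: a_closed Icarr)
qed simp

lemma (in ideal) minus_mem: "a \<in> I \<Longrightarrow> b \<in> I \<Longrightarrow> a \<ominus> b \<in> I"
  unfolding a_minus_def by (auto intro: a_closed)

text \<open>The kernel of the map from A[\<Lambda>] to A[\<Lambda>/\<Gamma>], that is, the ideal of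
  the diagonalizable subgroup scheme with character group \<Lambda>/\<Gamma>. Stating it through
  sums over cosets avoids the quotient group.\<close>

definition coset_sum_ideal ::
  "('l, 'n) monoid_scheme \<Rightarrow> 'l set \<Rightarrow> ('a, 'm) ring_scheme \<Rightarrow> ('l \<Rightarrow> 'a) set" where
  "coset_sum_ideal \<Lambda> \<Gamma> A = {f \<in> carrier (group_algebra \<Lambda> A).
     \<forall>l\<in>carrier \<Lambda>. finsum A (\<lambda>m. f (l \<otimes>\<^bsub>\<Lambda>\<^esub> m)) \<Gamma> = \<zero>\<^bsub>A\<^esub>}"

lemma (in finite_comm_group) subgroup_finite: "subgroup \<Gamma> \<Lambda> \<Longrightarrow> finite \<Gamma>"
  by (meson fin finite_subset subgroup.subset)

section \<open>The Hopf ideal attached to a subgroup of characters\<close>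

context group_ring begin

text \<open>The element \<open>g - 1\<close>. Those with \<open>g\<close> in \<Gamma> generate the
  ideal of coset sums, so most facts about that ideal are checked on them only.\<close>

definition ga_delta :: "'l \<Rightarrow> 'l \<Rightarrow> 'a" where
  "ga_delta g = ga_monom \<Lambda> A g \<one>\<^bsub>A\<^esub> \<ominus>\<^bsub>GA\<^esub> ga_monom \<Lambda> A \<one>\<^bsub>\<Lambda>\<^esub> \<one>\<^bsub>A\<^esub>"

lemma ga_delta_closed: "ga_delta g \<in> carrier GA"
  unfolding ga_delta_def by (intro G.minus_closed) auto

text \<open>Each coset sum of a product of \<open>g\<close> and \<open>f\<close> is a linear
  combination, with the values of \<open>g\<close> as coefficients, of coset sums of
  \<open>f\<close> over translated cosets.\<close>

lemma coset_sum_ideal: 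
  assumes "subgroup \<Gamma> \<Lambda>"
  shows "ideal (coset_sum_ideal \<Lambda> \<Gamma> A) GA"
proof (rule G.idealI')
  interpret S: subgroup \<Gamma> \<Lambda> by fact
  show "\<zero>\<^bsub>GA\<^esub> \<in> coset_sum_ideal \<Lambda> \<Gamma> A"
    using G.zero_closed
    by (auto simp: coset_sum_ideal_def ga_zero simp del: G.zero_closed intro!: R.add.finprod_one_eqI)
  fix f g assume f: "f \<in> coset_sum_ideal \<Lambda> \<Gamma> A"
  {
    assume g: "g \<in> coset_sum_ideal \<Lambda> \<Gamma> A"
    have "finsum A (\<lambda>m. (f \<oplus>\<^bsub>GA\<^esub> g) (l \<otimes>\<^bsub>\<Lambda>\<^esub> m)) \<Gamma> = \<zero>\<^bsub>A\<^esub>" if "l \<in> carrier \<Lambda>" for l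
    proof -
      have "finsum A (\<lambda>m. (f \<oplus>\<^bsub>GA\<^esub> g) (l \<otimes>\<^bsub>\<Lambda>\<^esub> m)) \<Gamma> =
        finsum A (\<lambda>m. f (l \<otimes>\<^bsub>\<Lambda>\<^esub> m) \<oplus>\<^bsub>A\<^esub> g (l \<otimes>\<^bsub>\<Lambda>\<^esub> m)) \<Gamma>"
        using f g that by (intro R.finsum_cong') (auto simp: coset_sum_ideal_def ga_add ga_memD[of f] ga_memD[of g])
      also have "\<dots> = \<zero>\<^bsub>A\<^esub>"
        using f g that by (subst R.finsum_addf) (auto simp: coset_sum_ideal_def ga_memD[of f] ga_memD[of g])
      finally show ?thesis .
    qed
    with f g show "f \<oplus>\<^bsub>GA\<^esub> g \<in> coset_sum_ideal \<Lambda> \<Gamma> A"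
      using ga_add_closed[of f g] by (auto simp: coset_sum_ideal_def)
  }
  {
    assume g: "g \<in> carrier GA"
    have "finsum A (\<lambda>m. (g \<otimes>\<^bsub>GA\<^esub> f) (l \<otimes>\<^bsub>\<Lambda>\<^esub> m)) \<Gamma> = \<zero>\<^bsub>A\<^esub>" if l: "l \<in> carrier \<Lambda>" for l
    proof -
      note c = ga_memD[OF g]
      have fc: "f m \<in> carrier A" if "m \<in> carrier \<Lambda>" for m
        using f that by (auto simp: coset_sum_ideal_def ga_memD[of f])
      have "finsum A (\<lambda>m. (g \<otimes>\<^bsub>GA\<^esub> f) (l \<otimes>\<^bsub>\<Lambda>\<^esub> m)) \<Gamma> =
        finsum A (\<lambda>m. finsum A (\<lambda>n. g n \<otimes>\<^bsub>A\<^esub> f (inv\<^bsub>\<Lambda>\<^esub> n \<otimes>\<^bsub>\<Lambda>\<^esub> l \<otimes>\<^bsub>\<Lambda>\<^esub> m)) (carrier \<Lambda>)) \<Gamma>"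
        using fc c l by (intro R.finsum_cong') (auto simp: ga_mult L.m_assoc intro!: R.finsum_closed R.finsum_cong')
      also have "\<dots> = finsum A (\<lambda>n. finsum A (\<lambda>m. g n \<otimes>\<^bsub>A\<^esub> f (inv\<^bsub>\<Lambda>\<^esub> n \<otimes>\<^bsub>\<Lambda>\<^esub> l \<otimes>\<^bsub>\<Lambda>\<^esub> m)) \<Gamma>) (carrier \<Lambda>)"
        using fc c l by (intro R.finsum_swap) (auto simp: L.fin L.subgroup_finite[OF assms])
      also have "\<dots> = finsum A (\<lambda>n. \<zero>\<^bsub>A\<^esub>) (carrier \<Lambda>)"
        using fc c l f
        by (intro R.finsum_cong')
          (auto simp: coset_sum_ideal_def L.subgroup_finite[OF assms] simp flip: R.finsum_rdistr)
      finally show ?thesis by simp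
    qed
    with f g show "g \<otimes>\<^bsub>GA\<^esub> f \<in> coset_sum_ideal \<Lambda> \<Gamma> A"
      using ga_mult_closed[of g f] by (auto simp: coset_sum_ideal_def)
  }
qed (auto simp: coset_sum_ideal_def)

lemma coset_sum_monom:
  assumes "subgroup \<Gamma> \<Lambda>" "l \<in> carrier \<Lambda>" "n \<in> carrier \<Lambda>" "a \<in> carrier A"
  shows "finsum A (\<lambda>m. ga_monom \<Lambda> A l a (n \<otimes>\<^bsub>\<Lambda>\<^esub> m)) \<Gamma> =
    (if inv\<^bsub>\<Lambda>\<^esub> n \<otimes>\<^bsub>\<Lambda>\<^esub> l \<in> \<Gamma> then a else \<zero>\<^bsub>A\<^esub>)"
proof -
  interpret S: subgroup \<Gamma> \<Lambda> by fact
  have *: "n \<otimes>\<^bsub>\<Lambda>\<^esub> m = l \<longleftrightarrow> m = inv\<^bsub>\<Lambda>\<^esub> n \<otimes>\<^bsub>\<Lambda>\<^esub> l" if "m \<in> carrier \<Lambda>" for m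
    using assms that by (metis L.inv_solve_left)
  have "finsum A (\<lambda>m. ga_monom \<Lambda> A l a (n \<otimes>\<^bsub>\<Lambda>\<^esub> m)) \<Gamma> =
      finsum A (\<lambda>m. if m = inv\<^bsub>\<Lambda>\<^esub> n \<otimes>\<^bsub>\<Lambda>\<^esub> l then a else \<zero>\<^bsub>A\<^esub>) \<Gamma>"
    using assms * by (intro R.finsum_cong') (auto simp: ga_monom_def)
  also have "\<dots> = (if inv\<^bsub>\<Lambda>\<^esub> n \<otimes>\<^bsub>\<Lambda>\<^esub> l \<in> \<Gamma> then a else \<zero>\<^bsub>A\<^esub>)"
    using assms by (intro R.finsum_delta L.subgroup_finite) auto
  finally show ?thesis .
qed

lemma coset_sum_minus:
  assumes "\<Gamma> \<subseteq> carrier \<Lambda>" "l \<in> carrier \<Lambda>" "f \<in> carrier GA" "g \<in> carrier GA"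
  shows "finsum A (\<lambda>m. (f \<ominus>\<^bsub>GA\<^esub> g) (l \<otimes>\<^bsub>\<Lambda>\<^esub> m)) \<Gamma> =
    finsum A (\<lambda>m. f (l \<otimes>\<^bsub>\<Lambda>\<^esub> m)) \<Gamma> \<ominus>\<^bsub>A\<^esub> finsum A (\<lambda>m. g (l \<otimes>\<^bsub>\<Lambda>\<^esub> m)) \<Gamma>"
proof -
  have "finite \<Gamma>" using assms L.fin finite_subset by blast
  then show ?thesis using assms
    by (subst R.finsum_diff[symmetric]) (auto simp: ga_minus ga_memD[of f] ga_memD[of g] subset_iff intro!: R.finsum_cong')
qed

text \<open>For \<open>g\<close> in \<Gamma> the characters \<open>g\<close> and 1 lie in the same
  coset, so the coefficients 1 and -1 cancel in every coset sum. Otherwise the sum over \<Gamma>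
  itself equals -1, which is nonzero unless the ring is trivial.\<close>

lemma ga_delta_mem:
  assumes "subgroup \<Gamma> \<Lambda>" "g \<in> carrier \<Lambda>"
  shows "g \<in> \<Gamma> \<Longrightarrow> ga_delta g \<in> coset_sum_ideal \<Lambda> \<Gamma> A"
    and "ga_delta g \<in> coset_sum_ideal \<Lambda> \<Gamma> A \<Longrightarrow> \<one>\<^bsub>A\<^esub> \<noteq> \<zero>\<^bsub>A\<^esub> \<Longrightarrow> g \<in> \<Gamma>"
proof -
  interpret S: subgroup \<Gamma> \<Lambda> by fact
  have eq: "finsum A (\<lambda>m. ga_delta g (l \<otimes>\<^bsub>\<Lambda>\<^esub> m)) \<Gamma> =
    (if inv\<^bsub>\<Lambda>\<^esub> l \<otimes>\<^bsub>\<Lambda>\<^esub> g \<in> \<Gamma> then \<one>\<^bsub>A\<^esub> else \<zero>\<^bsub>A\<^esub>) \<ominus>\<^bsub>A\<^esub> (if inv\<^bsub>\<Lambda>\<^esub> l \<in> \<Gamma> then \<one>\<^bsub>A\<^esub> else \<zero>\<^bsub>A\<^esub>)"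
    if "l \<in> carrier \<Lambda>" for l
    unfolding ga_delta_def using that assms
    by (subst coset_sum_minus) (auto simp: coset_sum_monom)
  show "ga_delta g \<in> coset_sum_ideal \<Lambda> \<Gamma> A" if g: "g \<in> \<Gamma>"
  proof -
    have "inv\<^bsub>\<Lambda>\<^esub> l \<otimes>\<^bsub>\<Lambda>\<^esub> g \<in> \<Gamma> \<longleftrightarrow> inv\<^bsub>\<Lambda>\<^esub> l \<in> \<Gamma>" if "l \<in> carrier \<Lambda>" for l
    proof
      assume "inv\<^bsub>\<Lambda>\<^esub> l \<otimes>\<^bsub>\<Lambda>\<^esub> g \<in> \<Gamma>"
      from S.m_closed[OF this S.m_inv_closed[OF g]] show "inv\<^bsub>\<Lambda>\<^esub> l \<in> \<Gamma>"
        using that assms by (simp add: L.m_assoc)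
    qed (use g in auto)
    with eq ga_delta_closed[of g] show ?thesis by (simp add: coset_sum_ideal_def a_minus_def R.r_neg)
  qed
  assume mem: "ga_delta g \<in> coset_sum_ideal \<Lambda> \<Gamma> A" and nz: "\<one>\<^bsub>A\<^esub> \<noteq> \<zero>\<^bsub>A\<^esub>"
  have "finsum A (\<lambda>m. ga_delta g (\<one>\<^bsub>\<Lambda>\<^esub> \<otimes>\<^bsub>\<Lambda>\<^esub> m)) \<Gamma> = \<zero>\<^bsub>A\<^esub>"
    using mem L.one_closed unfolding coset_sum_ideal_def by blast
  then have eq1: "(if g \<in> \<Gamma> then \<one>\<^bsub>A\<^esub> else \<zero>\<^bsub>A\<^esub>) \<ominus>\<^bsub>A\<^esub> \<one>\<^bsub>A\<^esub> = \<zero>\<^bsub>A\<^esub>"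
    unfolding eq[OF L.one_closed] using assms(2) S.one_closed by simp
  show "g \<in> \<Gamma>"
  proof (rule ccontr)
    assume "g \<notin> \<Gamma>"
    with eq1 have "\<ominus>\<^bsub>A\<^esub> \<one>\<^bsub>A\<^esub> = \<zero>\<^bsub>A\<^esub>" by (simp add: a_minus_def)
    with R.l_neg[OF R.one_closed] nz show False by simp
  qed
qed

text \<open>Modulo an ideal containing all \<open>g - 1\<close> with \<open>g \<in> \<Gamma>\<close>, every element is congruent to one
  supported on a set of coset representatives, whose coefficients are the coset sums.\<close>

lemma coset_sum_ideal_minimal:
  assumes \<Gamma>: "subgroup \<Gamma> \<Lambda>" and J: "ideal J GA" and gen: "\<And>g. g \<in> \<Gamma> \<Longrightarrow> ga_delta g \<in> J"
  shows "coset_sum_ideal \<Lambda> \<Gamma> A \<subseteq> J"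
proof
  interpret S: subgroup \<Gamma> \<Lambda> by fact
  interpret J: ideal J GA by fact
  fix f assume f: "f \<in> coset_sum_ideal \<Lambda> \<Gamma> A"
  then have fc: "f \<in> carrier GA" by (simp add: coset_sum_ideal_def)
  note c = ga_memD[OF fc]
  let ?L = "carrier \<Lambda>"
  \<comment> \<open>A representative of the coset of \<open>l\<close>. The predicate under the
    choice depends only on that coset, so \<open>r\<close> is constant on cosets.\<close>
  define r where "r l = (SOME n. n \<in> ?L \<and> inv\<^bsub>\<Lambda>\<^esub> n \<otimes>\<^bsub>\<Lambda>\<^esub> l \<in> \<Gamma>)" for l
  have r: "r l \<in> ?L" "inv\<^bsub>\<Lambda>\<^esub> (r l) \<otimes>\<^bsub>\<Lambda>\<^esub> l \<in> \<Gamma>" if "l \<in> ?L" for l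
  proof -
    have "r l \<in> ?L \<and> inv\<^bsub>\<Lambda>\<^esub> (r l) \<otimes>\<^bsub>\<Lambda>\<^esub> l \<in> \<Gamma>"
      unfolding r_def by (rule someI[of _ l]) (use that in simp)
    then show "r l \<in> ?L" "inv\<^bsub>\<Lambda>\<^esub> (r l) \<otimes>\<^bsub>\<Lambda>\<^esub> l \<in> \<Gamma>" by auto
  qed
  have rm: "r (l \<otimes>\<^bsub>\<Lambda>\<^esub> g) = r l" if "l \<in> ?L" "g \<in> \<Gamma>" for l g
  proof -
    have "inv\<^bsub>\<Lambda>\<^esub> n \<otimes>\<^bsub>\<Lambda>\<^esub> (l \<otimes>\<^bsub>\<Lambda>\<^esub> g) \<in> \<Gamma> \<longleftrightarrow> inv\<^bsub>\<Lambda>\<^esub> n \<otimes>\<^bsub>\<Lambda>\<^esub> l \<in> \<Gamma>" if n: "n \<in> ?L" for n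
    proof
      assume "inv\<^bsub>\<Lambda>\<^esub> n \<otimes>\<^bsub>\<Lambda>\<^esub> (l \<otimes>\<^bsub>\<Lambda>\<^esub> g) \<in> \<Gamma>"
      from S.m_closed[OF this S.m_inv_closed[OF \<open>g \<in> \<Gamma>\<close>]] show "inv\<^bsub>\<Lambda>\<^esub> n \<otimes>\<^bsub>\<Lambda>\<^esub> l \<in> \<Gamma>"
        using n \<open>l \<in> ?L\<close> \<open>g \<in> \<Gamma>\<close> by (simp add: L.m_assoc)
    next
      assume "inv\<^bsub>\<Lambda>\<^esub> n \<otimes>\<^bsub>\<Lambda>\<^esub> l \<in> \<Gamma>"
      from S.m_closed[OF this \<open>g \<in> \<Gamma>\<close>] show "inv\<^bsub>\<Lambda>\<^esub> n \<otimes>\<^bsub>\<Lambda>\<^esub> (l \<otimes>\<^bsub>\<Lambda>\<^esub> g) \<in> \<Gamma>"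
        using n \<open>l \<in> ?L\<close> \<open>g \<in> \<Gamma>\<close> by (simp add: L.m_assoc)
    qed
    then show ?thesis unfolding r_def by (metis (no_types, lifting))
  qed
  have d: "ga_monom \<Lambda> A l a \<ominus>\<^bsub>GA\<^esub> ga_monom \<Lambda> A (r l) a \<in> J" if "l \<in> ?L" "a \<in> carrier A" for l a
  proof -
    \<comment> \<open>The difference of the terms at \<open>l\<close> and at \<open>r l\<close> is
      the term at \<open>r l\<close> times \<open>g - 1\<close>, where \<open>g\<close> is the
      quotient of \<open>l\<close> by \<open>r l\<close> and lies in \<Gamma>.\<close>
    have "ga_monom \<Lambda> A (r l) a \<otimes>\<^bsub>GA\<^esub> ga_delta (inv\<^bsub>\<Lambda>\<^esub> (r l) \<otimes>\<^bsub>\<Lambda>\<^esub> l) \<in> J"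
      using r[OF that(1)] that gen by (intro J.I_l_closed) auto
    also have "ga_monom \<Lambda> A (r l) a \<otimes>\<^bsub>GA\<^esub> ga_delta (inv\<^bsub>\<Lambda>\<^esub> (r l) \<otimes>\<^bsub>\<Lambda>\<^esub> l) =
      ga_monom \<Lambda> A l a \<ominus>\<^bsub>GA\<^esub> ga_monom \<Lambda> A (r l) a"
    proof -
      have "r l \<otimes>\<^bsub>\<Lambda>\<^esub> (inv\<^bsub>\<Lambda>\<^esub> (r l) \<otimes>\<^bsub>\<Lambda>\<^esub> l) = l"
        using r[OF that(1)] that by (simp add: L.m_assoc[symmetric])
      then show ?thesis unfolding ga_delta_def a_minus_def using r[OF that(1)] that
        by (subst G.r_distr) (simp_all add: ga_monom_split G.r_minus)
    qed
    finally show ?thesis .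
  qed
  let ?m = "\<lambda>l. ga_monom \<Lambda> A (r l) (f l)"
  \<comment> \<open>The coefficient at \<open>n\<close> is the sum of \<open>f\<close> over the
    coset represented by \<open>n\<close>, which vanishes by the choice of \<open>f\<close>; if
    \<open>n\<close> is not a chosen representative, the sum is empty.\<close>
  have "finsum GA ?m ?L = \<zero>\<^bsub>GA\<^esub>"
  proof (rule ga_ext)
    have mc: "?m \<in> ?L \<rightarrow> carrier GA" using c by auto
    show "finsum GA ?m ?L \<in> carrier GA" using G.finsum_closed[OF mc] by simp
    fix n assume n: "n \<in> ?L"
    have "finsum GA ?m ?L n = finsum A (\<lambda>l. ?m l n) ?L"
      using mc n by (intro ga_finsum L.fin)
    also have "\<dots> = finsum A f {l\<in>?L. r l = n}"
      using c n by (intro R.add.finprod_mono_neutral_cong_right) (auto simp: L.fin ga_monom_def)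
    also have "\<dots> = \<zero>\<^bsub>A\<^esub>"
    proof (cases "\<exists>l\<in>?L. r l = n")
      case True
      then obtain l where l: "l \<in> ?L" "r l = n" by auto
      have "{l\<in>?L. r l = n} = (\<lambda>g. l \<otimes>\<^bsub>\<Lambda>\<^esub> g) ` \<Gamma>"
      proof (intro equalityI subsetI)
        fix l' assume "l' \<in> {l\<in>?L. r l = n}"
        then have l': "l' \<in> ?L" "r l' = n" by auto
        have "inv\<^bsub>\<Lambda>\<^esub> (inv\<^bsub>\<Lambda>\<^esub> n \<otimes>\<^bsub>\<Lambda>\<^esub> l) \<otimes>\<^bsub>\<Lambda>\<^esub> (inv\<^bsub>\<Lambda>\<^esub> n \<otimes>\<^bsub>\<Lambda>\<^esub> l') \<in> \<Gamma>"
          using r(2)[OF l(1)] r(2)[OF l'(1)] l l' by auto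
        also have "inv\<^bsub>\<Lambda>\<^esub> (inv\<^bsub>\<Lambda>\<^esub> n \<otimes>\<^bsub>\<Lambda>\<^esub> l) \<otimes>\<^bsub>\<Lambda>\<^esub> (inv\<^bsub>\<Lambda>\<^esub> n \<otimes>\<^bsub>\<Lambda>\<^esub> l') = inv\<^bsub>\<Lambda>\<^esub> l \<otimes>\<^bsub>\<Lambda>\<^esub> l'"
        proof -
          have "n \<otimes>\<^bsub>\<Lambda>\<^esub> (inv\<^bsub>\<Lambda>\<^esub> n \<otimes>\<^bsub>\<Lambda>\<^esub> l') = l'" using n l' by (simp add: L.m_assoc[symmetric])
          then show ?thesis using n l l' by (simp add: L.inv_mult_group L.m_assoc)
        qed
        finally have "inv\<^bsub>\<Lambda>\<^esub> l \<otimes>\<^bsub>\<Lambda>\<^esub> l' \<in> \<Gamma>" .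
        moreover have "l' = l \<otimes>\<^bsub>\<Lambda>\<^esub> (inv\<^bsub>\<Lambda>\<^esub> l \<otimes>\<^bsub>\<Lambda>\<^esub> l')" using l l' by (simp add: L.m_assoc[symmetric])
        ultimately show "l' \<in> (\<lambda>g. l \<otimes>\<^bsub>\<Lambda>\<^esub> g) ` \<Gamma>" by blast
      qed (use l rm in auto)
      moreover have "finsum A f ((\<lambda>g. l \<otimes>\<^bsub>\<Lambda>\<^esub> g) ` \<Gamma>) = finsum A (\<lambda>g. f (l \<otimes>\<^bsub>\<Lambda>\<^esub> g)) \<Gamma>"
        using l c by (intro R.finsum_reindex) (auto simp: inj_on_def)
      ultimately show ?thesis using f l by (simp add: coset_sum_ideal_def)
    next
      case False
      then have "{l\<in>?L. r l = n} = {}" by auto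
      then show ?thesis by (simp only: R.finsum_empty)
    qed
    finally show "finsum GA ?m ?L n = \<zero>\<^bsub>GA\<^esub> n" using n by (simp add: ga_zero)
  qed auto
  then have "f = finsum GA (\<lambda>l. ga_monom \<Lambda> A l (f l)) ?L \<ominus>\<^bsub>GA\<^esub> finsum GA ?m ?L"
    using ga_expand[OF fc] fc by (simp add: a_minus_def)
  also have "\<dots> = finsum GA (\<lambda>l. ga_monom \<Lambda> A l (f l) \<ominus>\<^bsub>GA\<^esub> ?m l) ?L"
    using c by (intro G.finsum_diff[symmetric]) (auto simp: L.fin)
  also have "\<dots> \<in> J" using c d by (intro J.finsum_mem) (auto simp: L.fin)
  finally show "f \<in> J" .
qed

lemma ga_map_delta:
  assumes "\<phi> \<in> ring_hom R A" "cring R" "g \<in> carrier \<Lambda>"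
  shows "ga_map \<Lambda> \<phi> (group_ring.ga_delta \<Lambda> R g) = ga_delta g"
proof -
  interpret R': cring R by fact
  interpret R': group_ring \<Lambda> R by unfold_locales
  interpret h: ring_hom_cring R A \<phi> by unfold_locales fact
  show ?thesis unfolding R'.ga_delta_def ga_delta_def
    by (simp only: ga_minus R'.ga_minus ga_closed R'.ga_closed R.one_closed R'.one_closed)
      (auto simp: ga_map_def a_minus_def ga_monom_def intro!: restrict_ext)
qed

text \<open>Both sides are generated by the elements \<open>g - 1\<close> with \<open>g\<close> in
  \<Gamma>, which \<open>ga_map\<close> carries to each other. So base change of a subgroup scheme
  keeps its subgroup of characters.\<close>

lemma genideal_coset_sum:
  assumes "\<phi> \<in> ring_hom R A" "cring R" "subgroup \<Gamma> \<Lambda>"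
  shows "genideal GA (ga_map \<Lambda> \<phi> ` coset_sum_ideal \<Lambda> \<Gamma> R) = coset_sum_ideal \<Lambda> \<Gamma> A"
proof -
  interpret R': cring R by fact
  interpret R': group_ring \<Lambda> R by unfold_locales
  interpret h: ring_hom_cring R A \<phi> by unfold_locales fact
  interpret S: subgroup \<Gamma> \<Lambda> by fact
  have sub: "ga_map \<Lambda> \<phi> ` coset_sum_ideal \<Lambda> \<Gamma> R \<subseteq> coset_sum_ideal \<Lambda> \<Gamma> A"
  proof (rule image_subsetI)
    fix f assume f: "f \<in> coset_sum_ideal \<Lambda> \<Gamma> R"
    have fc: "f m \<in> carrier R" if "m \<in> carrier \<Lambda>" for m
      using f that by (auto simp: coset_sum_ideal_def R'.ga_memD[of f])
    have "finsum A (\<lambda>m. ga_map \<Lambda> \<phi> f (l \<otimes>\<^bsub>\<Lambda>\<^esub> m)) \<Gamma> = \<zero>\<^bsub>A\<^esub>" if "l \<in> carrier \<Lambda>" for l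
    proof -
      have "finsum A (\<lambda>m. ga_map \<Lambda> \<phi> f (l \<otimes>\<^bsub>\<Lambda>\<^esub> m)) \<Gamma> = \<phi> (finsum R (\<lambda>m. f (l \<otimes>\<^bsub>\<Lambda>\<^esub> m)) \<Gamma>)"
        using fc that by (subst h.hom_finsum) (auto simp: ga_map_def intro!: R.finsum_cong')
      with f that show ?thesis by (simp add: coset_sum_ideal_def)
    qed
    with fc show "ga_map \<Lambda> \<phi> f \<in> coset_sum_ideal \<Lambda> \<Gamma> A"
      by (auto simp: coset_sum_ideal_def ga_map_def intro!: gaI)
  qed
  then have c: "ga_map \<Lambda> \<phi> ` coset_sum_ideal \<Lambda> \<Gamma> R \<subseteq> carrier GA"
    by (auto simp: coset_sum_ideal_def)
  show ?thesis
  proof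
    show "genideal GA (ga_map \<Lambda> \<phi> ` coset_sum_ideal \<Lambda> \<Gamma> R) \<subseteq> coset_sum_ideal \<Lambda> \<Gamma> A"
      by (rule G.genideal_minimal[OF coset_sum_ideal[OF assms(3)] sub])
    show "coset_sum_ideal \<Lambda> \<Gamma> A \<subseteq> genideal GA (ga_map \<Lambda> \<phi> ` coset_sum_ideal \<Lambda> \<Gamma> R)"
    proof (rule coset_sum_ideal_minimal[OF assms(3) G.genideal_ideal[OF c]])
      fix g assume g: "g \<in> \<Gamma>"
      then have "ga_map \<Lambda> \<phi> (R'.ga_delta g) \<in> genideal GA (ga_map \<Lambda> \<phi> ` coset_sum_ideal \<Lambda> \<Gamma> R)"
        using G.genideal_self[OF c] R'.ga_delta_mem(1)[OF assms(3), of g] by auto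
      then show "ga_delta g \<in> genideal GA (ga_map \<Lambda> \<phi> ` coset_sum_ideal \<Lambda> \<Gamma> R)"
        using g by (simp add: ga_map_delta[OF assms(1,2)])
    qed
  qed
qed

lemma ga_monom_finsum:
  assumes "finite S" "a \<in> S \<rightarrow> carrier A"
  shows "ga_monom \<Lambda> A l (finsum A a S) = finsum GA (\<lambda>s. ga_monom \<Lambda> A l (a s)) S"
proof (rule ga_ext)
  have a: "a s \<in> carrier A" if "s \<in> S" for s using assms(2) that by blast
  have c: "(\<lambda>s. ga_monom \<Lambda> A l (a s)) \<in> S \<rightarrow> carrier GA"
    by (rule funcsetI) (rule ga_closed(1)[OF a])
  show "finsum GA (\<lambda>s. ga_monom \<Lambda> A l (a s)) S \<in> carrier GA"
    by (rule G.finsum_closed[OF c])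
  show "ga_monom \<Lambda> A l (finsum A a S) \<in> carrier GA"
    by (rule ga_closed(1)[OF R.finsum_closed[OF assms(2)]])
  fix m assume m: "m \<in> carrier \<Lambda>"
  have "finsum A (\<lambda>s. ga_monom \<Lambda> A l (a s) m) S = finsum A (\<lambda>s. if m = l then a s else \<zero>\<^bsub>A\<^esub>) S"
    using m by (simp add: ga_monom_def)
  also have "\<dots> = (if m = l then finsum A a S else \<zero>\<^bsub>A\<^esub>)"
    by simp
  finally show "ga_monom \<Lambda> A l (finsum A a S) m = finsum GA (\<lambda>s. ga_monom \<Lambda> A l (a s)) S m"
    using m ga_finsum[OF assms(1) c m] by (simp add: ga_monom_def)
qed

lemma ga_comult_monom: "ga_comult \<Lambda> A f = (\<lambda>l\<in>carrier \<Lambda>. ga_monom \<Lambda> A l (f l))"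
  by (auto simp: ga_comult_def ga_monom_def intro!: restrict_ext)

text \<open>This is the action of the group scheme on itself by translations, in which the part of
  degree \<open>l\<close> is spanned by the character \<open>l\<close>. With it the general
  computation of invariants applies to the quotient G/H.\<close>

lemma ga_comult_coaction: "coaction A \<Lambda> GA (ga_const \<Lambda> A) (ga_comult \<Lambda> A)"
proof -
  interpret GG: group_ring \<Lambda> GA by unfold_locales
  have closed: "ga_comult \<Lambda> A f \<in> carrier GG.GA" if "f \<in> carrier GA" for f
    using that by (auto simp: ga_comult_monom ga_memD[of f] intro!: GG.gaI)
  have hom: "ga_comult \<Lambda> A \<in> ring_hom GA GG.GA"
  proof (rule ring_hom_memI)
    show "ga_comult \<Lambda> A \<one>\<^bsub>GA\<^esub> = \<one>\<^bsub>GG.GA\<^esub>"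
      by (auto simp: ga_comult_def ga_one ga_const_def ga_zero intro!: restrict_ext)
    fix f g assume fg: "f \<in> carrier GA" "g \<in> carrier GA"
    note c = ga_memD[OF fg(1)] ga_memD[OF fg(2)]
    show "ga_comult \<Lambda> A (f \<oplus>\<^bsub>GA\<^esub> g) = ga_comult \<Lambda> A f \<oplus>\<^bsub>GG.GA\<^esub> ga_comult \<Lambda> A g"
      using c by (auto simp: ga_comult_def ga_add intro!: restrict_ext)
    show "ga_comult \<Lambda> A (f \<otimes>\<^bsub>GA\<^esub> g) = ga_comult \<Lambda> A f \<otimes>\<^bsub>GG.GA\<^esub> ga_comult \<Lambda> A g"
    proof (rule GG.ga_ext)
      fix l assume l: "l \<in> carrier \<Lambda>"
      have "(ga_comult \<Lambda> A f \<otimes>\<^bsub>GG.GA\<^esub> ga_comult \<Lambda> A g) l = finsum GA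
         (\<lambda>m. ga_monom \<Lambda> A l (f m \<otimes>\<^bsub>A\<^esub> g (inv\<^bsub>\<Lambda>\<^esub> m \<otimes>\<^bsub>\<Lambda>\<^esub> l))) (carrier \<Lambda>)"
        unfolding ga_mult[of \<Lambda> GA] using l c
      proof (simp add: ga_comult_monom, intro G.finsum_cong', goal_cases)
        case (3 m)
        then have "m \<otimes>\<^bsub>\<Lambda>\<^esub> (inv\<^bsub>\<Lambda>\<^esub> m \<otimes>\<^bsub>\<Lambda>\<^esub> l) = l" by (simp add: L.m_assoc[symmetric])
        with 3 show ?case by (simp add: ga_monom_split)
      qed auto
      then show "ga_comult \<Lambda> A (f \<otimes>\<^bsub>GA\<^esub> g) l = (ga_comult \<Lambda> A f \<otimes>\<^bsub>GG.GA\<^esub> ga_comult \<Lambda> A g) l"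
        using l c by (simp add: ga_comult_monom ga_mult[of \<Lambda> A] ga_monom_finsum L.fin)
    qed (use fg closed G.m_closed GG.G.m_closed in auto)
  qed (use closed in simp)
  show ?thesis
    unfolding coaction_def
  proof (intro conjI ballI)
    fix r assume "r \<in> carrier A"
    then show "ga_comult \<Lambda> A (ga_const \<Lambda> A r) = ga_const \<Lambda> GA (ga_const \<Lambda> A r)"
      by (auto simp: ga_comult_def ga_const_def ga_zero intro!: restrict_ext)
  next
    fix a assume a: "a \<in> carrier GA"
    then have "finsum GA (ga_comult \<Lambda> A a) (carrier \<Lambda>) = 
      finsum GA (\<lambda>l. ga_monom \<Lambda> A l (a l)) (carrier \<Lambda>)"
      by (intro G.finsum_cong') (auto simp: ga_comult_monom ga_memD[of a])
    then show "finsum GA (ga_comult \<Lambda> A a) (carrier \<Lambda>) = a" using ga_expand[OF a] by simp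
    fix l m assume "l \<in> carrier \<Lambda>" "m \<in> carrier \<Lambda>"
    then show "ga_comult \<Lambda> A (ga_comult \<Lambda> A a l) m = (if m = l then ga_comult \<Lambda> A a l else \<zero>\<^bsub>GA\<^esub>)"
      by (auto simp: ga_comult_def ga_zero intro!: restrict_ext)
  qed (rule ga_const_hom hom)+
qed

text \<open>\<Lambda> is a single coset of itself, so one coset sum is left: the largest \<Gamma>
  gives the trivial subgroup scheme.\<close>

lemma augmentation_ideal: "coset_sum_ideal \<Lambda> (carrier \<Lambda>) A = trivial_subgroup_scheme A \<Lambda>"
proof -
  have "finsum A (\<lambda>m. f (l \<otimes>\<^bsub>\<Lambda>\<^esub> m)) (carrier \<Lambda>) = finsum A f (carrier \<Lambda>)"
    if "f \<in> carrier GA" "l \<in> carrier \<Lambda>" for f l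
    using that by (intro finsum_shift) (auto simp: ga_memD[of f])
  then show ?thesis
    by (fastforce simp: coset_sum_ideal_def trivial_subgroup_scheme_def)
qed

text \<open>Inversion carries the coset of \<open>l\<close> to the coset of the inverse of
  \<open>l\<close>, hence permutes the coset sums.\<close>

lemma coset_sum_antipode:
  assumes \<Gamma>: "subgroup \<Gamma> \<Lambda>" and f: "f \<in> coset_sum_ideal \<Lambda> \<Gamma> A"
  shows "(\<lambda>l\<in>carrier \<Lambda>. f (inv\<^bsub>\<Lambda>\<^esub> l)) \<in> coset_sum_ideal \<Lambda> \<Gamma> A"
proof -
    interpret S: subgroup \<Gamma> \<Lambda> by fact
    have fc: "f m \<in> carrier A" if "m \<in> carrier \<Lambda>" for m
      using f that by (auto simp: coset_sum_ideal_def intro: ga_memD[of f])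
    have "finsum A (\<lambda>m. f (inv\<^bsub>\<Lambda>\<^esub> (l \<otimes>\<^bsub>\<Lambda>\<^esub> m))) \<Gamma> = \<zero>\<^bsub>A\<^esub>" if l: "l \<in> carrier \<Lambda>" for l
    proof -
      have b: "bij_betw (\<lambda>l. inv\<^bsub>\<Lambda>\<^esub> l) \<Gamma> \<Gamma>"
        by (rule bij_betwI[where g = "\<lambda>l. inv\<^bsub>\<Lambda>\<^esub> l"]) auto
      have "\<zero>\<^bsub>A\<^esub> = finsum A (\<lambda>m. f (inv\<^bsub>\<Lambda>\<^esub> l \<otimes>\<^bsub>\<Lambda>\<^esub> m)) ((\<lambda>l. inv\<^bsub>\<Lambda>\<^esub> l) ` \<Gamma>)"
        using b f l by (auto simp: bij_betw_def coset_sum_ideal_def)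
      also have "\<dots> = finsum A (\<lambda>m. f (inv\<^bsub>\<Lambda>\<^esub> l \<otimes>\<^bsub>\<Lambda>\<^esub> inv\<^bsub>\<Lambda>\<^esub> m)) \<Gamma>"
        using b l fc by (intro R.finsum_reindex) (auto simp: bij_betw_def)
      also have "\<dots> = finsum A (\<lambda>m. f (inv\<^bsub>\<Lambda>\<^esub> (l \<otimes>\<^bsub>\<Lambda>\<^esub> m))) \<Gamma>"
        using l fc by (intro R.finsum_cong') (auto simp: L.inv_mult)
      finally show ?thesis ..
    qed
    then have "finsum A (\<lambda>m. (\<lambda>l\<in>carrier \<Lambda>. f (inv\<^bsub>\<Lambda>\<^esub> l)) (l \<otimes>\<^bsub>\<Lambda>\<^esub> m)) \<Gamma> = \<zero>\<^bsub>A\<^esub>" if "l \<in> carrier \<Lambda>" for l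
    proof -
      have "finsum A (\<lambda>m. (\<lambda>l\<in>carrier \<Lambda>. f (inv\<^bsub>\<Lambda>\<^esub> l)) (l \<otimes>\<^bsub>\<Lambda>\<^esub> m)) \<Gamma> =
        finsum A (\<lambda>m. f (inv\<^bsub>\<Lambda>\<^esub> (l \<otimes>\<^bsub>\<Lambda>\<^esub> m))) \<Gamma>"
        using that fc by (intro R.finsum_cong') auto
      with \<open>\<And>l. l \<in> carrier \<Lambda> \<Longrightarrow> finsum A (\<lambda>m. f (inv\<^bsub>\<Lambda>\<^esub> (l \<otimes>\<^bsub>\<Lambda>\<^esub> m))) \<Gamma> = \<zero>\<^bsub>A\<^esub>\<close> that
      show ?thesis by simp
    qed
    with fc show ?thesis by (auto simp: coset_sum_ideal_def intro!: gaI)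
qed

text \<open>The elements satisfying the counit condition, and those satisfying the comultiplication
  condition, form ideals, so these two conditions need checking only for \<open>g - 1\<close>; the
  antipode condition is read off from the coset sums.\<close>

lemma subgroup_scheme_coset_sum:
  assumes \<Gamma>: "subgroup \<Gamma> \<Lambda>"
  shows "subgroup_scheme A \<Lambda> (coset_sum_ideal \<Lambda> \<Gamma> A)"
proof -
  interpret GG: group_ring \<Lambda> GA by unfold_locales
  interpret S: subgroup \<Gamma> \<Lambda> by fact
  let ?I = "coset_sum_ideal \<Lambda> \<Gamma> A"
  interpret I: ideal ?I GA by (rule coset_sum_ideal[OF \<Gamma>])
  interpret c: ring_hom_cring GA GG.GA "ga_comult \<Lambda> A"
    using ga_comult_coaction by unfold_locales (simp add: coaction_def)
  interpret d: ring_hom_cring A GA "ga_const \<Lambda> A"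
    using ga_const_hom by unfold_locales 
  let ?J = "genideal GG.GA (ga_const \<Lambda> GA ` ?I \<union> ga_map \<Lambda> (ga_const \<Lambda> A) ` ?I)"
  have sub: "ga_const \<Lambda> GA ` ?I \<union> ga_map \<Lambda> (ga_const \<Lambda> A) ` ?I \<subseteq> carrier GG.GA"
  proof -
    have "?I \<subseteq> carrier GA" by (rule I.a_subset)
    then show ?thesis
      unfolding ga_map_def
      by (intro Un_least image_subsetI GG.gaI ga_closed GG.ga_closed) (blast intro: ga_memD)+
  qed
  have J: "ideal ?J GG.GA" by (rule GG.G.genideal_ideal[OF sub])
  interpret J: ideal ?J GG.GA by (rule J)
  have mem: "ga_const \<Lambda> GA f \<in> ?J" "ga_map \<Lambda> (ga_const \<Lambda> A) f \<in> ?J" if "f \<in> ?I" for f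
    using GG.G.genideal_self[OF sub] that by auto
  have "ideal {f \<in> carrier GA. ga_comult \<Lambda> A f \<in> ?J} GA"
    by (rule G.idealI') (use J.a_closed J.zero_closed J.I_l_closed in auto)
  moreover have "ga_delta g \<in> {f \<in> carrier GA. ga_comult \<Lambda> A f \<in> ?J}" if g: "g \<in> \<Gamma>" for g
  proof -
    let ?e = "ga_monom \<Lambda> A" and ?E = "ga_monom \<Lambda> GA"
    have gI: "ga_delta g \<in> ?I" using ga_delta_mem(1)[OF \<Gamma>] g by auto
    have e: "?e n a \<in> carrier GA" if "a \<in> carrier A" for n a using that by simp
    have E: "?E n a \<in> carrier GG.GA" if "a \<in> carrier GA" for n a
      using that by simp
    have d: "ga_delta g \<in> carrier GA" by (rule ga_delta_closed)
    \<comment> \<open>With the coefficient ring as first tensor factor, the identity behind this is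
      g \<otimes> g - 1 \<otimes> 1 = (1 \<otimes> g)((g - 1) \<otimes> 1) + 1 \<otimes> (g -
      1).\<close>
    have "?E g \<one>\<^bsub>GA\<^esub> \<otimes>\<^bsub>GG.GA\<^esub> ga_const \<Lambda> GA (ga_delta g) \<oplus>\<^bsub>GG.GA\<^esub> ga_map \<Lambda> (ga_const \<Lambda> A) (ga_delta g) \<in> ?J"
      using mem[OF gI] E by (intro J.a_closed J.I_l_closed) auto
    also have "?E g \<one>\<^bsub>GA\<^esub> \<otimes>\<^bsub>GG.GA\<^esub> ga_const \<Lambda> GA (ga_delta g) = ?E g (ga_delta g)"
      using g d by (simp add: ga_const_monom GG.ga_monom_split)
    also have "?E g (ga_delta g) = ?E g (?e g \<one>\<^bsub>A\<^esub>) \<ominus>\<^bsub>GG.GA\<^esub> ?E g (?e \<one>\<^bsub>\<Lambda>\<^esub> \<one>\<^bsub>A\<^esub>)"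
      unfolding ga_delta_def using e E
      by (subst GG.ga_minus) (auto simp: ga_monom_def[of \<Lambda> GA] a_minus_def G.r_neg intro!: restrict_ext)
    also have "ga_map \<Lambda> (ga_const \<Lambda> A) (ga_delta g) = ?E g (?e \<one>\<^bsub>\<Lambda>\<^esub> \<one>\<^bsub>A\<^esub>) \<ominus>\<^bsub>GG.GA\<^esub> ?E \<one>\<^bsub>\<Lambda>\<^esub> (?e \<one>\<^bsub>\<Lambda>\<^esub> \<one>\<^bsub>A\<^esub>)"
      using g by (simp add: GG.ga_map_delta[OF ga_const_hom R.cring_axioms] GG.ga_delta_def ga_one ga_const_monom)
    also have "?E g (?e g \<one>\<^bsub>A\<^esub>) \<ominus>\<^bsub>GG.GA\<^esub> ?E g (?e \<one>\<^bsub>\<Lambda>\<^esub> \<one>\<^bsub>A\<^esub>) \<oplus>\<^bsub>GG.GA\<^esub>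
      (?E g (?e \<one>\<^bsub>\<Lambda>\<^esub> \<one>\<^bsub>A\<^esub>) \<ominus>\<^bsub>GG.GA\<^esub> ?E \<one>\<^bsub>\<Lambda>\<^esub> (?e \<one>\<^bsub>\<Lambda>\<^esub> \<one>\<^bsub>A\<^esub>)) =
      ?E g (?e g \<one>\<^bsub>A\<^esub>) \<ominus>\<^bsub>GG.GA\<^esub> ?E \<one>\<^bsub>\<Lambda>\<^esub> (?e \<one>\<^bsub>\<Lambda>\<^esub> \<one>\<^bsub>A\<^esub>)"
      using E[OF e[OF R.one_closed]] unfolding a_minus_def
      by (simp add: GG.G.a_assoc GG.G.r_neg1 GG.G.r_neg2)
    also have "\<dots> = ga_comult \<Lambda> A (ga_delta g)"
    proof -
      have cm: "ga_comult \<Lambda> A (?e n \<one>\<^bsub>A\<^esub>) = ?E n (?e n \<one>\<^bsub>A\<^esub>)" for n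
        by (auto simp: ga_comult_def ga_monom_def ga_zero intro!: restrict_ext)
      have "ga_comult \<Lambda> A (ga_delta g) =
        ga_comult \<Lambda> A (?e g \<one>\<^bsub>A\<^esub>) \<ominus>\<^bsub>GG.GA\<^esub> ga_comult \<Lambda> A (?e \<one>\<^bsub>\<Lambda>\<^esub> \<one>\<^bsub>A\<^esub>)"
        unfolding ga_delta_def a_minus_def using e by simp
      then show ?thesis by (simp only: cm)
    qed
    finally show ?thesis using d by simp
  qed
  ultimately have comult: "?I \<subseteq> {f \<in> carrier GA. ga_comult \<Lambda> A f \<in> ?J}"
    by (rule coset_sum_ideal_minimal[OF \<Gamma>])
  \<comment> \<open>The counit condition is membership in the ideal of the full group \<Lambda>,
    whose generators include those for \<Gamma>.\<close>
  have aug: "?I \<subseteq> coset_sum_ideal \<Lambda> (carrier \<Lambda>) A"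
    by (rule coset_sum_ideal_minimal[OF \<Gamma> coset_sum_ideal])
      (rule L.subgroup_self, rule ga_delta_mem(1), rule L.subgroup_self, auto)
  show ?thesis
    unfolding subgroup_scheme_def
  proof (intro conjI ballI I.ideal_axioms)
    fix f assume f: "f \<in> ?I"
    show "finsum A f (carrier \<Lambda>) = \<zero>\<^bsub>A\<^esub>"
      using subsetD[OF aug f] by (simp add: augmentation_ideal trivial_subgroup_scheme_def)
    show "(\<lambda>l\<in>carrier \<Lambda>. f (inv\<^bsub>\<Lambda>\<^esub> l)) \<in> ?I" by (rule coset_sum_antipode[OF \<Gamma> f])
    show "ga_comult \<Lambda> A f \<in> ?J" using subsetD[OF comult f] by simp
  qed
qed

end

text \<open>Linear duality on a coordinate space: a vector outside a subspace is separated from it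
  by a linear form, given here by its coefficients \<open>t\<close>. The induction is Gaussian
  elimination of the coordinate \<open>s\<close>.\<close>

lemma (in field) annihilator_separates:
  assumes "finite S" "I \<subseteq> S \<rightarrow>\<^sub>E carrier R" "(\<lambda>s\<in>S. \<zero>) \<in> I"
    "\<And>f g. f \<in> I \<Longrightarrow> g \<in> I \<Longrightarrow> (\<lambda>s\<in>S. f s \<oplus> g s) \<in> I"
    "\<And>c f. c \<in> carrier R \<Longrightarrow> f \<in> I \<Longrightarrow> (\<lambda>s\<in>S. c \<otimes> f s) \<in> I"
    "v \<in> S \<rightarrow>\<^sub>E carrier R" "v \<notin> I"
  shows "\<exists>t \<in> S \<rightarrow>\<^sub>E carrier R. (\<forall>f\<in>I. (\<Oplus>s\<in>S. f s \<otimes> t s) = \<zero>) \<and> (\<Oplus>s\<in>S. v s \<otimes> t s) \<noteq> \<zero>"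
  using assms
proof (induction S arbitrary: I v rule: finite_induct)
  case empty
  then have "v = (\<lambda>s\<in>{}. \<zero>)" by auto
  with empty show ?case by simp
next
  case (insert s S)
  note I_sub = insert.prems(1) and I_zero = insert.prems(2) and I_add = insert.prems(3)
    and I_scale = insert.prems(4) and v = insert.prems(5) and v_nin = insert.prems(6)
  have Ic: "f r \<in> carrier R" if "f \<in> I" "r \<in> insert s S" for f r
    using I_sub that by blast
  have vc: "v r \<in> carrier R" if "r \<in> insert s S" for r using v that by blast
  show ?case
  \<comment> \<open>If all of \<open>I\<close> vanishes at \<open>s\<close> while \<open>v\<close>
    does not, the coordinate form at \<open>s\<close> separates them.\<close>
  proof (cases "v s \<noteq> \<zero> \<and> (\<forall>f\<in>I. f s = \<zero>)")
    case True
    let ?t = "\<lambda>r\<in>insert s S. if r = s then \<one> else \<zero>"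
    have sum: "(\<Oplus>r\<in>insert s S. f r \<otimes> ?t r) = f s" if f: "\<And>r. r \<in> insert s S \<Longrightarrow> f r \<in> carrier R" for f
    proof -
      have "(\<Oplus>r\<in>insert s S. f r \<otimes> ?t r) = (\<Oplus>r\<in>insert s S. if r = s then f r else \<zero>)"
        using f by (intro finsum_cong') auto
      also have "\<dots> = f s" using f insert.hyps by (subst finsum_delta) auto
      finally show ?thesis .
    qed
    show ?thesis
    proof (intro bexI[of _ ?t] conjI ballI)
      fix f assume "f \<in> I"
      then have "f s = \<zero>" "\<And>r. r \<in> insert s S \<Longrightarrow> f r \<in> carrier R" using True Ic by blast+
      with sum[of f] show "(\<Oplus>r\<in>insert s S. f r \<otimes> ?t r) = \<zero>" by simp
    next
      show "(\<Oplus>r\<in>insert s S. v r \<otimes> ?t r) \<noteq> \<zero>" using True sum[of v] vc by simp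
    qed auto
  next
    case False
    \<comment> \<open>\<open>g\<close> is the pivot, scaled to the value 1 at \<open>s\<close>. If
      \<open>I\<close> vanishes at \<open>s\<close>, then so does \<open>v\<close> in this case, and
      the zero vector serves; the two equations cover both situations.\<close>
    obtain g where g: "g \<in> I" "v s \<otimes> g s = v s" "\<And>f. f \<in> I \<Longrightarrow> f s \<otimes> g s = f s"
    proof (cases "\<forall>f\<in>I. f s = \<zero>")
      case True
      with False have "v s = \<zero>" by auto
      show ?thesis
      proof (rule that[OF I_zero])
        show "v s \<otimes> (\<lambda>r\<in>insert s S. \<zero>) s = v s" using \<open>v s = \<zero>\<close> by simp
        fix f assume "f \<in> I"
        then have "f s = \<zero>" using True by blast
        then show "f s \<otimes> (\<lambda>r\<in>insert s S. \<zero>) s = f s" by simp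
      qed
    next
      case nz: False
      then obtain h where h: "h \<in> I" "h s \<noteq> \<zero>" by auto
      have hu: "h s \<in> Units R" using h Ic[of h s] by (simp add: field_Units)
      show ?thesis
      proof (rule that[of "\<lambda>r\<in>insert s S. inv (h s) \<otimes> h r"])
        show "(\<lambda>r\<in>insert s S. inv (h s) \<otimes> h r) \<in> I" using h hu by (intro I_scale) auto
        show "v s \<otimes> (\<lambda>r\<in>insert s S. inv (h s) \<otimes> h r) s = v s"
          using hu vc[of s] by simp
        fix f assume "f \<in> I"
        then show "f s \<otimes> (\<lambda>r\<in>insert s S. inv (h s) \<otimes> h r) s = f s"
          using hu Ic[of f s] by simp
      qed
    qed
    have gc: "g r \<in> carrier R" if "r \<in> insert s S" for r using Ic[OF g(1) that] .
    \<comment> \<open>Subtracting \<open>u s\<close> times the pivot clears the coordinate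
      \<open>s\<close>.\<close>
    define red where "red u = (\<lambda>r\<in>S. u r \<ominus> u s \<otimes> g r)" for u
    have red_c: "red u \<in> S \<rightarrow>\<^sub>E carrier R" if "\<And>r. r \<in> insert s S \<Longrightarrow> u r \<in> carrier R" for u
      using that gc by (auto simp: red_def)
    define I' where "I' = red ` I"
    have sub_mem: "(\<lambda>r\<in>insert s S. f r \<oplus> c \<otimes> g r) \<in> I" if "f \<in> I" "c \<in> carrier R" for f c
    proof -
      have "(\<lambda>r\<in>insert s S. f r \<oplus> (\<lambda>r\<in>insert s S. c \<otimes> g r) r) \<in> I"
        by (intro I_add I_scale that g)
      also have "(\<lambda>r\<in>insert s S. f r \<oplus> (\<lambda>r\<in>insert s S. c \<otimes> g r) r) =
          (\<lambda>r\<in>insert s S. f r \<oplus> c \<otimes> g r)" by (intro restrict_ext) simp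
      finally show ?thesis .
    qed
    have "\<exists>t\<in>S \<rightarrow>\<^sub>E carrier R. (\<forall>f\<in>I'. (\<Oplus>r\<in>S. f r \<otimes> t r) = \<zero>) \<and> (\<Oplus>r\<in>S. red v r \<otimes> t r) \<noteq> \<zero>"
    proof (rule insert.IH)
      show "I' \<subseteq> S \<rightarrow>\<^sub>E carrier R" unfolding I'_def by (intro image_subsetI red_c Ic)
      have "red (\<lambda>r\<in>insert s S. \<zero>) = (\<lambda>r\<in>S. \<zero>)"
        unfolding red_def using gc by (intro restrict_ext) (simp add: a_minus_def)
      then show "(\<lambda>r\<in>S. \<zero>) \<in> I'" using I_zero unfolding I'_def using imageI[OF I_zero, of red] by (simp only:)
      show "red v \<in> S \<rightarrow>\<^sub>E carrier R" by (rule red_c[OF vc])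
    next
      fix f h assume "f \<in> I'" "h \<in> I'"
      then obtain f0 h0 where fh: "f0 \<in> I" "h0 \<in> I" "f = red f0" "h = red h0" by (auto simp: I'_def)
      have "(\<lambda>r\<in>S. f r \<oplus> h r) = red (\<lambda>r\<in>insert s S. f0 r \<oplus> h0 r)"
        unfolding fh red_def
      proof (intro restrict_ext)
        fix r assume "r \<in> S"
        then have c: "f0 r \<in> carrier R" "h0 r \<in> carrier R" "f0 s \<in> carrier R" "h0 s \<in> carrier R" "g r \<in> carrier R"
          using Ic[OF fh(1)] Ic[OF fh(2)] gc by auto
        show "(\<lambda>r\<in>S. f0 r \<ominus> f0 s \<otimes> g r) r \<oplus> (\<lambda>r\<in>S. h0 r \<ominus> h0 s \<otimes> g r) r =
          (\<lambda>r\<in>insert s S. f0 r \<oplus> h0 r) r \<ominus> (\<lambda>r\<in>insert s S. f0 r \<oplus> h0 r) s \<otimes> g r"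
          using c \<open>r \<in> S\<close> by (simp add: a_minus_def l_distr minus_add a_ac)
      qed
      then show "(\<lambda>r\<in>S. f r \<oplus> h r) \<in> I'"
        unfolding I'_def using imageI[OF I_add[OF fh(1,2)], of red] by (simp only:)
    next
      fix c f assume "c \<in> carrier R" "f \<in> I'"
      then obtain f0 where f: "c \<in> carrier R" "f0 \<in> I" "f = red f0" by (auto simp: I'_def)
      have "(\<lambda>r\<in>S. c \<otimes> f r) = red (\<lambda>r\<in>insert s S. c \<otimes> f0 r)"
        unfolding f red_def
      proof (intro restrict_ext)
        fix r assume "r \<in> S"
        then have c: "f0 r \<in> carrier R" "f0 s \<in> carrier R" "g r \<in> carrier R"
          using Ic[OF f(2)] gc by auto
        show "c \<otimes> (\<lambda>r\<in>S. f0 r \<ominus> f0 s \<otimes> g r) r =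
          (\<lambda>r\<in>insert s S. c \<otimes> f0 r) r \<ominus> (\<lambda>r\<in>insert s S. c \<otimes> f0 r) s \<otimes> g r"
          using c \<open>r \<in> S\<close> f by (simp add: a_minus_def r_distr r_minus m_assoc)
      qed
      then show "(\<lambda>r\<in>S. c \<otimes> f r) \<in> I'"
        unfolding I'_def using imageI[OF I_scale[OF f(1,2)], of red] by (simp only:)
    next
      show "red v \<notin> I'"
      proof
        assume "red v \<in> I'"
        then obtain f where f: "f \<in> I" "red v = red f" by (auto simp: I'_def)
        \<comment> \<open>If \<open>red v\<close> came from \<open>f\<close>, then \<open>v\<close>
          would be \<open>f\<close> plus \<open>?c\<close> times the pivot, an element of
          \<open>I\<close>.\<close>
        let ?c = "v s \<ominus> f s"
        have "v = (\<lambda>r\<in>insert s S. f r \<oplus> ?c \<otimes> g r)"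
        proof (rule extensionalityI[where A = "insert s S"])
          fix r assume r: "r \<in> insert s S"
          have c: "v r \<in> carrier R" "f r \<in> carrier R" "g r \<in> carrier R" "v s \<in> carrier R" "f s \<in> carrier R"
            using r vc Ic[OF f(1)] gc by auto
          have "v r \<ominus> v s \<otimes> g r = f r \<ominus> f s \<otimes> g r"
          proof (cases "r = s")
            case True
            with c g(2) g(3)[OF f(1)] show ?thesis by (simp add: a_minus_def r_neg)
          next
            case False
            with fun_cong[OF f(2), of r] r show ?thesis by (simp add: red_def)
          qed
          note E = this
          have "v r = (v r \<ominus> v s \<otimes> g r) \<oplus> v s \<otimes> g r"
            using c by (simp add: a_minus_def a_assoc l_neg)
          also have "\<dots> = (f r \<ominus> f s \<otimes> g r) \<oplus> v s \<otimes> g r" by (simp only: E)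
          also have "\<dots> = f r \<oplus> ?c \<otimes> g r"
            using c by (simp add: a_minus_def l_distr l_minus a_ac)
          finally have "v r = f r \<oplus> ?c \<otimes> g r" .
          with r show "v r = (\<lambda>r\<in>insert s S. f r \<oplus> ?c \<otimes> g r) r" by simp
        qed (use v in \<open>auto simp: PiE_def\<close>)
        moreover have "(\<lambda>r\<in>insert s S. f r \<oplus> ?c \<otimes> g r) \<in> I"
          using vc Ic[OF f(1)] by (intro sub_mem f(1)) auto
        ultimately show False using v_nin by simp
      qed
    qed
    then obtain t where t: "t \<in> S \<rightarrow>\<^sub>E carrier R" "\<forall>f\<in>I'. (\<Oplus>r\<in>S. f r \<otimes> t r) = \<zero>" 
        "(\<Oplus>r\<in>S. red v r \<otimes> t r) \<noteq> \<zero>" by blast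
    have tc: "t r \<in> carrier R" if "r \<in> S" for r using t that by blast
    \<comment> \<open>The coefficient at \<open>s\<close> is chosen such that the extended form
      vanishes on the pivot; its value on any \<open>u\<close> is then the value of \<open>t\<close>
      on \<open>red u\<close>.\<close>
    let ?z = "\<ominus> (\<Oplus>r\<in>S. g r \<otimes> t r)"
    have zc: "(\<Oplus>r\<in>S. g r \<otimes> t r) \<in> carrier R" using gc tc by (intro finsum_closed) auto
    let ?t = "t(s := ?z)"
    have key: "(\<Oplus>r\<in>insert s S. u r \<otimes> ?t r) = (\<Oplus>r\<in>S. red u r \<otimes> t r)"
      if u: "\<And>r. r \<in> insert s S \<Longrightarrow> u r \<in> carrier R" for u
    proof -
      have us: "u s \<in> carrier R" using u by auto
      have "(\<Oplus>r\<in>S. red u r \<otimes> t r) = (\<Oplus>r\<in>S. u r \<otimes> t r \<ominus> u s \<otimes> (g r \<otimes> t r))"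
        using u us gc tc by (intro finsum_cong') (auto simp: red_def a_minus_def l_distr l_minus m_assoc)
      also have "\<dots> = (\<Oplus>r\<in>S. u r \<otimes> t r) \<ominus> u s \<otimes> (\<Oplus>r\<in>S. g r \<otimes> t r)"
        using u us gc tc insert.hyps by (subst finsum_diff) (auto simp: finsum_rdistr)
      also have "\<dots> = (\<Oplus>r\<in>insert s S. u r \<otimes> ?t r)"
      proof -
        have "(\<Oplus>r\<in>S. u r \<otimes> t r) = (\<Oplus>r\<in>S. u r \<otimes> ?t r)"
          using u tc insert.hyps by (intro finsum_cong') auto
        moreover have "(\<Oplus>r\<in>S. u r \<otimes> t r) \<in> carrier R" using u tc by (intro finsum_closed) auto
        moreover have "(\<Oplus>r\<in>insert s S. u r \<otimes> ?t r) = u s \<otimes> ?t s \<oplus> (\<Oplus>r\<in>S. u r \<otimes> ?t r)"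
          using u tc zc insert.hyps by (intro finsum_insert) auto
        ultimately show ?thesis using us zc by (simp add: a_minus_def r_minus a_comm)
      qed
      finally show ?thesis ..
    qed
    show ?thesis
    proof (intro bexI[of _ ?t] conjI ballI)
      show "?t \<in> insert s S \<rightarrow>\<^sub>E carrier R" using t zc by (auto simp: PiE_def extensional_def)
      show "(\<Oplus>r\<in>insert s S. v r \<otimes> ?t r) \<noteq> \<zero>" using key[OF vc] t(3) by simp
      fix f assume f: "f \<in> I"
      then have "(\<Oplus>r\<in>S. red f r \<otimes> t r) = \<zero>" using t(2) by (simp add: I'_def)
      with key[OF Ic[OF f]] show "(\<Oplus>r\<in>insert s S. f r \<otimes> ?t r) = \<zero>" by simp
    qed
  qed
qed

section \<open>Duality: every Hopf ideal comes from a subgroup of characters\<close>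

context group_ring begin

text \<open>The second argument is meant as a function on \<Lambda>, an element of the dual algebra,
  although it has the same type as an element of the group algebra; the pairing extends it
  linearly.\<close>

definition ga_pair :: "('l \<Rightarrow> 'a) \<Rightarrow> ('l \<Rightarrow> 'a) \<Rightarrow> 'a" where
  "ga_pair f t = finsum A (\<lambda>l. f l \<otimes>\<^bsub>A\<^esub> t l) (carrier \<Lambda>)"

lemma ga_pair_closed:
  assumes "f \<in> carrier GA" "t \<in> carrier GA"
  shows "ga_pair f t \<in> carrier A"
  using ga_memD[OF assms(1)] ga_memD[OF assms(2)] by (auto simp: ga_pair_def intro!: R.finsum_closed)

lemma ga_pair_add:
  assumes "f \<in> carrier GA" "g \<in> carrier GA" "t \<in> carrier GA"
  shows "ga_pair (f \<oplus>\<^bsub>GA\<^esub> g) t = ga_pair f t \<oplus>\<^bsub>A\<^esub> ga_pair g t"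
    and "ga_pair t (f \<oplus>\<^bsub>GA\<^esub> g) = ga_pair t f \<oplus>\<^bsub>A\<^esub> ga_pair t g"
proof -
  note c = ga_memD[OF assms(1)] ga_memD[OF assms(2)] ga_memD[OF assms(3)]
  have "ga_pair (f \<oplus>\<^bsub>GA\<^esub> g) t = finsum A (\<lambda>l. f l \<otimes>\<^bsub>A\<^esub> t l \<oplus>\<^bsub>A\<^esub> g l \<otimes>\<^bsub>A\<^esub> t l) (carrier \<Lambda>)"
    unfolding ga_pair_def using c by (intro R.finsum_cong') (auto simp: ga_add R.l_distr)
  also have "\<dots> = ga_pair f t \<oplus>\<^bsub>A\<^esub> ga_pair g t"
    unfolding ga_pair_def using c by (intro R.finsum_addf) auto
  finally show "ga_pair (f \<oplus>\<^bsub>GA\<^esub> g) t = ga_pair f t \<oplus>\<^bsub>A\<^esub> ga_pair g t" .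
  have "ga_pair t (f \<oplus>\<^bsub>GA\<^esub> g) = finsum A (\<lambda>l. t l \<otimes>\<^bsub>A\<^esub> f l \<oplus>\<^bsub>A\<^esub> t l \<otimes>\<^bsub>A\<^esub> g l) (carrier \<Lambda>)"
    unfolding ga_pair_def using c by (intro R.finsum_cong') (auto simp: ga_add R.r_distr)
  also have "\<dots> = ga_pair t f \<oplus>\<^bsub>A\<^esub> ga_pair t g"
    unfolding ga_pair_def using c by (intro R.finsum_addf) auto
  finally show "ga_pair t (f \<oplus>\<^bsub>GA\<^esub> g) = ga_pair t f \<oplus>\<^bsub>A\<^esub> ga_pair t g" .
qed

text \<open>The transpose, for \<open>ga_pair\<close>, of multiplication by the character
  \<open>g\<close>.\<close>

definition ga_shift :: "'l \<Rightarrow> ('l \<Rightarrow> 'a) \<Rightarrow> 'l \<Rightarrow> 'a" where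
  "ga_shift g t = (\<lambda>l\<in>carrier \<Lambda>. t (g \<otimes>\<^bsub>\<Lambda>\<^esub> l))"

lemma ga_shift_closed: "g \<in> carrier \<Lambda> \<Longrightarrow> t \<in> carrier GA \<Longrightarrow> ga_shift g t \<in> carrier GA"
  unfolding ga_shift_def by (rule gaI) (rule ga_memD, auto)

lemma ga_pair_monom_mult:
  assumes "g \<in> carrier \<Lambda>" "a \<in> carrier A" "f \<in> carrier GA" "t \<in> carrier GA"
  shows "ga_pair (ga_monom \<Lambda> A g a \<otimes>\<^bsub>GA\<^esub> f) t = a \<otimes>\<^bsub>A\<^esub> ga_pair f (ga_shift g t)"
proof -
  note c = ga_memD[OF assms(3)] ga_memD[OF assms(4)]
  let ?h = "\<lambda>l. a \<otimes>\<^bsub>A\<^esub> (f (inv\<^bsub>\<Lambda>\<^esub> g \<otimes>\<^bsub>\<Lambda>\<^esub> l) \<otimes>\<^bsub>A\<^esub> t l)"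
  have "ga_pair (ga_monom \<Lambda> A g a \<otimes>\<^bsub>GA\<^esub> f) t = finsum A ?h (carrier \<Lambda>)"
    unfolding ga_pair_def ga_monom_mult[OF assms(1-3)]
    using assms(1,2) c by (intro R.finsum_cong') (auto simp: R.m_assoc)
  also have "\<dots> = finsum A (\<lambda>l. ?h (g \<otimes>\<^bsub>\<Lambda>\<^esub> l)) (carrier \<Lambda>)"
    using assms(1,2) c by (intro finsum_shift[symmetric]) auto
  also have "\<dots> = finsum A (\<lambda>l. a \<otimes>\<^bsub>A\<^esub> (f l \<otimes>\<^bsub>A\<^esub> ga_shift g t l)) (carrier \<Lambda>)"
  proof (rule R.finsum_cong')
    fix l assume l: "l \<in> carrier \<Lambda>"
    then have "inv\<^bsub>\<Lambda>\<^esub> g \<otimes>\<^bsub>\<Lambda>\<^esub> (g \<otimes>\<^bsub>\<Lambda>\<^esub> l) = l" using assms(1) by (simp add: L.m_assoc[symmetric])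
    with l show "?h (g \<otimes>\<^bsub>\<Lambda>\<^esub> l) = a \<otimes>\<^bsub>A\<^esub> (f l \<otimes>\<^bsub>A\<^esub> ga_shift g t l)" by (simp add: ga_shift_def)
  qed (use assms(1,2) c in \<open>auto simp: ga_shift_def\<close>)
  also have "\<dots> = a \<otimes>\<^bsub>A\<^esub> ga_pair f (ga_shift g t)"
    unfolding ga_pair_def using assms(1,2) c
    by (intro R.finsum_rdistr[symmetric]) (auto simp: L.fin ga_shift_def)
  finally show ?thesis .
qed

lemma ga_pair_monom:
  assumes "g \<in> carrier \<Lambda>" "a \<in> carrier A" "t \<in> carrier GA"
  shows "ga_pair (ga_monom \<Lambda> A g a) t = a \<otimes>\<^bsub>A\<^esub> t g"
proof -
  note c = ga_memD[OF assms(3)]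
  have "ga_pair (ga_monom \<Lambda> A g a) t = finsum A (\<lambda>l. if l = g then a \<otimes>\<^bsub>A\<^esub> t l else \<zero>\<^bsub>A\<^esub>) (carrier \<Lambda>)"
    unfolding ga_pair_def using assms(1,2) c by (intro R.finsum_cong') (auto simp: ga_monom_def)
  also have "\<dots> = a \<otimes>\<^bsub>A\<^esub> t g" using assms(1,2) c by (subst R.finsum_delta) (auto simp: L.fin)
  finally show ?thesis .
qed

text \<open>The linear dual of A[\<Lambda>]/I, realised as a set of functions on \<Lambda>.\<close>

definition ga_perp :: "('l \<Rightarrow> 'a) set \<Rightarrow> ('l \<Rightarrow> 'a) set" where
  "ga_perp I = {t \<in> carrier GA. \<forall>f\<in>I. ga_pair f t = \<zero>\<^bsub>A\<^esub>}"

text \<open>An ideal is stable under multiplication by characters, so its annihilator is stable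
  under the transposed maps.\<close>

lemma ga_perp_shift:
  assumes "ideal I GA" "t \<in> ga_perp I" "g \<in> carrier \<Lambda>"
  shows "ga_shift g t \<in> ga_perp I"
proof -
  interpret I: ideal I GA by fact
  have t: "t \<in> carrier GA" "\<And>f. f \<in> I \<Longrightarrow> ga_pair f t = \<zero>\<^bsub>A\<^esub>" using assms(2) by (auto simp: ga_perp_def)
  have "ga_pair f (ga_shift g t) = \<zero>\<^bsub>A\<^esub>" if f: "f \<in> I" for f
  proof -
    have fc: "f \<in> carrier GA" by (rule I.Icarr[OF f])
    have "ga_pair f (ga_shift g t) = \<one>\<^bsub>A\<^esub> \<otimes>\<^bsub>A\<^esub> ga_pair f (ga_shift g t)"
      using ga_pair_closed[OF fc ga_shift_closed[OF assms(3) t(1)]] by simp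
    also have "\<dots> = ga_pair (ga_monom \<Lambda> A g \<one>\<^bsub>A\<^esub> \<otimes>\<^bsub>GA\<^esub> f) t"
      using ga_pair_monom_mult[OF assms(3) R.one_closed fc t(1)] by simp
    also have "\<dots> = \<zero>\<^bsub>A\<^esub>" by (rule t(2)) (intro I.I_l_closed f ga_closed R.one_closed)
    finally show ?thesis .
  qed
  then show ?thesis using ga_shift_closed[OF assms(3) t(1)] by (simp add: ga_perp_def)
qed

text \<open>The comultiplication of a Hopf ideal dualises to multiplicativity of its annihilator in the
  dual algebra, the algebra of functions on \<open>\<Lambda>\<close> with pointwise multiplication.\<close>

lemma ga_perp_mult:
  assumes I: "subgroup_scheme A \<Lambda> I" and t: "t \<in> ga_perp I" and u: "u \<in> ga_perp I"
  shows "(\<lambda>l\<in>carrier \<Lambda>. t l \<otimes>\<^bsub>A\<^esub> u l) \<in> ga_perp I"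
proof -
  interpret GG: group_ring \<Lambda> GA by unfold_locales
  have Iid: "ideal I GA" using I by (simp add: subgroup_scheme_def)
  interpret I: ideal I GA by (rule Iid)
  let ?L = "carrier \<Lambda>"
  \<comment> \<open>\<open>B F t u\<close> is the value on \<open>F\<close> of the tensor product of
    two functions: \<open>u\<close> is applied to the coefficients and \<open>t\<close> to the outer
    variable.\<close>
  define B where "B F t u = ga_pair (\<lambda>l\<in>?L. ga_pair (F l) u) t" for F t u
  let ?P = "ga_perp I"
  have Pc: "t \<in> carrier GA" if "t \<in> ?P" for t using that by (simp add: ga_perp_def)
  have inner: "(\<lambda>l\<in>?L. ga_pair (F l) u) \<in> carrier GA" if "F \<in> carrier GG.GA" "u \<in> ?P" for F u
    by (rule gaI) (rule ga_pair_closed[OF GG.ga_memD[OF that(1)] Pc[OF that(2)]])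
  \<comment> \<open>\<open>N\<close> consists of the elements killed by all such tensors. Being an
    ideal that contains the generators, it contains the ideal in which the comultiplication of
    \<open>I\<close> takes its values.\<close>
  define N where "N = {F \<in> carrier GG.GA. \<forall>t\<in>?P. \<forall>u\<in>?P. B F t u = \<zero>\<^bsub>A\<^esub>}"
  have N_add: "F \<oplus>\<^bsub>GG.GA\<^esub> H \<in> N" if F: "F \<in> N" and H: "H \<in> N" for F H
  proof -
    have c: "F \<in> carrier GG.GA" "H \<in> carrier GG.GA" using F H by (auto simp: N_def)
    have "B (F \<oplus>\<^bsub>GG.GA\<^esub> H) t u = \<zero>\<^bsub>A\<^esub>" if tu: "t \<in> ?P" "u \<in> ?P" for t u
    proof -
      have "(\<lambda>l\<in>?L. ga_pair ((F \<oplus>\<^bsub>GG.GA\<^esub> H) l) u) =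
        (\<lambda>l\<in>?L. ga_pair (F l) u) \<oplus>\<^bsub>GA\<^esub> (\<lambda>l\<in>?L. ga_pair (H l) u)"
        unfolding ga_add[where f = "\<lambda>l\<in>?L. ga_pair (F l) u"]
      proof (intro restrict_ext)
        fix l assume l: "l \<in> ?L"
        then have "(F \<oplus>\<^bsub>GG.GA\<^esub> H) l = F l \<oplus>\<^bsub>GA\<^esub> H l" by (simp add: ga_add[where f = F])
        with l show "ga_pair ((F \<oplus>\<^bsub>GG.GA\<^esub> H) l) u =
          (\<lambda>l\<in>?L. ga_pair (F l) u) l \<oplus>\<^bsub>A\<^esub> (\<lambda>l\<in>?L. ga_pair (H l) u) l"
          by (simp add: ga_pair_add(1)[OF GG.ga_memD[OF c(1)] GG.ga_memD[OF c(2)] Pc[OF tu(2)]])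
      qed
      then have "B (F \<oplus>\<^bsub>GG.GA\<^esub> H) t u = B F t u \<oplus>\<^bsub>A\<^esub> B H t u"
        unfolding B_def by (simp add: ga_pair_add(1)[OF inner[OF c(1) tu(2)] inner[OF c(2) tu(2)] Pc[OF tu(1)]])
      with F H tu show ?thesis by (simp add: N_def)
    qed
    with c show ?thesis by (simp add: N_def)
  qed
  have N_zero: "\<zero>\<^bsub>GG.GA\<^esub> \<in> N"
  proof -
    have z: "\<zero>\<^bsub>GG.GA\<^esub> l = ga_monom \<Lambda> A \<one>\<^bsub>\<Lambda>\<^esub> \<zero>\<^bsub>A\<^esub>" if "l \<in> ?L" for l
      using that by (auto simp: ga_zero ga_monom_def intro!: restrict_ext)
    have "B \<zero>\<^bsub>GG.GA\<^esub> t u = \<zero>\<^bsub>A\<^esub>" if tu: "t \<in> ?P" "u \<in> ?P" for t u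
    proof -
      have "(\<lambda>l\<in>?L. ga_pair (\<zero>\<^bsub>GG.GA\<^esub> l) u) = ga_monom \<Lambda> A \<one>\<^bsub>\<Lambda>\<^esub> \<zero>\<^bsub>A\<^esub>"
        unfolding ga_monom_def[of _ _ "\<one>\<^bsub>\<Lambda>\<^esub>" "\<zero>\<^bsub>A\<^esub>"] using ga_memD[OF Pc[OF tu(2)] L.one_closed]
        by (intro restrict_ext) (simp add: z ga_pair_monom[OF L.one_closed R.zero_closed Pc[OF tu(2)]])
      then show ?thesis
        using ga_memD[OF Pc[OF tu(1)] L.one_closed]
        by (simp add: B_def ga_pair_monom[OF L.one_closed R.zero_closed Pc[OF tu(1)]])
    qed
    then show ?thesis by (simp add: N_def)
  qed
  \<comment> \<open>Up to the scalar \<open>a\<close>, a product of characters acts on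
    \<open>B\<close> by translating \<open>t\<close> and \<open>u\<close>, and the annihilator is
    stable under translations.\<close>
  have N_monom: "ga_monom \<Lambda> GA g (ga_monom \<Lambda> A h a) \<otimes>\<^bsub>GG.GA\<^esub> F \<in> N"
    if F: "F \<in> N" and g: "g \<in> ?L" and h: "h \<in> ?L" and a: "a \<in> carrier A" for F g h a
  proof -
    have Fc: "F \<in> carrier GG.GA" using F by (simp add: N_def)
    have mc: "ga_monom \<Lambda> A h a \<in> carrier GA" using a by simp
    have "B (ga_monom \<Lambda> GA g (ga_monom \<Lambda> A h a) \<otimes>\<^bsub>GG.GA\<^esub> F) t u = \<zero>\<^bsub>A\<^esub>" if tu: "t \<in> ?P" "u \<in> ?P" for t u
    proof -
      have u': "ga_shift h u \<in> ?P" by (rule ga_perp_shift[OF Iid tu(2) h])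
      have t': "ga_shift g t \<in> ?P" by (rule ga_perp_shift[OF Iid tu(1) g])
      let ?f = "\<lambda>l\<in>?L. ga_pair (F l) (ga_shift h u)"
      have "(\<lambda>l\<in>?L. ga_pair ((ga_monom \<Lambda> GA g (ga_monom \<Lambda> A h a) \<otimes>\<^bsub>GG.GA\<^esub> F) l) u) =
        ga_monom \<Lambda> A g a \<otimes>\<^bsub>GA\<^esub> ?f"
        unfolding GG.ga_monom_mult[OF g mc Fc] ga_monom_mult[OF g a inner[OF Fc u']]
      proof (intro restrict_ext)
        fix l assume l: "l \<in> ?L"
        with g have gl: "inv\<^bsub>\<Lambda>\<^esub> g \<otimes>\<^bsub>\<Lambda>\<^esub> l \<in> ?L" by simp
        show "ga_pair ((\<lambda>l\<in>?L. ga_monom \<Lambda> A h a \<otimes>\<^bsub>GA\<^esub> F (inv\<^bsub>\<Lambda>\<^esub> g \<otimes>\<^bsub>\<Lambda>\<^esub> l)) l) u =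
          a \<otimes>\<^bsub>A\<^esub> ?f (inv\<^bsub>\<Lambda>\<^esub> g \<otimes>\<^bsub>\<Lambda>\<^esub> l)"
          using l gl ga_pair_monom_mult[OF h a GG.ga_memD[OF Fc gl] Pc[OF tu(2)]] by simp
      qed
      then have "B (ga_monom \<Lambda> GA g (ga_monom \<Lambda> A h a) \<otimes>\<^bsub>GG.GA\<^esub> F) t u = a \<otimes>\<^bsub>A\<^esub> B F (ga_shift g t) (ga_shift h u)"
        unfolding B_def by (simp add: ga_pair_monom_mult[OF g a inner[OF Fc u'] Pc[OF tu(1)]])
      also have "\<dots> = \<zero>\<^bsub>A\<^esub>" using F t' u' a by (simp add: N_def)
      finally show ?thesis .
    qed
    moreover have "ga_monom \<Lambda> GA g (ga_monom \<Lambda> A h a) \<otimes>\<^bsub>GG.GA\<^esub> F \<in> carrier GG.GA"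
      using Fc mc by (intro GG.G.m_closed) simp
    ultimately show ?thesis by (simp add: N_def)
  qed
  have N_finsum: "finsum GG.GA f S \<in> N" if "finite S" "\<And>s. s \<in> S \<Longrightarrow> f s \<in> N" for f and S :: "'l set"
    using that
  proof (induction S rule: finite_induct)
    case empty show ?case using N_zero by simp
  next
    case (insert s S)
    then have "f s \<in> carrier GG.GA" "f \<in> S \<rightarrow> carrier GG.GA" by (auto simp: N_def)
    with insert N_add show ?case by (simp add: GG.G.finsum_insert)
  qed
  have N_mult: "G \<otimes>\<^bsub>GG.GA\<^esub> F \<in> N" if F: "F \<in> N" and G: "G \<in> carrier GG.GA" for F G
  proof -
    have Fc: "F \<in> carrier GG.GA" using F by (simp add: N_def)
    note Gl = GG.ga_memD[OF G]
    have *: "ga_monom \<Lambda> GA l a \<otimes>\<^bsub>GG.GA\<^esub> F \<in> N" if l: "l \<in> ?L" and a: "a \<in> carrier GA" for l a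
    proof -
      have mc: "(\<lambda>m. ga_monom \<Lambda> A m (a m)) \<in> ?L \<rightarrow> carrier GA" using ga_memD[OF a] by simp
      have "ga_monom \<Lambda> GA l a = finsum GG.GA (\<lambda>m. ga_monom \<Lambda> GA l (ga_monom \<Lambda> A m (a m))) ?L"
        by (subst ga_expand[OF a]) (rule GG.ga_monom_finsum[OF L.fin mc])
      then have "ga_monom \<Lambda> GA l a \<otimes>\<^bsub>GG.GA\<^esub> F =
        finsum GG.GA (\<lambda>m. ga_monom \<Lambda> GA l (ga_monom \<Lambda> A m (a m)) \<otimes>\<^bsub>GG.GA\<^esub> F) ?L"
        using mc Fc by (simp add: GG.G.finsum_ldistr L.fin Pi_iff)
      also have "\<dots> \<in> N" using ga_memD[OF a] l by (intro N_finsum L.fin N_monom F) auto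
      finally show ?thesis .
    qed
    have "G \<otimes>\<^bsub>GG.GA\<^esub> F = finsum GG.GA (\<lambda>l. ga_monom \<Lambda> GA l (G l)) ?L \<otimes>\<^bsub>GG.GA\<^esub> F"
      by (subst GG.ga_expand[OF G]) (rule refl)
    also have "\<dots> = finsum GG.GA (\<lambda>l. ga_monom \<Lambda> GA l (G l) \<otimes>\<^bsub>GG.GA\<^esub> F) ?L"
      using Gl Fc by (simp add: GG.G.finsum_ldistr L.fin Pi_iff)
    also have "\<dots> \<in> N" using Gl by (intro N_finsum L.fin *) auto
    finally show ?thesis .
  qed
  have Nid: "ideal N GG.GA"
    by (rule GG.G.idealI') (use N_add N_zero N_mult in \<open>auto simp: N_def\<close>)
  have gens: "ga_const \<Lambda> GA ` I \<union> ga_map \<Lambda> (ga_const \<Lambda> A) ` I \<subseteq> N"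
  proof (intro Un_least image_subsetI)
    fix f assume f: "f \<in> I"
    have fc: "f \<in> carrier GA" by (rule I.Icarr[OF f])
    have p: "ga_pair f t = \<zero>\<^bsub>A\<^esub>" if "t \<in> ?P" for t using that f by (simp add: ga_perp_def)
    \<comment> \<open>For this kind of generator the inner pairing with \<open>u\<close> vanishes.
      For the other kind it only multiplies by the value of \<open>u\<close> at the neutral element,
      and then the pairing with \<open>t\<close> vanishes.\<close>
    have "B (ga_const \<Lambda> GA f) t u = \<zero>\<^bsub>A\<^esub>" if tu: "t \<in> ?P" "u \<in> ?P" for t u
    proof -
      have "(\<lambda>l\<in>?L. ga_pair (ga_const \<Lambda> GA f l) u) = ga_monom \<Lambda> A \<one>\<^bsub>\<Lambda>\<^esub> \<zero>\<^bsub>A\<^esub>"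
        unfolding ga_monom_def
      proof (intro restrict_ext)
        fix l assume l: "l \<in> ?L"
        have "\<zero>\<^bsub>GA\<^esub> = ga_monom \<Lambda> A \<one>\<^bsub>\<Lambda>\<^esub> \<zero>\<^bsub>A\<^esub>"
          by (auto simp: ga_zero ga_monom_def intro!: restrict_ext)
        then have "ga_pair \<zero>\<^bsub>GA\<^esub> u = \<zero>\<^bsub>A\<^esub>"
          using ga_memD[OF Pc[OF tu(2)] L.one_closed]
          by (simp add: ga_pair_monom[OF L.one_closed R.zero_closed Pc[OF tu(2)]])
        with p[OF tu(2)] l show "ga_pair (ga_const \<Lambda> GA f l) u = (if l = \<one>\<^bsub>\<Lambda>\<^esub> then \<zero>\<^bsub>A\<^esub> else \<zero>\<^bsub>A\<^esub>)"
          by (simp add: ga_const_def)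
      qed
      then show ?thesis
        using ga_memD[OF Pc[OF tu(1)] L.one_closed]
        by (simp add: B_def ga_pair_monom[OF L.one_closed R.zero_closed Pc[OF tu(1)]])
    qed
    with fc show "ga_const \<Lambda> GA f \<in> N" by (simp add: N_def)
    have "B (ga_map \<Lambda> (ga_const \<Lambda> A) f) t u = \<zero>\<^bsub>A\<^esub>" if tu: "t \<in> ?P" "u \<in> ?P" for t u
    proof -
      have u1: "u \<one>\<^bsub>\<Lambda>\<^esub> \<in> carrier A" by (rule ga_memD[OF Pc[OF tu(2)] L.one_closed])
      have "(\<lambda>l\<in>?L. ga_pair (ga_map \<Lambda> (ga_const \<Lambda> A) f l) u) = (\<lambda>l\<in>?L. f l \<otimes>\<^bsub>A\<^esub> u \<one>\<^bsub>\<Lambda>\<^esub>)"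
        by (intro restrict_ext) (simp add: ga_map_def ga_const_monom ga_pair_monom[OF L.one_closed ga_memD[OF fc] Pc[OF tu(2)]])
      then have "B (ga_map \<Lambda> (ga_const \<Lambda> A) f) t u = finsum A (\<lambda>l. u \<one>\<^bsub>\<Lambda>\<^esub> \<otimes>\<^bsub>A\<^esub> (f l \<otimes>\<^bsub>A\<^esub> t l)) ?L"
        using u1 ga_memD[OF fc] ga_memD[OF Pc[OF tu(1)]] unfolding B_def ga_pair_def
        by (simp, intro R.finsum_cong') (auto simp: R.m_ac)
      also have "\<dots> = u \<one>\<^bsub>\<Lambda>\<^esub> \<otimes>\<^bsub>A\<^esub> ga_pair f t" unfolding ga_pair_def
        using u1 ga_memD[OF fc] ga_memD[OF Pc[OF tu(1)]] by (intro R.finsum_rdistr[symmetric]) (auto simp: L.fin)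
      finally show ?thesis using p[OF tu(1)] u1 by simp
    qed
    moreover have "ga_map \<Lambda> (ga_const \<Lambda> A) f \<in> carrier GG.GA"
      unfolding ga_map_def by (rule GG.gaI) (rule ga_closed(2)[OF ga_memD[OF fc]])
    ultimately show "ga_map \<Lambda> (ga_const \<Lambda> A) f \<in> N" by (simp add: N_def)
  qed
  have genN: "genideal GG.GA (ga_const \<Lambda> GA ` I \<union> ga_map \<Lambda> (ga_const \<Lambda> A) ` I) \<subseteq> N"
    by (rule GG.G.genideal_minimal[OF Nid gens])
  note tc = ga_memD[OF Pc[OF t]] and uc = ga_memD[OF Pc[OF u]]
  have "ga_pair f (\<lambda>l\<in>?L. t l \<otimes>\<^bsub>A\<^esub> u l) = \<zero>\<^bsub>A\<^esub>" if f: "f \<in> I" for f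
  proof -
    have fc: "f \<in> carrier GA" by (rule I.Icarr[OF f])
    \<comment> \<open>On the comultiplication of \<open>f\<close> the form \<open>B\<close> is the
      pairing of \<open>f\<close> with the pointwise product of \<open>t\<close> and
      \<open>u\<close>.\<close>
    have "ga_comult \<Lambda> A f \<in> N" using I f genN by (auto simp: subgroup_scheme_def)
    then have "B (ga_comult \<Lambda> A f) t u = \<zero>\<^bsub>A\<^esub>" using t u by (simp add: N_def)
    moreover have "(\<lambda>l\<in>?L. ga_pair (ga_comult \<Lambda> A f l) u) = (\<lambda>l\<in>?L. f l \<otimes>\<^bsub>A\<^esub> u l)"
      by (intro restrict_ext) (simp add: ga_comult_monom ga_pair_monom[OF _ ga_memD[OF fc] Pc[OF u]])
    moreover have "ga_pair (\<lambda>l\<in>?L. f l \<otimes>\<^bsub>A\<^esub> u l) t = ga_pair f (\<lambda>l\<in>?L. t l \<otimes>\<^bsub>A\<^esub> u l)"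
      unfolding ga_pair_def using tc uc ga_memD[OF fc] by (intro R.finsum_cong') (auto simp: R.m_ac)
    ultimately show ?thesis by (simp add: B_def)
  qed
  moreover have "(\<lambda>l\<in>?L. t l \<otimes>\<^bsub>A\<^esub> u l) \<in> carrier GA" by (rule gaI) (use tc uc in simp)
  ultimately show ?thesis by (simp add: ga_perp_def)
qed

text \<open>The dual of the Hopf algebra \<open>A[\<Lambda>]/I\<close> is a subalgebra of \<open>A\<^sup>\<Lambda>\<close>, hence consists of the functions
  constant on the classes of a partition of \<open>\<Lambda>\<close>. It is stable under translations, so the classes
  are the cosets of a subgroup.\<close>

theorem subgroup_scheme_imp_coset_sum:
  assumes "field A" and I: "subgroup_scheme A \<Lambda> I"
  shows "\<exists>\<Gamma>. subgroup \<Gamma> \<Lambda> \<and> I = coset_sum_ideal \<Lambda> \<Gamma> A"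
proof -
  interpret F: field A by fact
  have Iid: "ideal I GA" using I by (simp add: subgroup_scheme_def)
  interpret I: ideal I GA by (rule Iid)
  let ?L = "carrier \<Lambda>" and ?P = "ga_perp I"
  have Pc: "t \<in> carrier GA" if "t \<in> ?P" for t using that by (simp add: ga_perp_def)
  note Pm = ga_memD[OF Pc]
  \<comment> \<open>Constant functions lie in the annihilator because the counit vanishes on
    \<open>I\<close>; with them, separating functions can be normalised.\<close>
  have affine: "(\<lambda>l\<in>?L. a \<otimes>\<^bsub>A\<^esub> t l \<oplus>\<^bsub>A\<^esub> b) \<in> ?P" if t: "t \<in> ?P" and a: "a \<in> carrier A" and b: "b \<in> carrier A" for t a b
  proof -
    have "ga_pair f (\<lambda>l\<in>?L. a \<otimes>\<^bsub>A\<^esub> t l \<oplus>\<^bsub>A\<^esub> b) = \<zero>\<^bsub>A\<^esub>" if f: "f \<in> I" for f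
    proof -
      note fm = ga_memD[OF I.Icarr[OF f]]
      have "ga_pair f (\<lambda>l\<in>?L. a \<otimes>\<^bsub>A\<^esub> t l \<oplus>\<^bsub>A\<^esub> b) =
        finsum A (\<lambda>l. a \<otimes>\<^bsub>A\<^esub> (f l \<otimes>\<^bsub>A\<^esub> t l) \<oplus>\<^bsub>A\<^esub> b \<otimes>\<^bsub>A\<^esub> f l) ?L"
        unfolding ga_pair_def using fm Pm[OF t] a b
        by (intro R.finsum_cong') (auto simp: R.r_distr R.m_ac)
      also have "\<dots> = a \<otimes>\<^bsub>A\<^esub> ga_pair f t \<oplus>\<^bsub>A\<^esub> b \<otimes>\<^bsub>A\<^esub> finsum A f ?L"
        unfolding ga_pair_def using fm Pm[OF t] a b
        by (subst R.finsum_addf) (auto simp: R.finsum_rdistr L.fin)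
      also have "ga_pair f t = \<zero>\<^bsub>A\<^esub>" using t f by (simp add: ga_perp_def)
      also have "finsum A f ?L = \<zero>\<^bsub>A\<^esub>" using I f by (simp add: subgroup_scheme_def)
      also have "a \<otimes>\<^bsub>A\<^esub> \<zero>\<^bsub>A\<^esub> \<oplus>\<^bsub>A\<^esub> b \<otimes>\<^bsub>A\<^esub> \<zero>\<^bsub>A\<^esub> = \<zero>\<^bsub>A\<^esub>" using a b by simp
      finally show ?thesis .
    qed
    moreover have "(\<lambda>l\<in>?L. a \<otimes>\<^bsub>A\<^esub> t l \<oplus>\<^bsub>A\<^esub> b) \<in> carrier GA" by (rule gaI) (use Pm[OF t] a b in simp)
    ultimately show ?thesis by (simp add: ga_perp_def)
  qed
  have zeroP: "(\<lambda>l\<in>?L. \<zero>\<^bsub>A\<^esub>) \<in> ?P"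
  proof -
    have c: "(\<lambda>l\<in>?L. \<zero>\<^bsub>A\<^esub>) \<in> carrier GA" by (rule gaI) simp
    have "ga_pair f (\<lambda>l\<in>?L. \<zero>\<^bsub>A\<^esub>) = \<zero>\<^bsub>A\<^esub>" if f: "f \<in> I" for f
      unfolding ga_pair_def using ga_memD[OF I.Icarr[OF f]] by (intro R.add.finprod_one_eqI) simp
    with c show ?thesis by (simp add: ga_perp_def)
  qed
  have oneP: "(\<lambda>l\<in>?L. \<one>\<^bsub>A\<^esub>) \<in> ?P"
  proof -
    have "(\<lambda>l\<in>?L. \<zero>\<^bsub>A\<^esub> \<otimes>\<^bsub>A\<^esub> (\<lambda>l\<in>?L. \<zero>\<^bsub>A\<^esub>) l \<oplus>\<^bsub>A\<^esub> \<one>\<^bsub>A\<^esub>) \<in> ?P" by (rule affine[OF zeroP]) auto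
    also have "(\<lambda>l\<in>?L. \<zero>\<^bsub>A\<^esub> \<otimes>\<^bsub>A\<^esub> (\<lambda>l\<in>?L. \<zero>\<^bsub>A\<^esub>) l \<oplus>\<^bsub>A\<^esub> \<one>\<^bsub>A\<^esub>) = (\<lambda>l\<in>?L. \<one>\<^bsub>A\<^esub>)"
      by (intro restrict_ext) simp
    finally show ?thesis .
  qed
  \<comment> \<open>The class of the neutral element in the partition of \<Lambda> defined by the
    functions in the annihilator.\<close>
  define \<Gamma> where "\<Gamma> = {g \<in> ?L. \<forall>t\<in>?P. t g = t \<one>\<^bsub>\<Lambda>\<^esub>}"
  have \<Gamma>_sub: "\<Gamma> \<subseteq> ?L" by (auto simp: \<Gamma>_def)
  \<comment> \<open>Translation by \<open>l\<close> moves the equality of values at \<open>g\<close>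
    and at the neutral element to the coset of \<open>l\<close>.\<close>
  have trans: "t (l \<otimes>\<^bsub>\<Lambda>\<^esub> g) = t l" if "g \<in> \<Gamma>" "l \<in> ?L" "t \<in> ?P" for g l t
  proof -
    have "ga_shift l t g = ga_shift l t \<one>\<^bsub>\<Lambda>\<^esub>"
      using ga_perp_shift[OF Iid that(3,2)] that(1) unfolding \<Gamma>_def by blast
    with that \<Gamma>_sub show ?thesis by (auto simp: ga_shift_def)
  qed
  have sg: "subgroup \<Gamma> \<Lambda>"
  proof (rule L.subgroupI[OF \<Gamma>_sub])
    show "\<Gamma> \<noteq> {}" using L.one_closed unfolding \<Gamma>_def by blast
    fix g assume g: "g \<in> \<Gamma>"
    then have gL: "g \<in> ?L" using \<Gamma>_sub by auto
    have "t (inv\<^bsub>\<Lambda>\<^esub> g) = t \<one>\<^bsub>\<Lambda>\<^esub>" if "t \<in> ?P" for t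
      using trans[OF g L.inv_closed[OF gL] that] gL by simp
    with gL show "inv\<^bsub>\<Lambda>\<^esub> g \<in> \<Gamma>" by (simp add: \<Gamma>_def)
    fix h assume h: "h \<in> \<Gamma>"
    then have hL: "h \<in> ?L" using \<Gamma>_sub by auto
    have "t (g \<otimes>\<^bsub>\<Lambda>\<^esub> h) = t \<one>\<^bsub>\<Lambda>\<^esub>" if "t \<in> ?P" for t
      using trans[OF h gL that] g that by (simp add: \<Gamma>_def)
    with gL hL show "g \<otimes>\<^bsub>\<Lambda>\<^esub> h \<in> \<Gamma>" by (simp add: \<Gamma>_def)
  qed
  \<comment> \<open>Some function in the annihilator takes different values at \<open>l\<close> and
    \<open>n\<close>; since their difference is invertible in the field, an affine change gives the
    values 1 and 0.\<close>
  have sep: "\<exists>s\<in>?P. s l = \<one>\<^bsub>A\<^esub> \<and> s n = \<zero>\<^bsub>A\<^esub>"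
    if l: "l \<in> ?L" and n: "n \<in> ?L" and nin: "inv\<^bsub>\<Lambda>\<^esub> l \<otimes>\<^bsub>\<Lambda>\<^esub> n \<notin> \<Gamma>" for l n
  proof -
    have "inv\<^bsub>\<Lambda>\<^esub> l \<otimes>\<^bsub>\<Lambda>\<^esub> n \<in> ?L" using l n by simp
    with nin obtain t where t: "t \<in> ?P" "t (inv\<^bsub>\<Lambda>\<^esub> l \<otimes>\<^bsub>\<Lambda>\<^esub> n) \<noteq> t \<one>\<^bsub>\<Lambda>\<^esub>" unfolding \<Gamma>_def by blast
    let ?u = "ga_shift (inv\<^bsub>\<Lambda>\<^esub> l) t"
    have u: "?u \<in> ?P" by (rule ga_perp_shift[OF Iid t(1)]) (use l in simp)
    have ne: "?u l \<noteq> ?u n" using t(2) l n by (simp add: ga_shift_def)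
    have uc: "?u l \<in> carrier A" "?u n \<in> carrier A" using Pm[OF u] l n by auto
    let ?d = "?u l \<ominus>\<^bsub>A\<^esub> ?u n"
    have d: "?d \<in> Units A" using uc ne by (simp add: F.field_Units R.r_right_minus_eq)
    let ?s = "\<lambda>m\<in>?L. inv\<^bsub>A\<^esub> ?d \<otimes>\<^bsub>A\<^esub> ?u m \<oplus>\<^bsub>A\<^esub> \<ominus>\<^bsub>A\<^esub> (inv\<^bsub>A\<^esub> ?d \<otimes>\<^bsub>A\<^esub> ?u n)"
    have "?s \<in> ?P" by (rule affine[OF u]) (use d uc in auto)
    moreover have "?s l = inv\<^bsub>A\<^esub> ?d \<otimes>\<^bsub>A\<^esub> ?d"
      using l d uc by (simp add: a_minus_def R.r_distr R.r_minus)
    then have "?s l = \<one>\<^bsub>A\<^esub>" using d by (simp add: R.Units_l_inv)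
    moreover have "?s n = \<zero>\<^bsub>A\<^esub>" using n d uc by (simp add: R.r_neg)
    ultimately show ?thesis by blast
  qed
  \<comment> \<open>The witness is the pointwise product of the separating functions for the points
    of \<open>N\<close>, which stays in the annihilator by \<open>ga_perp_mult\<close>.\<close>
  have indicator: "\<exists>e\<in>?P. e l = \<one>\<^bsub>A\<^esub> \<and> (\<forall>n\<in>N. e n = \<zero>\<^bsub>A\<^esub>)"
    if "finite N" "l \<in> ?L" "\<And>n. n \<in> N \<Longrightarrow> n \<in> ?L \<and> inv\<^bsub>\<Lambda>\<^esub> l \<otimes>\<^bsub>\<Lambda>\<^esub> n \<notin> \<Gamma>" for l N
    using that
  proof (induction N rule: finite_induct)
    case empty
    then have "(\<lambda>l\<in>?L. \<one>\<^bsub>A\<^esub>) l = \<one>\<^bsub>A\<^esub>" by simp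
    with oneP show ?case by blast
  next
    case (insert n N)
    then obtain e where e: "e \<in> ?P" "e l = \<one>\<^bsub>A\<^esub>" "\<And>n. n \<in> N \<Longrightarrow> e n = \<zero>\<^bsub>A\<^esub>" by blast
    have n: "n \<in> ?L" "inv\<^bsub>\<Lambda>\<^esub> l \<otimes>\<^bsub>\<Lambda>\<^esub> n \<notin> \<Gamma>" using insert.prems by auto
    obtain s where s: "s \<in> ?P" "s l = \<one>\<^bsub>A\<^esub>" "s n = \<zero>\<^bsub>A\<^esub>" using sep[OF insert.prems(1) n] by blast
    let ?e = "\<lambda>m\<in>?L. e m \<otimes>\<^bsub>A\<^esub> s m"
    have "?e m = \<zero>\<^bsub>A\<^esub>" if "m \<in> insert n N" for m
    proof -
      have m: "m \<in> ?L" using insert.prems that by blast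
      from that have "e m = \<zero>\<^bsub>A\<^esub> \<or> s m = \<zero>\<^bsub>A\<^esub>" using e(3) s(3) by blast
      then show ?thesis using m Pm[OF e(1) m] Pm[OF s(1) m] by auto
    qed
    moreover have "?e l = \<one>\<^bsub>A\<^esub>" using e s insert.prems by simp
    ultimately show ?case using ga_perp_mult[OF I e(1) s(1)] by blast
  qed
  have "I \<subseteq> coset_sum_ideal \<Lambda> \<Gamma> A"
  proof
    fix f assume f: "f \<in> I"
    note fm = ga_memD[OF I.Icarr[OF f]]
    have "finsum A (\<lambda>m. f (l \<otimes>\<^bsub>\<Lambda>\<^esub> m)) \<Gamma> = \<zero>\<^bsub>A\<^esub>" if l: "l \<in> ?L" for l
    proof -
      \<comment> \<open>Pairing \<open>f\<close> with the indicator function of the coset of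
        \<open>l\<close> leaves exactly the coset sum.\<close>
      obtain e where e: "e \<in> ?P" "e l = \<one>\<^bsub>A\<^esub>" and
          e0: "\<forall>n\<in>{n\<in>?L. inv\<^bsub>\<Lambda>\<^esub> l \<otimes>\<^bsub>\<Lambda>\<^esub> n \<notin> \<Gamma>}. e n = \<zero>\<^bsub>A\<^esub>"
      proof -
        have "\<exists>e\<in>?P. e l = \<one>\<^bsub>A\<^esub> \<and> (\<forall>n\<in>{n\<in>?L. inv\<^bsub>\<Lambda>\<^esub> l \<otimes>\<^bsub>\<Lambda>\<^esub> n \<notin> \<Gamma>}. e n = \<zero>\<^bsub>A\<^esub>)"
          by (rule indicator[OF _ l]) (simp_all add: L.fin)
        then show ?thesis using that by blast
      qed
      note em = Pm[OF e(1)]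
      have "\<zero>\<^bsub>A\<^esub> = ga_pair f e" using e(1) f by (simp add: ga_perp_def)
      also have "\<dots> = finsum A (\<lambda>m. f (l \<otimes>\<^bsub>\<Lambda>\<^esub> m) \<otimes>\<^bsub>A\<^esub> e (l \<otimes>\<^bsub>\<Lambda>\<^esub> m)) ?L"
        unfolding ga_pair_def using fm em l by (intro finsum_shift[symmetric]) auto
      also have "\<dots> = finsum A (\<lambda>m. f (l \<otimes>\<^bsub>\<Lambda>\<^esub> m)) \<Gamma>"
      proof (rule R.add.finprod_mono_neutral_cong_right[OF L.fin \<Gamma>_sub])
        fix m assume m: "m \<in> ?L - \<Gamma>"
        then have "inv\<^bsub>\<Lambda>\<^esub> l \<otimes>\<^bsub>\<Lambda>\<^esub> (l \<otimes>\<^bsub>\<Lambda>\<^esub> m) = m" using l by (simp add: L.m_assoc[symmetric])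
        with e0 l m have "e (l \<otimes>\<^bsub>\<Lambda>\<^esub> m) = \<zero>\<^bsub>A\<^esub>" by simp
        then show "f (l \<otimes>\<^bsub>\<Lambda>\<^esub> m) \<otimes>\<^bsub>A\<^esub> e (l \<otimes>\<^bsub>\<Lambda>\<^esub> m) = \<zero>\<^bsub>A\<^esub>" using fm l m by simp
      next
        fix m assume m: "m \<in> \<Gamma>"
        then have "e (l \<otimes>\<^bsub>\<Lambda>\<^esub> m) = \<one>\<^bsub>A\<^esub>" using trans[OF m l e(1)] e(2) by simp
        then show "f (l \<otimes>\<^bsub>\<Lambda>\<^esub> m) \<otimes>\<^bsub>A\<^esub> e (l \<otimes>\<^bsub>\<Lambda>\<^esub> m) = f (l \<otimes>\<^bsub>\<Lambda>\<^esub> m)"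
          using fm l m \<Gamma>_sub by auto
      qed (use fm em l in auto)
      finally show ?thesis ..
    qed
    with I.Icarr[OF f] show "f \<in> coset_sum_ideal \<Lambda> \<Gamma> A" by (simp add: coset_sum_ideal_def)
  qed
  moreover have "coset_sum_ideal \<Lambda> \<Gamma> A \<subseteq> I"
  proof (rule coset_sum_ideal_minimal[OF sg Iid], rule ccontr)
    fix g assume g: "g \<in> \<Gamma>" and nin: "ga_delta g \<notin> I"
    have gL: "g \<in> ?L" using g \<Gamma>_sub by auto
    \<comment> \<open>If \<open>g - 1\<close> were outside \<open>I\<close>, some linear form
      killing \<open>I\<close> would take different values at \<open>g\<close> and at the neutral
      element, against the definition of \<Gamma>.\<close>
    have "\<exists>t\<in>?L \<rightarrow>\<^sub>E carrier A. (\<forall>f\<in>I. finsum A (\<lambda>s. f s \<otimes>\<^bsub>A\<^esub> t s) ?L = \<zero>\<^bsub>A\<^esub>) \<and>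
        finsum A (\<lambda>s. ga_delta g s \<otimes>\<^bsub>A\<^esub> t s) ?L \<noteq> \<zero>\<^bsub>A\<^esub>"
    proof (rule F.annihilator_separates[OF L.fin _ _ _ _ _ nin])
      show "I \<subseteq> ?L \<rightarrow>\<^sub>E carrier A" using I.a_subset by (simp add: ga_simps)
      show "(\<lambda>s\<in>?L. \<zero>\<^bsub>A\<^esub>) \<in> I" using I.zero_closed by (simp add: ga_zero)
      show "ga_delta g \<in> ?L \<rightarrow>\<^sub>E carrier A" using ga_delta_closed[of g] by (simp add: ga_simps)
      show "(\<lambda>s\<in>?L. f s \<oplus>\<^bsub>A\<^esub> h s) \<in> I" if "f \<in> I" "h \<in> I" for f h
        using I.a_closed[OF that] by (simp add: ga_add)
      show "(\<lambda>s\<in>?L. c \<otimes>\<^bsub>A\<^esub> f s) \<in> I" if "c \<in> carrier A" "f \<in> I" for c f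
        using I.I_l_closed[OF that(2) ga_closed(2)[OF that(1)]] by (simp add: ga_const_mult[OF that(1) I.Icarr[OF that(2)]])
    qed
    then obtain t where t: "t \<in> carrier GA" "\<forall>f\<in>I. ga_pair f t = \<zero>\<^bsub>A\<^esub>" "ga_pair (ga_delta g) t \<noteq> \<zero>\<^bsub>A\<^esub>"
      unfolding ga_pair_def ga_simps by blast
    then have tP: "t \<in> ?P" by (simp add: ga_perp_def)
    note tm = ga_memD[OF t(1)]
    have o: "\<one>\<^bsub>A\<^esub> \<in> carrier A" by simp
    have "ga_monom \<Lambda> A g \<one>\<^bsub>A\<^esub> = ga_delta g \<oplus>\<^bsub>GA\<^esub> ga_monom \<Lambda> A \<one>\<^bsub>\<Lambda>\<^esub> \<one>\<^bsub>A\<^esub>"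
      unfolding ga_delta_def by (simp add: a_minus_def G.a_assoc G.l_neg)
    then have "ga_pair (ga_monom \<Lambda> A g \<one>\<^bsub>A\<^esub>) t = ga_pair (ga_delta g) t \<oplus>\<^bsub>A\<^esub> ga_pair (ga_monom \<Lambda> A \<one>\<^bsub>\<Lambda>\<^esub> \<one>\<^bsub>A\<^esub>) t"
      by (simp add: ga_pair_add(1)[OF ga_delta_closed ga_closed(1)[OF o] t(1)])
    then have eq: "t g = ga_pair (ga_delta g) t \<oplus>\<^bsub>A\<^esub> t \<one>\<^bsub>\<Lambda>\<^esub>"
      using tm gL by (simp add: ga_pair_monom[OF _ o t(1)])
    have "t g = t \<one>\<^bsub>\<Lambda>\<^esub>" using tP g unfolding \<Gamma>_def by blast
    with eq have "ga_pair (ga_delta g) t = \<zero>\<^bsub>A\<^esub>"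
      using tm[OF L.one_closed] ga_pair_closed[OF ga_delta_closed t(1)] R.add.l_cancel_one' R.a_comm by metis
    with t(3) show False by simp
  qed
  ultimately show ?thesis using sg by blast
qed

end

section \<open>Graded algebras\<close>

locale graded_algebra = group_ring \<Lambda> A + B: cring R
  for \<Lambda> :: "('l, 'n) monoid_scheme" and A :: "('a, 'm) ring_scheme" and R :: "('r, 'x) ring_scheme" +
  fixes \<phi> :: "'r \<Rightarrow> 'a" and \<rho> :: "'a \<Rightarrow> 'l \<Rightarrow> 'a"
  assumes coaction: "coaction R \<Lambda> A \<phi> \<rho>"
begin

lemma phi_hom: "\<phi> \<in> ring_hom R A" and rho_hom: "\<rho> \<in> ring_hom A GA"
  and rho_phi: "r \<in> carrier R \<Longrightarrow> \<rho> (\<phi> r) = ga_const \<Lambda> A (\<phi> r)"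
  and rho_sum: "a \<in> carrier A \<Longrightarrow> finsum A (\<rho> a) (carrier \<Lambda>) = a"
  and rho_rho: "a \<in> carrier A \<Longrightarrow> l \<in> carrier \<Lambda> \<Longrightarrow> m \<in> carrier \<Lambda> \<Longrightarrow>
    \<rho> (\<rho> a l) m = (if m = l then \<rho> a l else \<zero>\<^bsub>A\<^esub>)"
  using coaction by (simp_all add: coaction_def)

lemma phi_closed [simp]: "r \<in> carrier R \<Longrightarrow> \<phi> r \<in> carrier A"
  by (rule ring_hom_closed[OF phi_hom])

lemma rho_GA: "a \<in> carrier A \<Longrightarrow> \<rho> a \<in> carrier GA"
  by (rule ring_hom_closed[OF rho_hom])

lemma rho_closed [simp]: "a \<in> carrier A \<Longrightarrow> l \<in> carrier \<Lambda> \<Longrightarrow> \<rho> a l \<in> carrier A"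
  by (rule ga_memD[OF rho_GA])

sublocale rho: ring_hom_cring A GA \<rho>
  by unfold_locales (rule rho_hom)

lemma rho_add:
  "a \<in> carrier A \<Longrightarrow> b \<in> carrier A \<Longrightarrow> l \<in> carrier \<Lambda> \<Longrightarrow> \<rho> (a \<oplus>\<^bsub>A\<^esub> b) l = \<rho> a l \<oplus>\<^bsub>A\<^esub> \<rho> b l"
  by (simp add: ga_add)

lemma rho_mult:
  "a \<in> carrier A \<Longrightarrow> b \<in> carrier A \<Longrightarrow> l \<in> carrier \<Lambda> \<Longrightarrow>
    \<rho> (a \<otimes>\<^bsub>A\<^esub> b) l = finsum A (\<lambda>m. \<rho> a m \<otimes>\<^bsub>A\<^esub> \<rho> b (inv\<^bsub>\<Lambda>\<^esub> m \<otimes>\<^bsub>\<Lambda>\<^esub> l)) (carrier \<Lambda>)"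
  by (simp add: ga_mult)

lemma rho_finsum:
  assumes "finite S" "\<And>s. s \<in> S \<Longrightarrow> f s \<in> carrier A" "l \<in> carrier \<Lambda>"
  shows "\<rho> (finsum A f S) l = finsum A (\<lambda>s. \<rho> (f s) l) S"
proof -
  have "\<rho> (finsum A f S) = finsum GA (\<lambda>s. \<rho> (f s)) S"
    using assms by (simp add: o_def Pi_iff)
  then show ?thesis using assms rho_GA by (simp add: ga_finsum Pi_iff)
qed

definition homog :: "'l \<Rightarrow> 'a set" where
  "homog l = {a \<in> carrier A. \<rho> a = ga_monom \<Lambda> A l a}"

lemma homogD: "a \<in> homog l \<Longrightarrow> a \<in> carrier A" "a \<in> homog l \<Longrightarrow> m \<in> carrier \<Lambda> \<Longrightarrow> \<rho> a m = (if m = l then a else \<zero>\<^bsub>A\<^esub>)"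
  by (simp_all add: homog_def ga_monom_def)

lemma homogI:
  assumes "a \<in> carrier A" "\<And>m. m \<in> carrier \<Lambda> \<Longrightarrow> \<rho> a m = (if m = l then a else \<zero>\<^bsub>A\<^esub>)"
  shows "a \<in> homog l"
proof -
  have "\<rho> a = ga_monom \<Lambda> A l a"
    by (rule ga_ext[OF rho_GA[OF assms(1)] ga_closed(1)[OF assms(1)]]) (simp add: assms(2) ga_monom_def)
  then show ?thesis using assms(1) by (simp add: homog_def)
qed

lemma rho_homog: "a \<in> carrier A \<Longrightarrow> l \<in> carrier \<Lambda> \<Longrightarrow> \<rho> a l \<in> homog l"
  by (rule homogI) (simp_all add: rho_rho)

lemma homog_zero: "\<zero>\<^bsub>A\<^esub> \<in> homog l"
  by (rule homogI) (auto simp: ga_zero simp del: rho.hom_zero simp: rho.hom_zero)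

lemma homog_mult:
  assumes "a \<in> homog l" "b \<in> homog m" "l \<in> carrier \<Lambda>" "m \<in> carrier \<Lambda>"
  shows "a \<otimes>\<^bsub>A\<^esub> b \<in> homog (l \<otimes>\<^bsub>\<Lambda>\<^esub> m)"
  using assms by (simp add: homog_def ga_monom_split)

lemma homog_one: "\<one>\<^bsub>A\<^esub> \<in> homog \<one>\<^bsub>\<Lambda>\<^esub>"
  by (simp add: homog_def ga_one ga_const_monom)

lemma homog_pow:
  assumes "a \<in> homog l" "l \<in> carrier \<Lambda>"
  shows "a [^]\<^bsub>A\<^esub> (n::nat) \<in> homog (l [^]\<^bsub>\<Lambda>\<^esub> n)"
  by (induction n) (auto intro: homog_one homog_mult assms)

text \<open>The product of \<open>\<rho> u\<close> with the image under \<rho> of the inverse is 1.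
  Its trivial component shows that \<open>u\<close> is already inverted by the component of its
  inverse in the degree inverse to \<open>l\<close>; by uniqueness of inverses this component is the
  whole inverse.\<close>

lemma homog_inv:
  assumes "u \<in> homog l" "u \<in> Units A" "l \<in> carrier \<Lambda>"
  shows "inv\<^bsub>A\<^esub> u \<in> homog (inv\<^bsub>\<Lambda>\<^esub> l)"
proof -
  let ?v = "inv\<^bsub>A\<^esub> u"
  have v: "?v \<in> carrier A" using assms(2) by simp
  have u: "u \<in> carrier A" using assms(2) by auto
  have "ga_monom \<Lambda> A l u \<otimes>\<^bsub>GA\<^esub> \<rho> ?v = ga_const \<Lambda> A \<one>\<^bsub>A\<^esub>"
  proof -
    have "ga_monom \<Lambda> A l u \<otimes>\<^bsub>GA\<^esub> \<rho> ?v = \<rho> u \<otimes>\<^bsub>GA\<^esub> \<rho> ?v" using assms(1) by (simp add: homog_def)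
    also have "\<dots> = \<rho> (u \<otimes>\<^bsub>A\<^esub> ?v)" using u v by simp
    also have "\<dots> = ga_const \<Lambda> A \<one>\<^bsub>A\<^esub>" using assms(2) by (simp add: R.Units_r_inv ga_one)
    finally show ?thesis .
  qed
  then have "(ga_monom \<Lambda> A l u \<otimes>\<^bsub>GA\<^esub> \<rho> ?v) \<one>\<^bsub>\<Lambda>\<^esub> = \<one>\<^bsub>A\<^esub>" by (simp add: ga_const_def)
  then have "u \<otimes>\<^bsub>A\<^esub> \<rho> ?v (inv\<^bsub>\<Lambda>\<^esub> l) = \<one>\<^bsub>A\<^esub>"
    using assms(3) by (simp add: ga_monom_mult[OF assms(3) u rho_GA[OF v]])
  then have "\<rho> ?v (inv\<^bsub>\<Lambda>\<^esub> l) = ?v"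
    using assms u v by (metis L.inv_closed R.comm_inv_char rho_closed)
  then show ?thesis using rho_homog[OF v, of "inv\<^bsub>\<Lambda>\<^esub> l"] assms(3) by simp
qed

definition supported :: "'l set \<Rightarrow> 'a set" where
  "supported \<Gamma> = {a \<in> carrier A. \<forall>l\<in>carrier \<Lambda> - \<Gamma>. \<rho> a l = \<zero>\<^bsub>A\<^esub>}"

text \<open>In A[\<Lambda>/\<Gamma>], invariance of \<open>a\<close> says that the components of
  \<open>a\<close> over each coset other than \<Gamma> add up to zero, and those over \<Gamma> to
  \<open>a\<close>. Components of different degrees are independent, so all components outside
  \<Gamma> vanish.\<close>

lemma invariants_coset_sum:
  assumes "subgroup \<Gamma> \<Lambda>"
  shows "invariants \<Lambda> A \<phi> \<rho> (coset_sum_ideal \<Lambda> \<Gamma> R) = supported \<Gamma>"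
proof -
  interpret S: subgroup \<Gamma> \<Lambda> by fact
  let ?L = "carrier \<Lambda>"
  have fin\<Gamma>: "finite \<Gamma>" by (rule L.subgroup_finite[OF assms])
  have sum: "finsum A (\<lambda>m. (\<rho> a \<ominus>\<^bsub>GA\<^esub> ga_const \<Lambda> A a) (l \<otimes>\<^bsub>\<Lambda>\<^esub> m)) \<Gamma> =
      finsum A (\<lambda>m. \<rho> a (l \<otimes>\<^bsub>\<Lambda>\<^esub> m)) \<Gamma> \<ominus>\<^bsub>A\<^esub> (if l \<in> \<Gamma> then a else \<zero>\<^bsub>A\<^esub>)"
    if a: "a \<in> carrier A" and l: "l \<in> ?L" for a l
  proof -
    have "inv\<^bsub>\<Lambda>\<^esub> l \<in> \<Gamma> \<longleftrightarrow> l \<in> \<Gamma>" using l S.m_inv_closed L.inv_inv by metis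
    then show ?thesis
      using coset_sum_minus[OF S.subset l rho_GA[OF a] ga_closed(2)[OF a]]
      by (simp add: ga_const_monom coset_sum_monom[OF assms L.one_closed l a] l)
  qed
  have "\<rho> a \<ominus>\<^bsub>GA\<^esub> ga_const \<Lambda> A a \<in> coset_sum_ideal \<Lambda> \<Gamma> A \<longleftrightarrow> (\<forall>l\<in>?L - \<Gamma>. \<rho> a l = \<zero>\<^bsub>A\<^esub>)"
    if a: "a \<in> carrier A" for a
  proof
    assume "\<rho> a \<ominus>\<^bsub>GA\<^esub> ga_const \<Lambda> A a \<in> coset_sum_ideal \<Lambda> \<Gamma> A"
    then have z: "finsum A (\<lambda>m. (\<rho> a \<ominus>\<^bsub>GA\<^esub> ga_const \<Lambda> A a) (l \<otimes>\<^bsub>\<Lambda>\<^esub> m)) \<Gamma> = \<zero>\<^bsub>A\<^esub>" if "l \<in> ?L" for l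
      using that unfolding coset_sum_ideal_def by blast
    show "\<forall>l\<in>?L - \<Gamma>. \<rho> a l = \<zero>\<^bsub>A\<^esub>"
    proof
      fix l assume l: "l \<in> ?L - \<Gamma>"
      have c: "\<rho> a (l \<otimes>\<^bsub>\<Lambda>\<^esub> m) \<in> carrier A" if "m \<in> \<Gamma>" for m using a l that by auto
      then have "finsum A (\<lambda>m. \<rho> a (l \<otimes>\<^bsub>\<Lambda>\<^esub> m)) \<Gamma> = \<zero>\<^bsub>A\<^esub>"
        using z[of l] sum[OF a, of l] l by (simp add: a_minus_def R.finsum_closed Pi_iff)
      \<comment> \<open>Taking the component of degree \<open>l\<close> of this vanishing sum
        isolates the term where \<open>m\<close> is the neutral element.\<close>
      then have "\<rho> (finsum A (\<lambda>m. \<rho> a (l \<otimes>\<^bsub>\<Lambda>\<^esub> m)) \<Gamma>) l = \<zero>\<^bsub>A\<^esub>" using l by (simp add: ga_zero)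
      moreover have "\<rho> (finsum A (\<lambda>m. \<rho> a (l \<otimes>\<^bsub>\<Lambda>\<^esub> m)) \<Gamma>) l = finsum A (\<lambda>m. \<rho> (\<rho> a (l \<otimes>\<^bsub>\<Lambda>\<^esub> m)) l) \<Gamma>"
        using c l by (intro rho_finsum fin\<Gamma>) auto
      moreover have "finsum A (\<lambda>m. \<rho> (\<rho> a (l \<otimes>\<^bsub>\<Lambda>\<^esub> m)) l) \<Gamma> =
        finsum A (\<lambda>m. if m = \<one>\<^bsub>\<Lambda>\<^esub> then \<rho> a l else \<zero>\<^bsub>A\<^esub>) \<Gamma>"
      proof (rule R.finsum_cong')
        fix m assume m: "m \<in> \<Gamma>"
        have "l = l \<otimes>\<^bsub>\<Lambda>\<^esub> m \<longleftrightarrow> m = \<one>\<^bsub>\<Lambda>\<^esub>" using l m by auto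
        then show "\<rho> (\<rho> a (l \<otimes>\<^bsub>\<Lambda>\<^esub> m)) l = (if m = \<one>\<^bsub>\<Lambda>\<^esub> then \<rho> a l else \<zero>\<^bsub>A\<^esub>)"
          using l m a by (auto simp: rho_rho)
      qed (use a l in auto)
      moreover have "\<dots> = \<rho> a l" using a l by (subst R.finsum_delta[OF fin\<Gamma>]) auto
      ultimately show "\<rho> a l = \<zero>\<^bsub>A\<^esub>" by simp
    qed
  next
    assume z: "\<forall>l\<in>?L - \<Gamma>. \<rho> a l = \<zero>\<^bsub>A\<^esub>"
    have "finsum A (\<lambda>m. \<rho> a (l \<otimes>\<^bsub>\<Lambda>\<^esub> m)) \<Gamma> = (if l \<in> \<Gamma> then a else \<zero>\<^bsub>A\<^esub>)" if l: "l \<in> ?L" for l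
    proof (cases "l \<in> \<Gamma>")
      case True
      have b: "bij_betw (\<lambda>m. l \<otimes>\<^bsub>\<Lambda>\<^esub> m) \<Gamma> \<Gamma>"
        by (rule bij_betwI[where g = "\<lambda>m. inv\<^bsub>\<Lambda>\<^esub> l \<otimes>\<^bsub>\<Lambda>\<^esub> m"]) (use True l in \<open>auto simp: L.m_assoc[symmetric]\<close>)
      have "finsum A (\<rho> a) ((\<lambda>m. l \<otimes>\<^bsub>\<Lambda>\<^esub> m) ` \<Gamma>) = finsum A (\<lambda>m. \<rho> a (l \<otimes>\<^bsub>\<Lambda>\<^esub> m)) \<Gamma>"
        using b l a by (intro R.finsum_reindex) (auto simp: bij_betw_def)
      then have "finsum A (\<lambda>m. \<rho> a (l \<otimes>\<^bsub>\<Lambda>\<^esub> m)) \<Gamma> = finsum A (\<rho> a) \<Gamma>" using b by (simp add: bij_betw_def)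
      also have "\<dots> = finsum A (\<rho> a) ?L"
        using z a by (intro R.add.finprod_mono_neutral_cong_left L.fin) auto
      also have "\<dots> = a" by (rule rho_sum[OF a])
      finally show ?thesis using True by simp
    next
      case False
      have "\<rho> a (l \<otimes>\<^bsub>\<Lambda>\<^esub> m) = \<zero>\<^bsub>A\<^esub>" if m: "m \<in> \<Gamma>" for m
      proof -
        have "l \<otimes>\<^bsub>\<Lambda>\<^esub> m \<notin> \<Gamma>"
        proof
          assume "l \<otimes>\<^bsub>\<Lambda>\<^esub> m \<in> \<Gamma>"
          from S.m_closed[OF this S.m_inv_closed[OF m]] have "l \<in> \<Gamma>" using l m by (simp add: L.m_assoc)
          with False show False by simp
        qed
        with z l m show ?thesis by simp
      qed
      with False show ?thesis by (simp add: R.add.finprod_one_eqI)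
    qed
    then have "finsum A (\<lambda>m. (\<rho> a \<ominus>\<^bsub>GA\<^esub> ga_const \<Lambda> A a) (l \<otimes>\<^bsub>\<Lambda>\<^esub> m)) \<Gamma> = \<zero>\<^bsub>A\<^esub>" if "l \<in> ?L" for l
      using sum[OF a that] that a by (simp add: a_minus_def R.r_neg)
    moreover have "\<rho> a \<ominus>\<^bsub>GA\<^esub> ga_const \<Lambda> A a \<in> carrier GA" using rho_GA a by (intro G.minus_closed) auto
    ultimately show "\<rho> a \<ominus>\<^bsub>GA\<^esub> ga_const \<Lambda> A a \<in> coset_sum_ideal \<Lambda> \<Gamma> A"
      by (simp add: coset_sum_ideal_def)
  qed
  then show ?thesis
    unfolding invariants_def supported_def genideal_coset_sum[OF phi_hom B.cring_axioms assms] by blast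
qed

end

text \<open>This is A[\<Gamma>] inside A[\<Lambda>]; for the subgroup scheme H that belongs to
  \<Gamma> it is the coordinate ring of G/H with scalars extended to \<open>A\<close>.\<close>

definition ga_supported ::
  "('l, 'n) monoid_scheme \<Rightarrow> 'l set \<Rightarrow> ('a, 'm) ring_scheme \<Rightarrow> ('l \<Rightarrow> 'a) set" where
  "ga_supported \<Lambda> \<Gamma> A = {f \<in> carrier (group_algebra \<Lambda> A). \<forall>l\<in>carrier \<Lambda> - \<Gamma>. f l = \<zero>\<^bsub>A\<^esub>}"

section \<open>Coordinate rings of quotients of the group scheme\<close>

context group_ring begin

lemma ga_supported_subring:
  assumes \<Gamma>: "subgroup \<Gamma> \<Lambda>"
  shows "subring (ga_supported \<Lambda> \<Gamma> A) GA"
proof -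
  interpret S: subgroup \<Gamma> \<Lambda> by fact
  let ?L = "carrier \<Lambda>"
  show ?thesis
  proof (rule G.subringI)
    show "\<one>\<^bsub>GA\<^esub> \<in> ga_supported \<Lambda> \<Gamma> A"
      using G.one_closed by (auto simp: ga_supported_def) (auto simp: ga_one ga_const_def)
    fix f assume f: "f \<in> ga_supported \<Lambda> \<Gamma> A"
    then have fc: "f \<in> carrier GA" by (simp add: ga_supported_def)
    have "\<ominus>\<^bsub>GA\<^esub> f = (\<lambda>l\<in>?L. \<ominus>\<^bsub>A\<^esub> f l)"
    proof (rule G.minus_equality)
      show "(\<lambda>l\<in>?L. \<ominus>\<^bsub>A\<^esub> f l) \<oplus>\<^bsub>GA\<^esub> f = \<zero>\<^bsub>GA\<^esub>"
        unfolding ga_add ga_zero using ga_memD[OF fc] by (intro restrict_ext) (simp add: R.l_neg)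
      show "(\<lambda>l\<in>?L. \<ominus>\<^bsub>A\<^esub> f l) \<in> carrier GA" by (rule gaI) (simp add: ga_memD[OF fc])
    qed (rule fc)
    with f G.a_inv_closed[OF fc] show "\<ominus>\<^bsub>GA\<^esub> f \<in> ga_supported \<Lambda> \<Gamma> A"
      by (simp add: ga_supported_def)
    fix g assume g: "g \<in> ga_supported \<Lambda> \<Gamma> A"
    then have gc: "g \<in> carrier GA" by (simp add: ga_supported_def)
    show "f \<oplus>\<^bsub>GA\<^esub> g \<in> ga_supported \<Lambda> \<Gamma> A"
      using f g G.a_closed[OF fc gc] by (simp add: ga_supported_def) (simp add: ga_add)
    have "(f \<otimes>\<^bsub>GA\<^esub> g) l = \<zero>\<^bsub>A\<^esub>" if l: "l \<in> ?L - \<Gamma>" for l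
    proof -
      have "f m \<otimes>\<^bsub>A\<^esub> g (inv\<^bsub>\<Lambda>\<^esub> m \<otimes>\<^bsub>\<Lambda>\<^esub> l) = \<zero>\<^bsub>A\<^esub>" if m: "m \<in> ?L" for m
      proof (cases "m \<in> \<Gamma>")
        case True
        have "inv\<^bsub>\<Lambda>\<^esub> m \<otimes>\<^bsub>\<Lambda>\<^esub> l \<notin> \<Gamma>"
        proof
          assume "inv\<^bsub>\<Lambda>\<^esub> m \<otimes>\<^bsub>\<Lambda>\<^esub> l \<in> \<Gamma>"
          from S.m_closed[OF True this] have "l \<in> \<Gamma>" using l m by (simp add: L.m_assoc[symmetric])
          with l show False by simp
        qed
        then have "g (inv\<^bsub>\<Lambda>\<^esub> m \<otimes>\<^bsub>\<Lambda>\<^esub> l) = \<zero>\<^bsub>A\<^esub>" using g l m by (simp add: ga_supported_def)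
        then show ?thesis using ga_memD[OF fc m] by simp
      next
        case False
        then have "f m = \<zero>\<^bsub>A\<^esub>" using f m by (simp add: ga_supported_def)
        then show ?thesis using ga_memD[OF gc, of "inv\<^bsub>\<Lambda>\<^esub> m \<otimes>\<^bsub>\<Lambda>\<^esub> l"] l m by simp
      qed
      then show ?thesis using l by (simp add: ga_mult R.add.finprod_one_eqI)
    qed
    with G.m_closed[OF fc gc] show "f \<otimes>\<^bsub>GA\<^esub> g \<in> ga_supported \<Lambda> \<Gamma> A"
      by (simp add: ga_supported_def)
  qed (auto simp: ga_supported_def)
qed

text \<open>An element supported on \<Gamma> is a sum of constants times characters in \<Gamma>, and
  these characters are already defined over \<open>R\<close>: extension of scalars turns R[\<Gamma>]
  into A[\<Gamma>].\<close>

lemma extend_coords_supported: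
  assumes \<phi>: "\<phi> \<in> ring_hom R A" and "cring R" and \<Gamma>: "subgroup \<Gamma> \<Lambda>"
  shows "extend_coords \<Lambda> A \<phi> (ga_supported \<Lambda> \<Gamma> R) = ga_supported \<Lambda> \<Gamma> A"
proof -
  interpret R': cring R by fact
  interpret R': group_ring \<Lambda> R by unfold_locales
  interpret h: ring_hom_cring R A \<phi> by unfold_locales fact
  interpret S: subgroup \<Gamma> \<Lambda> by fact
  let ?L = "carrier \<Lambda>"
  let ?H = "ga_const \<Lambda> A ` carrier A \<union> ga_map \<Lambda> \<phi> ` ga_supported \<Lambda> \<Gamma> R"
  have H1: "?H \<subseteq> ga_supported \<Lambda> \<Gamma> A"
  proof (intro Un_least image_subsetI)
    fix a assume "a \<in> carrier A"
    then show "ga_const \<Lambda> A a \<in> ga_supported \<Lambda> \<Gamma> A"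
      by (auto simp: ga_supported_def) (auto simp: ga_const_def)
  next
    fix f assume f: "f \<in> ga_supported \<Lambda> \<Gamma> R"
    then have fc: "f \<in> carrier R'.GA" by (simp add: ga_supported_def)
    have "ga_map \<Lambda> \<phi> f \<in> carrier GA"
      unfolding ga_map_def by (rule gaI) (rule h.hom_closed[OF R'.ga_memD[OF fc]])
    with f show "ga_map \<Lambda> \<phi> f \<in> ga_supported \<Lambda> \<Gamma> A"
      by (simp add: ga_supported_def ga_map_def)
  qed
  then have Hc: "?H \<subseteq> carrier GA" by (auto simp: ga_supported_def)
  note sr = ga_supported_subring[OF \<Gamma>]
  show ?thesis
    unfolding extend_coords_def
  proof
    show "generate_ring GA ?H \<subseteq> ga_supported \<Lambda> \<Gamma> A"
      by (rule G.generate_ring_min_subring1[OF Hc sr H1])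
    interpret g: ring "GA\<lparr>carrier := generate_ring GA ?H\<rparr>" by (rule G.generate_ring_is_ring[OF Hc])
    have gsub: "subring (generate_ring GA ?H) GA" by (rule G.generate_ring_is_subring[OF Hc])
    show "ga_supported \<Lambda> \<Gamma> A \<subseteq> generate_ring GA ?H"
    proof
      fix f assume f: "f \<in> ga_supported \<Lambda> \<Gamma> A"
      then have fc: "f \<in> carrier GA" by (simp add: ga_supported_def)
      have mem: "ga_monom \<Lambda> A l (f l) \<in> generate_ring GA ?H" if l: "l \<in> ?L" for l
      proof (cases "l \<in> \<Gamma>")
        case True
        have "ga_monom \<Lambda> R l \<one>\<^bsub>R\<^esub> \<in> ga_supported \<Lambda> \<Gamma> R"
          using True by (auto simp: ga_supported_def) (auto simp: ga_monom_def)
        moreover have "ga_map \<Lambda> \<phi> (ga_monom \<Lambda> R l \<one>\<^bsub>R\<^esub>) = ga_monom \<Lambda> A l \<one>\<^bsub>A\<^esub>"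
          by (auto simp: ga_map_def ga_monom_def intro!: restrict_ext)
        ultimately have "ga_monom \<Lambda> A l \<one>\<^bsub>A\<^esub> \<in> ?H" by (metis UnI2 imageI)
        moreover have "ga_const \<Lambda> A (f l) \<in> ?H" using ga_memD[OF fc l] by blast
        ultimately have "ga_const \<Lambda> A (f l) \<otimes>\<^bsub>GA\<^esub> ga_monom \<Lambda> A l \<one>\<^bsub>A\<^esub> \<in> generate_ring GA ?H"
          by (intro generate_ring.eng_mult generate_ring.incl)
        then show ?thesis using l ga_memD[OF fc l] by (simp add: ga_const_monom ga_monom_split)
      next
        case False
        then have "f l = \<zero>\<^bsub>A\<^esub>" using f l by (simp add: ga_supported_def)
        then have "ga_monom \<Lambda> A l (f l) = \<zero>\<^bsub>GA\<^esub>"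
          by (auto simp: ga_monom_def ga_zero intro!: restrict_ext)
        then show ?thesis using G.zero_in_generate by simp
      qed
      have "finsum GA (\<lambda>l. ga_monom \<Lambda> A l (f l)) S \<in> generate_ring GA ?H" if "finite S" "S \<subseteq> ?L" for S
        using that
      proof (induction S rule: finite_induct)
        case empty then show ?case using G.zero_in_generate by simp
      next
        case (insert s S)
        then have "(\<lambda>l. ga_monom \<Lambda> A l (f l)) \<in> S \<rightarrow> carrier GA" "ga_monom \<Lambda> A s (f s) \<in> carrier GA"
          using ga_memD[OF fc] by auto
        with insert mem[of s] show ?case by (simp add: G.finsum_insert generate_ring.eng_add)
      qed
      from this[OF L.fin order_refl] ga_expand[OF fc] show "f \<in> generate_ring GA ?H" by simp
    qed
  qed
qed

text \<open>In the regular coaction the component of degree \<open>l\<close> of \<open>f\<close> is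
  the term of \<open>f\<close> at \<open>l\<close>, so \<open>invariants_coset_sum\<close> becomes a
  condition on coefficients.\<close>

lemma quotient_group_coords_coset_sum:
  assumes "subgroup \<Gamma> \<Lambda>"
  shows "quotient_group_coords A \<Lambda> (coset_sum_ideal \<Lambda> \<Gamma> A) = ga_supported \<Lambda> \<Gamma> A"
proof -
  interpret GG: graded_algebra \<Lambda> GA A "ga_const \<Lambda> A" "ga_comult \<Lambda> A"
    by unfold_locales (rule ga_comult_coaction)
  have "ga_monom \<Lambda> A l a = \<zero>\<^bsub>GA\<^esub> \<longleftrightarrow> a = \<zero>\<^bsub>A\<^esub>" if "l \<in> carrier \<Lambda>" for l a
  proof
    assume "ga_monom \<Lambda> A l a = \<zero>\<^bsub>GA\<^esub>"
    from fun_cong[OF this, of l] that show "a = \<zero>\<^bsub>A\<^esub>" by (simp add: ga_monom_def ga_zero)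
  qed (auto simp: ga_monom_def ga_zero intro!: restrict_ext)
  then show ?thesis
    unfolding quotient_group_coords_def GG.invariants_coset_sum[OF assms] GG.supported_def ga_supported_def
    by (auto simp: ga_comult_monom)
qed

end

section \<open>Maps out of quotient rings given by representatives\<close>

context ideal begin

lemma mem_coset_iff: "a' \<in> I +> a \<longleftrightarrow> (\<exists>i\<in>I. a' = i \<oplus> a)"
  by (auto simp: a_r_coset_def')

lemma coset_eq_iff: "a \<in> carrier R \<Longrightarrow> b \<in> carrier R \<Longrightarrow> I +> a = I +> b \<longleftrightarrow> a \<ominus> b \<in> I"
  using quotient_eq_iff_same_a_r_cos[OF ideal_axioms] by blast

lemma coset_eq_self_iff: "a \<in> carrier R \<Longrightarrow> I +> a = I \<longleftrightarrow> a \<in> I"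
  using a_rcos_zero[OF ideal_axioms] rcos_const_imp_mem by blast

lemma Quot_carrier: "carrier (R Quot I) = (\<lambda>a. I +> a) ` carrier R"
  by (auto simp: FactRing_simps)

lemma Quot_zero: "\<zero>\<^bsub>R Quot I\<^esub> = I"
  by (simp add: FactRing_def)

lemma coset_self: "a \<in> carrier R \<Longrightarrow> a \<in> I +> a"
  using additive_subgroup.zero_closed[OF ideal.axioms(1)[OF ideal_axioms]]
  by (force simp: mem_coset_iff)

text \<open>Maps out of a quotient are encoded as unions over all representatives of a coset; when
  the set \<open>f b\<close> does not change with the representative, the union is that set.\<close>

lemma UN_coset:
  assumes "a \<in> carrier R" "\<And>b. b \<in> carrier R \<Longrightarrow> b \<ominus> a \<in> I \<Longrightarrow> f b = f a"
  shows "(\<Union>b\<in>I +> a. f b) = f a"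
proof -
  have "f b = f a" if b: "b \<in> I +> a" for b
  proof -
    obtain i where i: "i \<in> I" "b = i \<oplus> a" using b mem_coset_iff by blast
    then have "i \<in> carrier R" by (auto intro: Icarr)
    then have "b \<ominus> a = i" "b \<in> carrier R" using i assms(1) by (simp_all add: a_minus_def a_assoc r_neg)
    with assms(2) i show ?thesis by simp
  qed
  with coset_self[OF assms(1)] show ?thesis by blast
qed

end

lemma (in ring) subring_finsum:
  assumes "subring H R" "\<And>s. s \<in> S \<Longrightarrow> f s \<in> H"
  shows "finsum (R\<lparr>carrier := H\<rparr>) f S = finsum R f S"
proof -
  interpret H: ring "R\<lparr>carrier := H\<rparr>" by (rule subring_is_ring[OF assms(1)])
  show ?thesis
    using assms(2)
  proof (induction S rule: infinite_finite_induct)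
    case (insert s S)
    then have "f s \<in> H" "\<And>s. s \<in> S \<Longrightarrow> f s \<in> H" by auto
    with insert subringE(1)[OF assms(1)] show ?case
      by (simp add: H.finsum_insert finsum_insert Pi_iff subset_iff)
  qed auto
qed

lemma (in cring) subring_is_cring: "subring H R \<Longrightarrow> cring (R\<lparr>carrier := H\<rparr>)"
  using subcring_iff subcringI' subringE(1) by blast

context group_ring begin

lemma ga_map_hom:
  assumes "\<phi> \<in> ring_hom R A" "cring R"
  shows "ga_map \<Lambda> \<phi> \<in> ring_hom (group_algebra \<Lambda> R) GA"
proof -
  interpret R': cring R by fact
  interpret R': group_ring \<Lambda> R by unfold_locales
  interpret h: ring_hom_cring R A \<phi> by unfold_locales fact
  show ?thesis
  proof (rule ring_hom_memI)
    show "ga_map \<Lambda> \<phi> \<one>\<^bsub>R'.GA\<^esub> = \<one>\<^bsub>GA\<^esub>"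
      by (auto simp: ga_map_def ga_one ga_const_def intro!: restrict_ext)
    fix f assume f: "f \<in> carrier R'.GA"
    note fm = R'.ga_memD[OF f]
    show "ga_map \<Lambda> \<phi> f \<in> carrier GA"
      unfolding ga_map_def by (rule gaI) (rule h.hom_closed[OF fm])
    fix g assume g: "g \<in> carrier R'.GA"
    note gm = R'.ga_memD[OF g]
    show "ga_map \<Lambda> \<phi> (f \<oplus>\<^bsub>R'.GA\<^esub> g) = ga_map \<Lambda> \<phi> f \<oplus>\<^bsub>GA\<^esub> ga_map \<Lambda> \<phi> g"
      unfolding ga_map_def ga_add by (intro restrict_ext) (simp add: fm gm)
    show "ga_map \<Lambda> \<phi> (f \<otimes>\<^bsub>R'.GA\<^esub> g) = ga_map \<Lambda> \<phi> f \<otimes>\<^bsub>GA\<^esub> ga_map \<Lambda> \<phi> g"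
      unfolding ga_map_def ga_mult
    proof (intro restrict_ext)
      fix l assume l: "l \<in> carrier \<Lambda>"
      have c: "(\<lambda>m. f m \<otimes>\<^bsub>R\<^esub> g (inv\<^bsub>\<Lambda>\<^esub> m \<otimes>\<^bsub>\<Lambda>\<^esub> l)) \<in> carrier \<Lambda> \<rightarrow> carrier R"
        using fm gm l by auto
      have "\<phi> (finsum R (\<lambda>m. f m \<otimes>\<^bsub>R\<^esub> g (inv\<^bsub>\<Lambda>\<^esub> m \<otimes>\<^bsub>\<Lambda>\<^esub> l)) (carrier \<Lambda>)) =
        finsum A (\<lambda>m. (\<lambda>l\<in>carrier \<Lambda>. \<phi> (f l)) m \<otimes>\<^bsub>A\<^esub> (\<lambda>l\<in>carrier \<Lambda>. \<phi> (g l)) (inv\<^bsub>\<Lambda>\<^esub> m \<otimes>\<^bsub>\<Lambda>\<^esub> l)) (carrier \<Lambda>)"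
        unfolding h.hom_finsum[OF c] using fm gm l by (intro R.finsum_cong') auto
      then show "\<phi> ((\<lambda>l\<in>carrier \<Lambda>. finsum R (\<lambda>m. f m \<otimes>\<^bsub>R\<^esub> g (inv\<^bsub>\<Lambda>\<^esub> m \<otimes>\<^bsub>\<Lambda>\<^esub> l)) (carrier \<Lambda>)) l) =
        finsum A (\<lambda>m. (\<lambda>l\<in>carrier \<Lambda>. \<phi> (f l)) m \<otimes>\<^bsub>A\<^esub> (\<lambda>l\<in>carrier \<Lambda>. \<phi> (g l)) (inv\<^bsub>\<Lambda>\<^esub> m \<otimes>\<^bsub>\<Lambda>\<^esub> l)) (carrier \<Lambda>)"
        using l by simp
    qed
  qed
qed

end

section \<open>Graded subalgebras and graded quotients\<close>

context graded_algebra begin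

lemma rho_minus:
  assumes "a \<in> carrier A" "b \<in> carrier A" "l \<in> carrier \<Lambda>"
  shows "\<rho> (a \<ominus>\<^bsub>A\<^esub> b) l = \<rho> a l \<ominus>\<^bsub>A\<^esub> \<rho> b l"
proof -
  have "\<rho> (a \<ominus>\<^bsub>A\<^esub> b) = \<rho> a \<ominus>\<^bsub>GA\<^esub> \<rho> b" using assms by (simp add: a_minus_def)
  then show ?thesis using assms by (simp add: ga_minus rho_GA)
qed

lemma supported_subring:
  assumes "subgroup \<Gamma> \<Lambda>"
  shows "subring (supported \<Gamma>) A"
proof -
  note sr = subringE[OF ga_supported_subring[OF assms]]
  have eq: "supported \<Gamma> = {a \<in> carrier A. \<rho> a \<in> ga_supported \<Lambda> \<Gamma> A}"
    using rho_GA by (auto simp: supported_def ga_supported_def)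
  show ?thesis
    unfolding eq by (rule R.subringI) (use sr in auto)
qed

lemma supported_coaction:
  assumes "subgroup \<Gamma> \<Lambda>"
  shows "coaction R \<Lambda> (A\<lparr>carrier := supported \<Gamma>\<rparr>) \<phi> \<rho>"
proof -
  interpret S: subgroup \<Gamma> \<Lambda> by fact
  let ?S = "A\<lparr>carrier := supported \<Gamma>\<rparr>"
  note sub = supported_subring[OF assms]
  have sc: "a \<in> carrier A" if "a \<in> supported \<Gamma>" for a using that by (simp add: supported_def)
  have homs: "\<rho> a l \<in> supported \<Gamma>" if a: "a \<in> supported \<Gamma>" and l: "l \<in> carrier \<Lambda>" for a l
    using a l by (auto simp: supported_def rho_rho)
  have \<phi>S: "\<phi> r \<in> supported \<Gamma>" if "r \<in> carrier R" for r
    using that by (auto simp: supported_def rho_phi) (auto simp: ga_const_def)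
  have GS: "\<rho> a \<in> carrier (group_algebra \<Lambda> ?S)" if "a \<in> supported \<Gamma>" for a
    using rho_GA[OF sc[OF that]] homs[OF that] by (auto simp: ga_simps PiE_def)
  show ?thesis
    unfolding coaction_def
  proof (intro conjI ballI)
    show "\<phi> \<in> ring_hom R ?S"
      using phi_hom \<phi>S by (auto simp: ring_hom_def)
    show "\<rho> \<in> ring_hom ?S (group_algebra \<Lambda> ?S)"
    proof (rule ring_hom_memI)
      show "\<rho> \<one>\<^bsub>?S\<^esub> = \<one>\<^bsub>group_algebra \<Lambda> ?S\<^esub>"
        by (simp add: ga_one, unfold ga_const_def, intro restrict_ext) simp
      fix a b assume "a \<in> carrier ?S" "b \<in> carrier ?S"
      then have ab: "a \<in> supported \<Gamma>" "b \<in> supported \<Gamma>" by simp_all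
      show "\<rho> (a \<oplus>\<^bsub>?S\<^esub> b) = \<rho> a \<oplus>\<^bsub>group_algebra \<Lambda> ?S\<^esub> \<rho> b"
        using ab sc by (simp add: ga_add)
      have "\<rho> a \<otimes>\<^bsub>group_algebra \<Lambda> ?S\<^esub> \<rho> b = \<rho> a \<otimes>\<^bsub>GA\<^esub> \<rho> b"
        unfolding ga_mult
        by (intro restrict_ext, subst R.subring_finsum[OF sub])
          (use homs ab subringE(6)[OF sub] in auto)
      then show "\<rho> (a \<otimes>\<^bsub>?S\<^esub> b) = \<rho> a \<otimes>\<^bsub>group_algebra \<Lambda> ?S\<^esub> \<rho> b"
        using ab sc by simp
    qed (use GS in simp)
    fix a assume "a \<in> carrier ?S"
    then have a: "a \<in> supported \<Gamma>" by simp
    show "finsum ?S (\<rho> a) (carrier \<Lambda>) = a"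
    proof -
      have "finsum ?S (\<rho> a) (carrier \<Lambda>) = finsum A (\<rho> a) (carrier \<Lambda>)"
        by (rule R.subring_finsum[OF sub]) (rule homs[OF a])
      with rho_sum[OF sc[OF a]] show ?thesis by simp
    qed
    fix l m assume "l \<in> carrier \<Lambda>" "m \<in> carrier \<Lambda>"
    then show "\<rho> (\<rho> a l) m = (if m = l then \<rho> a l else \<zero>\<^bsub>?S\<^esub>)"
      using sc[OF a] by (simp add: rho_rho)
  next
    fix r assume "r \<in> carrier R"
    then show "\<rho> (\<phi> r) = ga_const \<Lambda> ?S (\<phi> r)"
      by (simp add: rho_phi, unfold ga_const_def, intro restrict_ext) simp
  qed
qed

lemma factor_coaction_coset:
  assumes J: "graded_ideal \<Lambda> A \<rho> J" and a: "a \<in> carrier A"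
  shows "factor_coaction \<Lambda> A \<rho> J (a_r_coset A J a) = ga_map \<Lambda> (a_r_coset A J) (\<rho> a)"
  unfolding factor_coaction_def ga_map_def
proof (intro restrict_ext)
  interpret J: ideal J A using J by (simp add: graded_ideal_def)
  fix l assume l: "l \<in> carrier \<Lambda>"
  show "(\<Union>b\<in>a_r_coset A J a. a_r_coset A J (\<rho> b l)) = a_r_coset A J (\<rho> a l)"
  proof (rule J.UN_coset[OF a])
    fix b assume b: "b \<in> carrier A" "b \<ominus>\<^bsub>A\<^esub> a \<in> J"
    have "\<rho> (b \<ominus>\<^bsub>A\<^esub> a) l \<in> J" using J b l by (simp add: graded_ideal_def)
    also have "\<rho> (b \<ominus>\<^bsub>A\<^esub> a) l = \<rho> b l \<ominus>\<^bsub>A\<^esub> \<rho> a l" by (rule rho_minus[OF b(1) a l])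
    finally show "a_r_coset A J (\<rho> b l) = a_r_coset A J (\<rho> a l)"
      using a b l by (simp add: J.coset_eq_iff)
  qed
qed

lemma factor_is_coaction:
  assumes J: "graded_ideal \<Lambda> A \<rho> J"
  shows "coaction R \<Lambda> (A Quot J) (\<lambda>r. a_r_coset A J (\<phi> r)) (factor_coaction \<Lambda> A \<rho> J)"
proof -
  interpret J: ideal J A using J by (simp add: graded_ideal_def)
  let ?Q = "A Quot J" and ?\<pi> = "a_r_coset A J" and ?f = "factor_coaction \<Lambda> A \<rho> J"
  interpret Q: cring ?Q by (rule J.quotient_is_cring[OF R.cring_axioms])
  interpret Q: group_ring \<Lambda> ?Q by unfold_locales
  interpret \<pi>: ring_hom_cring A ?Q ?\<pi> by (rule J.rcos_ring_hom_cring[OF R.cring_axioms])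
  interpret m: ring_hom_cring GA Q.GA "ga_map \<Lambda> ?\<pi>"
    by unfold_locales (rule Q.ga_map_hom[OF J.rcos_ring_hom R.cring_axioms])
  note f = factor_coaction_coset[OF J]
  show ?thesis
    unfolding coaction_def
  proof (intro conjI ballI)
    show "(\<lambda>r. ?\<pi> (\<phi> r)) \<in> ring_hom R ?Q"
      using ring_hom_trans[OF phi_hom J.rcos_ring_hom] by (simp add: o_def)
    show "?f \<in> ring_hom ?Q Q.GA"
    proof (rule ring_hom_memI)
      show "?f \<one>\<^bsub>?Q\<^esub> = \<one>\<^bsub>Q.GA\<^esub>"
        using f[of "\<one>\<^bsub>A\<^esub>"] by (simp flip: \<pi>.hom_one)
      fix c assume "c \<in> carrier ?Q"
      then obtain a where a: "a \<in> carrier A" "c = ?\<pi> a" by (auto simp: J.Quot_carrier)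
      then show "?f c \<in> carrier Q.GA" using rho_GA by (simp add: f)
      fix d assume "d \<in> carrier ?Q"
      then obtain b where b: "b \<in> carrier A" "d = ?\<pi> b" by (auto simp: J.Quot_carrier)
      show "?f (c \<oplus>\<^bsub>?Q\<^esub> d) = ?f c \<oplus>\<^bsub>Q.GA\<^esub> ?f d"
        using a b rho_GA f by (simp flip: \<pi>.hom_add)
      show "?f (c \<otimes>\<^bsub>?Q\<^esub> d) = ?f c \<otimes>\<^bsub>Q.GA\<^esub> ?f d"
        using a b rho_GA f by (simp flip: \<pi>.hom_mult)
    qed
    fix r assume r: "r \<in> carrier R"
    have "?f (?\<pi> (\<phi> r)) = ga_map \<Lambda> ?\<pi> (ga_const \<Lambda> A (\<phi> r))"
      using f[of "\<phi> r"] r by (simp add: rho_phi)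
    also have "\<dots> = ga_const \<Lambda> ?Q (?\<pi> (\<phi> r))"
      unfolding ga_map_def ga_const_def by (intro restrict_ext) simp
    finally show "?f (?\<pi> (\<phi> r)) = ga_const \<Lambda> ?Q (?\<pi> (\<phi> r))" .
  next
    fix c assume "c \<in> carrier ?Q"
    then obtain a where a: "a \<in> carrier A" "c = ?\<pi> a" by (auto simp: J.Quot_carrier)
    have fa: "?f c m = ?\<pi> (\<rho> a m)" if "m \<in> carrier \<Lambda>" for m
      using f[OF a(1)] that a(2) by (simp add: ga_map_def)
    have "finsum ?Q (?f c) (carrier \<Lambda>) = finsum ?Q (\<lambda>m. ?\<pi> (\<rho> a m)) (carrier \<Lambda>)"
      using a fa by (intro Q.finsum_cong') auto
    also have "\<dots> = ?\<pi> (finsum A (\<rho> a) (carrier \<Lambda>))"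
      using a by (subst \<pi>.hom_finsum) (auto simp: o_def)
    also have "\<dots> = c" using rho_sum[OF a(1)] a(2) by simp
    finally show "finsum ?Q (?f c) (carrier \<Lambda>) = c" .
    fix l m assume lm: "l \<in> carrier \<Lambda>" "m \<in> carrier \<Lambda>"
    have "?f (?f c l) m = ?\<pi> (\<rho> (\<rho> a l) m)"
      using f[of "\<rho> a l"] fa[OF lm(1)] a lm by (simp add: ga_map_def)
    then show "?f (?f c l) m = (if m = l then ?f c l else \<zero>\<^bsub>?Q\<^esub>)"
      using lm a fa[OF lm(1)] by (simp add: rho_rho)
  qed
qed

end

text \<open>\<open>degree_one\<close> says that the ring of invariants is the base field, as for a
  fibre of a quotient morphism.\<close>

locale graded_fibre = graded_algebra \<Lambda> A K \<phi> \<rho> + K: field K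
  for \<Lambda> :: "('l, 'n) monoid_scheme" and A :: "('a, 'm) ring_scheme" and K :: "('c, 'x) ring_scheme"
    and \<phi> :: "'c \<Rightarrow> 'a" and \<rho> :: "'a \<Rightarrow> 'l \<Rightarrow> 'a" +
  assumes degree_one: "homog \<one>\<^bsub>\<Lambda>\<^esub> \<subseteq> \<phi> ` carrier K"
    and one_neq_zero: "\<one>\<^bsub>A\<^esub> \<noteq> \<zero>\<^bsub>A\<^esub>"
begin

sublocale phi: ring_hom_cring K A \<phi>
  by unfold_locales (rule phi_hom)

section \<open>Unit degrees and the largest proper graded ideal\<close>

definition unit_degrees :: "'l set" where
  "unit_degrees = {l \<in> carrier \<Lambda>. \<exists>u\<in>Units A. u \<in> homog l}"

definition nonunit_ideal :: "'a set" where
  "nonunit_ideal = {a \<in> carrier A. \<forall>l\<in>unit_degrees. \<rho> a l = \<zero>\<^bsub>A\<^esub>}"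

lemma phi_unit:
  assumes "r \<in> carrier K" "r \<noteq> \<zero>\<^bsub>K\<^esub>"
  shows "\<phi> r \<in> Units A"
proof -
  have "r \<in> Units K" using assms by (simp add: K.field_Units)
  then have "\<phi> r \<otimes>\<^bsub>A\<^esub> \<phi> (inv\<^bsub>K\<^esub> r) = \<one>\<^bsub>A\<^esub>" "\<phi> (inv\<^bsub>K\<^esub> r) \<in> carrier A"
    using assms(1) by (simp_all add: B.Units_r_inv flip: phi.hom_mult)
  then show ?thesis using assms(1) by (metis R.Units_inv_comm R.m_comm Units_def phi_closed mem_Collect_eq CollectI Units_def R.unit_factor R.Units_one_closed)
qed

lemma degree_one_unit:
  assumes "a \<in> homog \<one>\<^bsub>\<Lambda>\<^esub>" "a \<noteq> \<zero>\<^bsub>A\<^esub>"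
  shows "a \<in> Units A"
proof -
  obtain r where r: "r \<in> carrier K" "a = \<phi> r" using degree_one assms(1) by blast
  with assms(2) have "r \<noteq> \<zero>\<^bsub>K\<^esub>" by auto
  with r phi_unit show ?thesis by simp
qed

lemma unit_degrees_subgroup: "subgroup unit_degrees \<Lambda>"
proof (rule L.subgroupI)
  show "unit_degrees \<noteq> {}" using homog_one by (auto simp: unit_degrees_def)
  fix l assume l: "l \<in> unit_degrees"
  then obtain u where u: "l \<in> carrier \<Lambda>" "u \<in> Units A" "u \<in> homog l" by (auto simp: unit_degrees_def)
  then have "inv\<^bsub>A\<^esub> u \<in> Units A" "inv\<^bsub>A\<^esub> u \<in> homog (inv\<^bsub>\<Lambda>\<^esub> l)" by (auto intro: homog_inv)
  with u show "inv\<^bsub>\<Lambda>\<^esub> l \<in> unit_degrees" by (auto simp: unit_degrees_def)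
  fix m assume "m \<in> unit_degrees"
  then obtain v where v: "m \<in> carrier \<Lambda>" "v \<in> Units A" "v \<in> homog m" by (auto simp: unit_degrees_def)
  have "u \<otimes>\<^bsub>A\<^esub> v \<in> Units A" using u v by simp
  moreover have "u \<otimes>\<^bsub>A\<^esub> v \<in> homog (l \<otimes>\<^bsub>\<Lambda>\<^esub> m)" using u v by (intro homog_mult)
  ultimately show "l \<otimes>\<^bsub>\<Lambda>\<^esub> m \<in> unit_degrees" using u v by (auto simp: unit_degrees_def)
qed (auto simp: unit_degrees_def)

lemma unit_degrees_carrier: "l \<in> unit_degrees \<Longrightarrow> l \<in> carrier \<Lambda>"
  by (simp add: unit_degrees_def)

definition hunit :: "'l \<Rightarrow> 'a" where
  "hunit l = (SOME u. u \<in> Units A \<and> u \<in> homog l)"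

lemma hunit: "l \<in> unit_degrees \<Longrightarrow> hunit l \<in> Units A" "l \<in> unit_degrees \<Longrightarrow> hunit l \<in> homog l"
proof -
  assume "l \<in> unit_degrees"
  then have "\<exists>u. u \<in> Units A \<and> u \<in> homog l" by (auto simp: unit_degrees_def)
  from someI_ex[OF this] show "hunit l \<in> Units A" "hunit l \<in> homog l" by (simp_all add: hunit_def)
qed

lemma hunit_closed [simp]: "l \<in> unit_degrees \<Longrightarrow> hunit l \<in> carrier A"
  by (rule R.Units_closed[OF hunit(1)])

text \<open>Dividing by the unit of degree \<open>l\<close> lands in trivial degree, that is, in
  \<open>K\<close>; so every unit degree contributes a line.\<close>

lemma homog_unit_degree:
  assumes l: "l \<in> unit_degrees" and a: "a \<in> homog l"
  shows "\<exists>r\<in>carrier K. a = \<phi> r \<otimes>\<^bsub>A\<^esub> hunit l"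
proof -
  have lc: "l \<in> carrier \<Lambda>" by (rule unit_degrees_carrier[OF l])
  note u = hunit[OF l] and ac = homogD(1)[OF a]
  have "a \<otimes>\<^bsub>A\<^esub> inv\<^bsub>A\<^esub> hunit l \<in> homog (l \<otimes>\<^bsub>\<Lambda>\<^esub> inv\<^bsub>\<Lambda>\<^esub> l)"
    using lc by (intro homog_mult a homog_inv u) auto
  then obtain r where r: "r \<in> carrier K" "a \<otimes>\<^bsub>A\<^esub> inv\<^bsub>A\<^esub> hunit l = \<phi> r"
    using degree_one lc by auto
  have "a = a \<otimes>\<^bsub>A\<^esub> inv\<^bsub>A\<^esub> hunit l \<otimes>\<^bsub>A\<^esub> hunit l"
    using u(1) ac l by (simp add: R.m_assoc)
  with r show ?thesis by auto
qed

lemma unit_degree_unit: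
  assumes "l \<in> unit_degrees" "a \<in> homog l" "a \<noteq> \<zero>\<^bsub>A\<^esub>"
  shows "a \<in> Units A"
proof -
  obtain r where r: "r \<in> carrier K" "a = \<phi> r \<otimes>\<^bsub>A\<^esub> hunit l" using homog_unit_degree[OF assms(1,2)] by blast
  with assms(1,3) have "r \<noteq> \<zero>\<^bsub>K\<^esub>" by auto
  then show ?thesis using r phi_unit hunit(1)[OF assms(1)] by simp
qed

lemma nonunit_nilpotent:
  assumes "l \<in> carrier \<Lambda>" "l \<notin> unit_degrees" "a \<in> homog l"
  shows "a [^]\<^bsub>A\<^esub> order \<Lambda> = \<zero>\<^bsub>A\<^esub>"
proof (rule ccontr)
  assume nz: "a [^]\<^bsub>A\<^esub> order \<Lambda> \<noteq> \<zero>\<^bsub>A\<^esub>"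
  have ac: "a \<in> carrier A" by (rule homogD(1)[OF assms(3)])
  have "a [^]\<^bsub>A\<^esub> order \<Lambda> \<in> homog \<one>\<^bsub>\<Lambda>\<^esub>"
    using homog_pow[OF assms(3,1), of "order \<Lambda>"] L.pow_order_eq_1[OF assms(1)] by simp
  from degree_one_unit[OF this nz] have U: "a [^]\<^bsub>A\<^esub> order \<Lambda> \<in> Units A" .
  have "order \<Lambda> \<noteq> 0" using L.fin L.one_closed by (auto simp: order_def card_eq_0_iff)
  then obtain n where "order \<Lambda> = Suc n" using not0_implies_Suc by blast
  with U have "a [^]\<^bsub>A\<^esub> n \<otimes>\<^bsub>A\<^esub> a \<in> Units A" by simp
  then have "a \<in> Units A" using ac R.unit_factor R.m_comm by (metis R.nat_pow_closed)
  with assms show False by (auto simp: unit_degrees_def)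
qed

text \<open>For absorption, suppose that a product of components has unit degree and is nonzero. By
  \<open>unit_degree_unit\<close> it is a unit, so the factor coming from \<open>a\<close> is a unit
  as well and has a unit degree; but in such degrees \<open>a\<close> has no component.\<close>

lemma nonunit_ideal: "graded_ideal \<Lambda> A \<rho> nonunit_ideal"
  unfolding graded_ideal_def
proof
  show "ideal nonunit_ideal A"
  proof (rule R.idealI')
    show "\<zero>\<^bsub>A\<^esub> \<in> nonunit_ideal" using unit_degrees_carrier by (auto simp: nonunit_ideal_def) (auto simp: ga_zero)
    fix a b assume a: "a \<in> nonunit_ideal"
    then have ac: "a \<in> carrier A" by (simp add: nonunit_ideal_def)
    {
      assume b: "b \<in> nonunit_ideal"
      then have "b \<in> carrier A" by (simp add: nonunit_ideal_def)
      with a b show "a \<oplus>\<^bsub>A\<^esub> b \<in> nonunit_ideal"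
        using unit_degrees_carrier by (simp add: nonunit_ideal_def rho_add del: rho.hom_add)
    }
    assume b: "b \<in> carrier A"
    have "\<rho> (b \<otimes>\<^bsub>A\<^esub> a) l = \<zero>\<^bsub>A\<^esub>" if l: "l \<in> unit_degrees" for l
    proof -
      have lc: "l \<in> carrier \<Lambda>" by (rule unit_degrees_carrier[OF l])
      have "\<rho> b m \<otimes>\<^bsub>A\<^esub> \<rho> a (inv\<^bsub>\<Lambda>\<^esub> m \<otimes>\<^bsub>\<Lambda>\<^esub> l) = \<zero>\<^bsub>A\<^esub>" if m: "m \<in> carrier \<Lambda>" for m
      proof (rule ccontr)
        let ?n = "inv\<^bsub>\<Lambda>\<^esub> m \<otimes>\<^bsub>\<Lambda>\<^esub> l"
        assume nz: "\<rho> b m \<otimes>\<^bsub>A\<^esub> \<rho> a ?n \<noteq> \<zero>\<^bsub>A\<^esub>"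
        have nc: "?n \<in> carrier \<Lambda>" using m lc by simp
        have "\<rho> b m \<otimes>\<^bsub>A\<^esub> \<rho> a ?n \<in> homog (m \<otimes>\<^bsub>\<Lambda>\<^esub> ?n)"
          using m nc ac b by (intro homog_mult rho_homog)
        then have "\<rho> b m \<otimes>\<^bsub>A\<^esub> \<rho> a ?n \<in> Units A"
          using unit_degree_unit[OF l _ nz] m lc by (simp add: L.m_assoc[symmetric])
        then have "\<rho> a ?n \<in> Units A"
          using R.unit_factor[of "\<rho> a ?n" "\<rho> b m"] R.m_comm m nc ac b by simp
        then have "?n \<in> unit_degrees" using rho_homog[OF ac nc] nc by (auto simp: unit_degrees_def)
        then have "\<rho> a ?n = \<zero>\<^bsub>A\<^esub>" using a by (simp add: nonunit_ideal_def)
        with nz m b show False by simp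
      qed
      then show ?thesis using lc ac b by (simp add: rho_mult R.add.finprod_one_eqI del: rho.hom_mult)
    qed
    with ac b show "b \<otimes>\<^bsub>A\<^esub> a \<in> nonunit_ideal" by (simp add: nonunit_ideal_def)
  qed (simp add: nonunit_ideal_def)
  show "\<forall>a\<in>nonunit_ideal. \<forall>l\<in>carrier \<Lambda>. \<rho> a l \<in> nonunit_ideal"
    using unit_degrees_carrier by (auto simp: nonunit_ideal_def rho_rho)
qed

text \<open>A component in a unit degree is zero or a unit, and a graded ideal with a unit among its
  components is the whole ring.\<close>

lemma graded_ideal_le_nonunit:
  assumes J: "graded_ideal \<Lambda> A \<rho> J" "J \<noteq> carrier A"
  shows "J \<subseteq> nonunit_ideal"
proof
  interpret J: ideal J A using J by (simp add: graded_ideal_def)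
  fix a assume a: "a \<in> J"
  have ac: "a \<in> carrier A" by (rule J.Icarr[OF a])
  have "\<rho> a l = \<zero>\<^bsub>A\<^esub>" if l: "l \<in> unit_degrees" for l
  proof (rule ccontr)
    assume "\<rho> a l \<noteq> \<zero>\<^bsub>A\<^esub>"
    then have U: "\<rho> a l \<in> Units A"
      using unit_degree_unit[OF l rho_homog[OF ac unit_degrees_carrier[OF l]]] by simp
    have "\<rho> a l \<in> J" using J(1) a unit_degrees_carrier[OF l] by (simp add: graded_ideal_def)
    then have "inv\<^bsub>A\<^esub> (\<rho> a l) \<otimes>\<^bsub>A\<^esub> \<rho> a l \<in> J" using U by (intro J.I_l_closed) auto
    then have "\<one>\<^bsub>A\<^esub> \<in> J" using U by simp
    then show False using J.one_imp_carrier J(2) by simp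
  qed
  with ac show "a \<in> nonunit_ideal" by (simp add: nonunit_ideal_def)
qed

lemma one_notin_nonunit: "\<one>\<^bsub>A\<^esub> \<notin> nonunit_ideal"
proof -
  have "\<one>\<^bsub>\<Lambda>\<^esub> \<in> unit_degrees" by (rule subgroup.one_closed[OF unit_degrees_subgroup])
  moreover have "\<rho> \<one>\<^bsub>A\<^esub> \<one>\<^bsub>\<Lambda>\<^esub> = \<one>\<^bsub>A\<^esub>" by (simp add: ga_one ga_const_def)
  ultimately show ?thesis using one_neq_zero unfolding nonunit_ideal_def by force
qed

lemma largest_nonunit_ideal: "largest_proper_graded_ideal \<Lambda> A \<rho> nonunit_ideal"
  unfolding largest_proper_graded_ideal_def
  using nonunit_ideal graded_ideal_le_nonunit one_notin_nonunit R.one_closed by metis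

definition degree_part :: "'l set \<Rightarrow> 'a \<Rightarrow> 'a" where
  "degree_part \<Gamma> a = finsum A (\<rho> a) \<Gamma>"

lemma rho_degree_part:
  assumes "a \<in> carrier A" "\<Gamma> \<subseteq> carrier \<Lambda>" "l \<in> carrier \<Lambda>"
  shows "\<rho> (degree_part \<Gamma> a) l = (if l \<in> \<Gamma> then \<rho> a l else \<zero>\<^bsub>A\<^esub>)"
proof -
  have fin: "finite \<Gamma>" using assms(2) L.fin finite_subset by blast
  have mc: "m \<in> carrier \<Lambda>" if "m \<in> \<Gamma>" for m using assms(2) that by auto
  have "\<rho> (degree_part \<Gamma> a) l = finsum A (\<lambda>m. \<rho> (\<rho> a m) l) \<Gamma>"
    unfolding degree_part_def by (rule rho_finsum[OF fin _ assms(3)]) (simp add: mc assms(1))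
  also have "\<dots> = finsum A (\<lambda>m. if m = l then \<rho> a m else \<zero>\<^bsub>A\<^esub>) \<Gamma>"
    using assms(1,3) mc by (intro R.finsum_cong') (auto simp: rho_rho)
  also have "\<dots> = (if l \<in> \<Gamma> then \<rho> a l else \<zero>\<^bsub>A\<^esub>)"
    using assms by (intro R.finsum_delta[OF fin]) auto
  finally show ?thesis .
qed

lemma degree_part_closed: "a \<in> carrier A \<Longrightarrow> \<Gamma> \<subseteq> carrier \<Lambda> \<Longrightarrow> degree_part \<Gamma> a \<in> carrier A"
  unfolding degree_part_def by (intro R.finsum_closed) auto

lemma rho_inj:
  assumes "a \<in> carrier A" "b \<in> carrier A" "\<And>l. l \<in> carrier \<Lambda> \<Longrightarrow> \<rho> a l = \<rho> b l"
  shows "a = b"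
proof -
  have "finsum A (\<rho> a) (carrier \<Lambda>) = finsum A (\<rho> b) (carrier \<Lambda>)"
    using assms by (intro R.finsum_cong') auto
  then show ?thesis using rho_sum assms by simp
qed

lemma decompose:
  assumes "a \<in> carrier A"
  shows "degree_part unit_degrees a \<in> supported unit_degrees"
    and "a \<ominus>\<^bsub>A\<^esub> degree_part unit_degrees a \<in> nonunit_ideal"
proof -
  have sub: "unit_degrees \<subseteq> carrier \<Lambda>" by (auto simp: unit_degrees_def)
  note c = degree_part_closed[OF assms sub]
  show "degree_part unit_degrees a \<in> supported unit_degrees"
    using c by (simp add: supported_def rho_degree_part[OF assms sub])
  have "\<rho> (a \<ominus>\<^bsub>A\<^esub> degree_part unit_degrees a) l = \<zero>\<^bsub>A\<^esub>" if l: "l \<in> unit_degrees" for l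
  proof -
    have lc: "l \<in> carrier \<Lambda>" by (rule unit_degrees_carrier[OF l])
    have "\<rho> a l \<ominus>\<^bsub>A\<^esub> \<rho> a l = \<zero>\<^bsub>A\<^esub>" using assms lc by (simp add: a_minus_def R.r_neg)
    then show ?thesis
      unfolding rho_minus[OF assms c lc] rho_degree_part[OF assms sub lc] using l by simp
  qed
  with assms c show "a \<ominus>\<^bsub>A\<^esub> degree_part unit_degrees a \<in> nonunit_ideal"
    by (simp add: nonunit_ideal_def)
qed

lemma supported_int_nonunit: "supported unit_degrees \<inter> nonunit_ideal = {\<zero>\<^bsub>A\<^esub>}"
proof (intro equalityI subsetI)
  fix a assume a: "a \<in> supported unit_degrees \<inter> nonunit_ideal"
  then have ac: "a \<in> carrier A" by (simp add: supported_def)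
  have "a = \<zero>\<^bsub>A\<^esub>"
    by (rule rho_inj[OF ac R.zero_closed]) (use a in \<open>auto simp: supported_def nonunit_ideal_def ga_zero\<close>)
  then show "a \<in> {\<zero>\<^bsub>A\<^esub>}" by simp
next
  fix a assume "a \<in> {\<zero>\<^bsub>A\<^esub>}"
  moreover have "\<zero>\<^bsub>A\<^esub> \<in> nonunit_ideal" "\<zero>\<^bsub>A\<^esub> \<in> supported unit_degrees"
    using unit_degrees_carrier by (auto simp: supported_def nonunit_ideal_def ga_zero)
  ultimately show "a \<in> supported unit_degrees \<inter> nonunit_ideal" by simp
qed

lemma supported_plus_nonunit: "supported unit_degrees <+>\<^bsub>A\<^esub> nonunit_ideal = carrier A"
proof
  show "supported unit_degrees <+>\<^bsub>A\<^esub> nonunit_ideal \<subseteq> carrier A"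
    by (auto simp: set_add_def' supported_def nonunit_ideal_def)
  show "carrier A \<subseteq> supported unit_degrees <+>\<^bsub>A\<^esub> nonunit_ideal"
  proof
    fix a assume a: "a \<in> carrier A"
    have c: "degree_part unit_degrees a \<in> carrier A" by (intro degree_part_closed a) (auto simp: unit_degrees_def)
    have "a = degree_part unit_degrees a \<oplus>\<^bsub>A\<^esub> (a \<ominus>\<^bsub>A\<^esub> degree_part unit_degrees a)"
      using a c by (simp add: a_minus_def R.a_lcomm R.r_neg)
    with decompose[OF a] show "a \<in> supported unit_degrees <+>\<^bsub>A\<^esub> nonunit_ideal"
      unfolding set_add_def' by blast
  qed
qed

text \<open>A degree in \<Gamma> that is no unit degree would put a nonzero homogeneous element into
  both summands; this is where \<open>full\<close> enters. A unit degree missing from \<Gamma> would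
  make the component of that degree vanish on both summands, although a unit lives there.\<close>

lemma complement_unique:
  assumes full: "\<And>l. l \<in> carrier \<Lambda> \<Longrightarrow> homog l \<noteq> {\<zero>\<^bsub>A\<^esub>}" and \<Gamma>: "subgroup \<Gamma> \<Lambda>"
    and int: "supported \<Gamma> \<inter> nonunit_ideal = {\<zero>\<^bsub>A\<^esub>}"
    and sum: "supported \<Gamma> <+>\<^bsub>A\<^esub> nonunit_ideal = carrier A"
  shows "\<Gamma> = unit_degrees"
proof
  interpret S: subgroup \<Gamma> \<Lambda> by fact
  show "\<Gamma> \<subseteq> unit_degrees"
  proof (rule subsetI, rule ccontr)
    fix l assume l: "l \<in> \<Gamma>" and nl: "l \<notin> unit_degrees"
    have lc: "l \<in> carrier \<Lambda>" using l by simp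
    obtain a where a: "a \<in> homog l" "a \<noteq> \<zero>\<^bsub>A\<^esub>" using full[OF lc] homog_zero by blast
    have "a \<in> supported \<Gamma>" using homogD[OF a(1)] l by (auto simp: supported_def)
    moreover have "a \<in> nonunit_ideal" using homogD[OF a(1)] nl unit_degrees_carrier
      by (auto simp: nonunit_ideal_def)
    ultimately show False using int a(2) by blast
  qed
  show "unit_degrees \<subseteq> \<Gamma>"
  proof (rule subsetI, rule ccontr)
    fix l assume l: "l \<in> unit_degrees" and nl: "l \<notin> \<Gamma>"
    have lc: "l \<in> carrier \<Lambda>" by (rule unit_degrees_carrier[OF l])
    have "hunit l \<in> supported \<Gamma> <+>\<^bsub>A\<^esub> nonunit_ideal" using sum l by simp
    then obtain b c where bc: "b \<in> supported \<Gamma>" "c \<in> nonunit_ideal" "hunit l = b \<oplus>\<^bsub>A\<^esub> c"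
      unfolding set_add_def' by blast
    then have cc: "b \<in> carrier A" "c \<in> carrier A" by (auto simp: supported_def nonunit_ideal_def)
    have "hunit l = \<rho> (hunit l) l" using homogD(2)[OF hunit(2)[OF l] lc] by simp
    also have "\<dots> = \<rho> b l \<oplus>\<^bsub>A\<^esub> \<rho> c l" unfolding bc(3) using cc lc by (rule rho_add)
    also have "\<dots> = \<zero>\<^bsub>A\<^esub>" using bc(1,2) l lc nl by (simp add: supported_def nonunit_ideal_def)
    finally have "\<zero>\<^bsub>A\<^esub> \<in> Units A" using hunit(1)[OF l] by simp
    then show False using one_neq_zero by (metis R.Units_r_inv R.Units_inv_closed R.l_null)
  qed
qed

lemma nonunit_ideal_le_prime:
  assumes "primeideal \<mm> A"
  shows "nonunit_ideal \<subseteq> \<mm>"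
proof
  interpret m: primeideal \<mm> A by fact
  fix a assume a: "a \<in> nonunit_ideal"
  then have ac: "a \<in> carrier A" by (simp add: nonunit_ideal_def)
  have pow: "b \<in> \<mm>" if "b \<in> carrier A" "b [^]\<^bsub>A\<^esub> (n::nat) \<in> \<mm>" for b n
    using that(2)
  proof (induction n)
    case 0
    then show ?case using m.one_imp_carrier m.I_notcarr by simp
  next
    case (Suc n)
    then show ?case using m.I_prime[of "b [^]\<^bsub>A\<^esub> n" b] that(1) by auto
  qed
  have "\<rho> a l \<in> \<mm>" if l: "l \<in> carrier \<Lambda>" for l
  proof (cases "l \<in> unit_degrees")
    case True
    then show ?thesis using a by (simp add: nonunit_ideal_def)
  next
    case False
    then have "\<rho> a l [^]\<^bsub>A\<^esub> order \<Lambda> \<in> \<mm>" using nonunit_nilpotent[OF l _ rho_homog[OF ac l]] by simp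
    then show ?thesis by (rule pow[OF rho_closed[OF ac l]])
  qed
  then have "finsum A (\<rho> a) (carrier \<Lambda>) \<in> \<mm>" by (intro m.finsum_mem L.fin)
  then show "a \<in> \<mm>" using rho_sum[OF ac] by simp
qed

text \<open>A graded ideal inside a prime is proper, hence lies in \<open>nonunit_ideal\<close>,
  which in turn lies in the prime. So the orbit is cut out by the same ideal whatever prime is
  taken.\<close>

lemma orbit_nonunit_ideal:
  assumes "primeideal \<mm> A"
  shows "orbit_ideal \<Lambda> A \<rho> \<mm> nonunit_ideal"
proof -
  interpret m: primeideal \<mm> A by fact
  have "J \<noteq> carrier A" if "J \<subseteq> \<mm>" for J
    using that m.I_notcarr m.a_subset by blast
  then show ?thesis
    unfolding orbit_ideal_def
    using nonunit_ideal nonunit_ideal_le_prime[OF assms] graded_ideal_le_nonunit by blast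
qed

text \<open>Triviality: modulo the ideal the characters of unit degree become 1, and the components
  of all other degrees lie in the prime. Maximality: if another subgroup scheme, with subgroup
  \<Gamma>', acts trivially, then for a unit \<open>u\<close> of degree \<open>l\<close> the class
  of \<open>u\<close> times \<open>l - 1\<close> lies in the ideal of \<Gamma>' over the residue
  ring; this class of \<open>u\<close> is nonzero, which forces \<open>l\<close> into
  \<Gamma>'.\<close>

lemma centralizer_unit_degrees:
  assumes "primeideal \<mm> A"
  shows "is_centralizer K \<Lambda> A \<phi> \<rho> \<mm> (coset_sum_ideal \<Lambda> unit_degrees K)"
proof -
  interpret m: primeideal \<mm> A by fact
  interpret KG: group_ring \<Lambda> K by unfold_locales
  let ?\<Gamma> = "unit_degrees"
  note sg = unit_degrees_subgroup
  let ?I = "coset_sum_ideal \<Lambda> ?\<Gamma> K"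
  have gens_sub: "ga_const \<Lambda> A ` \<mm> \<union> ga_map \<Lambda> \<phi> ` I \<subseteq> carrier GA" if "I \<subseteq> carrier KG.GA" for I
  proof (intro Un_least image_subsetI)
    fix a assume "a \<in> \<mm>"
    then show "ga_const \<Lambda> A a \<in> carrier GA" using m.Icarr by simp
  next
    fix f assume "f \<in> I"
    then show "ga_map \<Lambda> \<phi> f \<in> carrier GA"
      using that ring_hom_closed[OF ga_map_hom[OF phi_hom B.cring_axioms]] by blast
  qed
  have Isub: "?I \<subseteq> carrier KG.GA" by (auto simp: coset_sum_ideal_def)
  have triv: "acts_trivially_on \<Lambda> A \<phi> \<rho> \<mm> ?I"
    unfolding acts_trivially_on_def
  proof
    fix a assume a: "a \<in> carrier A"
    let ?S = "ga_const \<Lambda> A ` \<mm> \<union> ga_map \<Lambda> \<phi> ` ?I"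
    let ?J = "genideal GA ?S"
    note Sc = gens_sub[OF Isub]
    interpret J: ideal ?J GA by (rule G.genideal_ideal[OF Sc])
    have "coset_sum_ideal \<Lambda> ?\<Gamma> A \<subseteq> ?J"
      using G.subset_Idl_subset[OF Sc, of "ga_map \<Lambda> \<phi> ` ?I"]
      by (simp add: genideal_coset_sum[OF phi_hom B.cring_axioms sg])
    then have dJ: "ga_delta l \<in> ?J" if "l \<in> ?\<Gamma>" for l
      using ga_delta_mem(1)[OF sg unit_degrees_carrier[OF that] that] by blast
    have comp: "ga_monom \<Lambda> A l (\<rho> a l) \<ominus>\<^bsub>GA\<^esub> ga_const \<Lambda> A (\<rho> a l) \<in> ?J" if l: "l \<in> carrier \<Lambda>" for l
    proof (cases "l \<in> ?\<Gamma>")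
      case True
      have "ga_const \<Lambda> A (\<rho> a l) \<otimes>\<^bsub>GA\<^esub> ga_delta l \<in> ?J"
        using a l by (intro J.I_l_closed dJ True) auto
      also have "ga_const \<Lambda> A (\<rho> a l) \<otimes>\<^bsub>GA\<^esub> ga_delta l = ga_monom \<Lambda> A l (\<rho> a l) \<ominus>\<^bsub>GA\<^esub> ga_const \<Lambda> A (\<rho> a l)"
        using a l unfolding ga_delta_def a_minus_def
        by (subst G.r_distr) (simp_all add: ga_const_monom ga_monom_split G.r_minus)
      finally show ?thesis .
    next
      case False
      have "\<rho> a l \<in> nonunit_ideal"
        using False a l unit_degrees_carrier by (auto simp: nonunit_ideal_def rho_rho)
      then have am: "\<rho> a l \<in> \<mm>" using nonunit_ideal_le_prime[OF assms] by blast
      then have cJ: "ga_const \<Lambda> A (\<rho> a l) \<in> ?J" using G.genideal_self[OF Sc] by blast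
      have "ga_monom \<Lambda> A l \<one>\<^bsub>A\<^esub> \<otimes>\<^bsub>GA\<^esub> ga_const \<Lambda> A (\<rho> a l) \<in> ?J"
        by (intro J.I_l_closed cJ) simp
      also have "ga_monom \<Lambda> A l \<one>\<^bsub>A\<^esub> \<otimes>\<^bsub>GA\<^esub> ga_const \<Lambda> A (\<rho> a l) = ga_monom \<Lambda> A l (\<rho> a l)"
        using a l by (simp add: ga_const_monom ga_monom_split)
      finally show ?thesis using cJ by (rule J.minus_mem)
    qed
    have mc: "(\<lambda>l. ga_monom \<Lambda> A l (\<rho> a l)) \<in> carrier \<Lambda> \<rightarrow> carrier GA"
      "(\<lambda>l. ga_const \<Lambda> A (\<rho> a l)) \<in> carrier \<Lambda> \<rightarrow> carrier GA" using a by auto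
    have "finsum GA (\<lambda>l. ga_monom \<Lambda> A l (\<rho> a l) \<ominus>\<^bsub>GA\<^esub> ga_const \<Lambda> A (\<rho> a l)) (carrier \<Lambda>) \<in> ?J"
      by (rule J.finsum_mem[OF L.fin comp])
    also have "finsum GA (\<lambda>l. ga_monom \<Lambda> A l (\<rho> a l) \<ominus>\<^bsub>GA\<^esub> ga_const \<Lambda> A (\<rho> a l)) (carrier \<Lambda>) =
      finsum GA (\<lambda>l. ga_monom \<Lambda> A l (\<rho> a l)) (carrier \<Lambda>) \<ominus>\<^bsub>GA\<^esub>
      finsum GA (\<lambda>l. ga_const \<Lambda> A (\<rho> a l)) (carrier \<Lambda>)"
      by (rule G.finsum_diff[OF L.fin mc])
    also have "finsum GA (\<lambda>l. ga_monom \<Lambda> A l (\<rho> a l)) (carrier \<Lambda>) = \<rho> a"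
      by (rule ga_expand[OF rho_GA[OF a], symmetric])
    also have "finsum GA (\<lambda>l. ga_const \<Lambda> A (\<rho> a l)) (carrier \<Lambda>) = ga_const \<Lambda> A a"
      using ga_monom_finsum[OF L.fin, of "\<rho> a" "\<one>\<^bsub>\<Lambda>\<^esub>"] a rho_sum[OF a] by (simp add: ga_const_monom)
    finally show "\<rho> a \<ominus>\<^bsub>GA\<^esub> ga_const \<Lambda> A a \<in> ?J" .
  qed
  have max: "?I \<subseteq> I'" if I': "subgroup_scheme K \<Lambda> I'" and tr: "acts_trivially_on \<Lambda> A \<phi> \<rho> \<mm> I'" for I'
  proof -
    obtain \<Gamma>' where \<Gamma>': "subgroup \<Gamma>' \<Lambda>" "I' = coset_sum_ideal \<Lambda> \<Gamma>' K"
      using KG.subgroup_scheme_imp_coset_sum[OF K.field_axioms I'] by blast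
    let ?Q = "A Quot \<mm>" and ?\<pi> = "a_r_coset A \<mm>"
    interpret Q: cring ?Q by (rule m.quotient_is_cring[OF R.cring_axioms])
    interpret Q: group_ring \<Lambda> ?Q by unfold_locales
    interpret \<pi>: ring_hom_cring A ?Q ?\<pi> by (rule m.rcos_ring_hom_cring)
    interpret M: ring_hom_cring GA Q.GA "ga_map \<Lambda> ?\<pi>"
      by unfold_locales (rule Q.ga_map_hom[OF m.rcos_ring_hom R.cring_axioms])
    \<comment> \<open>Passing to the residue ring kills the generators coming from
      \<open>\<mm>\<close> and leaves the ideal of \<Gamma>', so membership can be tested by coset
      sums.\<close>
    let ?N = "{F \<in> carrier GA. ga_map \<Lambda> ?\<pi> F \<in> coset_sum_ideal \<Lambda> \<Gamma>' ?Q}"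
    interpret C: ideal "coset_sum_ideal \<Lambda> \<Gamma>' ?Q" Q.GA by (rule Q.coset_sum_ideal[OF \<Gamma>'(1)])
    have Nid: "ideal ?N GA"
      by (rule G.idealI') (auto intro: C.a_closed C.I_l_closed)
    have I'sub: "I' \<subseteq> carrier KG.GA" unfolding \<Gamma>' by (auto simp: coset_sum_ideal_def)
    have gens: "ga_const \<Lambda> A ` \<mm> \<union> ga_map \<Lambda> \<phi> ` I' \<subseteq> ?N"
    proof
      fix F assume F: "F \<in> ga_const \<Lambda> A ` \<mm> \<union> ga_map \<Lambda> \<phi> ` I'"
      then have Fc: "F \<in> carrier GA" using gens_sub[OF I'sub] by blast
      from F show "F \<in> ?N"
      proof
        assume "F \<in> ga_const \<Lambda> A ` \<mm>"
        then obtain a where a: "a \<in> \<mm>" "F = ga_const \<Lambda> A a" by blast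
        have "?\<pi> a = \<zero>\<^bsub>?Q\<^esub>" using a m.coset_eq_self_iff[of a] m.Icarr m.Quot_zero by simp
        then have "ga_map \<Lambda> ?\<pi> F = \<zero>\<^bsub>Q.GA\<^esub>"
          unfolding a ga_map_def ga_const_def ga_zero by (intro restrict_ext) simp
        with Fc C.zero_closed show ?thesis by simp
      next
        assume "F \<in> ga_map \<Lambda> \<phi> ` I'"
        then obtain f where f: "f \<in> I'" "F = ga_map \<Lambda> \<phi> f" by blast
        have "ga_map \<Lambda> ?\<pi> F = ga_map \<Lambda> (\<lambda>r. ?\<pi> (\<phi> r)) f"
          unfolding f ga_map_def by (intro restrict_ext) simp
        moreover have "ga_map \<Lambda> (\<lambda>r. ?\<pi> (\<phi> r)) f \<in> coset_sum_ideal \<Lambda> \<Gamma>' ?Q"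
        proof -
          have h: "(\<lambda>r. ?\<pi> (\<phi> r)) \<in> ring_hom K ?Q"
            using ring_hom_trans[OF phi_hom m.rcos_ring_hom] by (simp add: o_def)
          have "ga_map \<Lambda> (\<lambda>r. ?\<pi> (\<phi> r)) ` I' \<subseteq> carrier Q.GA"
            using I'sub ring_hom_closed[OF Q.ga_map_hom[OF h B.cring_axioms]] by blast
          from Q.G.genideal_self[OF this] f(1) show ?thesis
            unfolding \<Gamma>'(2) Q.genideal_coset_sum[OF h B.cring_axioms \<Gamma>'(1)] by blast
        qed
        ultimately show ?thesis using Fc by simp
      qed
    qed
    have gN: "genideal GA (ga_const \<Lambda> A ` \<mm> \<union> ga_map \<Lambda> \<phi> ` I') \<subseteq> ?N"
      by (rule G.genideal_minimal[OF Nid gens])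
    have "?\<Gamma> \<subseteq> \<Gamma>'"
    proof (rule subsetI, rule ccontr)
      fix l assume l: "l \<in> ?\<Gamma>" and nl: "l \<notin> \<Gamma>'"
      have lc: "l \<in> carrier \<Lambda>" by (rule unit_degrees_carrier[OF l])
      let ?u = "hunit l"
      have uc: "?u \<in> carrier A" using l by simp
      have "\<rho> ?u \<ominus>\<^bsub>GA\<^esub> ga_const \<Lambda> A ?u \<in> ?N"
        using tr uc gN unfolding acts_trivially_on_def by blast
      then have "ga_map \<Lambda> ?\<pi> (\<rho> ?u \<ominus>\<^bsub>GA\<^esub> ga_const \<Lambda> A ?u) \<in> coset_sum_ideal \<Lambda> \<Gamma>' ?Q" by simp
      also have "ga_map \<Lambda> ?\<pi> (\<rho> ?u \<ominus>\<^bsub>GA\<^esub> ga_const \<Lambda> A ?u) =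
        ga_monom \<Lambda> ?Q l (?\<pi> ?u) \<ominus>\<^bsub>Q.GA\<^esub> ga_monom \<Lambda> ?Q \<one>\<^bsub>\<Lambda>\<^esub> (?\<pi> ?u)"
      proof -
        have e: "ga_map \<Lambda> ?\<pi> (ga_monom \<Lambda> A m ?u) = ga_monom \<Lambda> ?Q m (?\<pi> ?u)" for m
          unfolding ga_map_def ga_monom_def by (intro restrict_ext) simp
        have "\<rho> ?u = ga_monom \<Lambda> A l ?u" using hunit(2)[OF l] by (simp add: homog_def)
        then show ?thesis using uc by (simp add: a_minus_def ga_const_monom e)
      qed
      finally have "finsum ?Q (\<lambda>m. (ga_monom \<Lambda> ?Q l (?\<pi> ?u) \<ominus>\<^bsub>Q.GA\<^esub> ga_monom \<Lambda> ?Q \<one>\<^bsub>\<Lambda>\<^esub> (?\<pi> ?u)) (\<one>\<^bsub>\<Lambda>\<^esub> \<otimes>\<^bsub>\<Lambda>\<^esub> m)) \<Gamma>' = \<zero>\<^bsub>?Q\<^esub>"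
        unfolding coset_sum_ideal_def using L.one_closed by blast
      moreover have pc: "?\<pi> ?u \<in> carrier ?Q" using uc by simp
      ultimately have "?\<pi> ?u = \<zero>\<^bsub>?Q\<^esub>"
        using nl lc subgroup.one_closed[OF \<Gamma>'(1)]
        by (simp add: Q.coset_sum_minus[OF subgroup.subset[OF \<Gamma>'(1)] L.one_closed]
            Q.coset_sum_monom[OF \<Gamma>'(1) _ L.one_closed pc])
      then have "?u \<in> \<mm>" using uc m.coset_eq_self_iff m.Quot_zero by simp
      then have "inv\<^bsub>A\<^esub> ?u \<otimes>\<^bsub>A\<^esub> ?u \<in> \<mm>" using hunit(1)[OF l] by (intro m.I_l_closed) auto
      then show False using hunit(1)[OF l] m.one_imp_carrier m.I_notcarr by simp
    qed
    then show ?thesis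
      unfolding \<Gamma>'(2)
      by (intro KG.coset_sum_ideal_minimal[OF sg KG.coset_sum_ideal[OF \<Gamma>'(1)]] KG.ga_delta_mem(1)[OF \<Gamma>'(1)])
        (auto simp: unit_degrees_carrier)
  qed
  show ?thesis
    unfolding is_centralizer_def
    using KG.subgroup_scheme_coset_sum[OF sg] triv max by blast
qed

end

section \<open>Tensor products and torsors\<close>

lemma free_pair_ring_simps [simp]:
  "carrier (free_pair_ring A B) = {c. Poly_Mapping.keys c \<subseteq> carrier A \<times> carrier B}"
  "\<zero>\<^bsub>free_pair_ring A B\<^esub> = 0"
  "p \<oplus>\<^bsub>free_pair_ring A B\<^esub> q = p + q"
  "\<one>\<^bsub>free_pair_ring A B\<^esub> = frag_of (\<one>\<^bsub>A\<^esub>, \<one>\<^bsub>B\<^esub>)"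
  by (simp_all add: free_pair_ring_def)

lemma free_pair_mult_of:
  "frag_of (a, b) \<otimes>\<^bsub>free_pair_ring A B\<^esub> frag_of (a', b') = frag_of (a \<otimes>\<^bsub>A\<^esub> a', b \<otimes>\<^bsub>B\<^esub> b')"
  by (simp add: free_pair_ring_def)

lemma free_pair_mult_diff:
  "(p - p') \<otimes>\<^bsub>free_pair_ring A B\<^esub> q = p \<otimes>\<^bsub>free_pair_ring A B\<^esub> q - p' \<otimes>\<^bsub>free_pair_ring A B\<^esub> q"
  "p \<otimes>\<^bsub>free_pair_ring A B\<^esub> (q - q') = p \<otimes>\<^bsub>free_pair_ring A B\<^esub> q - p \<otimes>\<^bsub>free_pair_ring A B\<^esub> q'"
proof -
  show "(p - p') \<otimes>\<^bsub>free_pair_ring A B\<^esub> q = p \<otimes>\<^bsub>free_pair_ring A B\<^esub> q - p' \<otimes>\<^bsub>free_pair_ring A B\<^esub> q"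
    by (simp add: free_pair_ring_def frag_extend_diff)
  have "frag_extend (\<lambda>x. F x - F' x) p = frag_extend F p - frag_extend F' p"
    for F F' :: "'a \<times> 'b \<Rightarrow> ('a \<times> 'b) \<Rightarrow>\<^sub>0 int"
  proof -
    have "frag_cmul c (x - y) = frag_cmul c x - frag_cmul c y" for c and x y :: "('a \<times> 'b) \<Rightarrow>\<^sub>0 int"
      by (rule poly_mapping_eqI) (simp add: lookup_minus right_diff_distrib)
    then show ?thesis by (simp add: frag_extend_def sum_subtractf)
  qed
  then show "p \<otimes>\<^bsub>free_pair_ring A B\<^esub> (q - q') = p \<otimes>\<^bsub>free_pair_ring A B\<^esub> q - p \<otimes>\<^bsub>free_pair_ring A B\<^esub> q'"
    by (simp add: free_pair_ring_def frag_extend_diff case_prod_unfold)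
qed

lemma free_pair_mult_zero:
  "0 \<otimes>\<^bsub>free_pair_ring A B\<^esub> q = 0" "p \<otimes>\<^bsub>free_pair_ring A B\<^esub> 0 = 0"
  using free_pair_mult_diff(1)[where p = 0 and p' = 0] free_pair_mult_diff(2)[where q = 0 and q' = 0]
  by simp_all

section \<open>Ring structure on formal sums of pairs\<close>

locale pair_ring = A: cring A + B: cring B
  for A :: "('a, 'x) ring_scheme" and B :: "('b, 'y) ring_scheme"
begin

abbreviation "P \<equiv> free_pair_ring A B"

lemma frag_of_carrier: "a \<in> carrier A \<Longrightarrow> b \<in> carrier B \<Longrightarrow> frag_of (a, b) \<in> carrier P"
  by simp

lemma diff_carrier: "p \<in> carrier P \<Longrightarrow> q \<in> carrier P \<Longrightarrow> p - q \<in> carrier P"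
  using keys_diff[of p q] by auto

lemma sum_carrier: "(\<And>s. s \<in> S \<Longrightarrow> f s \<in> carrier P) \<Longrightarrow> sum f S \<in> carrier P"
  using keys_sum[of f S] by fastforce

text \<open>Subtraction alone builds the free abelian group from its basis, which is why bilinearity
  of the product is recorded for differences.\<close>

lemma P_induct [consumes 1, case_names zero one diff]:
  assumes "p \<in> carrier P" "Q 0" "\<And>a b. a \<in> carrier A \<Longrightarrow> b \<in> carrier B \<Longrightarrow> Q (frag_of (a, b))"
    "\<And>p q. p \<in> carrier P \<Longrightarrow> q \<in> carrier P \<Longrightarrow> Q p \<Longrightarrow> Q q \<Longrightarrow> Q (p - q)"
  shows "Q p"
proof -
  have "Poly_Mapping.keys p \<subseteq> carrier A \<times> carrier B" using assms(1) by simp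
  then show ?thesis
    by (rule free_Abelian_group_induct) (use assms(2-4) in auto)
qed

lemma P_mult_closed:
  assumes "p \<in> carrier P" "q \<in> carrier P"
  shows "p \<otimes>\<^bsub>P\<^esub> q \<in> carrier P"
  using assms(1)
proof (induction p rule: P_induct)
  case zero show ?case by (simp add: free_pair_mult_zero)
next
  case (one a b)
  show ?case using assms(2)
  proof (induction q rule: P_induct)
    case zero show ?case by (simp add: free_pair_mult_zero)
  next
    case (one a' b')
    then show ?case using \<open>a \<in> carrier A\<close> \<open>b \<in> carrier B\<close> by (simp add: free_pair_mult_of)
  next
    case (diff p q) then show ?case by (simp only: free_pair_mult_diff) (rule diff_carrier)
  qed
next
  case (diff p q) then show ?case by (simp only: free_pair_mult_diff) (rule diff_carrier)
qed

lemma P_mult_comm: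
  assumes "p \<in> carrier P" "q \<in> carrier P"
  shows "p \<otimes>\<^bsub>P\<^esub> q = q \<otimes>\<^bsub>P\<^esub> p"
  using assms(1)
proof (induction p rule: P_induct)
  case zero show ?case by (simp add: free_pair_mult_zero)
next
  case (one a b)
  show ?case using assms(2)
  proof (induction q rule: P_induct)
    case zero show ?case by (simp add: free_pair_mult_zero)
  next
    case (one a' b')
    then show ?case using \<open>a \<in> carrier A\<close> \<open>b \<in> carrier B\<close>
      by (simp add: free_pair_mult_of A.m_comm B.m_comm)
  qed (simp add: free_pair_mult_diff)
qed (simp add: free_pair_mult_diff)

lemma P_mult_assoc:
  assumes "p \<in> carrier P" "q \<in> carrier P" "r \<in> carrier P"
  shows "p \<otimes>\<^bsub>P\<^esub> q \<otimes>\<^bsub>P\<^esub> r = p \<otimes>\<^bsub>P\<^esub> (q \<otimes>\<^bsub>P\<^esub> r)"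
  using assms(1)
proof (induction p rule: P_induct)
  case zero show ?case by (simp add: free_pair_mult_zero)
next
  case (one a b)
  show ?case using assms(2)
  proof (induction q rule: P_induct)
    case zero show ?case by (simp add: free_pair_mult_zero)
  next
    case (one a' b')
    show ?case using assms(3)
    proof (induction r rule: P_induct)
      case zero show ?case by (simp add: free_pair_mult_zero)
    next
      case (one a'' b'')
      then show ?case
        using \<open>a \<in> carrier A\<close> \<open>b \<in> carrier B\<close> \<open>a' \<in> carrier A\<close> \<open>b' \<in> carrier B\<close>
        by (simp add: free_pair_mult_of A.m_assoc B.m_assoc)
    qed (simp add: free_pair_mult_diff)
  qed (simp add: free_pair_mult_diff)
qed (simp add: free_pair_mult_diff)

lemma P_cring: "cring P"
proof (rule cringI)
  show "abelian_group P"
  proof (rule abelian_groupI)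
    fix p assume p: "p \<in> carrier P"
    then show "\<exists>q\<in>carrier P. q \<oplus>\<^bsub>P\<^esub> p = \<zero>\<^bsub>P\<^esub>"
      by (intro bexI[of _ "- p"]) auto
    fix q assume "q \<in> carrier P"
    with p show "p \<oplus>\<^bsub>P\<^esub> q \<in> carrier P" using keys_add[of p q] by auto
  qed (auto simp: add_ac)
  show "comm_monoid P"
  proof (rule comm_monoidI)
    fix p assume "p \<in> carrier P"
    then show "\<one>\<^bsub>P\<^esub> \<otimes>\<^bsub>P\<^esub> p = p"
      by (induction p rule: P_induct) (simp_all add: free_pair_mult_zero free_pair_mult_of free_pair_mult_diff)
  qed (use P_mult_closed P_mult_comm P_mult_assoc in \<open>auto simp del: free_pair_ring_simps(1) simp: frag_of_carrier\<close>)
  fix p q r assume c: "p \<in> carrier P" "q \<in> carrier P" "r \<in> carrier P"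
  \<comment> \<open>The sum is written as a difference of differences, for which distributivity is
    available.\<close>
  have "(p - (0 - q)) \<otimes>\<^bsub>P\<^esub> r = p \<otimes>\<^bsub>P\<^esub> r - (0 - q \<otimes>\<^bsub>P\<^esub> r)"
    by (simp only: free_pair_mult_diff free_pair_mult_zero)
  then show "(p \<oplus>\<^bsub>P\<^esub> q) \<otimes>\<^bsub>P\<^esub> r = p \<otimes>\<^bsub>P\<^esub> r \<oplus>\<^bsub>P\<^esub> q \<otimes>\<^bsub>P\<^esub> r" by simp
qed

sublocale P: cring P by (rule P_cring)

lemma P_uminus: "p \<in> carrier P \<Longrightarrow> \<ominus>\<^bsub>P\<^esub> p = - p"
  by (rule P.minus_equality) auto

end

lemma (in cring) additive_zero_diff:
  fixes h :: "'g :: ab_group_add \<Rightarrow> 'a"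
  assumes h: "\<And>p q. p \<in> C \<Longrightarrow> q \<in> C \<Longrightarrow> h (p + q) = h p \<oplus> h q"
    and C: "\<And>p. p \<in> C \<Longrightarrow> h p \<in> carrier R" "0 \<in> C"
    "\<And>p q. p \<in> C \<Longrightarrow> q \<in> C \<Longrightarrow> p - q \<in> C"
  shows "h 0 = \<zero>" "\<And>p q. p \<in> C \<Longrightarrow> q \<in> C \<Longrightarrow> h (p - q) = h p \<ominus> h q"
proof -
  have "h 0 = h 0 \<oplus> h 0" using h[OF C(2) C(2)] by simp
  then show "h 0 = \<zero>" using C(1)[OF C(2)] by (metis add.l_cancel_one)
  fix p q assume pq: "p \<in> C" "q \<in> C"
  have "h p = h (p - q) \<oplus> h q" using h[OF C(3)[OF pq] pq(2)] by simp
  then show "h (p - q) = h p \<ominus> h q"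
    using C(1)[OF C(3)[OF pq]] C(1)[OF pq(2)] by (simp add: a_minus_def a_assoc r_neg)
qed

text \<open>The universal property of the free abelian group yields an additive map, and
  multiplicativity on basis elements uses that \<open>T\<close> is commutative. Compatibility with
  differences is listed separately because these are taken in the type of formal sums and not
  through the ring record.\<close>

lemma (in pair_ring) tensor_lift:
  assumes "cring T" and f: "f \<in> ring_hom A T" and g: "g \<in> ring_hom B T"
  obtains h where "h \<in> ring_hom P T"
    "\<And>a b. a \<in> carrier A \<Longrightarrow> b \<in> carrier B \<Longrightarrow> h (frag_of (a, b)) = f a \<otimes>\<^bsub>T\<^esub> g b"
    "\<And>p q. p \<in> carrier P \<Longrightarrow> q \<in> carrier P \<Longrightarrow> h (p - q) = h p \<ominus>\<^bsub>T\<^esub> h q"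
proof -
  interpret T: cring T by fact
  interpret f: ring_hom_cring A T f by unfold_locales (rule f)
  interpret g: ring_hom_cring B T g by unfold_locales (rule g)
  have "(\<lambda>(a, b). f a \<otimes>\<^bsub>T\<^esub> g b) ` (carrier A \<times> carrier B) \<subseteq> carrier (add_monoid T)" by auto
  from comm_group.free_Abelian_group_universal[OF T.a_comm_group this] obtain h where
    h: "h \<in> hom (free_Abelian_group (carrier A \<times> carrier B)) (add_monoid T)"
      "\<And>x. x \<in> carrier A \<times> carrier B \<Longrightarrow> h (frag_of x) = (\<lambda>(a, b). f a \<otimes>\<^bsub>T\<^esub> g b) x" by blast
  have of: "h (frag_of (a, b)) = f a \<otimes>\<^bsub>T\<^esub> g b" if "a \<in> carrier A" "b \<in> carrier B" for a b
    using h(2)[of "(a, b)"] that by simp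
  have hc: "h p \<in> carrier T" if "p \<in> carrier P" for p
    using h(1) that by (auto simp: hom_def free_Abelian_group_def)
  have hadd: "h (p + q) = h p \<oplus>\<^bsub>T\<^esub> h q" if "p \<in> carrier P" "q \<in> carrier P" for p q
    using h(1) that by (auto simp: hom_def free_Abelian_group_def)
  have z: "0 \<in> carrier P" by simp
  have h0: "h 0 = \<zero>\<^bsub>T\<^esub>" by (rule T.additive_zero_diff(1)[OF hadd hc z diff_carrier])
  have hdiff: "h (p - q) = h p \<ominus>\<^bsub>T\<^esub> h q" if "p \<in> carrier P" "q \<in> carrier P" for p q
    by (rule T.additive_zero_diff(2)[OF hadd hc z diff_carrier that])
  have hmult: "h (p \<otimes>\<^bsub>P\<^esub> q) = h p \<otimes>\<^bsub>T\<^esub> h q" if p: "p \<in> carrier P" and q: "q \<in> carrier P" for p q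
    using p
  proof (induction p rule: P_induct)
    case zero
    then show ?case using hc[OF q] by (simp add: free_pair_mult_zero h0)
  next
    case (one a b)
    have ab: "frag_of (a, b) \<in> carrier P" using one by simp
    show ?case using q
    proof (induction q rule: P_induct)
      case zero
      then show ?case using hc[OF ab] by (simp add: free_pair_mult_zero h0)
    next
      case (one a' b')
      then show ?case
        using \<open>a \<in> carrier A\<close> \<open>b \<in> carrier B\<close> by (simp add: free_pair_mult_of of T.m_ac)
    next
      case (diff p q)
      then show ?case
        using hdiff[OF P_mult_closed[OF ab diff(1)] P_mult_closed[OF ab diff(2)]] hdiff[OF diff(1,2)]
          hc[OF ab] hc[OF diff(1)] hc[OF diff(2)]
        by (simp add: free_pair_mult_diff a_minus_def T.r_distr T.r_minus del: free_pair_ring_simps)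
    qed
  next
    case (diff p p')
    then show ?case
      using hdiff[OF P_mult_closed[OF diff(1) q] P_mult_closed[OF diff(2) q]] hdiff[OF diff(1,2)]
        hc[OF q] hc[OF diff(1)] hc[OF diff(2)]
      by (simp add: free_pair_mult_diff a_minus_def T.l_distr T.l_minus del: free_pair_ring_simps)
  qed
  have hom: "h \<in> ring_hom P T"
    by (rule ring_hom_memI) (use hc hmult hadd of[of "\<one>\<^bsub>A\<^esub>" "\<one>\<^bsub>B\<^esub>"] in \<open>auto simp del: free_pair_ring_simps(1)\<close>)
  show thesis by (rule that[OF hom of hdiff])
qed

section \<open>The tensor product as a quotient by the bilinearity relations\<close>

locale tensor_pair = pair_ring A B + R: cring R
  for A :: "('a, 'x) ring_scheme" and B :: "('b, 'y) ring_scheme" and R :: "('r, 'z) ring_scheme" +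
  fixes \<phi> :: "'r \<Rightarrow> 'a" and \<psi> :: "'r \<Rightarrow> 'b"
  assumes phi: "\<phi> \<in> ring_hom R A" and psi: "\<psi> \<in> ring_hom R B"
begin

abbreviation "J \<equiv> tensor_ideal R A \<phi> B \<psi>"

lemma relations_carrier: "tensor_relations R A \<phi> B \<psi> \<subseteq> carrier P"
proof
  fix p assume "p \<in> tensor_relations R A \<phi> B \<psi>"
  then show "p \<in> carrier P"
    unfolding tensor_relations_def
    using ring_hom_closed[OF phi] ring_hom_closed[OF psi]
    by (elim UnE CollectE exE conjE; hypsubst; intro diff_carrier frag_of_carrier)
      (simp_all add: A.m_closed B.m_closed)
qed

lemma J_ideal: "ideal J P"
  unfolding tensor_ideal_def by (rule P.genideal_ideal[OF relations_carrier])

sublocale J: ideal J P by (rule J_ideal)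

lemma J_rel: "p \<in> tensor_relations R A \<phi> B \<psi> \<Longrightarrow> p \<in> J"
  unfolding tensor_ideal_def using P.genideal_self[OF relations_carrier] by blast

lemma J_add: "p \<in> J \<Longrightarrow> q \<in> J \<Longrightarrow> p + q \<in> J"
  using J.a_closed[of p q] by simp

lemma J_uminus: "p \<in> J \<Longrightarrow> - p \<in> J"
  using J.a_inv_closed[of p] P_uminus[OF J.Icarr] by metis

lemma J_diff: "p \<in> J \<Longrightarrow> q \<in> J \<Longrightarrow> p - q \<in> J"
  using J_add[of p "- q"] J_uminus[of q] by simp

lemma J_zero: "0 \<in> J"
  using J.zero_closed by simp

lemma J_add_left:
  "a \<in> carrier A \<Longrightarrow> a' \<in> carrier A \<Longrightarrow> b \<in> carrier B \<Longrightarrow>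
    frag_of (a \<oplus>\<^bsub>A\<^esub> a', b) - frag_of (a, b) - frag_of (a', b) \<in> J"
  by (rule J_rel) (auto simp: tensor_relations_def)

lemma J_add_right:
  "a \<in> carrier A \<Longrightarrow> b \<in> carrier B \<Longrightarrow> b' \<in> carrier B \<Longrightarrow>
    frag_of (a, b \<oplus>\<^bsub>B\<^esub> b') - frag_of (a, b) - frag_of (a, b') \<in> J"
  by (rule J_rel) (auto simp: tensor_relations_def)

lemma J_balanced:
  "r \<in> carrier R \<Longrightarrow> a \<in> carrier A \<Longrightarrow> b \<in> carrier B \<Longrightarrow>
    frag_of (\<phi> r \<otimes>\<^bsub>A\<^esub> a, b) - frag_of (a, \<psi> r \<otimes>\<^bsub>B\<^esub> b) \<in> J"
  by (rule J_rel) (auto simp: tensor_relations_def)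

text \<open>The additivity relation with both summands zero is, up to sign, the symbol in
  question.\<close>

lemma J_null:
  "b \<in> carrier B \<Longrightarrow> frag_of (\<zero>\<^bsub>A\<^esub>, b) \<in> J"
  "a \<in> carrier A \<Longrightarrow> frag_of (a, \<zero>\<^bsub>B\<^esub>) \<in> J"
  using J_uminus[OF J_add_left[of "\<zero>\<^bsub>A\<^esub>" "\<zero>\<^bsub>A\<^esub>" b]] J_uminus[OF J_add_right[of a "\<zero>\<^bsub>B\<^esub>" "\<zero>\<^bsub>B\<^esub>"]]
  by simp_all

lemma J_diff_left:
  assumes "a \<in> carrier A" "a' \<in> carrier A" "b \<in> carrier B"
  shows "frag_of (a, b) - frag_of (a', b) - frag_of (a \<ominus>\<^bsub>A\<^esub> a', b) \<in> J"
proof -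
  have "a \<ominus>\<^bsub>A\<^esub> a' \<oplus>\<^bsub>A\<^esub> a' = a" using assms by (simp add: a_minus_def A.a_assoc A.l_neg)
  with J_add_left[of "a \<ominus>\<^bsub>A\<^esub> a'" a' b] assms show ?thesis by (simp add: algebra_simps)
qed

lemma J_finsum_right:
  assumes "finite S" "a \<in> carrier A" "\<And>s. s \<in> S \<Longrightarrow> f s \<in> carrier B"
  shows "frag_of (a, finsum B f S) - (\<Sum>s\<in>S. frag_of (a, f s)) \<in> J"
  using assms(1,3)
proof (induction S rule: finite_induct)
  case empty
  then show ?case using J_null(2)[OF assms(2)] by simp
next
  case (insert s S)
  then have c: "f s \<in> carrier B" "f \<in> S \<rightarrow> carrier B" by auto
  have "frag_of (a, f s \<oplus>\<^bsub>B\<^esub> finsum B f S) - frag_of (a, f s) - frag_of (a, finsum B f S) \<in> J"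
    by (rule J_add_right[OF assms(2) c(1) B.finsum_closed[OF c(2)]])
  moreover have "frag_of (a, finsum B f S) - (\<Sum>s\<in>S. frag_of (a, f s)) \<in> J"
    using insert by simp
  ultimately have "frag_of (a, f s \<oplus>\<^bsub>B\<^esub> finsum B f S) - frag_of (a, f s) - frag_of (a, finsum B f S) +
      (frag_of (a, finsum B f S) - (\<Sum>s\<in>S. frag_of (a, f s))) \<in> J"
    by (rule J_add)
  then show ?case using insert c by (simp add: B.finsum_insert algebra_simps)
qed

text \<open>The first isomorphism theorem with kernel \<open>J\<close>. The homomorphism becomes
  available only inside the proof, so \<open>surj\<close> and \<open>inj\<close> are demanded of
  every homomorphism with the prescribed values on symbols.\<close>

lemma tensor_ring_iso:
  assumes "cring T" and f: "f \<in> ring_hom A T" and g: "g \<in> ring_hom B T"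
    and fg: "\<And>r. r \<in> carrier R \<Longrightarrow> f (\<phi> r) = g (\<psi> r)"
    and surj: "\<And>h. h \<in> ring_hom P T \<Longrightarrow>
      (\<And>a b. a \<in> carrier A \<Longrightarrow> b \<in> carrier B \<Longrightarrow> h (frag_of (a, b)) = f a \<otimes>\<^bsub>T\<^esub> g b) \<Longrightarrow>
      carrier T \<subseteq> h ` carrier P"
    and inj: "\<And>h p. h \<in> ring_hom P T \<Longrightarrow>
      (\<And>a b. a \<in> carrier A \<Longrightarrow> b \<in> carrier B \<Longrightarrow> h (frag_of (a, b)) = f a \<otimes>\<^bsub>T\<^esub> g b) \<Longrightarrow>
      (\<And>p q. p \<in> carrier P \<Longrightarrow> q \<in> carrier P \<Longrightarrow> h (p - q) = h p \<ominus>\<^bsub>T\<^esub> h q) \<Longrightarrow>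
      (\<And>p. p \<in> J \<Longrightarrow> h p = \<zero>\<^bsub>T\<^esub>) \<Longrightarrow>
      p \<in> carrier P \<Longrightarrow> h p = \<zero>\<^bsub>T\<^esub> \<Longrightarrow> p \<in> J"
  shows "\<exists>h \<in> ring_iso (tensor_ring R A \<phi> B \<psi>) T. \<forall>a\<in>carrier A. \<forall>b\<in>carrier B.
    h (pure_tensor R A \<phi> B \<psi> a b) = f a \<otimes>\<^bsub>T\<^esub> g b"
proof -
  interpret T: cring T by fact
  interpret f: ring_hom_cring A T f by unfold_locales (rule f)
  interpret g: ring_hom_cring B T g by unfold_locales (rule g)
  obtain h where h: "h \<in> ring_hom P T"
    "\<And>a b. a \<in> carrier A \<Longrightarrow> b \<in> carrier B \<Longrightarrow> h (frag_of (a, b)) = f a \<otimes>\<^bsub>T\<^esub> g b"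
    "\<And>p q. p \<in> carrier P \<Longrightarrow> q \<in> carrier P \<Longrightarrow> h (p - q) = h p \<ominus>\<^bsub>T\<^esub> h q"
    using tensor_lift[OF \<open>cring T\<close> f g] by blast
  interpret h: ring_hom_ring P T h by (rule ring_hom_ringI2[OF P.ring_axioms T.ring_axioms h(1)])
  have ker: "ideal (a_kernel P T h) P" by (rule h.kernel_is_ideal)
  have \<phi>c: "\<phi> r \<in> carrier A" and \<psi>c: "\<psi> r \<in> carrier B" if "r \<in> carrier R" for r
    using that ring_hom_closed[OF phi] ring_hom_closed[OF psi] by auto
  have rel: "h p = \<zero>\<^bsub>T\<^esub>" if p: "p \<in> tensor_relations R A \<phi> B \<psi>" for p
  proof -
    note d = h(3)[OF diff_carrier[OF frag_of_carrier frag_of_carrier] frag_of_carrier]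
      h(3)[OF frag_of_carrier frag_of_carrier]
    from p consider
      (1) a a' b where "p = frag_of (a \<oplus>\<^bsub>A\<^esub> a', b) - frag_of (a, b) - frag_of (a', b)"
        "a \<in> carrier A" "a' \<in> carrier A" "b \<in> carrier B"
    | (2) a b b' where "p = frag_of (a, b \<oplus>\<^bsub>B\<^esub> b') - frag_of (a, b) - frag_of (a, b')"
        "a \<in> carrier A" "b \<in> carrier B" "b' \<in> carrier B"
    | (3) r a b where "p = frag_of (\<phi> r \<otimes>\<^bsub>A\<^esub> a, b) - frag_of (a, \<psi> r \<otimes>\<^bsub>B\<^esub> b)"
        "r \<in> carrier R" "a \<in> carrier A" "b \<in> carrier B"
      unfolding tensor_relations_def by blast
    then show ?thesis
    proof cases
      case 1
      have "f a \<otimes>\<^bsub>T\<^esub> g b \<oplus>\<^bsub>T\<^esub> f a' \<otimes>\<^bsub>T\<^esub> g b \<ominus>\<^bsub>T\<^esub> f a \<otimes>\<^bsub>T\<^esub> g b \<ominus>\<^bsub>T\<^esub> f a' \<otimes>\<^bsub>T\<^esub> g b = \<zero>\<^bsub>T\<^esub>"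
        using 1 f.hom_closed g.hom_closed
        by (simp add: a_minus_def T.a_assoc T.a_comm[of "f a' \<otimes>\<^bsub>T\<^esub> g b"] T.r_neg1 T.r_neg2 T.r_neg)
      with 1 show ?thesis by (simp add: d h(2) T.l_distr)
    next
      case 2
      have "f a \<otimes>\<^bsub>T\<^esub> g b \<oplus>\<^bsub>T\<^esub> f a \<otimes>\<^bsub>T\<^esub> g b' \<ominus>\<^bsub>T\<^esub> f a \<otimes>\<^bsub>T\<^esub> g b \<ominus>\<^bsub>T\<^esub> f a \<otimes>\<^bsub>T\<^esub> g b' = \<zero>\<^bsub>T\<^esub>"
        using 2 f.hom_closed g.hom_closed
        by (simp add: a_minus_def T.a_assoc T.a_comm[of "f a \<otimes>\<^bsub>T\<^esub> g b'"] T.r_neg1 T.r_neg2 T.r_neg)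
      with 2 show ?thesis by (simp add: d h(2) T.r_distr)
    next
      case 3
      have "f (\<phi> r) \<otimes>\<^bsub>T\<^esub> f a \<otimes>\<^bsub>T\<^esub> g b = f a \<otimes>\<^bsub>T\<^esub> (g (\<psi> r) \<otimes>\<^bsub>T\<^esub> g b)"
        using 3 \<psi>c[of r] by (simp add: fg T.m_ac)
      with 3 show ?thesis using \<phi>c[of r] \<psi>c[of r]
        by (simp add: d h(2) a_minus_def T.r_neg)
    qed
  qed
  have "tensor_relations R A \<phi> B \<psi> \<subseteq> a_kernel P T h"
    using relations_carrier rel unfolding a_kernel_def' by blast
  then have JK: "J \<subseteq> a_kernel P T h" unfolding tensor_ideal_def by (rule P.genideal_minimal[OF ker])
  then have hJ: "h p = \<zero>\<^bsub>T\<^esub>" if "p \<in> J" for p using that unfolding a_kernel_def' by blast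
  have "a_kernel P T h \<subseteq> J" unfolding a_kernel_def' using inj[OF h(1,2,3) hJ] by blast
  with JK have K: "a_kernel P T h = J" by blast
  have "h ` carrier P = carrier T"
    using surj[OF h(1,2)] h.hom_closed by (intro equalityI image_subsetI)
  from h.FactRing_iso_set[OF this] have iso: "(\<lambda>Z. the_elem (h ` Z)) \<in> ring_iso (tensor_ring R A \<phi> B \<psi>) T"
    by (simp add: K tensor_ring_def)
  have "the_elem (h ` (pure_tensor R A \<phi> B \<psi> a b)) = f a \<otimes>\<^bsub>T\<^esub> g b"
    if "a \<in> carrier A" "b \<in> carrier B" for a b
    using h.the_elem_simp[OF frag_of_carrier[OF that]] h(2)[OF that] by (simp add: K pure_tensor_def)
  with iso show ?thesis by (intro bexI[of _ "\<lambda>Z. the_elem (h ` Z)"]) auto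
qed

end

section \<open>The torsor and its identification with the orbit\<close>

context graded_fibre begin

lemma supported_in_ga_supported:
  assumes "\<Gamma> \<subseteq> carrier \<Lambda>" "a \<in> supported \<Gamma>"
  shows "\<rho> a \<in> ga_supported \<Lambda> \<Gamma> A"
  using assms rho_GA by (auto simp: supported_def ga_supported_def)

text \<open>If all degrees are unit degrees, \<open>A \<otimes> A\<close> is free over \<open>A \<otimes> 1\<close> on the elements \<open>1 \<otimes> u\<^sub>l\<close>, where
  \<open>u\<^sub>l\<close> is a unit of degree \<open>l\<close>, and \<open>a \<otimes> b \<mapsto> a \<rho>(b)\<close> sends \<open>1 \<otimes> u\<^sub>l\<close> to a unit multiple of \<open>l\<close>.\<close>

lemma torsor_iso:
  assumes full: "supported unit_degrees = carrier A"
  defines "T \<equiv> GA\<lparr>carrier := ga_supported \<Lambda> unit_degrees A\<rparr>"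
  shows "\<exists>h \<in> ring_iso (tensor_ring K A \<phi> A \<phi>) T. \<forall>a\<in>carrier A. \<forall>b\<in>carrier A.
    h (pure_tensor K A \<phi> A \<phi> a b) = ga_const \<Lambda> A a \<otimes>\<^bsub>GA\<^esub> \<rho> b"
proof -
  let ?\<Gamma> = "unit_degrees"
  interpret tp: tensor_pair A A K \<phi> \<phi> by unfold_locales (rule phi_hom)+
  have \<Gamma>sub: "?\<Gamma> \<subseteq> carrier \<Lambda>" using unit_degrees_carrier by blast
  have fin\<Gamma>: "finite ?\<Gamma>" by (rule finite_subset[OF \<Gamma>sub L.fin])
  have sr: "subring (ga_supported \<Lambda> ?\<Gamma> A) GA" by (rule ga_supported_subring[OF unit_degrees_subgroup])
  have Tc: "cring T" unfolding T_def by (rule G.subring_is_cring[OF sr])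
  interpret T: cring T by (rule Tc)
  have Tops: "\<zero>\<^bsub>T\<^esub> = \<zero>\<^bsub>GA\<^esub>" "x \<oplus>\<^bsub>T\<^esub> y = x \<oplus>\<^bsub>GA\<^esub> y" "x \<otimes>\<^bsub>T\<^esub> y = x \<otimes>\<^bsub>GA\<^esub> y" "\<one>\<^bsub>T\<^esub> = \<one>\<^bsub>GA\<^esub>" for x y
    by (simp_all add: T_def)
  have const_T: "ga_const \<Lambda> A a \<in> carrier T" if "a \<in> carrier A" for a
  proof -
    have "ga_const \<Lambda> A a l = \<zero>\<^bsub>A\<^esub>" if "l \<in> carrier \<Lambda> - ?\<Gamma>" for l
      using that subgroup.one_closed[OF unit_degrees_subgroup] by (auto simp: ga_const_def)
    with that show ?thesis by (simp add: T_def ga_supported_def)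
  qed
  have rho_T: "\<rho> a \<in> carrier T" if "a \<in> carrier A" for a
    using supported_in_ga_supported[OF \<Gamma>sub, of a] that full by (simp add: T_def)
  have f: "ga_const \<Lambda> A \<in> ring_hom A T"
    using ga_const_hom const_T by (auto simp: ring_hom_def Tops)
  have g: "\<rho> \<in> ring_hom A T"
    using rho_hom rho_T by (auto simp: ring_hom_def Tops)
  \<comment> \<open>By \<open>full\<close> only unit degrees occur, and each component is a scalar
    times the chosen unit: the elements \<open>hunit l\<close> span the algebra over
    \<open>K\<close>.\<close>
  have expand: "\<exists>r\<in>?\<Gamma> \<rightarrow> carrier K. b = finsum A (\<lambda>l. \<phi> (r l) \<otimes>\<^bsub>A\<^esub> hunit l) ?\<Gamma>" if b: "b \<in> carrier A" for b
  proof -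
    have "\<forall>l\<in>?\<Gamma>. \<exists>r\<in>carrier K. \<rho> b l = \<phi> r \<otimes>\<^bsub>A\<^esub> hunit l"
      using homog_unit_degree rho_homog[OF b unit_degrees_carrier] by blast
    then obtain r where r: "\<forall>l\<in>?\<Gamma>. r l \<in> carrier K \<and> \<rho> b l = \<phi> (r l) \<otimes>\<^bsub>A\<^esub> hunit l" by metis
    have "b = finsum A (\<rho> b) (carrier \<Lambda>)" using rho_sum[OF b] by simp
    also have "\<dots> = finsum A (\<rho> b) ?\<Gamma>"
    proof (rule R.add.finprod_mono_neutral_cong_right[OF L.fin \<Gamma>sub])
      fix l assume "l \<in> carrier \<Lambda> - ?\<Gamma>"
      then show "\<rho> b l = \<zero>\<^bsub>A\<^esub>" using b full unfolding supported_def by blast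
    qed (use b in auto)
    also have "\<dots> = finsum A (\<lambda>l. \<phi> (r l) \<otimes>\<^bsub>A\<^esub> hunit l) ?\<Gamma>"
      using r by (intro R.finsum_cong') auto
    finally show ?thesis using r by (intro bexI[of _ r]) auto
  qed
  \<comment> \<open>The tensor of \<open>c l\<close> with the unit of degree \<open>l\<close> goes
    to \<open>c l\<close> times that unit, placed at the character \<open>l\<close>.\<close>
  have hsum: "h (\<Sum>l\<in>S. frag_of (c l, hunit l)) = finsum GA (\<lambda>l. ga_monom \<Lambda> A l (c l \<otimes>\<^bsub>A\<^esub> hunit l)) S"
    if h: "h \<in> ring_hom tp.P T"
      "\<And>a b. a \<in> carrier A \<Longrightarrow> b \<in> carrier A \<Longrightarrow> h (frag_of (a, b)) = ga_const \<Lambda> A a \<otimes>\<^bsub>T\<^esub> \<rho> b"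
      and S: "finite S" "S \<subseteq> ?\<Gamma>" and c: "\<And>l. l \<in> ?\<Gamma> \<Longrightarrow> c l \<in> carrier A" for h S c
  proof -
    interpret h: ring_hom_ring tp.P T h by (rule ring_hom_ringI2[OF tp.P.ring_axioms T.ring_axioms h(1)])
    show ?thesis using S
    proof (induction S rule: finite_induct)
      case empty
      then show ?case using h.hom_zero by (simp add: Tops)
    next
      case (insert l S)
      then have l: "l \<in> ?\<Gamma>" and S: "S \<subseteq> ?\<Gamma>" by auto
      have lc: "l \<in> carrier \<Lambda>" by (rule unit_degrees_carrier[OF l])
      have sumc: "(\<Sum>l\<in>S. frag_of (c l, hunit l)) \<in> carrier tp.P"
        using S c by (intro tp.sum_carrier tp.frag_of_carrier) auto
      have lcar: "frag_of (c l, hunit l) \<in> carrier tp.P" using c l by simp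
      have "h (frag_of (c l, hunit l)) = ga_monom \<Lambda> A l (c l \<otimes>\<^bsub>A\<^esub> hunit l)"
        using h(2)[OF c[OF l] hunit_closed[OF l]] hunit(2)[OF l] c[OF l] l lc
        by (simp add: Tops homog_def ga_const_monom ga_monom_split)
      moreover have "h (frag_of (c l, hunit l) + (\<Sum>l\<in>S. frag_of (c l, hunit l))) =
        h (frag_of (c l, hunit l)) \<oplus>\<^bsub>GA\<^esub> h (\<Sum>l\<in>S. frag_of (c l, hunit l))"
        using h.hom_add[OF lcar sumc] by (simp add: Tops)
      moreover have "(\<lambda>l. ga_monom \<Lambda> A l (c l \<otimes>\<^bsub>A\<^esub> hunit l)) \<in> S \<rightarrow> carrier GA"
        "ga_monom \<Lambda> A l (c l \<otimes>\<^bsub>A\<^esub> hunit l) \<in> carrier GA" using S c l by auto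
      ultimately show ?case using insert by (simp add: G.finsum_insert)
    qed
  qed
  have "\<exists>h \<in> ring_iso (tensor_ring K A \<phi> A \<phi>) T. \<forall>a\<in>carrier A. \<forall>b\<in>carrier A.
      h (pure_tensor K A \<phi> A \<phi> a b) = ga_const \<Lambda> A a \<otimes>\<^bsub>T\<^esub> \<rho> b"
  proof (rule tp.tensor_ring_iso[OF Tc f g])
    show "ga_const \<Lambda> A (\<phi> r) = \<rho> (\<phi> r)" if "r \<in> carrier K" for r using rho_phi[OF that] by simp
  next
    fix h assume h: "h \<in> ring_hom tp.P T"
      "\<And>a b. a \<in> carrier A \<Longrightarrow> b \<in> carrier A \<Longrightarrow> h (frag_of (a, b)) = ga_const \<Lambda> A a \<otimes>\<^bsub>T\<^esub> \<rho> b"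
    show "carrier T \<subseteq> h ` carrier tp.P"
    proof
      fix F assume "F \<in> carrier T"
      then have F: "F \<in> carrier GA" "\<And>l. l \<in> carrier \<Lambda> - ?\<Gamma> \<Longrightarrow> F l = \<zero>\<^bsub>A\<^esub>"
        by (simp_all add: T_def ga_supported_def)
      \<comment> \<open>Dividing the coefficients of \<open>F\<close> by the chosen units gives a
        preimage.\<close>
      let ?c = "\<lambda>l. F l \<otimes>\<^bsub>A\<^esub> inv\<^bsub>A\<^esub> hunit l"
      have Fl: "F l \<in> carrier A" if "l \<in> ?\<Gamma>" for l using ga_memD[OF F(1)] \<Gamma>sub that by blast
      have c: "?c l \<in> carrier A" if "l \<in> ?\<Gamma>" for l using Fl[OF that] hunit(1)[OF that] by simp
      have mon: "(\<lambda>l. ga_monom \<Lambda> A l (F l)) \<in> carrier \<Lambda> \<rightarrow> carrier GA" using ga_memD[OF F(1)] by simp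
      have z: "ga_monom \<Lambda> A l \<zero>\<^bsub>A\<^esub> = \<zero>\<^bsub>GA\<^esub>" for l
        by (auto simp: ga_monom_def ga_zero intro!: restrict_ext)
      have "h (\<Sum>l\<in>?\<Gamma>. frag_of (?c l, hunit l)) = finsum GA (\<lambda>l. ga_monom \<Lambda> A l (?c l \<otimes>\<^bsub>A\<^esub> hunit l)) ?\<Gamma>"
        by (rule hsum[OF h fin\<Gamma> order_refl c])
      also have "\<dots> = finsum GA (\<lambda>l. ga_monom \<Lambda> A l (F l)) (carrier \<Lambda>)"
      proof (rule G.add.finprod_mono_neutral_cong_left[OF L.fin \<Gamma>sub])
        show "ga_monom \<Lambda> A l (F l) = \<zero>\<^bsub>GA\<^esub>" if "l \<in> carrier \<Lambda> - ?\<Gamma>" for l using F(2)[OF that] z by simp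
        show "ga_monom \<Lambda> A l (?c l \<otimes>\<^bsub>A\<^esub> hunit l) = ga_monom \<Lambda> A l (F l)" if "l \<in> ?\<Gamma>" for l
          using Fl[OF that] hunit(1)[OF that] that by (simp add: R.m_assoc)
      qed (use mon in simp)
      also have "\<dots> = F" by (rule ga_expand[OF F(1), symmetric])
      finally have "F = h (\<Sum>l\<in>?\<Gamma>. frag_of (?c l, hunit l))" ..
      moreover have "(\<Sum>l\<in>?\<Gamma>. frag_of (?c l, hunit l)) \<in> carrier tp.P"
        using c by (intro tp.sum_carrier tp.frag_of_carrier) auto
      ultimately show "F \<in> h ` carrier tp.P" by blast
    qed
  next
    fix h p assume h: "h \<in> ring_hom tp.P T"
      "\<And>a b. a \<in> carrier A \<Longrightarrow> b \<in> carrier A \<Longrightarrow> h (frag_of (a, b)) = ga_const \<Lambda> A a \<otimes>\<^bsub>T\<^esub> \<rho> b"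
      and hdiff: "\<And>p q. p \<in> carrier tp.P \<Longrightarrow> q \<in> carrier tp.P \<Longrightarrow> h (p - q) = h p \<ominus>\<^bsub>T\<^esub> h q"
      and hJ: "\<And>p. p \<in> tp.J \<Longrightarrow> h p = \<zero>\<^bsub>T\<^esub>"
      and p: "p \<in> carrier tp.P" and hp: "h p = \<zero>\<^bsub>T\<^esub>"
    \<comment> \<open>Moving scalars across the tensor sign brings every element, modulo
      \<open>J\<close>, to a normal form whose second factors are the elements
      \<open>hunit l\<close>.\<close>
    have "\<exists>c. (\<forall>l\<in>?\<Gamma>. c l \<in> carrier A) \<and> p - (\<Sum>l\<in>?\<Gamma>. frag_of (c l, hunit l)) \<in> tp.J"
      using p
    proof (induction p rule: tp.P_induct)
      case zero
      have "(\<Sum>l\<in>S. frag_of (\<zero>\<^bsub>A\<^esub>, hunit l)) \<in> tp.J" if "finite S" "S \<subseteq> ?\<Gamma>" for S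
        using that
      proof (induction S rule: finite_induct)
        case (insert l S)
        then show ?case using tp.J_add[OF tp.J_null(1)[of "hunit l"]] by simp
      qed (simp add: tp.J_zero)
      from tp.J_uminus[OF this[OF fin\<Gamma> order_refl]] show ?case by (intro exI[of _ "\<lambda>_. \<zero>\<^bsub>A\<^esub>"]) simp
    next
      case (one a b)
      obtain r where r: "r \<in> ?\<Gamma> \<rightarrow> carrier K" "b = finsum A (\<lambda>l. \<phi> (r l) \<otimes>\<^bsub>A\<^esub> hunit l) ?\<Gamma>"
        using expand[OF one(2)] by blast
      have rc: "r l \<in> carrier K" if "l \<in> ?\<Gamma>" for l using r(1) that by blast
      have 1: "frag_of (a, b) - (\<Sum>l\<in>?\<Gamma>. frag_of (a, \<phi> (r l) \<otimes>\<^bsub>A\<^esub> hunit l)) \<in> tp.J"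
        unfolding r(2) by (rule tp.J_finsum_right[OF fin\<Gamma> one(1)]) (simp add: rc)
      have 2: "(\<Sum>l\<in>S. frag_of (a, \<phi> (r l) \<otimes>\<^bsub>A\<^esub> hunit l)) - (\<Sum>l\<in>S. frag_of (\<phi> (r l) \<otimes>\<^bsub>A\<^esub> a, hunit l)) \<in> tp.J"
        if "finite S" "S \<subseteq> ?\<Gamma>" for S
        using that
      proof (induction S rule: finite_induct)
        case (insert l S)
        then have l: "l \<in> ?\<Gamma>" by simp
        have "- (frag_of (\<phi> (r l) \<otimes>\<^bsub>A\<^esub> a, hunit l) - frag_of (a, \<phi> (r l) \<otimes>\<^bsub>A\<^esub> hunit l)) \<in> tp.J"
          by (rule tp.J_uminus[OF tp.J_balanced[OF rc[OF l] one(1) hunit_closed[OF l]]])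
        from tp.J_add[OF this insert.IH] insert show ?case by (simp add: algebra_simps)
      qed (simp add: tp.J_zero)
      from tp.J_add[OF 1 2[OF fin\<Gamma> order_refl]]
      have "frag_of (a, b) - (\<Sum>l\<in>?\<Gamma>. frag_of (\<phi> (r l) \<otimes>\<^bsub>A\<^esub> a, hunit l)) \<in> tp.J" by simp
      then show ?case using rc one(1) by (intro exI[of _ "\<lambda>l. \<phi> (r l) \<otimes>\<^bsub>A\<^esub> a"]) simp
    next
      case (diff p q)
      then obtain c d where c: "\<And>l. l \<in> ?\<Gamma> \<Longrightarrow> c l \<in> carrier A" "p - (\<Sum>l\<in>?\<Gamma>. frag_of (c l, hunit l)) \<in> tp.J"
        and d: "\<And>l. l \<in> ?\<Gamma> \<Longrightarrow> d l \<in> carrier A" "q - (\<Sum>l\<in>?\<Gamma>. frag_of (d l, hunit l)) \<in> tp.J" by blast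
      have "(\<Sum>l\<in>S. frag_of (c l, hunit l)) - (\<Sum>l\<in>S. frag_of (d l, hunit l)) -
          (\<Sum>l\<in>S. frag_of (c l \<ominus>\<^bsub>A\<^esub> d l, hunit l)) \<in> tp.J" if "finite S" "S \<subseteq> ?\<Gamma>" for S
        using that
      proof (induction S rule: finite_induct)
        case (insert l S)
        then have l: "l \<in> ?\<Gamma>" by simp
        from tp.J_add[OF tp.J_diff_left[OF c(1)[OF l] d(1)[OF l] hunit_closed[OF l]] insert.IH] insert
        show ?case by (simp add: algebra_simps)
      qed (simp add: tp.J_zero)
      from tp.J_add[OF this[OF fin\<Gamma> order_refl] tp.J_diff[OF c(2) d(2)]]
      have "p - q - (\<Sum>l\<in>?\<Gamma>. frag_of (c l \<ominus>\<^bsub>A\<^esub> d l, hunit l)) \<in> tp.J"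
        by (simp add: algebra_simps)
      then show ?case using c(1) d(1) by (intro exI[of _ "\<lambda>l. c l \<ominus>\<^bsub>A\<^esub> d l"]) simp
    qed
    then obtain c where c: "\<And>l. l \<in> ?\<Gamma> \<Longrightarrow> c l \<in> carrier A" "p - (\<Sum>l\<in>?\<Gamma>. frag_of (c l, hunit l)) \<in> tp.J" by blast
    let ?s = "\<Sum>l\<in>?\<Gamma>. frag_of (c l, hunit l)"
    have sc: "?s \<in> carrier tp.P"
      using c(1) by (intro tp.sum_carrier tp.frag_of_carrier) auto
    interpret h: ring_hom_ring tp.P T h by (rule ring_hom_ringI2[OF tp.P.ring_axioms T.ring_axioms h(1)])
    have "\<zero>\<^bsub>T\<^esub> \<ominus>\<^bsub>T\<^esub> h ?s = \<zero>\<^bsub>T\<^esub>" using hdiff[OF p sc] hJ[OF c(2)] hp by simp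
    then have "h ?s = \<zero>\<^bsub>T\<^esub>" using h.hom_closed[OF sc] by (metis T.r_right_minus_eq T.zero_closed)
    then have z: "finsum GA (\<lambda>l. ga_monom \<Lambda> A l (c l \<otimes>\<^bsub>A\<^esub> hunit l)) ?\<Gamma> = \<zero>\<^bsub>GA\<^esub>"
      using hsum[OF h fin\<Gamma> order_refl, of c] c(1) by (simp add: Tops)
    have "c l = \<zero>\<^bsub>A\<^esub>" if l: "l \<in> ?\<Gamma>" for l
    proof -
      have lc: "l \<in> carrier \<Lambda>" by (rule unit_degrees_carrier[OF l])
      have cu: "c m \<otimes>\<^bsub>A\<^esub> hunit m \<in> carrier A" if "m \<in> ?\<Gamma>" for m using c(1)[OF that] that by simp
      have "\<zero>\<^bsub>A\<^esub> = finsum GA (\<lambda>l. ga_monom \<Lambda> A l (c l \<otimes>\<^bsub>A\<^esub> hunit l)) ?\<Gamma> l"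
        unfolding z using lc by (simp add: ga_zero)
      also have "\<dots> = finsum A (\<lambda>m. ga_monom \<Lambda> A m (c m \<otimes>\<^bsub>A\<^esub> hunit m) l) ?\<Gamma>"
        using lc cu by (intro ga_finsum[OF fin\<Gamma>]) auto
      also have "\<dots> = finsum A (\<lambda>m. if m = l then c m \<otimes>\<^bsub>A\<^esub> hunit m else \<zero>\<^bsub>A\<^esub>) ?\<Gamma>"
        using lc cu by (intro R.finsum_cong') (auto simp: ga_monom_def)
      also have "\<dots> = c l \<otimes>\<^bsub>A\<^esub> hunit l" using l cu[OF l] by (subst R.finsum_delta[OF fin\<Gamma>]) auto
      \<comment> \<open>The unit cancels, so a normal form that maps to zero has zero
        coefficients.\<close>
      finally have "c l \<otimes>\<^bsub>A\<^esub> hunit l \<otimes>\<^bsub>A\<^esub> inv\<^bsub>A\<^esub> hunit l = \<zero>\<^bsub>A\<^esub> \<otimes>\<^bsub>A\<^esub> inv\<^bsub>A\<^esub> hunit l"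
        by (simp only:)
      then show ?thesis using c(1)[OF l] hunit(1)[OF l] l by (simp add: R.m_assoc)
    qed
    then have "?s = (\<Sum>l\<in>?\<Gamma>. frag_of (\<zero>\<^bsub>A\<^esub>, hunit l))" by (intro sum.cong) auto
    moreover have "(\<Sum>l\<in>S. frag_of (\<zero>\<^bsub>A\<^esub>, hunit l)) \<in> tp.J" if "finite S" "S \<subseteq> ?\<Gamma>" for S
      using that
    proof (induction S rule: finite_induct)
      case (insert l S)
      then show ?case using tp.J_add[OF tp.J_null(1)[of "hunit l"]] by simp
    qed (simp add: tp.J_zero)
    ultimately have "?s \<in> tp.J" using fin\<Gamma> by simp
    from tp.J_add[OF c(2) this] show "p \<in> tp.J" by simp
  qed
  then show ?thesis by (simp add: Tops)
qed

lemma fin_gen_full: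
  assumes full: "supported unit_degrees = carrier A"
  shows "fin_gen_algebra K A \<phi>"
proof -
  let ?\<Gamma> = "unit_degrees" and ?H = "\<phi> ` carrier K \<union> hunit ` unit_degrees"
  have \<Gamma>sub: "?\<Gamma> \<subseteq> carrier \<Lambda>" using unit_degrees_carrier by blast
  have fin\<Gamma>: "finite ?\<Gamma>" by (rule finite_subset[OF \<Gamma>sub L.fin])
  have Hc: "?H \<subseteq> carrier A" using hunit_closed by auto
  have "b \<in> generate_ring A ?H" if b: "b \<in> carrier A" for b
  proof -
    have mem: "\<rho> b l \<in> generate_ring A ?H" if l: "l \<in> carrier \<Lambda>" for l
    proof (cases "l \<in> ?\<Gamma>")
      case True
      then obtain r where r: "r \<in> carrier K" "\<rho> b l = \<phi> r \<otimes>\<^bsub>A\<^esub> hunit l"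
        using homog_unit_degree rho_homog[OF b l] by blast
      show ?thesis unfolding r(2)
        by (intro generate_ring.eng_mult generate_ring.incl) (use r(1) True in auto)
    next
      case False
      then have "\<rho> b l = \<zero>\<^bsub>A\<^esub>" using b full l unfolding supported_def by blast
      then show ?thesis using R.zero_in_generate by simp
    qed
    have "finsum A (\<rho> b) S \<in> generate_ring A ?H" if "finite S" "S \<subseteq> carrier \<Lambda>" for S
      using that
    proof (induction S rule: finite_induct)
      case empty then show ?case using R.zero_in_generate by simp
    next
      case (insert l S)
      then have "\<rho> b \<in> S \<rightarrow> carrier A" "\<rho> b l \<in> carrier A" using b by auto
      with insert mem[of l] show ?case by (simp add: R.finsum_insert generate_ring.eng_add)
    qed
    from this[OF L.fin order_refl] show ?thesis using rho_sum[OF b] by simp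
  qed
  then have "generate_ring A ?H = carrier A" using R.generate_ring_incl[OF Hc] by blast
  then show ?thesis
    unfolding fin_gen_algebra_def using fin\<Gamma> Hc
    by (intro exI[of _ "hunit ` ?\<Gamma>"] conjI) simp_all
qed

lemma torsor_full:
  assumes full: "supported unit_degrees = carrier A"
  shows "is_torsor K \<Lambda> (ga_supported \<Lambda> unit_degrees K) A \<phi> \<rho>"
  unfolding is_torsor_def quotient_coaction_def
    extend_coords_supported[OF phi_hom B.cring_axioms unit_degrees_subgroup]
  using coaction one_neq_zero fin_gen_full[OF full] torsor_iso[OF full]
    supported_in_ga_supported unit_degrees_carrier full by blast

abbreviation "AH \<equiv> A\<lparr>carrier := supported unit_degrees\<rparr>"

lemma supported_graded_fibre: "graded_fibre \<Lambda> AH K \<phi> \<rho>"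
proof -
  note sr = supported_subring[OF unit_degrees_subgroup]
  interpret S: cring AH by (rule R.subring_is_cring[OF sr])
  interpret S: graded_algebra \<Lambda> AH K \<phi> \<rho>
    by unfold_locales (rule supported_coaction[OF unit_degrees_subgroup])
  show ?thesis
  proof unfold_locales
    have "ga_monom \<Lambda> AH l a = ga_monom \<Lambda> A l a" for l a unfolding ga_monom_def by (intro restrict_ext) simp
    then have "S.homog \<one>\<^bsub>\<Lambda>\<^esub> \<subseteq> homog \<one>\<^bsub>\<Lambda>\<^esub>"
      unfolding S.homog_def homog_def by (auto simp: supported_def)
    then show "S.homog \<one>\<^bsub>\<Lambda>\<^esub> \<subseteq> \<phi> ` carrier K" using degree_one by blast
    show "\<one>\<^bsub>AH\<^esub> \<noteq> \<zero>\<^bsub>AH\<^esub>" using one_neq_zero by simp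
  qed
qed

text \<open>The elements supported on unit degrees form a graded algebra with the same unit degrees
  and no components elsewhere, so \<open>torsor_full\<close> applies to it.\<close>

lemma supported_torsor: "is_torsor K \<Lambda> (ga_supported \<Lambda> unit_degrees K) AH \<phi> \<rho>"
proof -
  interpret S: graded_fibre \<Lambda> AH K \<phi> \<rho> by (rule supported_graded_fibre)
  have m: "ga_monom \<Lambda> AH l a = ga_monom \<Lambda> A l a" for l a unfolding ga_monom_def by (intro restrict_ext) simp
  have hs: "u \<in> supported unit_degrees" if "u \<in> homog l" "l \<in> unit_degrees" for u l
    using homogD[OF that(1)] that(2) by (auto simp: supported_def)
  have sh: "S.homog l = homog l \<inter> supported unit_degrees" for l
  proof -
    have "supported unit_degrees \<subseteq> carrier A" by (simp add: supported_def)
    then show ?thesis unfolding S.homog_def homog_def m by auto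
  qed
  have ud: "S.unit_degrees = unit_degrees"
  proof
    show "S.unit_degrees \<subseteq> unit_degrees"
    proof
      fix l assume "l \<in> S.unit_degrees"
      then obtain u where u: "l \<in> carrier \<Lambda>" "u \<in> Units AH" "u \<in> homog l" by (auto simp: S.unit_degrees_def sh)
      then have "u \<in> Units A" by (auto simp: Units_def supported_def)
      with u show "l \<in> unit_degrees" by (auto simp: unit_degrees_def)
    qed
    show "unit_degrees \<subseteq> S.unit_degrees"
    proof
      fix l assume l: "l \<in> unit_degrees"
      have lc: "l \<in> carrier \<Lambda>" by (rule unit_degrees_carrier[OF l])
      note u = hunit[OF l]
      have il: "inv\<^bsub>\<Lambda>\<^esub> l \<in> unit_degrees" by (rule subgroup.m_inv_closed[OF unit_degrees_subgroup l])
      have us: "hunit l \<in> supported unit_degrees" by (rule hs[OF u(2) l])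
      \<comment> \<open>A unit remains one in the subalgebra only if its inverse belongs to it; the
        degree of the inverse is again a unit degree.\<close>
      have vs: "inv\<^bsub>A\<^esub> hunit l \<in> supported unit_degrees" by (rule hs[OF homog_inv[OF u(2,1) lc] il])
      have "hunit l \<in> Units AH"
        unfolding Units_def using us vs u(1) by (auto intro!: bexI[of _ "inv\<^bsub>A\<^esub> hunit l"])
      with lc u(2) us show "l \<in> S.unit_degrees" by (auto simp: S.unit_degrees_def sh)
    qed
  qed
  have "S.supported S.unit_degrees = carrier AH"
    unfolding S.supported_def ud by (auto simp: supported_def)
  from S.torsor_full[OF this] show ?thesis by (simp only: ud)
qed

lemma nonunit_component:
  assumes "a \<in> carrier A" "l \<in> carrier \<Lambda>" "l \<notin> unit_degrees"
  shows "\<rho> a l \<in> nonunit_ideal"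
  using assms unit_degrees_carrier by (auto simp: nonunit_ideal_def rho_rho)

text \<open>The algebra is the direct sum of its supported part and the ideal, so reduction modulo
  the ideal is bijective on the supported part, and it respects components. The isomorphism asked
  for is its inverse.\<close>

lemma supported_equivariant_iso:
  "equivariantly_isomorphic K \<Lambda> (ga_supported \<Lambda> unit_degrees K) AH \<phi> \<rho>
     (A Quot nonunit_ideal) (\<lambda>r. a_r_coset A nonunit_ideal (\<phi> r)) (factor_coaction \<Lambda> A \<rho> nonunit_ideal)"
proof -
  let ?J = "nonunit_ideal" and ?\<Gamma> = "unit_degrees"
  let ?Q = "A Quot ?J" and ?\<pi> = "a_r_coset A ?J"
  interpret J: ideal ?J A using nonunit_ideal by (simp add: graded_ideal_def)
  interpret Q: cring ?Q by (rule J.quotient_is_cring[OF R.cring_axioms])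
  interpret Q: graded_algebra \<Lambda> ?Q K "\<lambda>r. ?\<pi> (\<phi> r)" "factor_coaction \<Lambda> A \<rho> ?J"
    by unfold_locales (rule factor_is_coaction[OF nonunit_ideal])
  interpret S: graded_fibre \<Lambda> AH K \<phi> \<rho> by (rule supported_graded_fibre)
  interpret \<pi>: ring_hom_cring A ?Q ?\<pi> by (rule J.rcos_ring_hom_cring[OF R.cring_axioms])
  note sr = subringE[OF supported_subring[OF unit_degrees_subgroup]]
  have q1: "quotient_coaction K \<Lambda> (ga_supported \<Lambda> ?\<Gamma> K) AH \<phi> \<rho>"
    using supported_torsor by (simp add: is_torsor_def)
  have "factor_coaction \<Lambda> A \<rho> ?J c \<in> ga_supported \<Lambda> ?\<Gamma> ?Q" if c: "c \<in> carrier ?Q" for c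
  proof -
    obtain a where a: "a \<in> carrier A" "c = ?\<pi> a" using c by (auto simp: J.Quot_carrier)
    have "factor_coaction \<Lambda> A \<rho> ?J c l = \<zero>\<^bsub>?Q\<^esub>" if l: "l \<in> carrier \<Lambda> - ?\<Gamma>" for l
    proof -
      have "?\<pi> (\<rho> a l) = ?J"
        by (rule iffD2[OF J.coset_eq_self_iff]) (use l a(1) nonunit_component in auto)
      then show ?thesis
        unfolding a(2) factor_coaction_coset[OF nonunit_ideal a(1)] J.Quot_zero ga_map_def using l by simp
    qed
    with Q.rho_GA[OF c] show ?thesis by (simp add: ga_supported_def)
  qed
  then have q2: "quotient_coaction K \<Lambda> (ga_supported \<Lambda> ?\<Gamma> K) ?Q (\<lambda>r. ?\<pi> (\<phi> r)) (factor_coaction \<Lambda> A \<rho> ?J)"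
    unfolding quotient_coaction_def Q.extend_coords_supported[OF Q.phi_hom B.cring_axioms unit_degrees_subgroup]
    using Q.coaction by blast
  have sc: "a \<in> carrier A" if "a \<in> supported ?\<Gamma>" for a using that by (simp add: supported_def)
  have iso: "?\<pi> \<in> ring_iso AH ?Q"
  proof (rule ring_iso_memI)
    show "bij_betw ?\<pi> (carrier AH) (carrier ?Q)"
    proof (rule bij_betw_imageI)
      show "inj_on ?\<pi> (carrier AH)"
      proof (rule inj_onI)
        fix a b assume "a \<in> carrier AH" "b \<in> carrier AH" and eq: "?\<pi> a = ?\<pi> b"
        then have ab: "a \<in> supported ?\<Gamma>" "b \<in> supported ?\<Gamma>" by simp_all
        have "a \<ominus>\<^bsub>A\<^esub> b \<in> ?J" using eq ab sc by (simp add: J.coset_eq_iff)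
        moreover have "a \<ominus>\<^bsub>A\<^esub> b \<in> supported ?\<Gamma>" unfolding a_minus_def using ab sr(5,7) by blast
        ultimately have "a \<ominus>\<^bsub>A\<^esub> b = \<zero>\<^bsub>A\<^esub>" using supported_int_nonunit by blast
        then show "a = b" using ab sc by simp
      qed
      show "?\<pi> ` carrier AH = carrier ?Q"
      proof
        show "?\<pi> ` carrier AH \<subseteq> carrier ?Q" using sc by auto
        show "carrier ?Q \<subseteq> ?\<pi> ` carrier AH"
        proof
          fix c assume "c \<in> carrier ?Q"
          then obtain a where a: "a \<in> carrier A" "c = ?\<pi> a" by (auto simp: J.Quot_carrier)
          let ?d = "degree_part ?\<Gamma> a"
          have d: "?d \<in> supported ?\<Gamma>" "a \<ominus>\<^bsub>A\<^esub> ?d \<in> ?J" using decompose[OF a(1)] by auto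
          then have "c = ?\<pi> ?d" using a sc[OF d(1)] by (simp add: J.coset_eq_iff)
          with d(1) show "c \<in> ?\<pi> ` carrier AH" by simp
        qed
      qed
    qed
  qed (use sc in auto)
  let ?h = "inv_into (carrier AH) ?\<pi>"
  have h: "?h \<in> ring_iso ?Q AH" by (rule ring_iso_set_sym[OF S.R.ring_axioms iso])
  have bij: "bij_betw ?\<pi> (carrier AH) (carrier ?Q)" using iso by (simp add: ring_iso_def)
  have hp: "?h (?\<pi> a) = a" if "a \<in> supported ?\<Gamma>" for a
    using bij_betw_inv_into_left[OF bij, of a] that by simp
  have \<phi>S: "\<phi> r \<in> supported ?\<Gamma>" if "r \<in> carrier K" for r using S.phi_closed[OF that] by simp
  have "\<rho> (?h c) = ga_map \<Lambda> ?h (factor_coaction \<Lambda> A \<rho> ?J c)" if c: "c \<in> carrier ?Q" for c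
  proof -
    obtain a where a: "a \<in> supported ?\<Gamma>" "c = ?\<pi> a"
      using bij c unfolding bij_betw_def by auto
    have "ga_map \<Lambda> ?h (factor_coaction \<Lambda> A \<rho> ?J c) = (\<lambda>l\<in>carrier \<Lambda>. ?h (?\<pi> (\<rho> a l)))"
      unfolding a(2) factor_coaction_coset[OF nonunit_ideal sc[OF a(1)]] ga_map_def
      by (intro restrict_ext) simp
    also have "\<dots> = (\<lambda>l\<in>carrier \<Lambda>. \<rho> a l)"
      using S.rho_closed a(1) hp by (intro restrict_ext) simp
    also have "\<dots> = \<rho> a"
      using rho_GA[OF sc[OF a(1)]] by (intro ga_ext gaI) (auto simp: ga_memD[OF rho_GA[OF sc[OF a(1)]]])
    finally show ?thesis using hp[OF a(1)] a(2) by simp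
  qed
  with q1 q2 h hp[OF \<phi>S] show ?thesis unfolding equivariantly_isomorphic_def by blast
qed

text \<open>Over \<open>k\<close> every candidate is the subgroup scheme of some \<Gamma>; base
  change to \<open>K\<close> keeps \<Gamma>, and its invariants are the elements supported on
  \<Gamma>. Uniqueness thus becomes \<open>complement_unique\<close>, and the second claim expresses
  all data of an admissible \<open>H\<close> through the unit degrees.\<close>

theorem graded_fibre_structure:
  fixes k :: "('k, 'z) ring_scheme"
  assumes "field k" and \<kappa>: "\<kappa> \<in> ring_hom k K" and m: "primeideal \<mm> A"
    and full: "\<forall>l\<in>carrier \<Lambda>. homog l \<noteq> {\<zero>\<^bsub>A\<^esub>}"
  defines "inv\<^sub>H \<equiv> \<lambda>H. invariants \<Lambda> A \<phi> \<rho> (subgroup_base_change \<kappa> K \<Lambda> H)"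
  shows "(\<exists>!H. subgroup_scheme k \<Lambda> H \<and>
      inv\<^sub>H H \<inter> nonunit_ideal = {\<zero>\<^bsub>A\<^esub>} \<and> inv\<^sub>H H <+>\<^bsub>A\<^esub> nonunit_ideal = carrier A)"
    and "\<And>H. subgroup_scheme k \<Lambda> H \<Longrightarrow>
      inv\<^sub>H H \<inter> nonunit_ideal = {\<zero>\<^bsub>A\<^esub>} \<Longrightarrow> inv\<^sub>H H <+>\<^bsub>A\<^esub> nonunit_ideal = carrier A \<Longrightarrow>
      subgroup_base_change \<kappa> K \<Lambda> H = coset_sum_ideal \<Lambda> unit_degrees K \<and>
      inv\<^sub>H H = supported unit_degrees \<and>
      extend_coords \<Lambda> K \<kappa> (quotient_group_coords k \<Lambda> H) = ga_supported \<Lambda> unit_degrees K"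
proof -
  interpret k: field k by fact
  interpret kG: group_ring \<Lambda> k by unfold_locales
  interpret KG: group_ring \<Lambda> K by unfold_locales
  let ?\<Gamma> = "unit_degrees"
  have bc: "subgroup_base_change \<kappa> K \<Lambda> (coset_sum_ideal \<Lambda> \<Gamma> k) = coset_sum_ideal \<Lambda> \<Gamma> K"
    if "subgroup \<Gamma> \<Lambda>" for \<Gamma>
    unfolding subgroup_base_change_def by (rule KG.genideal_coset_sum[OF \<kappa> k.cring_axioms that])
  have inv: "inv\<^sub>H (coset_sum_ideal \<Lambda> \<Gamma> k) = supported \<Gamma>" if "subgroup \<Gamma> \<Lambda>" for \<Gamma>
    unfolding inv\<^sub>H_def bc[OF that] by (rule invariants_coset_sum[OF that])
  have unique: "H = coset_sum_ideal \<Lambda> ?\<Gamma> k"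
    if H: "subgroup_scheme k \<Lambda> H" "inv\<^sub>H H \<inter> nonunit_ideal = {\<zero>\<^bsub>A\<^esub>}" "inv\<^sub>H H <+>\<^bsub>A\<^esub> nonunit_ideal = carrier A" for H
  proof -
    obtain \<Gamma> where \<Gamma>: "subgroup \<Gamma> \<Lambda>" "H = coset_sum_ideal \<Lambda> \<Gamma> k"
      using kG.subgroup_scheme_imp_coset_sum[OF k.field_axioms H(1)] by blast
    have "\<Gamma> = ?\<Gamma>"
      by (rule complement_unique[OF bspec[OF full] \<Gamma>(1)]) (use H(2,3) in \<open>simp_all add: \<Gamma>(2) inv[OF \<Gamma>(1)]\<close>)
    with \<Gamma>(2) show ?thesis by simp
  qed
  note sg = unit_degrees_subgroup
  show "\<exists>!H. subgroup_scheme k \<Lambda> H \<and>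
      inv\<^sub>H H \<inter> nonunit_ideal = {\<zero>\<^bsub>A\<^esub>} \<and> inv\<^sub>H H <+>\<^bsub>A\<^esub> nonunit_ideal = carrier A"
  proof (rule ex1I[of _ "coset_sum_ideal \<Lambda> ?\<Gamma> k"])
    show "subgroup_scheme k \<Lambda> (coset_sum_ideal \<Lambda> ?\<Gamma> k) \<and>
        inv\<^sub>H (coset_sum_ideal \<Lambda> ?\<Gamma> k) \<inter> nonunit_ideal = {\<zero>\<^bsub>A\<^esub>} \<and>
        inv\<^sub>H (coset_sum_ideal \<Lambda> ?\<Gamma> k) <+>\<^bsub>A\<^esub> nonunit_ideal = carrier A"
      unfolding inv[OF sg]
      by (intro conjI kG.subgroup_scheme_coset_sum[OF sg] supported_int_nonunit supported_plus_nonunit)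
  qed (use unique in blast)
  fix H assume H: "subgroup_scheme k \<Lambda> H" "inv\<^sub>H H \<inter> nonunit_ideal = {\<zero>\<^bsub>A\<^esub>}"
    "inv\<^sub>H H <+>\<^bsub>A\<^esub> nonunit_ideal = carrier A"
  show "subgroup_base_change \<kappa> K \<Lambda> H = coset_sum_ideal \<Lambda> ?\<Gamma> K \<and> inv\<^sub>H H = supported ?\<Gamma> \<and>
      extend_coords \<Lambda> K \<kappa> (quotient_group_coords k \<Lambda> H) = ga_supported \<Lambda> ?\<Gamma> K"
    unfolding unique[OF H]
    using bc[OF sg] inv[OF sg] kG.quotient_group_coords_coset_sum[OF sg]
      KG.extend_coords_supported[OF \<kappa> k.cring_axioms sg] by simp
qed

end

text \<open>Nakayama's lemma in terms of generators: the relation of \<open>g s\<close> can be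
  solved for \<open>g s\<close> because 1 minus its own coefficient is a unit, and substituting the
  solution removes one generator.\<close>

lemma (in ring_hom_cring) nakayama:
  assumes n: "ideal \<nn> R" and unit: "\<And>c. c \<in> \<nn> \<Longrightarrow> \<one> \<ominus> c \<in> Units R"
    and "finite I" and "\<And>i. i \<in> I \<Longrightarrow> g i \<in> carrier S"
    and "\<And>i. i \<in> I \<Longrightarrow> \<exists>c\<in>I \<rightarrow> \<nn>. g i = (\<Oplus>\<^bsub>S\<^esub>j\<in>I. h (c j) \<otimes>\<^bsub>S\<^esub> g j)"
  shows "\<forall>i\<in>I. g i = \<zero>\<^bsub>S\<^esub>"
  using assms(3-)
proof (induction I rule: finite_induct)
  case (insert s I)
  interpret n: ideal \<nn> R by fact
  have gc: "g i \<in> carrier S" if "i \<in> insert s I" for i using insert.prems(1) that by blast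
  obtain c where c: "c \<in> insert s I \<rightarrow> \<nn>" "g s = (\<Oplus>\<^bsub>S\<^esub>j\<in>insert s I. h (c j) \<otimes>\<^bsub>S\<^esub> g j)"
    using insert.prems(2)[of s] by blast
  have cn: "c j \<in> \<nn>" "c j \<in> carrier R" if "j \<in> insert s I" for j
    using c(1) that n.Icarr by blast+
  let ?u = "\<one> \<ominus> c s"
  have u: "?u \<in> Units R" by (rule unit) (use cn in auto)
  define d where "d j = inv ?u \<otimes> c j" for j
  have dn: "d j \<in> \<nn>" "d j \<in> carrier R" if "j \<in> I" for j
    using cn[of j] that u n.I_l_closed by (auto simp: d_def)
  let ?S = "\<Oplus>\<^bsub>S\<^esub>j\<in>I. h (c j) \<otimes>\<^bsub>S\<^esub> g j"
  have Sc: "?S \<in> carrier S" using cn gc by (intro S.finsum_closed) auto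
  have split: "g s = h (c s) \<otimes>\<^bsub>S\<^esub> g s \<oplus>\<^bsub>S\<^esub> ?S"
    using c(2) insert.hyps cn gc by (subst (asm) S.finsum_insert) auto
  have gs: "g s = (\<Oplus>\<^bsub>S\<^esub>j\<in>I. h (d j) \<otimes>\<^bsub>S\<^esub> g j)"
  proof -
    have "h ?u \<otimes>\<^bsub>S\<^esub> g s = g s \<ominus>\<^bsub>S\<^esub> h (c s) \<otimes>\<^bsub>S\<^esub> g s"
      using cn[of s] gc[of s] by (simp add: a_minus_def S.l_distr S.l_minus)
    also have "\<dots> = (h (c s) \<otimes>\<^bsub>S\<^esub> g s \<oplus>\<^bsub>S\<^esub> ?S) \<ominus>\<^bsub>S\<^esub> h (c s) \<otimes>\<^bsub>S\<^esub> g s"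
      by (subst (1) split) (rule refl)
    also have "\<dots> = ?S" using Sc cn[of s] gc[of s] by (simp add: a_minus_def S.a_ac S.r_neg1 S.r_neg2 S.r_neg)
    finally have e: "h ?u \<otimes>\<^bsub>S\<^esub> g s = ?S" .
    have "g s = h (inv ?u) \<otimes>\<^bsub>S\<^esub> (h ?u \<otimes>\<^bsub>S\<^esub> g s)"
    proof -
      have "h (inv ?u) \<otimes>\<^bsub>S\<^esub> h ?u = \<one>\<^bsub>S\<^esub>"
        using u R.Units_closed[OF u] R.Units_inv_closed[OF u] by (simp flip: hom_mult del: R.minus_closed)
      then show ?thesis
        using hom_closed[OF R.Units_closed[OF u]] hom_closed[OF R.Units_inv_closed[OF u]] gc[of s]
        by (simp add: S.m_assoc[symmetric])
    qed
    also have "\<dots> = h (inv ?u) \<otimes>\<^bsub>S\<^esub> ?S" by (simp only: e)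
    also have "\<dots> = (\<Oplus>\<^bsub>S\<^esub>j\<in>I. h (inv ?u) \<otimes>\<^bsub>S\<^esub> (h (c j) \<otimes>\<^bsub>S\<^esub> g j))"
      using insert.hyps cn gc hom_closed[OF R.Units_inv_closed[OF u]] by (intro S.finsum_rdistr) auto
    also have "\<dots> = (\<Oplus>\<^bsub>S\<^esub>j\<in>I. h (d j) \<otimes>\<^bsub>S\<^esub> g j)"
    proof (rule S.finsum_cong')
      fix j assume j: "j \<in> I"
      then show "h (inv ?u) \<otimes>\<^bsub>S\<^esub> (h (c j) \<otimes>\<^bsub>S\<^esub> g j) = h (d j) \<otimes>\<^bsub>S\<^esub> g j"
        using cn[of j] gc[of j] R.Units_inv_closed[OF u] by (simp add: d_def S.m_assoc)
    qed (use dn gc in auto)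
    finally show ?thesis .
  qed
  have "\<forall>i\<in>I. g i = \<zero>\<^bsub>S\<^esub>"
  proof (rule insert.IH)
    show "g i \<in> carrier S" if "i \<in> I" for i using gc that by blast
    fix i assume i: "i \<in> I"
    then obtain b where b: "b \<in> insert s I \<rightarrow> \<nn>" "g i = (\<Oplus>\<^bsub>S\<^esub>j\<in>insert s I. h (b j) \<otimes>\<^bsub>S\<^esub> g j)"
      using insert.prems(2)[of i] by blast
    have bn: "b j \<in> \<nn>" "b j \<in> carrier R" if "j \<in> insert s I" for j
      using b(1) that n.Icarr by blast+
    \<comment> \<open>The coefficients after \<open>g s\<close> has been replaced by its expression
      in the remaining generators.\<close>
    let ?e = "\<lambda>j. b s \<otimes> d j \<oplus> b j"
    have "g i = h (b s) \<otimes>\<^bsub>S\<^esub> g s \<oplus>\<^bsub>S\<^esub> (\<Oplus>\<^bsub>S\<^esub>j\<in>I. h (b j) \<otimes>\<^bsub>S\<^esub> g j)"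
      using b(2) insert.hyps bn gc by (subst (asm) S.finsum_insert) auto
    also have "h (b s) \<otimes>\<^bsub>S\<^esub> g s = (\<Oplus>\<^bsub>S\<^esub>j\<in>I. h (b s) \<otimes>\<^bsub>S\<^esub> (h (d j) \<otimes>\<^bsub>S\<^esub> g j))"
      by (subst gs) (use insert.hyps bn[of s] dn gc in \<open>intro S.finsum_rdistr; auto\<close>)
    also have "(\<Oplus>\<^bsub>S\<^esub>j\<in>I. h (b s) \<otimes>\<^bsub>S\<^esub> (h (d j) \<otimes>\<^bsub>S\<^esub> g j)) \<oplus>\<^bsub>S\<^esub> (\<Oplus>\<^bsub>S\<^esub>j\<in>I. h (b j) \<otimes>\<^bsub>S\<^esub> g j) =
        (\<Oplus>\<^bsub>S\<^esub>j\<in>I. h (b s) \<otimes>\<^bsub>S\<^esub> (h (d j) \<otimes>\<^bsub>S\<^esub> g j) \<oplus>\<^bsub>S\<^esub> h (b j) \<otimes>\<^bsub>S\<^esub> g j)"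
      using bn dn gc by (intro S.finsum_addf[symmetric]) auto
    also have "\<dots> = (\<Oplus>\<^bsub>S\<^esub>j\<in>I. h (?e j) \<otimes>\<^bsub>S\<^esub> g j)"
    proof (rule S.finsum_cong')
      fix j assume j: "j \<in> I"
      then show "h (b s) \<otimes>\<^bsub>S\<^esub> (h (d j) \<otimes>\<^bsub>S\<^esub> g j) \<oplus>\<^bsub>S\<^esub> h (b j) \<otimes>\<^bsub>S\<^esub> g j = h (?e j) \<otimes>\<^bsub>S\<^esub> g j"
        using bn[of s] bn[of j] dn[of j] gc[of j] by (simp add: S.l_distr S.m_assoc)
    qed (use bn dn gc in auto)
    finally have eq: "g i = (\<Oplus>\<^bsub>S\<^esub>j\<in>I. h (?e j) \<otimes>\<^bsub>S\<^esub> g j)" .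
    have "?e \<in> I \<rightarrow> \<nn>"
    proof (rule funcsetI)
      fix j assume j: "j \<in> I"
      show "?e j \<in> \<nn>" by (intro n.a_closed n.I_l_closed) (use j bn dn in auto)
    qed
    with eq show "\<exists>c\<in>I \<rightarrow> \<nn>. g i = (\<Oplus>\<^bsub>S\<^esub>j\<in>I. h (c j) \<otimes>\<^bsub>S\<^esub> g j)" by (rule bexI)
  qed
  moreover have "g s = \<zero>\<^bsub>S\<^esub>"
  proof -
    have "(\<Oplus>\<^bsub>S\<^esub>j\<in>I. h (d j) \<otimes>\<^bsub>S\<^esub> g j) = \<zero>\<^bsub>S\<^esub>"
      by (rule S.add.finprod_one_eqI) (use calculation dn in simp)
    with gs show ?thesis by simp
  qed
  ultimately show ?case by blast
qed simp

section \<open>Stalks\<close>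

text \<open>Functoriality without gluing is what stalks are built on; in this form the results also
  cover the direct image of the structure sheaf of X, for which functoriality is inherited from
  X.\<close>

locale ring_presheaf =
  fixes F :: "('p, 'a, 'm) ringed_space_scheme"
  assumes sec_cring: "openin (top_of F) U \<Longrightarrow> cring (sec F U)"
    and res_hom: "openin (top_of F) U \<Longrightarrow> openin (top_of F) V \<Longrightarrow> V \<subseteq> U \<Longrightarrow>
      res F U V \<in> ring_hom (sec F U) (sec F V)"
    and res_id: "openin (top_of F) U \<Longrightarrow> f \<in> carrier (sec F U) \<Longrightarrow> res F U U f = f"
    and res_res: "openin (top_of F) U \<Longrightarrow> openin (top_of F) V \<Longrightarrow> openin (top_of F) W \<Longrightarrow>
      W \<subseteq> V \<Longrightarrow> V \<subseteq> U \<Longrightarrow> f \<in> carrier (sec F U) \<Longrightarrow> res F V W (res F U V f) = res F U W f"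
begin

abbreviation "opn U \<equiv> openin (top_of F) U"

lemma res_closed: "opn U \<Longrightarrow> opn V \<Longrightarrow> V \<subseteq> U \<Longrightarrow> f \<in> carrier (sec F U) \<Longrightarrow> res F U V f \<in> carrier (sec F V)"
  by (rule ring_hom_closed[OF res_hom])

lemma res_hom_cring: "opn U \<Longrightarrow> opn V \<Longrightarrow> V \<subseteq> U \<Longrightarrow> ring_hom_cring (sec F U) (sec F V) (res F U V)"
  by (intro ring_hom_cring.intro ring_hom_cring_axioms.intro sec_cring res_hom)

end

lemma sheaf_imp_presheaf: "sheaf_of_rings F \<Longrightarrow> ring_presheaf F"
proof -
  assume "sheaf_of_rings F"
  note sh = this[unfolded sheaf_of_rings_def]
  note c = sh[THEN conjunct1] sh[THEN conjunct2, THEN conjunct1]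
    sh[THEN conjunct2, THEN conjunct2, THEN conjunct1]
    sh[THEN conjunct2, THEN conjunct2, THEN conjunct2, THEN conjunct1]
  show "ring_presheaf F"
  proof (rule ring_presheaf.intro)
    show "cring (sec F U)" if "openin (top_of F) U" for U using c(1) that by blast
    show "res F U U f = f" if "openin (top_of F) U" "f \<in> carrier (sec F U)" for U f
      using c(3) that by blast
    show "res F U V \<in> ring_hom (sec F U) (sec F V)"
      if "openin (top_of F) U" "openin (top_of F) V" "V \<subseteq> U" for U V
      using c(2) that by blast
    show "res F V W (res F U V f) = res F U W f"
      if "openin (top_of F) U" "openin (top_of F) V" "openin (top_of F) W" "W \<subseteq> V" "V \<subseteq> U"
        "f \<in> carrier (sec F U)" for U V W f
      using c(4) that by blast
  qed
qed

locale presheaf_point = ring_presheaf F for F :: "('p, 'a, 'm) ringed_space_scheme" +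
  fixes x :: 'p
  assumes x_space: "x \<in> topspace (top_of F)"
begin

abbreviation "nbhd U \<equiv> openin (top_of F) U \<and> x \<in> U"
abbreviation "S \<equiv> stalk F x"

lemma nbhd_space: "nbhd (topspace (top_of F))"
  using x_space by simp

lemma nbhd_Int: "nbhd U \<Longrightarrow> nbhd V \<Longrightarrow> nbhd (U \<inter> V)"
  by (auto intro: openin_Int)

lemma germ_self: "nbhd U \<Longrightarrow> f \<in> carrier (sec F U) \<Longrightarrow> (U, f) \<in> germ F x U f"
  by (auto simp: germ_def)

lemma germ_eqI:
  assumes "nbhd U" "f \<in> carrier (sec F U)" "nbhd V" "g \<in> carrier (sec F V)"
    "nbhd W" "W \<subseteq> U \<inter> V" "res F U W f = res F V W g"
  shows "germ F x U f = germ F x V g"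
proof -
  have "germ F x U f \<subseteq> germ F x V g"
    if f: "nbhd U" "f \<in> carrier (sec F U)" and g: "nbhd V" "g \<in> carrier (sec F V)"
      and W: "nbhd W" "W \<subseteq> U \<inter> V" "res F U W f = res F V W g" for U V f g
  proof
    fix C assume "C \<in> germ F x U f"
    then obtain Z h Y where Z: "C = (Z, h)" "nbhd Z" "h \<in> carrier (sec F Z)" "nbhd Y" "Y \<subseteq> U \<inter> Z"
        "res F U Y f = res F Z Y h" by (auto simp: germ_def)
    have o: "openin (top_of F) (W \<inter> Y)" using W Z by (intro openin_Int) auto
    have "res F V (W \<inter> Y) g = res F W (W \<inter> Y) (res F V W g)"
      using g W o by (intro res_res[symmetric]) auto
    also have "\<dots> = res F W (W \<inter> Y) (res F U W f)" using W by simp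
    also have "\<dots> = res F U (W \<inter> Y) f" using f W o by (intro res_res) auto
    also have "\<dots> = res F Y (W \<inter> Y) (res F U Y f)" using f Z o by (intro res_res[symmetric]) auto
    also have "\<dots> = res F Y (W \<inter> Y) (res F Z Y h)" using Z by simp
    also have "\<dots> = res F Z (W \<inter> Y) h" using Z o by (intro res_res) auto
    finally have "res F V (W \<inter> Y) g = res F Z (W \<inter> Y) h" .
    then show "C \<in> germ F x V g"
      using Z W o unfolding germ_def by (auto intro!: exI[of _ "W \<inter> Y"])
  qed
  from this[OF assms] this[OF assms(3,4,1,2,5)] assms(6,7) show ?thesis by auto
qed

lemma germ_eq_iff:
  assumes "nbhd U" "f \<in> carrier (sec F U)" "nbhd V" "g \<in> carrier (sec F V)"
  shows "germ F x U f = germ F x V g \<longleftrightarrow> (\<exists>W. nbhd W \<and> W \<subseteq> U \<inter> V \<and> res F U W f = res F V W g)"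
proof
  assume "germ F x U f = germ F x V g"
  then have "(V, g) \<in> germ F x U f" using germ_self[OF assms(3,4)] by simp
  then show "\<exists>W. nbhd W \<and> W \<subseteq> U \<inter> V \<and> res F U W f = res F V W g" by (auto simp: germ_def)
qed (use germ_eqI[OF assms] in blast)

lemma germ_memD:
  assumes "nbhd U" "f \<in> carrier (sec F U)" "(V, g) \<in> germ F x U f"
  shows "nbhd V" "g \<in> carrier (sec F V)" "germ F x V g = germ F x U f"
proof -
  show V: "nbhd V" "g \<in> carrier (sec F V)" using assms(3) by (auto simp: germ_def)
  obtain W where W: "nbhd W" "W \<subseteq> U \<inter> V" "res F U W f = res F V W g"
    using assms(3) by (auto simp: germ_def)
  show "germ F x V g = germ F x U f"
    by (rule germ_eqI[OF assms(1,2) V W, symmetric])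
qed

lemma germ_res:
  assumes "nbhd U" "f \<in> carrier (sec F U)" "nbhd W" "W \<subseteq> U"
  shows "germ F x W (res F U W f) = germ F x U f"
proof (rule germ_eqI)
  have "res F U W f \<in> carrier (sec F W)" using assms by (intro res_closed) auto
  then show "res F U W f \<in> carrier (sec F W)" "res F W W (res F U W f) = res F U W f"
    using assms by (simp_all add: res_id)
qed (use assms in auto)

text \<open>Stalk operations are encoded as unions over the representatives of a germ; independence
  of the representative collapses the union to one value.\<close>

lemma UN_germ:
  assumes "nbhd U" "f \<in> carrier (sec F U)"
    and "\<And>V g. nbhd V \<Longrightarrow> g \<in> carrier (sec F V) \<Longrightarrow> germ F x V g = germ F x U f \<Longrightarrow> Q V g = Q U f"
  shows "(\<Union>(V, g)\<in>germ F x U f. Q V g) = Q U f"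
proof -
  have "Q V g = Q U f" if "(V, g) \<in> germ F x U f" for V g
    using assms(3) germ_memD[OF assms(1,2) that] by blast
  with germ_self[OF assms(1,2)] show ?thesis by fast
qed

lemma stalk_carrier: "carrier S = {germ F x U f | U f. nbhd U \<and> f \<in> carrier (sec F U)}"
  by (auto simp: stalk_def)

lemma germ_closed [intro]: "nbhd U \<Longrightarrow> f \<in> carrier (sec F U) \<Longrightarrow> germ F x U f \<in> carrier S"
  by (auto simp: stalk_carrier)

lemma stalkE:
  assumes "c \<in> carrier S"
  obtains U f where "nbhd U" "f \<in> carrier (sec F U)" "c = germ F x U f"
  using assms by (auto simp: stalk_carrier)

lemma stalkE_small:
  assumes "c \<in> carrier S" "nbhd N"
  obtains U f where "nbhd U" "U \<subseteq> N" "f \<in> carrier (sec F U)" "c = germ F x U f"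
proof -
  obtain U f where U: "nbhd U" "f \<in> carrier (sec F U)" "c = germ F x U f" using assms(1) by (rule stalkE)
  show thesis
  proof (rule that)
    show "nbhd (U \<inter> N)" using U(1) assms(2) by (rule nbhd_Int)
    show "c = germ F x (U \<inter> N) (res F U (U \<inter> N) f)"
      unfolding U(3) using U assms(2) by (intro germ_res[symmetric] nbhd_Int) auto
    show "res F U (U \<inter> N) f \<in> carrier (sec F (U \<inter> N))"
      using U assms(2) nbhd_Int[OF U(1) assms(2)] by (intro res_closed) auto
  qed auto
qed

text \<open>Addition and multiplication of germs are treated together: any operation on sections
  that commutes with restriction descends, since two representatives of a germ agree on a small
  neighbourhood.\<close>

lemma germ_op:
  assumes op: "\<And>U V f g. nbhd U \<Longrightarrow> nbhd V \<Longrightarrow> V \<subseteq> U \<Longrightarrow> f \<in> carrier (sec F U) \<Longrightarrow> g \<in> carrier (sec F U) \<Longrightarrow>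
      res F U V (m U f g) = m V (res F U V f) (res F U V g)"
    and cl: "\<And>U f g. nbhd U \<Longrightarrow> f \<in> carrier (sec F U) \<Longrightarrow> g \<in> carrier (sec F U) \<Longrightarrow> m U f g \<in> carrier (sec F U)"
    and W: "nbhd W" "f \<in> carrier (sec F W)" "g \<in> carrier (sec F W)"
  shows "(\<Union>(U, f)\<in>germ F x W f. \<Union>(V, g)\<in>germ F x W g. germ F x (U \<inter> V)
      (m (U \<inter> V) (res F U (U \<inter> V) f) (res F V (U \<inter> V) g))) = germ F x W (m W f g)"
proof -
  let ?Q = "\<lambda>U f V g. germ F x (U \<inter> V) (m (U \<inter> V) (res F U (U \<inter> V) f) (res F V (U \<inter> V) g))"
  have small: "?Q U f V g = germ F x Z (m Z (res F U Z f) (res F V Z g))"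
    if U: "nbhd U" "f \<in> carrier (sec F U)" and V: "nbhd V" "g \<in> carrier (sec F V)"
      and Z: "nbhd Z" "Z \<subseteq> U \<inter> V" for U V Z f g
  proof -
    have I: "nbhd (U \<inter> V)" using U(1) V(1) by (rule nbhd_Int)
    have fg: "res F U (U \<inter> V) f \<in> carrier (sec F (U \<inter> V))" "res F V (U \<inter> V) g \<in> carrier (sec F (U \<inter> V))"
      using U V I by (auto intro!: res_closed)
    have "?Q U f V g = germ F x Z (res F (U \<inter> V) Z (m (U \<inter> V) (res F U (U \<inter> V) f) (res F V (U \<inter> V) g)))"
      by (rule germ_res[OF I cl[OF I fg] Z, symmetric])
    also have "res F (U \<inter> V) Z (m (U \<inter> V) (res F U (U \<inter> V) f) (res F V (U \<inter> V) g)) =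
      m Z (res F (U \<inter> V) Z (res F U (U \<inter> V) f)) (res F (U \<inter> V) Z (res F V (U \<inter> V) g))"
      by (rule op[OF I Z fg])
    also have "res F (U \<inter> V) Z (res F U (U \<inter> V) f) = res F U Z f"
      using U Z I by (intro res_res) auto
    also have "res F (U \<inter> V) Z (res F V (U \<inter> V) g) = res F V Z g"
      using V Z I by (intro res_res) auto
    finally show ?thesis .
  qed
  have wd: "?Q U f V g = ?Q U' f' V' g'"
    if U: "nbhd U" "f \<in> carrier (sec F U)" and V: "nbhd V" "g \<in> carrier (sec F V)"
      and U': "nbhd U'" "f' \<in> carrier (sec F U')" and V': "nbhd V'" "g' \<in> carrier (sec F V')"
      and eq: "germ F x U f = germ F x U' f'" "germ F x V g = germ F x V' g'" for U V U' V' f g f' g'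
  proof -
    obtain Y where Y: "nbhd Y" "Y \<subseteq> U \<inter> U'" "res F U Y f = res F U' Y f'"
      using eq(1) germ_eq_iff[OF U U'] by auto
    obtain Z where Z: "nbhd Z" "Z \<subseteq> V \<inter> V'" "res F V Z g = res F V' Z g'"
      using eq(2) germ_eq_iff[OF V V'] by auto
    have I: "nbhd (Y \<inter> Z)" using Y(1) Z(1) by (rule nbhd_Int)
    have "res F U (Y \<inter> Z) f = res F Y (Y \<inter> Z) (res F U Y f)"
      using U Y I by (intro res_res[symmetric]) auto
    also have "\<dots> = res F U' (Y \<inter> Z) f'" unfolding Y(3) using U' Y I by (intro res_res) auto
    finally have f: "res F U (Y \<inter> Z) f = res F U' (Y \<inter> Z) f'" .
    have "res F V (Y \<inter> Z) g = res F Z (Y \<inter> Z) (res F V Z g)"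
      using V Z I by (intro res_res[symmetric]) auto
    also have "\<dots> = res F V' (Y \<inter> Z) g'" unfolding Z(3) using V' Z I by (intro res_res) auto
    finally have g: "res F V (Y \<inter> Z) g = res F V' (Y \<inter> Z) g'" .
    have "Y \<inter> Z \<subseteq> U \<inter> V" "Y \<inter> Z \<subseteq> U' \<inter> V'" using Y Z by auto
    with small[OF U V I] small[OF U' V' I] f g show ?thesis by simp
  qed
  have inner: "(\<Union>(V, g)\<in>germ F x W g. ?Q U f' V g) = ?Q U f' W g" if "nbhd U" "f' \<in> carrier (sec F U)" for U f'
    by (rule UN_germ[OF W(1,3)]) (use wd that W in blast)
  have "(\<Union>(U, f)\<in>germ F x W f. \<Union>(V, g)\<in>germ F x W g. ?Q U f V g) = (\<Union>(U, f)\<in>germ F x W f. ?Q U f W g)"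
  proof (intro SUP_cong refl)
    fix C assume C: "C \<in> germ F x W f"
    obtain U f' where [simp]: "C = (U, f')" by (cases C)
    have "nbhd U" "f' \<in> carrier (sec F U)" using germ_memD[OF W(1,2)] C by auto
    then show "(case C of (U, f) \<Rightarrow> \<Union>(V, g)\<in>germ F x W g. ?Q U f V g) = (case C of (U, f) \<Rightarrow> ?Q U f W g)"
      unfolding \<open>C = (U, f')\<close> prod.case by (rule inner)
  qed
  also have "\<dots> = ?Q W f W g" by (rule UN_germ[OF W(1,2)]) (use wd W in blast)
  also have "\<dots> = germ F x W (m W f g)" using W by (simp add: res_id)
  finally show ?thesis .
qed

lemma germ_mult:
  assumes "nbhd W" "f \<in> carrier (sec F W)" "g \<in> carrier (sec F W)"
  shows "germ F x W f \<otimes>\<^bsub>S\<^esub> germ F x W g = germ F x W (f \<otimes>\<^bsub>sec F W\<^esub> g)"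
  unfolding stalk_def monoid.simps
proof (rule germ_op[where m = "\<lambda>W. monoid.mult (sec F W)", OF _ _ assms])
  fix U V f g assume a: "nbhd U" "nbhd V" "V \<subseteq> U" "f \<in> carrier (sec F U)" "g \<in> carrier (sec F U)"
  interpret ring_hom_cring "sec F U" "sec F V" "res F U V" using a by (intro res_hom_cring) auto
  show "res F U V (f \<otimes>\<^bsub>sec F U\<^esub> g) = res F U V f \<otimes>\<^bsub>sec F V\<^esub> res F U V g" using a by simp
next
  fix U f g assume a: "nbhd U" "f \<in> carrier (sec F U)" "g \<in> carrier (sec F U)"
  interpret cring "sec F U" using a by (intro sec_cring) auto
  show "f \<otimes>\<^bsub>sec F U\<^esub> g \<in> carrier (sec F U)" using a by simp
qed

lemma germ_add:
  assumes "nbhd W" "f \<in> carrier (sec F W)" "g \<in> carrier (sec F W)"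
  shows "germ F x W f \<oplus>\<^bsub>S\<^esub> germ F x W g = germ F x W (f \<oplus>\<^bsub>sec F W\<^esub> g)"
  unfolding stalk_def ring.simps
proof (rule germ_op[where m = "\<lambda>W. ring.add (sec F W)", OF _ _ assms])
  fix U V f g assume a: "nbhd U" "nbhd V" "V \<subseteq> U" "f \<in> carrier (sec F U)" "g \<in> carrier (sec F U)"
  interpret ring_hom_cring "sec F U" "sec F V" "res F U V" using a by (intro res_hom_cring) auto
  show "res F U V (f \<oplus>\<^bsub>sec F U\<^esub> g) = res F U V f \<oplus>\<^bsub>sec F V\<^esub> res F U V g" using a by simp
next
  fix U f g assume a: "nbhd U" "f \<in> carrier (sec F U)" "g \<in> carrier (sec F U)"
  interpret cring "sec F U" using a by (intro sec_cring) auto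
  show "f \<oplus>\<^bsub>sec F U\<^esub> g \<in> carrier (sec F U)" using a by simp
qed

lemma germ_one: "nbhd W \<Longrightarrow> germ F x W \<one>\<^bsub>sec F W\<^esub> = \<one>\<^bsub>S\<^esub>"
  and germ_zero: "nbhd W \<Longrightarrow> germ F x W \<zero>\<^bsub>sec F W\<^esub> = \<zero>\<^bsub>S\<^esub>"
proof -
  let ?T = "topspace (top_of F)"
  assume W: "nbhd W"
  have sub: "W \<subseteq> ?T" using W openin_subset by blast
  interpret ring_hom_cring "sec F ?T" "sec F W" "res F ?T W" using W sub by (intro res_hom_cring) auto
  show "germ F x W \<one>\<^bsub>sec F W\<^esub> = \<one>\<^bsub>S\<^esub>"
    using germ_res[OF nbhd_space R.one_closed W sub] by (simp add: stalk_def)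
  show "germ F x W \<zero>\<^bsub>sec F W\<^esub> = \<zero>\<^bsub>S\<^esub>"
    using germ_res[OF nbhd_space R.zero_closed W sub] by (simp add: stalk_def)
qed

lemma stalkE2:
  assumes "c \<in> carrier S" "d \<in> carrier S"
  obtains W f g where "nbhd W" "f \<in> carrier (sec F W)" "g \<in> carrier (sec F W)"
    "c = germ F x W f" "d = germ F x W g"
proof -
  obtain U f where U: "nbhd U" "f \<in> carrier (sec F U)" "c = germ F x U f" using assms(1) by (rule stalkE)
  obtain V g where V: "nbhd V" "V \<subseteq> U" "g \<in> carrier (sec F V)" "d = germ F x V g"
    using assms(2) U(1) by (rule stalkE_small)
  have "res F U V f \<in> carrier (sec F V)" using U V by (intro res_closed) auto
  with germ_res[OF U(1,2) V(1,2)] U V that show thesis by metis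
qed

lemma stalk_cring: "cring S"
proof (rule cringI)
  have c3: "\<exists>W f g h. nbhd W \<and> f \<in> carrier (sec F W) \<and> g \<in> carrier (sec F W) \<and> h \<in> carrier (sec F W) \<and>
      a = germ F x W f \<and> b = germ F x W g \<and> c = germ F x W h"
    if abc: "a \<in> carrier S" "b \<in> carrier S" "c \<in> carrier S" for a b c
  proof -
    obtain U f g where U: "nbhd U" "f \<in> carrier (sec F U)" "g \<in> carrier (sec F U)"
      "a = germ F x U f" "b = germ F x U g" using abc(1,2) by (rule stalkE2)
    obtain V h where V: "nbhd V" "V \<subseteq> U" "h \<in> carrier (sec F V)" "c = germ F x V h"
      using abc(3) U(1) by (rule stalkE_small)
    have "res F U V f \<in> carrier (sec F V)" "res F U V g \<in> carrier (sec F V)"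
      using U V by (auto intro!: res_closed)
    with germ_res[OF U(1,2) V(1,2)] germ_res[OF U(1,3) V(1,2)] U V show ?thesis by metis
  qed
  show "abelian_group S"
  proof (rule abelian_groupI)
    show "\<zero>\<^bsub>S\<^esub> \<in> carrier S"
      using germ_zero[OF nbhd_space] germ_closed[OF nbhd_space cring.cring_simprules(2)[OF sec_cring]] nbhd_space by auto
    fix a assume a: "a \<in> carrier S"
    then obtain W f where W: "nbhd W" "f \<in> carrier (sec F W)" "a = germ F x W f" by (rule stalkE)
    interpret cring "sec F W" using W by (intro sec_cring) auto
    show "\<zero>\<^bsub>S\<^esub> \<oplus>\<^bsub>S\<^esub> a = a" using W by (simp add: germ_add flip: germ_zero[OF W(1)])
    have "germ F x W (\<ominus>\<^bsub>sec F W\<^esub> f) \<oplus>\<^bsub>S\<^esub> a = \<zero>\<^bsub>S\<^esub>"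
      using W by (simp add: germ_add l_neg flip: germ_zero[OF W(1)])
    then show "\<exists>b\<in>carrier S. b \<oplus>\<^bsub>S\<^esub> a = \<zero>\<^bsub>S\<^esub>" using germ_closed[OF W(1) a_inv_closed[OF W(2)]] by blast
  next
    fix a b c assume "a \<in> carrier S" "b \<in> carrier S" "c \<in> carrier S"
    from c3[OF this] obtain W f g h where W: "nbhd W" "f \<in> carrier (sec F W)" "g \<in> carrier (sec F W)"
      "h \<in> carrier (sec F W)" "a = germ F x W f" "b = germ F x W g" "c = germ F x W h" by blast
    interpret cring "sec F W" using W by (intro sec_cring) auto
    show "a \<oplus>\<^bsub>S\<^esub> b \<oplus>\<^bsub>S\<^esub> c = a \<oplus>\<^bsub>S\<^esub> (b \<oplus>\<^bsub>S\<^esub> c)" using W by (simp add: germ_add a_assoc)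
  next
    fix a b assume "a \<in> carrier S" "b \<in> carrier S"
    then obtain W f g where W: "nbhd W" "f \<in> carrier (sec F W)" "g \<in> carrier (sec F W)"
      "a = germ F x W f" "b = germ F x W g" by (rule stalkE2)
    interpret cring "sec F W" using W by (intro sec_cring) auto
    show "a \<oplus>\<^bsub>S\<^esub> b \<in> carrier S" using W by (auto simp: germ_add)
    show "a \<oplus>\<^bsub>S\<^esub> b = b \<oplus>\<^bsub>S\<^esub> a" using W by (simp add: germ_add a_comm)
  qed
  show "comm_monoid S"
  proof (rule comm_monoidI)
    show "\<one>\<^bsub>S\<^esub> \<in> carrier S"
      using germ_one[OF nbhd_space] germ_closed[OF nbhd_space cring.cring_simprules(6)[OF sec_cring]] nbhd_space by auto
    fix a assume a: "a \<in> carrier S"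
    then obtain W f where W: "nbhd W" "f \<in> carrier (sec F W)" "a = germ F x W f" by (rule stalkE)
    interpret cring "sec F W" using W by (intro sec_cring) auto
    show "\<one>\<^bsub>S\<^esub> \<otimes>\<^bsub>S\<^esub> a = a" using W by (simp add: germ_mult flip: germ_one[OF W(1)])
  next
    fix a b c assume "a \<in> carrier S" "b \<in> carrier S" "c \<in> carrier S"
    from c3[OF this] obtain W f g h where W: "nbhd W" "f \<in> carrier (sec F W)" "g \<in> carrier (sec F W)"
      "h \<in> carrier (sec F W)" "a = germ F x W f" "b = germ F x W g" "c = germ F x W h" by blast
    interpret cring "sec F W" using W by (intro sec_cring) auto
    show "a \<otimes>\<^bsub>S\<^esub> b \<otimes>\<^bsub>S\<^esub> c = a \<otimes>\<^bsub>S\<^esub> (b \<otimes>\<^bsub>S\<^esub> c)" using W by (simp add: germ_mult m_assoc)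
  next
    fix a b assume "a \<in> carrier S" "b \<in> carrier S"
    then obtain W f g where W: "nbhd W" "f \<in> carrier (sec F W)" "g \<in> carrier (sec F W)"
      "a = germ F x W f" "b = germ F x W g" by (rule stalkE2)
    interpret cring "sec F W" using W by (intro sec_cring) auto
    show "a \<otimes>\<^bsub>S\<^esub> b \<in> carrier S" using W by (auto simp: germ_mult)
    show "a \<otimes>\<^bsub>S\<^esub> b = b \<otimes>\<^bsub>S\<^esub> a" using W by (simp add: germ_mult m_comm)
  qed
  fix a b c assume "a \<in> carrier S" "b \<in> carrier S" "c \<in> carrier S"
  from c3[OF this] obtain W f g h where W: "nbhd W" "f \<in> carrier (sec F W)" "g \<in> carrier (sec F W)"
    "h \<in> carrier (sec F W)" "a = germ F x W f" "b = germ F x W g" "c = germ F x W h" by blast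
  interpret cring "sec F W" using W by (intro sec_cring) auto
  show "(a \<oplus>\<^bsub>S\<^esub> b) \<otimes>\<^bsub>S\<^esub> c = a \<otimes>\<^bsub>S\<^esub> c \<oplus>\<^bsub>S\<^esub> b \<otimes>\<^bsub>S\<^esub> c"
    using W by (simp add: germ_mult germ_add l_distr)
qed

lemma germ_hom: "nbhd W \<Longrightarrow> germ F x W \<in> ring_hom (sec F W) S"
  by (rule ring_hom_memI) (auto simp: germ_mult germ_add germ_one)

lemma germ_hom_cring: "nbhd W \<Longrightarrow> ring_hom_cring (sec F W) S (germ F x W)"
  by (intro ring_hom_cring.intro ring_hom_cring_axioms.intro sec_cring stalk_cring germ_hom) auto

lemma germ_eq_zero:
  assumes "nbhd U" "f \<in> carrier (sec F U)" "germ F x U f = \<zero>\<^bsub>S\<^esub>"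
  shows "\<exists>W. nbhd W \<and> W \<subseteq> U \<and> res F U W f = \<zero>\<^bsub>sec F W\<^esub>"
proof -
  interpret U: cring "sec F U" using assms(1) by (intro sec_cring) auto
  have "germ F x U f = germ F x U \<zero>\<^bsub>sec F U\<^esub>" using assms germ_zero[OF assms(1)] by simp
  then obtain W where W: "nbhd W" "W \<subseteq> U" "res F U W f = res F U W \<zero>\<^bsub>sec F U\<^esub>"
    using germ_eq_iff[OF assms(1,2,1) U.zero_closed] by auto
  interpret ring_hom_cring "sec F U" "sec F W" "res F U W" using assms W by (intro res_hom_cring) auto
  show ?thesis using W by auto
qed

lemma stalk_map_germ:
  assumes Z: "ring_presheaf Z" and top: "top_of Z = top_of F"
    and th: "\<And>U f. openin (top_of F) U \<Longrightarrow> f \<in> carrier (sec F U) \<Longrightarrow> \<theta> U f \<in> carrier (sec Z U)"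
    and nat: "\<And>U V f. openin (top_of F) U \<Longrightarrow> openin (top_of F) V \<Longrightarrow> V \<subseteq> U \<Longrightarrow> f \<in> carrier (sec F U) \<Longrightarrow>
      \<theta> V (res F U V f) = res Z U V (\<theta> U f)"
    and U: "nbhd U" "f \<in> carrier (sec F U)"
  shows "stalk_map Z x \<theta> (germ F x U f) = germ Z x U (\<theta> U f)"
  unfolding stalk_map_def
proof (rule UN_germ[OF U])
  interpret Z: presheaf_point Z x using Z x_space top by (simp add: presheaf_point_def presheaf_point_axioms_def)
  fix V g assume V: "nbhd V" "g \<in> carrier (sec F V)" and eq: "germ F x V g = germ F x U f"
  obtain W where W: "nbhd W" "W \<subseteq> V \<inter> U" "res F V W g = res F U W f"
    using eq germ_eq_iff[OF V U] by auto
  have "res Z V W (\<theta> V g) = \<theta> W (res F V W g)" using V W by (intro nat[symmetric]) auto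
  also have "\<dots> = res Z U W (\<theta> U f)" unfolding W(3) using U W by (intro nat) auto
  finally show "germ Z x V (\<theta> V g) = germ Z x U (\<theta> U f)"
    using U V W th by (intro Z.germ_eqI[of _ _ _ _ W]) (auto simp: top)
qed

end

section \<open>Affine charts\<close>

lemma (in cring) nonunits_maximalideal:
  assumes "\<zero> \<notin> Units R"
    and add: "\<And>a b. a \<in> carrier R - Units R \<Longrightarrow> b \<in> carrier R - Units R \<Longrightarrow> a \<oplus> b \<notin> Units R"
  shows "maximalideal (carrier R - Units R) R"
proof (rule maximalidealI)
  show "ideal (carrier R - Units R) R"
  proof (rule idealI')
    fix a b assume ab: "a \<in> carrier R - Units R" "b \<in> carrier R"
    then show "b \<otimes> a \<in> carrier R - Units R" using unit_factor[of a b] by (auto simp: m_comm)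
  qed (use assms in auto)
  show "carrier R \<noteq> carrier R - Units R" by auto
  fix J assume J: "ideal J R" "carrier R - Units R \<subseteq> J" "J \<subseteq> carrier R"
  interpret J: ideal J R by fact
  show "J = carrier R - Units R \<or> J = carrier R"
  proof (cases "\<exists>u\<in>J. u \<in> Units R")
    case True
    then obtain u where u: "u \<in> J" "u \<in> Units R" by blast
    then have "inv u \<otimes> u \<in> J" by (intro J.I_l_closed) auto
    with u J.one_imp_carrier show ?thesis by simp
  qed (use J in auto)
qed

lemma (in cring) topspace_Spec: "topspace (Spec_top R) = {P. primeideal P R}"
proof -
  have "\<one> \<notin> P" if "primeideal P R" for P
  proof -
    interpret primeideal P R by fact
    show ?thesis using one_imp_carrier I_notcarr by blast
  qed
  then show ?thesis by (auto simp: Spec_top_def basic_open_def)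
qed

text \<open>By definition the basic open sets are only a subbasis; on prime ideals D(f) and D(g)
  intersect in D(fg), which makes them a basis.\<close>

lemma (in cring) Spec_basis:
  assumes "openin (Spec_top R) W" "P \<in> W"
  shows "\<exists>f\<in>carrier R. P \<in> basic_open R f \<and> basic_open R f \<subseteq> W"
proof -
  have "generate_topology_on (basic_open R ` carrier R) W"
    using assms(1) by (simp add: Spec_top_def openin_topology_generated_by_iff)
  then show ?thesis using assms(2)
  proof induction
    case (Int a b)
    then obtain f g where f: "f \<in> carrier R" "P \<in> basic_open R f" "basic_open R f \<subseteq> a"
      and g: "g \<in> carrier R" "P \<in> basic_open R g" "basic_open R g \<subseteq> b" by blast
    have "basic_open R (f \<otimes> g) = basic_open R f \<inter> basic_open R g"
    proof -
      have "f \<otimes> g \<in> Q \<longleftrightarrow> f \<in> Q \<or> g \<in> Q" if "primeideal Q R" for Q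
      proof -
        interpret primeideal Q R by fact
        show ?thesis using I_prime I_l_closed I_r_closed f(1) g(1) by blast
      qed
      then show ?thesis by (auto simp: basic_open_def)
    qed
    with f g show ?case by (intro bexI[of _ "f \<otimes> g"]) auto
  qed blast+
qed

locale affine_chart = ring_presheaf F for F :: "('p, 'a, 'm) ringed_space_scheme" +
  fixes U :: "'p set" and h :: "'p \<Rightarrow> 'a set"
  assumes U_open: "openin (top_of F) U"
    and homeo: "homeomorphic_map (subtopology (top_of F) U) (Spec_top (sec F U)) h"
    and loc: "f \<in> carrier (sec F U) \<Longrightarrow>
      localization_away (sec F U) f (sec F {x\<in>U. f \<notin> h x}) (res F U {x\<in>U. f \<notin> h x})"

lemma (in ring_presheaf) affine_openE:
  assumes "affine_open F U"
  obtains h where "affine_chart F U h"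
  using assms ring_presheaf_axioms
  unfolding affine_open_def affine_chart_def affine_chart_axioms_def by blast

context affine_chart begin

abbreviation "R \<equiv> sec F U"

definition D :: "'a \<Rightarrow> 'p set" where "D f = {x\<in>U. f \<notin> h x}"

sublocale R: cring R by (rule sec_cring[OF U_open])

lemma D_sub: "D f \<subseteq> U" by (auto simp: D_def)

lemma topspace_U: "topspace (subtopology (top_of F) U) = U"
  using openin_subset[OF U_open] by auto

lemma h_prime: "x \<in> U \<Longrightarrow> primeideal (h x) R"
  using homeomorphic_imp_surjective_map[OF homeo] topspace_U R.topspace_Spec by auto

lemma D_open: "f \<in> carrier R \<Longrightarrow> openin (top_of F) (D f)"
proof -
  assume f: "f \<in> carrier R"
  have "openin (subtopology (top_of F) U) {x \<in> topspace (subtopology (top_of F) U). h x \<in> basic_open R f}"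
    by (rule openin_continuous_map_preimage[OF homeomorphic_imp_continuous_map[OF homeo]])
      (use f in \<open>auto simp: Spec_top_def intro: topology_generated_by_Basis\<close>)
  also have "{x \<in> topspace (subtopology (top_of F) U). h x \<in> basic_open R f} = D f"
    unfolding topspace_U using h_prime by (auto simp: D_def basic_open_def)
  finally show ?thesis using U_open by (simp add: openin_open_subtopology)
qed

lemma D_basis:
  assumes "openin (top_of F) W" "x \<in> W" "x \<in> U"
  shows "\<exists>f\<in>carrier R. x \<in> D f \<and> D f \<subseteq> W"
proof -
  have WU: "openin (subtopology (top_of F) U) (W \<inter> U)"
    using assms(1) U_open by (simp add: openin_open_subtopology openin_Int)
  then have "openin (Spec_top R) (h ` (W \<inter> U))"
    using homeomorphic_imp_open_map[OF homeo] by (simp add: open_map_def)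
  then obtain f where f: "f \<in> carrier R" "h x \<in> basic_open R f" "basic_open R f \<subseteq> h ` (W \<inter> U)"
    using R.Spec_basis[of "h ` (W \<inter> U)" "h x"] assms by blast
  have "D f \<subseteq> W"
  proof
    fix z assume z: "z \<in> D f"
    then have "h z \<in> basic_open R f" using h_prime by (auto simp: D_def basic_open_def)
    with f(3) obtain w where w: "w \<in> W \<inter> U" "h z = h w" by blast
    then have "z = w"
      using homeomorphic_imp_injective_map[OF homeo] topspace_U z by (auto simp: D_def inj_on_def)
    with w show "z \<in> W" by simp
  qed
  moreover have "x \<in> D f" using f assms(3) by (auto simp: D_def basic_open_def)
  ultimately show ?thesis using f(1) by blast
qed

lemma zero_notin_D: "x \<in> D f \<Longrightarrow> f \<noteq> \<zero>\<^bsub>R\<^esub>"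
proof
  assume x: "x \<in> D f" and f: "f = \<zero>\<^bsub>R\<^esub>"
  then have "x \<in> U" by (simp add: D_def)
  interpret primeideal "h x" R by (rule h_prime[OF \<open>x \<in> U\<close>])
  show False using x f zero_closed by (simp add: D_def)
qed

lemma loc_unit: "f \<in> carrier R \<Longrightarrow> res F U (D f) f \<in> Units (sec F (D f))"
  and loc_frac: "f \<in> carrier R \<Longrightarrow> s \<in> carrier (sec F (D f)) \<Longrightarrow>
    \<exists>a\<in>carrier R. \<exists>n::nat. s \<otimes>\<^bsub>sec F (D f)\<^esub> res F U (D f) f [^]\<^bsub>sec F (D f)\<^esub> n = res F U (D f) a"
  and loc_zero: "f \<in> carrier R \<Longrightarrow> a \<in> carrier R \<Longrightarrow> res F U (D f) a = \<zero>\<^bsub>sec F (D f)\<^esub> \<Longrightarrow>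
    \<exists>n::nat. f [^]\<^bsub>R\<^esub> n \<otimes>\<^bsub>R\<^esub> a = \<zero>\<^bsub>R\<^esub>"
  using loc[of f] unfolding D_def[symmetric] localization_away_def by blast+

lemma prime_pow: "primeideal P R \<Longrightarrow> f \<in> carrier R \<Longrightarrow> f [^]\<^bsub>R\<^esub> (n::nat) \<in> P \<Longrightarrow> f \<in> P"
proof (induction n)
  case 0
  interpret primeideal P R by fact
  show ?case using 0 one_imp_carrier I_notcarr by simp
next
  case (Suc n)
  interpret primeideal P R by fact
  show ?case using Suc I_prime[of "f [^]\<^bsub>R\<^esub> n" f] by auto
qed

end

section \<open>Local rings at the points of an affine chart\<close>

locale affine_point = affine_chart F U h + presheaf_point F x
  for F :: "('p, 'a, 'm) ringed_space_scheme" and U h x +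
  assumes xU: "x \<in> U"
begin

sublocale S: cring S by (rule stalk_cring)

sublocale P: primeideal "h x" R by (rule h_prime[OF xU])

lemma nU: "nbhd U" using U_open xU by simp

sublocale gU: ring_hom_cring R S "germ F x U" by (rule germ_hom_cring[OF nU])

lemma nD: "e \<in> carrier R \<Longrightarrow> e \<notin> h x \<Longrightarrow> nbhd (D e)"
  using D_open xU by (simp add: D_def)

lemma germ_unit:
  assumes e: "e \<in> carrier R" "e \<notin> h x"
  shows "germ F x U e \<in> Units S"
proof -
  note n = nD[OF e]
  interpret g: ring_hom_cring "sec F (D e)" S "germ F x (D e)" by (rule germ_hom_cring[OF n])
  let ?r = "res F U (D e) e"
  have u: "?r \<in> Units (sec F (D e))" by (rule loc_unit[OF e(1)])
  have c: "?r \<in> carrier (sec F (D e))" "inv\<^bsub>sec F (D e)\<^esub> ?r \<in> carrier (sec F (D e))"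
    using g.R.Units_closed[OF u] g.R.Units_inv_closed[OF u] by auto
  have "germ F x (D e) ?r \<otimes>\<^bsub>S\<^esub> germ F x (D e) (inv\<^bsub>sec F (D e)\<^esub> ?r) = \<one>\<^bsub>S\<^esub>"
    using c g.R.Units_r_inv[OF u] by (simp flip: g.hom_mult)
  then have "germ F x (D e) ?r \<in> Units S"
    using S.unit_factor[of "germ F x (D e) ?r" "germ F x (D e) (inv\<^bsub>sec F (D e)\<^esub> ?r)"] g.hom_closed c by simp
  then show ?thesis using germ_res[OF nU e(1) n D_sub] by simp
qed

lemma stalk_frac:
  assumes s: "s \<in> carrier S" and W: "nbhd W"
  obtains e b n where "e \<in> carrier R" "e \<notin> h x" "D e \<subseteq> W" "b \<in> carrier R"
    "s \<otimes>\<^bsub>S\<^esub> germ F x U e [^]\<^bsub>S\<^esub> (n::nat) = germ F x U b"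
proof -
  obtain V g where V: "nbhd V" "V \<subseteq> W" "g \<in> carrier (sec F V)" "s = germ F x V g"
    using s W by (rule stalkE_small)
  obtain e where e: "e \<in> carrier R" "x \<in> D e" "D e \<subseteq> V" using D_basis[of V x] V xU by blast
  have n: "nbhd (D e)" using D_open e by simp
  interpret g: ring_hom_cring "sec F (D e)" S "germ F x (D e)" by (rule germ_hom_cring[OF n])
  have gc: "res F V (D e) g \<in> carrier (sec F (D e))" using V n e by (intro res_closed) auto
  have ec: "res F U (D e) e \<in> carrier (sec F (D e))" using e n U_open D_sub by (intro res_closed) auto
  obtain b m where b: "b \<in> carrier R"
    "res F V (D e) g \<otimes>\<^bsub>sec F (D e)\<^esub> res F U (D e) e [^]\<^bsub>sec F (D e)\<^esub> (m::nat) = res F U (D e) b"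
    using loc_frac[OF e(1) gc] by blast
  have "germ F x (D e) (res F U (D e) b) =
    germ F x (D e) (res F V (D e) g) \<otimes>\<^bsub>S\<^esub> germ F x (D e) (res F U (D e) e) [^]\<^bsub>S\<^esub> m"
    unfolding b(2)[symmetric] using gc ec by (simp add: g.ring.hom_nat_pow)
  then have "germ F x U b = s \<otimes>\<^bsub>S\<^esub> germ F x U e [^]\<^bsub>S\<^esub> m"
    unfolding germ_res[OF nU b(1) n D_sub] germ_res[OF nU e(1) n D_sub] germ_res[OF V(1,3) n e(3)] V(4) .
  with e b V that[of e b m] show thesis by (auto simp: D_def)
qed

text \<open>If the germ of \<open>f\<close> were invertible, then f b = e^n near \<open>x\<close>
  with \<open>e\<close> outside the prime. On a basic open set this equality holds up to a factor
  c^m with \<open>c\<close> outside the prime, so e^n would lie in the prime.\<close>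

lemma germ_nonunit:
  assumes f: "f \<in> h x"
  shows "germ F x U f \<notin> Units S"
proof
  assume u: "germ F x U f \<in> Units S"
  have fR: "f \<in> carrier R" by (rule P.Icarr[OF f])
  have ic: "inv\<^bsub>S\<^esub> germ F x U f \<in> carrier S" using u by simp
  obtain e b n where e: "e \<in> carrier R" "e \<notin> h x" and b: "b \<in> carrier R"
    and eq: "inv\<^bsub>S\<^esub> germ F x U f \<otimes>\<^bsub>S\<^esub> germ F x U e [^]\<^bsub>S\<^esub> (n::nat) = germ F x U b"
    using ic nU by (rule stalk_frac)
  have "germ F x U (f \<otimes>\<^bsub>R\<^esub> b) = germ F x U f \<otimes>\<^bsub>S\<^esub> (inv\<^bsub>S\<^esub> germ F x U f \<otimes>\<^bsub>S\<^esub> germ F x U e [^]\<^bsub>S\<^esub> n)"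
    using fR b by (simp add: eq)
  also have "\<dots> = germ F x U e [^]\<^bsub>S\<^esub> n"
    using u fR e ic by (simp add: S.m_assoc[symmetric])
  also have "\<dots> = germ F x U (e [^]\<^bsub>R\<^esub> n)" using e by (simp add: gU.ring.hom_nat_pow)
  finally have z: "germ F x U (f \<otimes>\<^bsub>R\<^esub> b \<ominus>\<^bsub>R\<^esub> e [^]\<^bsub>R\<^esub> n) = \<zero>\<^bsub>S\<^esub>"
    using fR b e by (simp add: a_minus_def S.r_neg)
  have dR: "f \<otimes>\<^bsub>R\<^esub> b \<ominus>\<^bsub>R\<^esub> e [^]\<^bsub>R\<^esub> n \<in> carrier R" using fR b e by simp
  obtain W where W: "nbhd W" "W \<subseteq> U" "res F U W (f \<otimes>\<^bsub>R\<^esub> b \<ominus>\<^bsub>R\<^esub> e [^]\<^bsub>R\<^esub> n) = \<zero>\<^bsub>sec F W\<^esub>"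
    using germ_eq_zero[OF nU dR z] by blast
  obtain c where c: "c \<in> carrier R" "x \<in> D c" "D c \<subseteq> W" using D_basis[of W x] W xU by blast
  let ?d = "f \<otimes>\<^bsub>R\<^esub> b \<ominus>\<^bsub>R\<^esub> e [^]\<^bsub>R\<^esub> n"
  interpret r: ring_hom_cring "sec F W" "sec F (D c)" "res F W (D c)"
    using W c D_open by (intro res_hom_cring) auto
  have "res F U (D c) ?d = res F W (D c) (res F U W ?d)"
    using U_open W c D_open dR by (intro res_res[symmetric]) auto
  then have "res F U (D c) ?d = \<zero>\<^bsub>sec F (D c)\<^esub>" using W by simp
  then obtain m where m: "c [^]\<^bsub>R\<^esub> (m::nat) \<otimes>\<^bsub>R\<^esub> ?d = \<zero>\<^bsub>R\<^esub>" using loc_zero[OF c(1) dR] by blast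
  have "c [^]\<^bsub>R\<^esub> m \<otimes>\<^bsub>R\<^esub> ?d \<in> h x" using m P.zero_closed by simp
  moreover have "c [^]\<^bsub>R\<^esub> m \<notin> h x" using prime_pow[OF P.primeideal c(1)] c(2) by (auto simp: D_def)
  ultimately have d: "?d \<in> h x" using P.I_prime c(1) dR by blast
  have "f \<otimes>\<^bsub>R\<^esub> b \<in> h x" using f b by (intro P.I_r_closed)
  then have "f \<otimes>\<^bsub>R\<^esub> b \<ominus>\<^bsub>R\<^esub> ?d \<in> h x" using d by (rule P.minus_mem)
  also have "f \<otimes>\<^bsub>R\<^esub> b \<ominus>\<^bsub>R\<^esub> ?d = e [^]\<^bsub>R\<^esub> n"
    using fR b e by (simp add: a_minus_def R.minus_add R.a_assoc[symmetric] R.r_neg)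
  finally show False using prime_pow[OF P.primeideal e(1)] e(2) by blast
qed

lemma germ_unit_iff: "f \<in> carrier R \<Longrightarrow> germ F x U f \<in> Units S \<longleftrightarrow> f \<notin> h x"
  using germ_unit germ_nonunit by blast

lemma stalk_max: "maximalideal (stalk_max_ideal F x) S"
  unfolding stalk_max_ideal_def
proof (rule S.nonunits_maximalideal)
  show "\<zero>\<^bsub>S\<^esub> \<notin> Units S" using germ_nonunit[OF P.zero_closed] by simp
  \<comment> \<open>Numerators of nonunit germs lie in the prime of \<open>x\<close>; over a common
    denominator this makes the nonunits closed under addition.\<close>
  have num: "b \<in> h x"
    if s: "s \<in> carrier S - Units S" and e: "e \<in> carrier R" "e \<notin> h x" and b: "b \<in> carrier R"
      and eq: "s \<otimes>\<^bsub>S\<^esub> germ F x U e [^]\<^bsub>S\<^esub> (n::nat) = germ F x U b" for s e b n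
  proof (rule ccontr)
    assume "b \<notin> h x"
    then have "s \<otimes>\<^bsub>S\<^esub> germ F x U e [^]\<^bsub>S\<^esub> n \<in> Units S" unfolding eq using germ_unit b by blast
    moreover have "germ F x U e [^]\<^bsub>S\<^esub> n \<in> carrier S" by (intro S.nat_pow_closed gU.hom_closed e(1))
    ultimately have "s \<in> Units S" using s S.unit_factor[of s] by blast
    with s show False by simp
  qed
  fix s t assume s: "s \<in> carrier S - Units S" and t: "t \<in> carrier S - Units S"
  have sc: "s \<in> carrier S" and tc: "t \<in> carrier S" using s t by auto
  obtain e b n where e: "e \<in> carrier R" "e \<notin> h x" and b: "b \<in> carrier R"
    and eb: "s \<otimes>\<^bsub>S\<^esub> germ F x U e [^]\<^bsub>S\<^esub> (n::nat) = germ F x U b"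
    using sc nU by (rule stalk_frac)
  obtain f c m where f: "f \<in> carrier R" "f \<notin> h x" and c: "c \<in> carrier R"
    and fc: "t \<otimes>\<^bsub>S\<^esub> germ F x U f [^]\<^bsub>S\<^esub> (m::nat) = germ F x U c"
    using tc nU by (rule stalk_frac)
  let ?E = "germ F x U e [^]\<^bsub>S\<^esub> n" and ?F = "germ F x U f [^]\<^bsub>S\<^esub> m"
  have EF: "?E \<in> carrier S" "?F \<in> carrier S" using e f by auto
  have bc: "b \<in> h x" "c \<in> h x" using num[OF s e b eb] num[OF t f c fc] by auto
  show "s \<oplus>\<^bsub>S\<^esub> t \<notin> Units S"
  proof
    assume u: "s \<oplus>\<^bsub>S\<^esub> t \<in> Units S"
    have "(s \<oplus>\<^bsub>S\<^esub> t) \<otimes>\<^bsub>S\<^esub> (?E \<otimes>\<^bsub>S\<^esub> ?F) = (s \<otimes>\<^bsub>S\<^esub> ?E) \<otimes>\<^bsub>S\<^esub> ?F \<oplus>\<^bsub>S\<^esub> (t \<otimes>\<^bsub>S\<^esub> ?F) \<otimes>\<^bsub>S\<^esub> ?E"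
      using s t EF by (simp add: S.l_distr S.m_ac)
    also have "\<dots> = germ F x U (b \<otimes>\<^bsub>R\<^esub> f [^]\<^bsub>R\<^esub> m \<oplus>\<^bsub>R\<^esub> c \<otimes>\<^bsub>R\<^esub> e [^]\<^bsub>R\<^esub> n)"
      unfolding eb fc using b c e f by (simp add: gU.ring.hom_nat_pow)
    finally have eq: "(s \<oplus>\<^bsub>S\<^esub> t) \<otimes>\<^bsub>S\<^esub> (?E \<otimes>\<^bsub>S\<^esub> ?F) =
      germ F x U (b \<otimes>\<^bsub>R\<^esub> f [^]\<^bsub>R\<^esub> m \<oplus>\<^bsub>R\<^esub> c \<otimes>\<^bsub>R\<^esub> e [^]\<^bsub>R\<^esub> n)" .
    have "b \<otimes>\<^bsub>R\<^esub> f [^]\<^bsub>R\<^esub> m \<oplus>\<^bsub>R\<^esub> c \<otimes>\<^bsub>R\<^esub> e [^]\<^bsub>R\<^esub> n \<in> h x"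
      using bc e f by (intro P.a_closed P.I_r_closed) auto
    from germ_nonunit[OF this] have "(s \<oplus>\<^bsub>S\<^esub> t) \<otimes>\<^bsub>S\<^esub> (?E \<otimes>\<^bsub>S\<^esub> ?F) \<notin> Units S" unfolding eq .
    moreover have "?E \<in> Units S" "?F \<in> Units S" using germ_unit e f by (auto intro: S.Units_pow_closed)
    ultimately have "(s \<oplus>\<^bsub>S\<^esub> t) \<otimes>\<^bsub>S\<^esub> (?E \<otimes>\<^bsub>S\<^esub> ?F) \<in> Units S" by (intro S.Units_m_closed u)
    with \<open>(s \<oplus>\<^bsub>S\<^esub> t) \<otimes>\<^bsub>S\<^esub> (?E \<otimes>\<^bsub>S\<^esub> ?F) \<notin> Units S\<close> show False by simp
  qed
qed

end

lemma scheme_stalk_max: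
  assumes "is_scheme F" "x \<in> topspace (top_of F)"
  shows "maximalideal (stalk_max_ideal F x) (stalk F x)"
proof -
  interpret presheaf_point F x
    using assms sheaf_imp_presheaf unfolding is_scheme_def presheaf_point_def presheaf_point_axioms_def by blast
  obtain U where U: "x \<in> U" "affine_open F U" using assms unfolding is_scheme_def by blast
  obtain h where "affine_chart F U h" using U(2) by (rule affine_openE)
  then interpret affine_chart F U h .
  interpret affine_point F U h x by unfold_locales (rule U(1))
  show ?thesis by (rule stalk_max)
qed

section \<open>Integral schemes\<close>

locale integral_sch = ring_presheaf F for F :: "('p, 'a, 'm) ringed_space_scheme" +
  assumes scheme: "is_scheme F" and integral: "integral_scheme F"
begin

lemma sheaf: "sheaf_of_rings F" using scheme by (simp add: is_scheme_def)

lemma sec_domain: "opn U \<Longrightarrow> U \<noteq> {} \<Longrightarrow> domain (sec F U)"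
  using integral by (simp add: integral_scheme_def)

lemma sheaf_covers:
  assumes "\<And>V. V \<in> \<U> \<Longrightarrow> opn V"
  shows "(\<forall>f\<in>carrier (sec F (\<Union>\<U>)). \<forall>g\<in>carrier (sec F (\<Union>\<U>)).
      (\<forall>V\<in>\<U>. res F (\<Union>\<U>) V f = res F (\<Union>\<U>) V g) \<longrightarrow> f = g) \<and>
    (\<forall>s. (\<forall>V\<in>\<U>. s V \<in> carrier (sec F V)) \<and>
       (\<forall>V\<in>\<U>. \<forall>W\<in>\<U>. res F V (V \<inter> W) (s V) = res F W (V \<inter> W) (s W)) \<longrightarrow>
       (\<exists>f\<in>carrier (sec F (\<Union>\<U>)). \<forall>V\<in>\<U>. res F (\<Union>\<U>) V f = s V))"
proof -
  note sh = sheaf[unfolded sheaf_of_rings_def, THEN conjunct2, THEN conjunct2, THEN conjunct2,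
      THEN conjunct2, THEN spec, of \<U>]
  show ?thesis by (rule mp[OF sh]) (use assms in blast)
qed

lemma separation:
  assumes "\<And>V. V \<in> \<U> \<Longrightarrow> opn V" "f \<in> carrier (sec F (\<Union>\<U>))" "g \<in> carrier (sec F (\<Union>\<U>))"
    "\<And>V. V \<in> \<U> \<Longrightarrow> res F (\<Union>\<U>) V f = res F (\<Union>\<U>) V g"
  shows "f = g"
  using sheaf_covers[OF assms(1), THEN conjunct1] assms(2-) by blast

lemma glue:
  assumes "\<And>V. V \<in> \<U> \<Longrightarrow> opn V" "\<And>V. V \<in> \<U> \<Longrightarrow> s V \<in> carrier (sec F V)"
    "\<And>V W. V \<in> \<U> \<Longrightarrow> W \<in> \<U> \<Longrightarrow> res F V (V \<inter> W) (s V) = res F W (V \<inter> W) (s W)"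
  shows "\<exists>f\<in>carrier (sec F (\<Union>\<U>)). \<forall>V\<in>\<U>. res F (\<Union>\<U>) V f = s V"
  by (rule sheaf_covers[OF assms(1), THEN conjunct2, THEN spec, THEN mp]) (use assms(2,3) in blast)+

text \<open>The empty family covers the empty set, so separation leaves room for a single
  section.\<close>

lemma sec_empty: "f \<in> carrier (sec F {}) \<Longrightarrow> g \<in> carrier (sec F {}) \<Longrightarrow> f = g"
  using separation[of "{}" f g] by simp

text \<open>On a disjoint union the sections glued from (1, 0) and (0, 1) would be zero
  divisors.\<close>

lemma opens_meet:
  assumes "opn U" "opn V" "U \<noteq> {}" "V \<noteq> {}"
  shows "U \<inter> V \<noteq> {}"
proof
  assume I: "U \<inter> V = {}"
  have UV: "U \<noteq> V" using I assms by auto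
  interpret U: domain "sec F U" by (rule sec_domain[OF assms(1,3)])
  interpret V: domain "sec F V" by (rule sec_domain[OF assms(2,4)])
  have o: "opn (U \<union> V)" using assms by (intro openin_Un)
  interpret W: domain "sec F (U \<union> V)" by (rule sec_domain[OF o]) (use assms in auto)
  interpret rU: ring_hom_cring "sec F (U \<union> V)" "sec F U" "res F (U \<union> V) U"
    using o assms by (intro res_hom_cring) auto
  interpret rV: ring_hom_cring "sec F (U \<union> V)" "sec F V" "res F (U \<union> V) V"
    using o assms by (intro res_hom_cring) auto
  have e0: "opn {}" by simp
  have ex: "\<exists>f\<in>carrier (sec F (U \<union> V)). res F (U \<union> V) U f = a \<and> res F (U \<union> V) V f = b"
    if "a \<in> carrier (sec F U)" "b \<in> carrier (sec F V)" for a b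
  proof -
    let ?s = "\<lambda>W. if W = U then a else b"
    have rc: "res F U {} a \<in> carrier (sec F {})" "res F V {} b \<in> carrier (sec F {})"
      using that assms by (auto intro!: res_closed)
    have "\<exists>f\<in>carrier (sec F (\<Union>{U, V})). \<forall>W\<in>{U, V}. res F (\<Union>{U, V}) W f = ?s W"
    proof (rule glue)
      fix W Z assume "W \<in> {U, V}" "Z \<in> {U, V}"
      then show "res F W (W \<inter> Z) (?s W) = res F Z (W \<inter> Z) (?s Z)"
        using UV I sec_empty[OF rc] by (auto simp: Int_commute)
    qed (use that assms UV in auto)
    then show ?thesis using UV by auto
  qed
  obtain f where f: "f \<in> carrier (sec F (U \<union> V))" "res F (U \<union> V) U f = \<one>\<^bsub>sec F U\<^esub>" "res F (U \<union> V) V f = \<zero>\<^bsub>sec F V\<^esub>"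
    using ex[OF U.one_closed V.zero_closed] by blast
  obtain g where g: "g \<in> carrier (sec F (U \<union> V))" "res F (U \<union> V) U g = \<zero>\<^bsub>sec F U\<^esub>" "res F (U \<union> V) V g = \<one>\<^bsub>sec F V\<^esub>"
    using ex[OF U.zero_closed V.one_closed] by blast
  have "f \<otimes>\<^bsub>sec F (U \<union> V)\<^esub> g = \<zero>\<^bsub>sec F (U \<union> V)\<^esub>"
  proof (rule separation[of "{U, V}", simplified])
    show "opn W" if "W = U \<or> W = V" for W using that assms by auto
    show "res F (U \<union> V) W (f \<otimes>\<^bsub>sec F (U \<union> V)\<^esub> g) = res F (U \<union> V) W \<zero>\<^bsub>sec F (U \<union> V)\<^esub>" if "W = U \<or> W = V" for W
      using that f g by auto
  qed (use f g in auto)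
  then have "f = \<zero>\<^bsub>sec F (U \<union> V)\<^esub> \<or> g = \<zero>\<^bsub>sec F (U \<union> V)\<^esub>" using W.integral f g by blast
  then show False using f g by auto
qed

text \<open>Near any point of \<open>U\<close> the section is a fraction with numerator
  \<open>b\<close> on a basic open set D(e) of a chart. It vanishes on a basic open set D(c) inside
  \<open>V\<close> and D(e), so a power of \<open>c\<close> kills \<open>b\<close>, and
  \<open>b\<close> is zero because sections over the chart form a domain. Hence the section vanishes
  near every point of \<open>U\<close>, and separation applies.\<close>

lemma res_inj:
  assumes U: "opn U" and V: "opn V" "V \<subseteq> U" "V \<noteq> {}" and f: "f \<in> carrier (sec F U)"
    and z: "res F U V f = \<zero>\<^bsub>sec F V\<^esub>"
  shows "f = \<zero>\<^bsub>sec F U\<^esub>"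
proof -
  have local: "\<exists>E. opn E \<and> E \<subseteq> U \<and> x \<in> E \<and> res F U E f = \<zero>\<^bsub>sec F E\<^esub>" if x: "x \<in> U" for x
  proof -
    have "x \<in> topspace (top_of F)" using x U openin_subset by blast
    then obtain W where W: "x \<in> W" "affine_open F W" using scheme unfolding is_scheme_def by blast
    obtain h where "affine_chart F W h" using W(2) by (rule affine_openE)
    then interpret W: affine_chart F W h .
    interpret Wd: domain "sec F W" using W sec_domain[OF W.U_open] by auto
    obtain e where e: "e \<in> carrier W.R" "x \<in> W.D e" "W.D e \<subseteq> U" using W.D_basis[OF U x W(1)] by blast
    let ?E = "W.D e"
    have Eo: "opn ?E" by (rule W.D_open[OF e(1)])
    interpret E: cring "sec F ?E" by (rule sec_cring[OF Eo])
    have "V \<inter> ?E \<noteq> {}" using opens_meet[OF V(1) Eo V(3)] e by blast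
    then obtain z where z': "z \<in> V \<inter> ?E" by blast
    have VE: "opn (V \<inter> ?E)" using V(1) Eo by (rule openin_Int)
    obtain c where c: "c \<in> carrier W.R" "z \<in> W.D c" "W.D c \<subseteq> V \<inter> ?E"
      using W.D_basis[OF VE z'] z' by (auto simp: W.D_def)
    let ?C = "W.D c"
    have Co: "opn ?C" by (rule W.D_open[OF c(1)])
    interpret EC: ring_hom_cring "sec F ?E" "sec F ?C" "res F ?E ?C" using Eo Co c by (intro res_hom_cring) auto
    interpret VC: ring_hom_cring "sec F V" "sec F ?C" "res F V ?C" using V Co c by (intro res_hom_cring) auto
    have fE: "res F U ?E f \<in> carrier (sec F ?E)" using U Eo e f by (intro res_closed)
    have eE: "res F W ?E e \<in> carrier (sec F ?E)" using W.U_open Eo e W.D_sub by (intro res_closed)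
    obtain b n where b: "b \<in> carrier W.R"
      "res F U ?E f \<otimes>\<^bsub>sec F ?E\<^esub> res F W ?E e [^]\<^bsub>sec F ?E\<^esub> (n::nat) = res F W ?E b"
      using W.loc_frac[OF e(1) fE] by blast
    have "res F ?E ?C (res F U ?E f) = res F U ?C f" using U Eo Co e c f by (intro res_res) auto
    also have "\<dots> = res F V ?C (res F U V f)" using U V Co c f by (intro res_res[symmetric]) auto
    also have "\<dots> = \<zero>\<^bsub>sec F ?C\<^esub>" unfolding z by simp
    finally have fC: "res F ?E ?C (res F U ?E f) = \<zero>\<^bsub>sec F ?C\<^esub>" .
    have "res F W ?C b = res F ?E ?C (res F W ?E b)"
      using W.U_open Eo Co c b W.D_sub by (intro res_res[symmetric]) auto
    also have "\<dots> = \<zero>\<^bsub>sec F ?C\<^esub>" unfolding b(2)[symmetric] using fE eE fC by simp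
    finally obtain m where m: "c [^]\<^bsub>W.R\<^esub> (m::nat) \<otimes>\<^bsub>W.R\<^esub> b = \<zero>\<^bsub>W.R\<^esub>" using W.loc_zero[OF c(1) b(1)] by blast
    have "c [^]\<^bsub>W.R\<^esub> m \<noteq> \<zero>\<^bsub>W.R\<^esub>" using W.zero_notin_D[OF c(2)] c(1)
      by (induction m) (auto simp: Wd.integral_iff)
    then have b0: "b = \<zero>\<^bsub>W.R\<^esub>" using m Wd.integral c(1) b(1) by blast
    interpret WE: ring_hom_cring "sec F W" "sec F ?E" "res F W ?E"
      using W.U_open Eo W.D_sub by (intro res_hom_cring) auto
    have u: "res F W ?E e [^]\<^bsub>sec F ?E\<^esub> n \<in> Units (sec F ?E)"
      using W.loc_unit[OF e(1)] by (rule E.Units_pow_closed)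
    have "res F U ?E f \<otimes>\<^bsub>sec F ?E\<^esub> res F W ?E e [^]\<^bsub>sec F ?E\<^esub> n = \<zero>\<^bsub>sec F ?E\<^esub>"
      unfolding b(2) b0 by simp
    then have "res F U ?E f \<otimes>\<^bsub>sec F ?E\<^esub> res F W ?E e [^]\<^bsub>sec F ?E\<^esub> n \<otimes>\<^bsub>sec F ?E\<^esub> inv\<^bsub>sec F ?E\<^esub> (res F W ?E e [^]\<^bsub>sec F ?E\<^esub> n) = \<zero>\<^bsub>sec F ?E\<^esub>"
      using u by simp
    then have "res F U ?E f = \<zero>\<^bsub>sec F ?E\<^esub>" using u fE eE by (simp add: E.m_assoc)
    with Eo e show ?thesis by blast
  qed
  define \<U> where "\<U> = {E. opn E \<and> E \<subseteq> U \<and> res F U E f = \<zero>\<^bsub>sec F E\<^esub>}"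
  have UU: "\<Union>\<U> = U" using local unfolding \<U>_def by blast
  interpret Uc: cring "sec F U" by (rule sec_cring[OF U])
  have "f = \<zero>\<^bsub>sec F (\<Union>\<U>)\<^esub>"
  proof (rule separation[of \<U>])
    fix E assume E: "E \<in> \<U>"
    then interpret r: ring_hom_cring "sec F U" "sec F E" "res F U E"
      using U by (intro res_hom_cring) (auto simp: \<U>_def)
    show "res F (\<Union>\<U>) E f = res F (\<Union>\<U>) E \<zero>\<^bsub>sec F (\<Union>\<U>)\<^esub>" unfolding UU using E by (simp add: \<U>_def)
  qed (use f UU in \<open>auto simp: \<U>_def\<close>)
  then show ?thesis by (simp add: UU)
qed

end

section \<open>Reduction of a graded algebra modulo a maximal ideal of the base\<close>

text \<open>Multiplying a combination with coefficients in \<open>\<nn>\<close> by \<open>c\<close>,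
  and expanding each product of \<open>c\<close> with a generator again in the generators, keeps the
  coefficients in \<open>\<nn>\<close>. So such combinations form an ideal.\<close>

lemma (in ring_hom_cring) genideal_image_span:
  assumes n: "ideal \<nn> R" and "finite E" and g: "\<And>e. e \<in> E \<Longrightarrow> g e \<in> carrier S"
    and span: "\<And>c. c \<in> carrier S \<Longrightarrow> \<exists>b\<in>E \<rightarrow> carrier R. c = (\<Oplus>\<^bsub>S\<^esub>e\<in>E. h (b e) \<otimes>\<^bsub>S\<^esub> g e)"
  shows "genideal S (h ` \<nn>) \<subseteq> {(\<Oplus>\<^bsub>S\<^esub>e\<in>E. h (b e) \<otimes>\<^bsub>S\<^esub> g e) | b. b \<in> E \<rightarrow> \<nn>}" (is "_ \<subseteq> ?M")
proof (rule S.genideal_minimal)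
  interpret n: ideal \<nn> R by fact
  let ?s = "\<lambda>b. \<Oplus>\<^bsub>S\<^esub>e\<in>E. h (b e) \<otimes>\<^bsub>S\<^esub> g e"
  have nc: "b e \<in> carrier R" if "b \<in> E \<rightarrow> \<nn>" "e \<in> E" for b e using that n.Icarr by blast
  have scale: "?s (\<lambda>e. r \<otimes> b e) = h r \<otimes>\<^bsub>S\<^esub> ?s b" if r: "r \<in> carrier R" and b: "\<And>e. e \<in> E \<Longrightarrow> b e \<in> carrier R" for r b
  proof -
    have "h r \<otimes>\<^bsub>S\<^esub> ?s b = (\<Oplus>\<^bsub>S\<^esub>e\<in>E. h r \<otimes>\<^bsub>S\<^esub> (h (b e) \<otimes>\<^bsub>S\<^esub> g e))"
      using r b g \<open>finite E\<close> by (intro S.finsum_rdistr) auto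
    also have "\<dots> = ?s (\<lambda>e. r \<otimes> b e)"
      using r b g by (intro S.finsum_cong') (auto simp: S.m_assoc)
    finally show ?thesis ..
  qed
  have add: "?s (\<lambda>e. b e \<oplus> c e) = ?s b \<oplus>\<^bsub>S\<^esub> ?s c"
    if b: "\<And>e. e \<in> E \<Longrightarrow> b e \<in> carrier R" and c: "\<And>e. e \<in> E \<Longrightarrow> c e \<in> carrier R" for b c
  proof -
    have "?s b \<oplus>\<^bsub>S\<^esub> ?s c = (\<Oplus>\<^bsub>S\<^esub>e\<in>E. h (b e) \<otimes>\<^bsub>S\<^esub> g e \<oplus>\<^bsub>S\<^esub> h (c e) \<otimes>\<^bsub>S\<^esub> g e)"
      using b c g by (intro S.finsum_addf[symmetric]) auto
    also have "\<dots> = ?s (\<lambda>e. b e \<oplus> c e)"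
      using b c g by (intro S.finsum_cong') (auto simp: S.l_distr)
    finally show ?thesis ..
  qed
  have zero: "?s (\<lambda>e. \<zero>) = \<zero>\<^bsub>S\<^esub>" using g by (intro S.add.finprod_one_eqI) simp
  have sc: "?s b \<in> carrier S" if "b \<in> E \<rightarrow> \<nn>" for b
    using nc[OF that] g by (intro S.finsum_closed) auto
  have M_scale: "h r \<otimes>\<^bsub>S\<^esub> c \<in> ?M" if r: "r \<in> \<nn>" and c: "c \<in> carrier S" for r c
  proof -
    obtain b where b: "b \<in> E \<rightarrow> carrier R" "c = ?s b" using span[OF c] by blast
    then have bc: "b e \<in> carrier R" if "e \<in> E" for e using that by blast
    have "h r \<otimes>\<^bsub>S\<^esub> c = ?s (\<lambda>e. r \<otimes> b e)" unfolding b(2) by (rule scale[symmetric, OF n.Icarr[OF r] bc])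
    moreover have "(\<lambda>e. r \<otimes> b e) \<in> E \<rightarrow> \<nn>" by (intro funcsetI n.I_r_closed[OF r] bc)
    ultimately show ?thesis by (intro CollectI exI[of _ "\<lambda>e. r \<otimes> b e"] conjI)
  qed
  have M_add: "a \<oplus>\<^bsub>S\<^esub> b \<in> ?M" if "a \<in> ?M" "b \<in> ?M" for a b
  proof -
    obtain c d where c: "c \<in> E \<rightarrow> \<nn>" "a = ?s c" and d: "d \<in> E \<rightarrow> \<nn>" "b = ?s d" using \<open>a \<in> ?M\<close> \<open>b \<in> ?M\<close> by blast
    have "a \<oplus>\<^bsub>S\<^esub> b = ?s (\<lambda>e. c e \<oplus> d e)" unfolding c(2) d(2) by (rule add[symmetric, OF nc[OF c(1)] nc[OF d(1)]])
    moreover have "(\<lambda>e. c e \<oplus> d e) \<in> E \<rightarrow> \<nn>" by (intro funcsetI n.a_closed funcset_mem[OF c(1)] funcset_mem[OF d(1)])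
    ultimately show ?thesis by (intro CollectI exI[of _ "\<lambda>e. c e \<oplus> d e"] conjI)
  qed
  have M_zero: "\<zero>\<^bsub>S\<^esub> \<in> ?M"
  proof -
    have "(\<lambda>e. \<zero>) \<in> E \<rightarrow> \<nn>" by simp
    with zero[symmetric] show ?thesis by (intro CollectI exI[of _ "\<lambda>e. \<zero>"] conjI)
  qed
  show "ideal ?M S"
  proof (rule S.idealI')
    show "?M \<subseteq> carrier S" using sc by blast
    show "\<zero>\<^bsub>S\<^esub> \<in> ?M" by (rule M_zero)
    show "a \<oplus>\<^bsub>S\<^esub> b \<in> ?M" if "a \<in> ?M" "b \<in> ?M" for a b by (rule M_add[OF that])
    fix a c assume "a \<in> ?M" and c: "c \<in> carrier S"
    then obtain b where b: "b \<in> E \<rightarrow> \<nn>" "a = ?s b" by blast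
    have "c \<otimes>\<^bsub>S\<^esub> a = (\<Oplus>\<^bsub>S\<^esub>e\<in>E. c \<otimes>\<^bsub>S\<^esub> (h (b e) \<otimes>\<^bsub>S\<^esub> g e))"
      unfolding b(2) using nc[OF b(1)] g c \<open>finite E\<close> by (intro S.finsum_rdistr) auto
    also have "\<dots> = (\<Oplus>\<^bsub>S\<^esub>e\<in>E. h (b e) \<otimes>\<^bsub>S\<^esub> (c \<otimes>\<^bsub>S\<^esub> g e))"
      using nc[OF b(1)] g c by (intro S.finsum_cong') (auto simp: S.m_lcomm)
    also have "\<dots> \<in> ?M"
    proof -
      \<comment> \<open>Each summand is an element of \<open>\<nn>\<close> times some element of
        \<open>S\<close>, which \<open>M_scale\<close> expands again.\<close>
      have "finsum S (\<lambda>e. h (b e) \<otimes>\<^bsub>S\<^esub> (c \<otimes>\<^bsub>S\<^esub> g e)) E' \<in> ?M" if "finite E'" "E' \<subseteq> E" for E'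
        using that
      proof (induction E' rule: finite_induct)
        case empty then show ?case using M_zero by simp
      next
        case (insert e E')
        then have e: "e \<in> E" and E': "E' \<subseteq> E" by auto
        have "(\<lambda>e. h (b e) \<otimes>\<^bsub>S\<^esub> (c \<otimes>\<^bsub>S\<^esub> g e)) \<in> E' \<rightarrow> carrier S"
          "h (b e) \<otimes>\<^bsub>S\<^esub> (c \<otimes>\<^bsub>S\<^esub> g e) \<in> carrier S" using nc[OF b(1)] g c e E' by auto
        then have "finsum S (\<lambda>e. h (b e) \<otimes>\<^bsub>S\<^esub> (c \<otimes>\<^bsub>S\<^esub> g e)) (insert e E') =
          h (b e) \<otimes>\<^bsub>S\<^esub> (c \<otimes>\<^bsub>S\<^esub> g e) \<oplus>\<^bsub>S\<^esub> finsum S (\<lambda>e. h (b e) \<otimes>\<^bsub>S\<^esub> (c \<otimes>\<^bsub>S\<^esub> g e)) E'"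
          using insert by (simp add: S.finsum_insert)
        moreover have "h (b e) \<otimes>\<^bsub>S\<^esub> (c \<otimes>\<^bsub>S\<^esub> g e) \<in> ?M"
          using b(1) e g[OF e] c by (intro M_scale) auto
        ultimately show ?case using insert.IH[OF E'] by (simp only: M_add)
      qed
      from this[OF \<open>finite E\<close> order_refl] show ?thesis .
    qed
    finally show "c \<otimes>\<^bsub>S\<^esub> a \<in> ?M" .
  qed
  show "h ` \<nn> \<subseteq> ?M"
  proof (rule image_subsetI)
    fix r assume r: "r \<in> \<nn>"
    have "h r \<otimes>\<^bsub>S\<^esub> \<one>\<^bsub>S\<^esub> \<in> ?M" by (rule M_scale[OF r S.one_closed])
    then show "h r \<in> ?M" using n.Icarr[OF r] by simp
  qed
qed

lemma (in cring) quot_primeideal: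
  assumes "ideal I R" and P: "primeideal P R" and "I \<subseteq> P"
  shows "primeideal ((+>) I ` P) (R Quot I)"
proof -
  interpret I: ideal I R by fact
  interpret P: primeideal P R by fact
  interpret Q: cring "R Quot I" by (rule I.quotient_is_cring[OF cring_axioms])
  interpret \<pi>: ring_hom_cring R "R Quot I" "(+>) I" by (rule I.rcos_ring_hom_cring[OF cring_axioms])
  have mem: "a \<in> P" if "I +> a \<in> (+>) I ` P" "a \<in> carrier R" for a
  proof -
    obtain p where p: "p \<in> P" "I +> a = I +> p" using \<open>I +> a \<in> _\<close> by blast
    then have "a \<ominus> p \<in> P" using I.coset_eq_iff[OF that(2) P.Icarr] assms(3) by blast
    then have "a \<ominus> p \<oplus> p \<in> P" using p(1) by (rule P.a_closed)
    then show ?thesis using that(2) P.Icarr[OF p(1)] by (simp add: a_minus_def a_assoc l_neg)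
  qed
  show ?thesis
  proof (rule primeidealI)
    show "ideal ((+>) I ` P) (R Quot I)" by (rule ring_ideal_imp_quot_ideal[OF assms(1) P.is_ideal])
    show "cring (R Quot I)" by (rule Q.cring_axioms)
    show "carrier (R Quot I) \<noteq> (+>) I ` P"
    proof
      assume "carrier (R Quot I) = (+>) I ` P"
      then have "I +> \<one> \<in> (+>) I ` P" using \<pi>.hom_closed[OF one_closed] by simp
      then have "\<one> \<in> P" using mem by blast
      then show False using P.one_imp_carrier P.I_notcarr by blast
    qed
    fix c d assume cd: "c \<in> carrier (R Quot I)" "d \<in> carrier (R Quot I)" "c \<otimes>\<^bsub>R Quot I\<^esub> d \<in> (+>) I ` P"
    then obtain a b where ab: "a \<in> carrier R" "b \<in> carrier R" "c = I +> a" "d = I +> b"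
      by (auto simp: I.Quot_carrier)
    have "I +> (a \<otimes> b) \<in> (+>) I ` P" using cd(3) unfolding ab(3,4) \<pi>.hom_mult[OF ab(1,2)] .
    then have "a \<otimes> b \<in> P" using ab by (intro mem) auto
    then have "a \<in> P \<or> b \<in> P" using P.I_prime ab by blast
    then show "c \<in> (+>) I ` P \<or> d \<in> (+>) I ` P" using ab by blast
  qed
qed

text \<open>In the application \<open>B\<close> is the local ring at y with maximal ideal
  \<open>\<nn>\<close>, \<open>A\<close> the stalk at y of the direct image, and \<open>P\<close>
  the prime of \<open>A\<close> that belongs to x.\<close>

locale graded_reduction = graded_algebra \<Lambda> A B \<phi> \<rho>
  for \<Lambda> :: "('l, 'n) monoid_scheme" and A :: "('a, 'm) ring_scheme" and B :: "('r, 'x) ring_scheme"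
    and \<phi> :: "'r \<Rightarrow> 'a" and \<rho> :: "'a \<Rightarrow> 'l \<Rightarrow> 'a" +
  fixes \<nn> :: "'r set" and P :: "'a set"
  assumes n_max: "maximalideal \<nn> B" and degree_one: "homog \<one>\<^bsub>\<Lambda>\<^esub> \<subseteq> \<phi> ` carrier B"
    and P_prime: "primeideal P A" and n_P: "\<phi> ` \<nn> \<subseteq> P"
begin

definition J :: "'a set" where "J = genideal A (\<phi> ` \<nn>)"

abbreviation "K \<equiv> B Quot \<nn>"
abbreviation "Abar \<equiv> A Quot J"

definition phibar :: "'r set \<Rightarrow> 'a set" where "phibar c = (\<Union>b\<in>c. a_r_coset A J (\<phi> b))"

sublocale n: maximalideal \<nn> B by (rule n_max)
sublocale P: primeideal P A by (rule P_prime)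
sublocale phi: ring_hom_cring B A \<phi> by unfold_locales (rule phi_hom)

lemma n_sub: "\<phi> ` \<nn> \<subseteq> carrier A"
  using n.Icarr by auto

sublocale J: ideal J A
  unfolding J_def by (rule R.genideal_ideal[OF n_sub])

lemma n_J: "r \<in> \<nn> \<Longrightarrow> \<phi> r \<in> J"
  unfolding J_def using R.genideal_self[OF n_sub] by blast

lemma J_P: "J \<subseteq> P"
  unfolding J_def by (rule R.genideal_minimal[OF P.is_ideal n_P])

text \<open>The generators have trivial degree, so they lie in the set of those elements of
  \<open>J\<close> whose components are all in \<open>J\<close>, and that set is an ideal.\<close>

lemma J_graded: "graded_ideal \<Lambda> A \<rho> J"
proof -
  let ?N = "{a \<in> J. \<forall>l\<in>carrier \<Lambda>. \<rho> a l \<in> J}"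
  have "ideal ?N A"
  proof (rule R.idealI')
    show "?N \<subseteq> carrier A" using J.Icarr by blast
    have "\<rho> \<zero>\<^bsub>A\<^esub> l \<in> J" if "l \<in> carrier \<Lambda>" for l using that J.zero_closed by (simp add: ga_zero)
    then show "\<zero>\<^bsub>A\<^esub> \<in> ?N" using J.zero_closed by blast
    fix a b assume a: "a \<in> ?N"
    then have ac: "a \<in> carrier A" using J.Icarr by blast
    show "a \<oplus>\<^bsub>A\<^esub> b \<in> ?N" if b: "b \<in> ?N"
    proof -
      have bc: "b \<in> carrier A" using b J.Icarr by blast
      have "\<rho> (a \<oplus>\<^bsub>A\<^esub> b) l \<in> J" if l: "l \<in> carrier \<Lambda>" for l
        unfolding rho_add[OF ac bc l] using a b l J.a_closed by blast
      then show ?thesis using a b J.a_closed by blast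
    qed
    assume b: "b \<in> carrier A"
    have "\<rho> (b \<otimes>\<^bsub>A\<^esub> a) l \<in> J" if l: "l \<in> carrier \<Lambda>" for l
      unfolding rho_mult[OF b ac l]
    proof (rule J.finsum_mem[OF L.fin])
      fix m assume m: "m \<in> carrier \<Lambda>"
      have "inv\<^bsub>\<Lambda>\<^esub> m \<otimes>\<^bsub>\<Lambda>\<^esub> l \<in> carrier \<Lambda>" using m l by simp
      then have "\<rho> a (inv\<^bsub>\<Lambda>\<^esub> m \<otimes>\<^bsub>\<Lambda>\<^esub> l) \<in> J" using a by blast
      then show "\<rho> b m \<otimes>\<^bsub>A\<^esub> \<rho> a (inv\<^bsub>\<Lambda>\<^esub> m \<otimes>\<^bsub>\<Lambda>\<^esub> l) \<in> J" by (rule J.I_l_closed[OF _ rho_closed[OF b m]])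
    qed
    then show "b \<otimes>\<^bsub>A\<^esub> a \<in> ?N" using J.I_l_closed[OF _ b] a by blast
  qed
  moreover have "\<phi> ` \<nn> \<subseteq> ?N"
  proof (rule image_subsetI)
    fix r assume r: "r \<in> \<nn>"
    have rc: "r \<in> carrier B" by (rule n.Icarr[OF r])
    have "\<rho> (\<phi> r) l \<in> J" if "l \<in> carrier \<Lambda>" for l
      using that n_J[OF r] J.zero_closed by (simp add: rho_phi[OF rc] ga_const_def)
    then show "\<phi> r \<in> ?N" using n_J[OF r] by blast
  qed
  ultimately have "J \<subseteq> ?N" by (subst (1) J_def) (rule R.genideal_minimal)
  then show ?thesis using J.is_ideal unfolding graded_ideal_def by blast
qed

lemma phibar_coset: "b \<in> carrier B \<Longrightarrow> phibar (a_r_coset B \<nn> b) = a_r_coset A J (\<phi> b)"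
  unfolding phibar_def
proof (rule n.UN_coset)
  fix b c assume b: "b \<in> carrier B" and c: "c \<in> carrier B" "c \<ominus>\<^bsub>B\<^esub> b \<in> \<nn>"
  have "\<phi> (c \<ominus>\<^bsub>B\<^esub> b) \<in> J" by (rule n_J[OF c(2)])
  also have "\<phi> (c \<ominus>\<^bsub>B\<^esub> b) = \<phi> c \<ominus>\<^bsub>A\<^esub> \<phi> b" using b c(1) by (simp add: a_minus_def)
  finally show "a_r_coset A J (\<phi> c) = a_r_coset A J (\<phi> b)"
    using b c(1) by (simp add: J.coset_eq_iff)
qed

lemma K_field: "field K"
  by (rule n.quotient_is_field[OF B.cring_axioms])

text \<open>The condition on trivial degree survives reduction because a class of trivial degree is
  the class of the trivial component of any representative. The quotient is nonzero because
  \<open>J\<close> lies in the prime \<open>P\<close>.\<close>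

lemma reduced_fibre: "graded_fibre \<Lambda> Abar K phibar (factor_coaction \<Lambda> A \<rho> J)"
proof -
  let ?f = "factor_coaction \<Lambda> A \<rho> J" and ?\<pi> = "a_r_coset A J"
  interpret K: field K by (rule K_field)
  interpret Q: cring Abar by (rule J.quotient_is_cring[OF R.cring_axioms])
  interpret p: ring_hom_cring A Abar ?\<pi> by (rule J.rcos_ring_hom_cring[OF R.cring_axioms])
  interpret nu: ring_hom_cring B K "a_r_coset B \<nn>" by (rule n.rcos_ring_hom_cring[OF B.cring_axioms])
  have fc: "coaction B \<Lambda> Abar (\<lambda>r. ?\<pi> (\<phi> r)) ?f" by (rule factor_is_coaction[OF J_graded])
  have "phibar \<in> ring_hom K Abar"
  proof (rule ring_hom_memI)
    fix c assume "c \<in> carrier K"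
    then obtain b where b: "b \<in> carrier B" "c = a_r_coset B \<nn> b" by (auto simp: n.Quot_carrier)
    show "phibar c \<in> carrier Abar" unfolding b(2) phibar_coset[OF b(1)] using b(1) by simp
    fix d assume "d \<in> carrier K"
    then obtain b' where b': "b' \<in> carrier B" "d = a_r_coset B \<nn> b'" by (auto simp: n.Quot_carrier)
    have "phibar (c \<otimes>\<^bsub>K\<^esub> d) = ?\<pi> (\<phi> (b \<otimes>\<^bsub>B\<^esub> b'))"
      unfolding b(2) b'(2) nu.hom_mult[OF b(1) b'(1), symmetric] using b(1) b'(1) by (intro phibar_coset) simp
    also have "\<dots> = ?\<pi> (\<phi> b) \<otimes>\<^bsub>Abar\<^esub> ?\<pi> (\<phi> b')" using b(1) b'(1) by (simp only: phi.hom_mult p.hom_mult phi_closed)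
    finally show "phibar (c \<otimes>\<^bsub>K\<^esub> d) = phibar c \<otimes>\<^bsub>Abar\<^esub> phibar d"
      unfolding b(2) b'(2) phibar_coset[OF b(1)] phibar_coset[OF b'(1)] .
    have "phibar (c \<oplus>\<^bsub>K\<^esub> d) = ?\<pi> (\<phi> (b \<oplus>\<^bsub>B\<^esub> b'))"
      unfolding b(2) b'(2) nu.hom_add[OF b(1) b'(1), symmetric] using b(1) b'(1) by (intro phibar_coset) simp
    also have "\<dots> = ?\<pi> (\<phi> b) \<oplus>\<^bsub>Abar\<^esub> ?\<pi> (\<phi> b')" using b(1) b'(1) by (simp only: phi.hom_add p.hom_add phi_closed)
    finally show "phibar (c \<oplus>\<^bsub>K\<^esub> d) = phibar c \<oplus>\<^bsub>Abar\<^esub> phibar d"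
      unfolding b(2) b'(2) phibar_coset[OF b(1)] phibar_coset[OF b'(1)] .
  next
    have "phibar \<one>\<^bsub>K\<^esub> = phibar (a_r_coset B \<nn> \<one>\<^bsub>B\<^esub>)" by simp
    then show "phibar \<one>\<^bsub>K\<^esub> = \<one>\<^bsub>Abar\<^esub>" by (simp add: phibar_coset del: nu.hom_one)
  qed
  moreover have "?f (phibar c) = ga_const \<Lambda> Abar (phibar c)" if c: "c \<in> carrier K" for c
  proof -
    obtain b where b: "b \<in> carrier B" "c = a_r_coset B \<nn> b" using c by (auto simp: n.Quot_carrier)
    with fc show ?thesis by (simp add: phibar_coset coaction_def)
  qed
  ultimately have coact: "coaction K \<Lambda> Abar phibar ?f" using fc by (simp add: coaction_def)
  interpret G: graded_algebra \<Lambda> Abar K phibar ?f by unfold_locales (rule coact)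
  show ?thesis
  proof unfold_locales
    show "G.homog \<one>\<^bsub>\<Lambda>\<^esub> \<subseteq> phibar ` carrier K"
    proof
      fix c assume c: "c \<in> G.homog \<one>\<^bsub>\<Lambda>\<^esub>"
      then obtain a where a: "a \<in> carrier A" "c = ?\<pi> a" using G.homogD(1) by (auto simp: J.Quot_carrier)
      have "c = ?f c \<one>\<^bsub>\<Lambda>\<^esub>" using G.homogD(2)[OF c L.one_closed] by simp
      also have "\<dots> = ?\<pi> (\<rho> a \<one>\<^bsub>\<Lambda>\<^esub>)"
        unfolding a(2) factor_coaction_coset[OF J_graded a(1)] by (simp add: ga_map_def)
      finally have c: "c = ?\<pi> (\<rho> a \<one>\<^bsub>\<Lambda>\<^esub>)" .
      obtain b where b: "b \<in> carrier B" "\<rho> a \<one>\<^bsub>\<Lambda>\<^esub> = \<phi> b"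
        using degree_one rho_homog[OF a(1) L.one_closed] by blast
      show "c \<in> phibar ` carrier K"
        using c b phibar_coset[OF b(1)] by (auto simp: n.Quot_carrier)
    qed
    show "\<one>\<^bsub>Abar\<^esub> \<noteq> \<zero>\<^bsub>Abar\<^esub>"
    proof
      assume "\<one>\<^bsub>Abar\<^esub> = \<zero>\<^bsub>Abar\<^esub>"
      then have "?\<pi> \<one>\<^bsub>A\<^esub> = J" by (simp add: J.Quot_zero)
      then have "\<one>\<^bsub>A\<^esub> \<in> J" by (simp add: J.coset_eq_self_iff del: p.hom_one)
      then show False using J_P P.one_imp_carrier P.I_notcarr by blast
    qed
  qed
qed

lemma reduced_prime: "primeideal (a_r_coset A J ` P) Abar"
  by (rule R.quot_primeideal[OF J.is_ideal P_prime J_P])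

text \<open>If the part of degree \<open>l\<close> vanished in the quotient, the components of
  degree \<open>l\<close> of the generators would be combinations of each other with coefficients in
  \<open>\<nn>\<close>. Nakayama's lemma would make them zero, and with them the whole part of
  degree \<open>l\<close> of \<open>A\<close>.\<close>

lemma reduced_homog_nonzero:
  assumes unit: "\<And>c. c \<in> \<nn> \<Longrightarrow> \<one>\<^bsub>B\<^esub> \<ominus>\<^bsub>B\<^esub> c \<in> Units B"
    and E: "finite E" "\<And>e. e \<in> E \<Longrightarrow> g e \<in> carrier A"
    and span: "\<And>c. c \<in> carrier A \<Longrightarrow> \<exists>b\<in>E \<rightarrow> carrier B. c = finsum A (\<lambda>e. \<phi> (b e) \<otimes>\<^bsub>A\<^esub> g e) E"
    and l: "l \<in> carrier \<Lambda>" and nz: "homog l \<noteq> {\<zero>\<^bsub>A\<^esub>}"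
  shows "graded_algebra.homog \<Lambda> Abar (factor_coaction \<Lambda> A \<rho> J) l \<noteq> {\<zero>\<^bsub>Abar\<^esub>}"
proof
  interpret F: graded_fibre \<Lambda> Abar K phibar "factor_coaction \<Lambda> A \<rho> J" by (rule reduced_fibre)
  assume z: "F.homog l = {\<zero>\<^bsub>Abar\<^esub>}"
  have inJ: "\<rho> c l \<in> J" if c: "c \<in> carrier A" for c
  proof -
    have cc: "a_r_coset A J c \<in> carrier Abar" using c by (auto simp: J.Quot_carrier)
    have "factor_coaction \<Lambda> A \<rho> J (a_r_coset A J c) l \<in> F.homog l" by (rule F.rho_homog[OF cc l])
    then have "a_r_coset A J (\<rho> c l) = J"
      unfolding z factor_coaction_coset[OF J_graded c] using l by (simp add: ga_map_def J.Quot_zero)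
    then show ?thesis using J.coset_eq_self_iff[OF rho_closed[OF c l]] by blast
  qed
  let ?g = "\<lambda>e. \<rho> (g e) l"
  have gc: "?g e \<in> carrier A" if "e \<in> E" for e by (rule rho_closed[OF E(2)[OF that] l])
  have lin: "\<rho> (finsum A (\<lambda>e. \<phi> (b e) \<otimes>\<^bsub>A\<^esub> g e) E) l = finsum A (\<lambda>e. \<phi> (b e) \<otimes>\<^bsub>A\<^esub> ?g e) E"
    if b: "\<And>e. e \<in> E \<Longrightarrow> b e \<in> carrier B" for b
  proof -
    have "\<rho> (finsum A (\<lambda>e. \<phi> (b e) \<otimes>\<^bsub>A\<^esub> g e) E) l = finsum A (\<lambda>e. \<rho> (\<phi> (b e) \<otimes>\<^bsub>A\<^esub> g e) l) E"
      by (rule rho_finsum[OF E(1) _ l]) (simp add: b E(2))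
    also have "\<dots> = finsum A (\<lambda>e. \<phi> (b e) \<otimes>\<^bsub>A\<^esub> ?g e) E"
    proof (rule R.finsum_cong')
      fix e assume e: "e \<in> E"
      have "\<rho> (\<phi> (b e) \<otimes>\<^bsub>A\<^esub> g e) = ga_const \<Lambda> A (\<phi> (b e)) \<otimes>\<^bsub>GA\<^esub> \<rho> (g e)"
        using b[OF e] E(2)[OF e] by (simp add: rho_phi)
      then show "\<rho> (\<phi> (b e) \<otimes>\<^bsub>A\<^esub> g e) l = \<phi> (b e) \<otimes>\<^bsub>A\<^esub> ?g e"
        using l ga_const_mult[OF phi_closed[OF b[OF e]] rho_GA[OF E(2)[OF e]]] by simp
    qed (use b gc in auto)
    finally show ?thesis .
  qed
  have "\<forall>e\<in>E. ?g e = \<zero>\<^bsub>A\<^esub>"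
  proof (rule phi.nakayama[OF n.is_ideal unit E(1) gc])
    fix e assume e: "e \<in> E"
    have "?g e \<in> J" by (rule inJ[OF E(2)[OF e]])
    then obtain b where b: "b \<in> E \<rightarrow> \<nn>" "?g e = finsum A (\<lambda>e. \<phi> (b e) \<otimes>\<^bsub>A\<^esub> g e) E"
      using phi.genideal_image_span[OF n.is_ideal E span] unfolding J_def by blast
    have bc: "b e \<in> carrier B" if "e \<in> E" for e using b(1) that n.Icarr by blast
    \<comment> \<open>\<open>?g e\<close> is its own component of degree \<open>l\<close>, and
      elements of the base have trivial degree, so the generators in the relation may be replaced by
      their components.\<close>
    have "?g e = \<rho> (?g e) l" using rho_rho[OF E(2)[OF e] l l] by simp
    also have "\<dots> = finsum A (\<lambda>e. \<phi> (b e) \<otimes>\<^bsub>A\<^esub> ?g e) E" unfolding b(2) by (rule lin[OF bc])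
    finally show "\<exists>c\<in>E \<rightarrow> \<nn>. ?g e = finsum A (\<lambda>e. \<phi> (c e) \<otimes>\<^bsub>A\<^esub> ?g e) E" using b(1) by blast
  qed
  then have g0: "?g e = \<zero>\<^bsub>A\<^esub>" if "e \<in> E" for e using that by blast
  have "\<rho> c l = \<zero>\<^bsub>A\<^esub>" if c: "c \<in> carrier A" for c
  proof -
    obtain b where b: "b \<in> E \<rightarrow> carrier B" "c = finsum A (\<lambda>e. \<phi> (b e) \<otimes>\<^bsub>A\<^esub> g e) E" using span[OF c] by blast
    have bc: "b e \<in> carrier B" if "e \<in> E" for e using b(1) that by blast
    have "\<rho> c l = finsum A (\<lambda>e. \<phi> (b e) \<otimes>\<^bsub>A\<^esub> ?g e) E" unfolding b(2) by (rule lin[OF bc])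
    also have "\<dots> = \<zero>\<^bsub>A\<^esub>" by (rule R.add.finprod_one_eqI) (simp add: g0 bc)
    finally show ?thesis .
  qed
  then have "homog l \<subseteq> {\<zero>\<^bsub>A\<^esub>}" using homogD l by (metis singletonI subsetI)
  with nz homog_zero show False by blast
qed

end

section \<open>The fibre of a \<open>G\<close>-variety\<close>

lemma (in ring_hom_cring) primeideal_vimage:
  assumes "primeideal P S"
  shows "primeideal {a \<in> carrier R. h a \<in> P} R"
proof -
  interpret P: primeideal P S by fact
  show ?thesis
  proof (rule primeidealI)
    show "ideal {a \<in> carrier R. h a \<in> P} R"
      by (rule R.idealI') (auto intro: P.a_closed P.I_l_closed)
    have "\<one>\<^bsub>S\<^esub> \<notin> P" using P.one_imp_carrier P.I_notcarr by blast
    then show "carrier R \<noteq> {a \<in> carrier R. h a \<in> P}" using R.one_closed hom_one by force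
    fix a b assume "a \<in> carrier R" "b \<in> carrier R" "a \<otimes> b \<in> {a \<in> carrier R. h a \<in> P}"
    then show "a \<in> {a \<in> carrier R. h a \<in> P} \<or> b \<in> {a \<in> carrier R. h a \<in> P}"
      using P.I_prime[of "h a" "h b"] by auto
  qed (rule R.cring_axioms)
qed

section \<open>Degrees of the sections of a G-variety\<close>

locale g_variety = k: field k + L: finite_comm_group \<Lambda>
  for k :: "'k ring" and \<Lambda> :: "('l, 'n) monoid_scheme" +
  fixes XX :: "('p, 'a, 'k) kscheme" and YY :: "('q, 'b, 'k) kscheme"
    and \<pi> :: "'p \<Rightarrow> 'q" and \<pi>s :: "'q set \<Rightarrow> 'b \<Rightarrow> 'a" and act :: "'q set \<Rightarrow> 'a \<Rightarrow> 'l \<Rightarrow> 'a"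
  assumes Y_variety: "is_variety k YY" and gv: "G_variety_over k \<Lambda> XX YY \<pi> \<pi>s act"
begin

abbreviation "Z \<equiv> pushforward XX YY \<pi>"
abbreviation "pre V \<equiv> preim XX \<pi> V"

lemma Z_top: "top_of Z = top_of YY" and Z_sec: "sec Z V = sec XX (pre V)"
  and Z_res: "res Z V W = res XX (pre V) (pre W)"
  by (simp_all add: pushforward_def)

lemmas gvD = gv[unfolded G_variety_over_def]

lemma X_variety: "is_variety k XX"
  and morphism: "scheme_morphism_over k XX YY \<pi> \<pi>s"
  and finite: "finite_morphism XX YY \<pi> \<pi>s"
  and surj: "\<pi> ` topspace (top_of XX) = topspace (top_of YY)"
  by (rule gvD[THEN conjunct1] gvD[THEN conjunct2, THEN conjunct1] gvD[THEN conjunct2, THEN conjunct2, THEN conjunct1]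
      gvD[THEN conjunct2, THEN conjunct2, THEN conjunct2, THEN conjunct1])+

sublocale X: integral_sch XX
  using X_variety sheaf_imp_presheaf
  by (auto simp: is_variety_def scheme_over_def geometrically_integral_def is_scheme_def
      integral_sch_def integral_sch_axioms_def)

sublocale Y: integral_sch YY
  using Y_variety sheaf_imp_presheaf
  by (auto simp: is_variety_def scheme_over_def geometrically_integral_def is_scheme_def
      integral_sch_def integral_sch_axioms_def)

lemma pi_hom: "Y.opn V \<Longrightarrow> \<pi>s V \<in> ring_hom (sec YY V) (sec Z V)"
  and pi_res: "Y.opn V \<Longrightarrow> Y.opn W \<Longrightarrow> W \<subseteq> V \<Longrightarrow> g \<in> carrier (sec YY V) \<Longrightarrow>
    \<pi>s W (res YY V W g) = res Z V W (\<pi>s V g)"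
  and pi_local: "x \<in> topspace (top_of XX) \<Longrightarrow> Y.opn V \<Longrightarrow> \<pi> x \<in> V \<Longrightarrow> g \<in> carrier (sec YY V) \<Longrightarrow>
    germ XX x (pre V) (\<pi>s V g) \<in> Units (stalk XX x) \<Longrightarrow> germ YY (\<pi> x) V g \<in> Units (stalk YY (\<pi> x))"
  and pi_cont: "continuous_map (top_of XX) (top_of YY) \<pi>"
  using morphism unfolding scheme_morphism_over_def Z_sec Z_res by (elim conjE; metis)+

lemma act_coaction: "Y.opn V \<Longrightarrow> coaction k \<Lambda> (sec Z V) (struct_on XX (pre V)) (act V)"
  and act_res: "Y.opn V \<Longrightarrow> Y.opn W \<Longrightarrow> W \<subseteq> V \<Longrightarrow> a \<in> carrier (sec Z V) \<Longrightarrow>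
    act W (res Z V W a) = ga_map \<Lambda> (res Z V W) (act V a)"
  and pi_bij: "Y.opn V \<Longrightarrow> bij_betw (\<pi>s V) (carrier (sec YY V))
    {a \<in> carrier (sec Z V). act V a = ga_const \<Lambda> (sec Z V) a}"
  and act_faithful: "subgroup_scheme k \<Lambda> I \<Longrightarrow> (\<And>V. Y.opn V \<Longrightarrow>
    acts_trivially_on \<Lambda> (sec Z V) (struct_on XX (pre V)) (act V) {\<zero>\<^bsub>sec Z V\<^esub>} I) \<Longrightarrow>
    I = trivial_subgroup_scheme k \<Lambda>"
  unfolding Z_sec Z_res using gvD by (elim conjE; blast)+

lemma pre_open: "Y.opn V \<Longrightarrow> X.opn (pre V)"
  unfolding preim_def by (rule openin_continuous_map_preimage[OF pi_cont])

lemma pre_mono: "W \<subseteq> V \<Longrightarrow> pre W \<subseteq> pre V"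
  by (auto simp: preim_def)

lemma pre_nonempty: "Y.opn V \<Longrightarrow> V \<noteq> {} \<Longrightarrow> pre V \<noteq> {}"
proof -
  assume V: "Y.opn V" "V \<noteq> {}"
  then obtain y where "y \<in> V" "y \<in> topspace (top_of YY)" using openin_subset by blast
  then show ?thesis using surj by (force simp: preim_def)
qed

sublocale Z: ring_presheaf Z
proof (rule ring_presheaf.intro; unfold Z_top Z_sec Z_res)
  show "cring (sec XX (pre U))" if "Y.opn U" for U by (rule X.sec_cring[OF pre_open[OF that]])
  show "res XX (pre U) (pre V) \<in> ring_hom (sec XX (pre U)) (sec XX (pre V))"
    if "Y.opn U" "Y.opn V" "V \<subseteq> U" for U V by (intro X.res_hom pre_open pre_mono that)
  show "res XX (pre U) (pre U) f = f" if "Y.opn U" "f \<in> carrier (sec XX (pre U))" for U f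
    by (intro X.res_id pre_open that)
  show "res XX (pre V) (pre W) (res XX (pre U) (pre V) f) = res XX (pre U) (pre W) f"
    if "Y.opn U" "Y.opn V" "Y.opn W" "W \<subseteq> V" "V \<subseteq> U" "f \<in> carrier (sec XX (pre U))" for U V W f
    by (intro X.res_res pre_open pre_mono that)
qed

lemma Z_hom_cring: "Y.opn U \<Longrightarrow> Y.opn V \<Longrightarrow> V \<subseteq> U \<Longrightarrow> ring_hom_cring (sec Z U) (sec Z V) (res Z U V)"
  by (rule Z.res_hom_cring) (simp_all add: Z_top)

lemma Z_inj:
  assumes "Y.opn U" "Y.opn V" "V \<subseteq> U" "V \<noteq> {}" "f \<in> carrier (sec Z U)" "res Z U V f = \<zero>\<^bsub>sec Z V\<^esub>"
  shows "f = \<zero>\<^bsub>sec Z U\<^esub>"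
  using X.res_inj[OF pre_open[OF assms(1)] pre_open[OF assms(2)] pre_mono[OF assms(3)]
      pre_nonempty[OF assms(2,4)]] assms(5,6) by (simp add: Z_sec Z_res)

lemma Z_domain: "Y.opn V \<Longrightarrow> V \<noteq> {} \<Longrightarrow> domain (sec Z V)"
  unfolding Z_sec by (rule X.sec_domain[OF pre_open pre_nonempty])

lemma graded: "Y.opn V \<Longrightarrow> graded_algebra \<Lambda> (sec Z V) k (struct_on XX (pre V)) (act V)"
proof -
  assume V: "Y.opn V"
  interpret c: cring "sec Z V" using V by (intro Z.sec_cring) (simp add: Z_top)
  show ?thesis by unfold_locales (rule act_coaction[OF V])
qed

abbreviation "hsec V l \<equiv> graded_algebra.homog \<Lambda> (sec Z V) (act V) l"

lemma act_res_comp: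
  "Y.opn V \<Longrightarrow> Y.opn W \<Longrightarrow> W \<subseteq> V \<Longrightarrow> a \<in> carrier (sec Z V) \<Longrightarrow> l \<in> carrier \<Lambda> \<Longrightarrow>
    act W (res Z V W a) l = res Z V W (act V a l)"
  by (simp add: act_res ga_map_def)

lemma hsec_res:
  assumes V: "Y.opn V" and W: "Y.opn W" "W \<subseteq> V" and s: "s \<in> hsec V l"
  shows "res Z V W s \<in> hsec W l"
proof -
  interpret V: graded_algebra \<Lambda> "sec Z V" k "struct_on XX (pre V)" "act V" by (rule graded[OF V])
  interpret W: graded_algebra \<Lambda> "sec Z W" k "struct_on XX (pre W)" "act W" by (rule graded[OF W(1)])
  interpret r: ring_hom_cring "sec Z V" "sec Z W" "res Z V W" by (rule Z_hom_cring[OF V W])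
  note sc = V.homogD(1)[OF s]
  show ?thesis
  proof (rule W.homogI)
    show "res Z V W s \<in> carrier (sec Z W)" by (rule r.hom_closed[OF sc])
    fix m assume m: "m \<in> carrier \<Lambda>"
    show "act W (res Z V W s) m = (if m = l then res Z V W s else \<zero>\<^bsub>sec Z W\<^esub>)"
      unfolding act_res_comp[OF V W sc m] V.homogD(2)[OF s m] by simp
  qed
qed

lemma sec_empty: "s \<in> carrier (sec Z {}) \<Longrightarrow> s = \<zero>\<^bsub>sec Z {}\<^esub>"
proof -
  assume s: "s \<in> carrier (sec Z {})"
  interpret c: cring "sec Z {}" by (intro Z.sec_cring) simp
  have "pre {} = {}" by (simp add: preim_def)
  then show ?thesis using X.sec_empty[of s "\<zero>\<^bsub>sec Z {}\<^esub>"] s c.zero_closed by (simp add: Z_sec)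
qed

text \<open>The degrees of nonzero sections form a subgroup \<open>\<Gamma>\<close> since \<open>X\<close> is integral, and the subgroup
  scheme with character group \<open>\<Lambda>/\<Gamma>\<close> acts trivially.\<close>

lemma all_degrees:
  assumes "l \<in> carrier \<Lambda>"
  shows "\<exists>V s. Y.opn V \<and> s \<in> hsec V l \<and> s \<noteq> \<zero>\<^bsub>sec Z V\<^esub>"
proof -
  interpret kG: group_ring \<Lambda> k by unfold_locales
  define \<Gamma> where "\<Gamma> = {l \<in> carrier \<Lambda>. \<exists>V s. Y.opn V \<and> s \<in> hsec V l \<and> s \<noteq> \<zero>\<^bsub>sec Z V\<^esub>}"
  have ne: "V \<noteq> {}" if "Y.opn V" "s \<in> hsec V l" "s \<noteq> \<zero>\<^bsub>sec Z V\<^esub>" for V s l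
  proof
    assume V: "V = {}"
    interpret V: graded_algebra \<Lambda> "sec Z V" k "struct_on XX (pre V)" "act V" by (rule graded[OF that(1)])
    show False using sec_empty V.homogD(1)[OF that(2)] that(3) V by simp
  qed
  have one: "\<one>\<^bsub>\<Lambda>\<^esub> \<in> \<Gamma>"
  proof -
    let ?T = "topspace (top_of YY)"
    have o: "Y.opn ?T" by simp
    interpret V: graded_algebra \<Lambda> "sec Z ?T" k "struct_on XX (pre ?T)" "act ?T" by (rule graded[OF o])
    have "?T \<noteq> {}" using Y.integral by (simp add: integral_scheme_def)
    interpret d: domain "sec Z ?T" by (rule Z_domain[OF o \<open>?T \<noteq> {}\<close>])
    show ?thesis using o V.homog_one d.one_not_zero unfolding \<Gamma>_def by blast
  qed
  have mult: "l \<otimes>\<^bsub>\<Lambda>\<^esub> m \<in> \<Gamma>" if "l \<in> \<Gamma>" "m \<in> \<Gamma>" for l m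
  proof -
    obtain V s where V: "l \<in> carrier \<Lambda>" "Y.opn V" "s \<in> hsec V l" "s \<noteq> \<zero>\<^bsub>sec Z V\<^esub>"
      using \<open>l \<in> \<Gamma>\<close> by (auto simp: \<Gamma>_def)
    obtain W t where W: "m \<in> carrier \<Lambda>" "Y.opn W" "t \<in> hsec W m" "t \<noteq> \<zero>\<^bsub>sec Z W\<^esub>"
      using \<open>m \<in> \<Gamma>\<close> by (auto simp: \<Gamma>_def)
    \<comment> \<open>The two sections live over different open sets; on the nonempty intersection
      their restrictions stay nonzero, and so does the product.\<close>
    let ?U = "V \<inter> W"
    have U: "Y.opn ?U" "?U \<noteq> {}"
      using V W Y.opens_meet[OF V(2) W(2) ne[OF V(2-4)] ne[OF W(2-4)]] by (auto intro: openin_Int)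
    interpret U: graded_algebra \<Lambda> "sec Z ?U" k "struct_on XX (pre ?U)" "act ?U" by (rule graded[OF U(1)])
    interpret d: domain "sec Z ?U" by (rule Z_domain[OF U])
    interpret V: graded_algebra \<Lambda> "sec Z V" k "struct_on XX (pre V)" "act V" by (rule graded[OF V(2)])
    interpret W: graded_algebra \<Lambda> "sec Z W" k "struct_on XX (pre W)" "act W" by (rule graded[OF W(2)])
    have a: "res Z V ?U s \<in> hsec ?U l" by (rule hsec_res[OF V(2) U(1) _ V(3)]) simp
    have b: "res Z W ?U t \<in> hsec ?U m" by (rule hsec_res[OF W(2) U(1) _ W(3)]) simp
    have "res Z V ?U s \<noteq> \<zero>\<^bsub>sec Z ?U\<^esub>" using Z_inj[OF V(2) U(1) _ U(2) V.homogD(1)[OF V(3)]] V(4) by blast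
    moreover have "res Z W ?U t \<noteq> \<zero>\<^bsub>sec Z ?U\<^esub>" using Z_inj[OF W(2) U(1) _ U(2) W.homogD(1)[OF W(3)]] W(4) by blast
    ultimately have "res Z V ?U s \<otimes>\<^bsub>sec Z ?U\<^esub> res Z W ?U t \<noteq> \<zero>\<^bsub>sec Z ?U\<^esub>"
      using d.integral U.homogD(1)[OF a] U.homogD(1)[OF b] by blast
    moreover have "res Z V ?U s \<otimes>\<^bsub>sec Z ?U\<^esub> res Z W ?U t \<in> hsec ?U (l \<otimes>\<^bsub>\<Lambda>\<^esub> m)"
      by (rule U.homog_mult[OF a b V(1) W(1)])
    ultimately show ?thesis using U(1) V(1) W(1) unfolding \<Gamma>_def by blast
  qed
  have \<Gamma>sub: "\<Gamma> \<subseteq> carrier \<Lambda>" by (auto simp: \<Gamma>_def)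
  have sg: "subgroup \<Gamma> \<Lambda>"
  proof (rule L.subgroupI[OF \<Gamma>sub])
    show "\<Gamma> \<noteq> {}" using one by blast
    fix l assume l: "l \<in> \<Gamma>"
    then have lc: "l \<in> carrier \<Lambda>" using \<Gamma>sub by blast
    have pow: "l [^]\<^bsub>\<Lambda>\<^esub> n \<in> \<Gamma>" for n :: nat by (induction n) (use one mult l in auto)
    have "order \<Lambda> \<noteq> 0" using L.fin L.one_closed by (auto simp: order_def card_eq_0_iff)
    then obtain n where n: "order \<Lambda> = Suc n" using not0_implies_Suc by blast
    have "l [^]\<^bsub>\<Lambda>\<^esub> n \<otimes>\<^bsub>\<Lambda>\<^esub> l = \<one>\<^bsub>\<Lambda>\<^esub>" using L.pow_order_eq_1[OF lc] n by simp
    \<comment> \<open>The inverse is the power with exponent one less than the order of \<Lambda>,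
      so closure under products is enough.\<close>
    then have "inv\<^bsub>\<Lambda>\<^esub> l = l [^]\<^bsub>\<Lambda>\<^esub> n" using lc by (intro L.inv_equality) auto
    with pow show "inv\<^bsub>\<Lambda>\<^esub> l \<in> \<Gamma>" by simp
  qed (rule mult)
  let ?I = "coset_sum_ideal \<Lambda> \<Gamma> k"
  have "acts_trivially_on \<Lambda> (sec Z V) (struct_on XX (pre V)) (act V) {\<zero>\<^bsub>sec Z V\<^esub>} ?I" if V: "Y.opn V" for V
    unfolding acts_trivially_on_def
  proof
    interpret V: graded_algebra \<Lambda> "sec Z V" k "struct_on XX (pre V)" "act V" by (rule graded[OF V])
    fix a assume a: "a \<in> carrier (sec Z V)"
    have "act V a l = \<zero>\<^bsub>sec Z V\<^esub>" if l: "l \<in> carrier \<Lambda> - \<Gamma>" for l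
      using V.rho_homog[OF a, of l] l V unfolding \<Gamma>_def by blast
    then have "a \<in> V.supported \<Gamma>" using a by (simp add: V.supported_def)
    then have mem: "act V a \<ominus>\<^bsub>V.GA\<^esub> ga_const \<Lambda> (sec Z V) a \<in> genideal V.GA (ga_map \<Lambda> (struct_on XX (pre V)) ` ?I)"
      unfolding V.invariants_coset_sum[OF sg, symmetric] invariants_def by blast
    have sub: "ga_const \<Lambda> (sec Z V) ` {\<zero>\<^bsub>sec Z V\<^esub>} \<union> ga_map \<Lambda> (struct_on XX (pre V)) ` ?I \<subseteq> carrier V.GA"
    proof -
      have "ga_map \<Lambda> (struct_on XX (pre V)) f \<in> carrier V.GA" if "f \<in> ?I" for f
        using that ring_hom_closed[OF V.ga_map_hom[OF V.phi_hom k.cring_axioms]]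
        by (simp add: coset_sum_ideal_def)
      moreover have "ga_const \<Lambda> (sec Z V) \<zero>\<^bsub>sec Z V\<^esub> \<in> carrier V.GA" by simp
      ultimately show ?thesis by blast
    qed
    show "act V a \<ominus>\<^bsub>V.GA\<^esub> ga_const \<Lambda> (sec Z V) a \<in>
        genideal V.GA (ga_const \<Lambda> (sec Z V) ` {\<zero>\<^bsub>sec Z V\<^esub>} \<union> ga_map \<Lambda> (struct_on XX (pre V)) ` ?I)"
      using V.G.subset_Idl_subset[OF sub, of "ga_map \<Lambda> (struct_on XX (pre V)) ` ?I"] mem by blast
  qed
  then have "?I = trivial_subgroup_scheme k \<Lambda>"
    by (intro act_faithful kG.subgroup_scheme_coset_sum[OF sg])
  \<comment> \<open>The trivial subgroup scheme is that of the full group \<Lambda>, whose ideal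
    contains \<open>l - 1\<close>; membership of this element in the ideal of \<Gamma> puts
    \<open>l\<close> into \<Gamma>.\<close>
  then have eq: "?I = coset_sum_ideal \<Lambda> (carrier \<Lambda>) k" by (simp add: kG.augmentation_ideal)
  have "kG.ga_delta l \<in> ?I"
    unfolding eq by (rule kG.ga_delta_mem(1)[OF L.subgroup_self assms assms])
  then have "l \<in> \<Gamma>" by (rule kG.ga_delta_mem(2)[OF sg assms]) simp
  then show ?thesis by (simp add: \<Gamma>_def)
qed

end

section \<open>Affine charts of Y with affine preimage\<close>

locale g_variety_chart = g_variety k \<Lambda> XX YY \<pi> \<pi>s act + C: affine_chart YY V h + C': affine_chart XX "preim XX \<pi> V" h'
  for k \<Lambda> XX YY \<pi> \<pi>s act V h h'
begin

text \<open>Locality of the morphism on stalks shows that \<open>f\<close> does not vanish at the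
  image of a point where its pullback does not vanish. Conversely \<open>f\<close> is a unit on
  D(f), hence its pullback is one over the preimage.\<close>

lemma pre_D:
  assumes f: "f \<in> carrier (sec YY V)"
  shows "pre (C.D f) = C'.D (\<pi>s V f)"
proof -
  interpret piV: ring_hom_cring "sec YY V" "sec Z V" "\<pi>s V"
    by (intro ring_hom_cring.intro ring_hom_cring_axioms.intro pi_hom C.U_open Y.sec_cring Z.sec_cring)
      (simp add: Z_top C.U_open)
  have fz: "\<pi>s V f \<in> carrier (sec XX (pre V))" using piV.hom_closed[OF f] by (simp add: Z_sec)
  have "f \<notin> h (\<pi> z) \<longleftrightarrow> \<pi>s V f \<notin> h' z" if z: "z \<in> pre V" for z
  proof -
    have zt: "z \<in> topspace (top_of XX)" and zV: "\<pi> z \<in> V" using z by (auto simp: preim_def)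
    interpret Xz: affine_point XX "pre V" h' z by unfold_locales (use z zt in auto)
    interpret Yz: affine_point YY V h "\<pi> z"
      by unfold_locales (use zV C.U_open openin_subset in auto)
    show ?thesis
    proof
      assume "\<pi>s V f \<notin> h' z"
      then have "germ XX z (pre V) (\<pi>s V f) \<in> Units (stalk XX z)" using Xz.germ_unit fz by blast
      then have "germ YY (\<pi> z) V f \<in> Units (stalk YY (\<pi> z))" by (rule pi_local[OF zt C.U_open zV f])
      then show "f \<notin> h (\<pi> z)" using Yz.germ_unit_iff[OF f] by blast
    next
      assume fh: "f \<notin> h (\<pi> z)"
      have Do: "Y.opn (C.D f)" by (rule C.D_open[OF f])
      interpret piD: ring_hom_cring "sec YY (C.D f)" "sec Z (C.D f)" "\<pi>s (C.D f)"
        by (intro ring_hom_cring.intro ring_hom_cring_axioms.intro pi_hom Do Y.sec_cring Z.sec_cring)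
          (simp add: Z_top Do)
      let ?r = "res YY V (C.D f) f"
      have u: "?r \<in> Units (sec YY (C.D f))" by (rule C.loc_unit[OF f])
      have n: "Xz.nbhd (pre (C.D f))" using pre_open[OF Do] zt zV fh by (auto simp: preim_def C.D_def)
      interpret g: ring_hom_cring "sec XX (pre (C.D f))" "stalk XX z" "germ XX z (pre (C.D f))"
        by (rule Xz.germ_hom_cring[OF n])
      let ?i = "inv\<^bsub>sec YY (C.D f)\<^esub> ?r"
      have c: "?r \<in> carrier (sec YY (C.D f))" "?i \<in> carrier (sec YY (C.D f))"
        using u piD.R.Units_closed piD.R.Units_inv_closed by auto
      have pc: "\<pi>s (C.D f) ?r \<in> carrier (sec XX (pre (C.D f)))" "\<pi>s (C.D f) ?i \<in> carrier (sec XX (pre (C.D f)))"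
        using piD.hom_closed[OF c(1)] piD.hom_closed[OF c(2)] by (simp_all add: Z_sec)
      have "\<pi>s (C.D f) ?r \<otimes>\<^bsub>sec Z (C.D f)\<^esub> \<pi>s (C.D f) ?i = \<one>\<^bsub>sec Z (C.D f)\<^esub>"
        using piD.R.Units_r_inv[OF u] c by (simp flip: piD.hom_mult)
      then have "germ XX z (pre (C.D f)) (\<pi>s (C.D f) ?r) \<otimes>\<^bsub>stalk XX z\<^esub> germ XX z (pre (C.D f)) (\<pi>s (C.D f) ?i) = \<one>\<^bsub>stalk XX z\<^esub>"
        using pc by (simp add: Z_sec flip: g.hom_mult)
      then have "germ XX z (pre (C.D f)) (\<pi>s (C.D f) ?r) \<in> Units (stalk XX z)"
        using Xz.S.unit_factor[OF _ g.hom_closed[OF pc(1)] g.hom_closed[OF pc(2)]] by simp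
      also have "\<pi>s (C.D f) ?r = res XX (pre V) (pre (C.D f)) (\<pi>s V f)"
        using pi_res[OF C.U_open Do C.D_sub f] by (simp add: Z_res)
      also have "germ XX z (pre (C.D f)) (res XX (pre V) (pre (C.D f)) (\<pi>s V f)) = germ XX z (pre V) (\<pi>s V f)"
        by (rule Xz.germ_res[OF Xz.nU fz n pre_mono[OF C.D_sub]])
      finally show "\<pi>s V f \<notin> h' z" using Xz.germ_unit_iff[OF fz] by blast
    qed
  qed
  then show ?thesis unfolding C'.D_def C.D_def by (auto simp: preim_def)
qed

text \<open>By \<open>pre_D\<close> the preimage of D(f) is a basic open set of the affine preimage
  of \<open>V\<close>, so localization on X applies to the direct image.\<close>

lemma frac:
  assumes f: "f \<in> carrier (sec YY V)" and s: "s \<in> carrier (sec Z (C.D f))"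
  defines "u \<equiv> res Z V (C.D f) (\<pi>s V f)"
  shows "\<exists>a\<in>carrier (sec Z V). \<exists>n::nat.
    s \<otimes>\<^bsub>sec Z (C.D f)\<^esub> u [^]\<^bsub>sec Z (C.D f)\<^esub> n = res Z V (C.D f) a"
    and "u \<in> Units (sec Z (C.D f))"
proof -
  have fz: "\<pi>s V f \<in> carrier (sec XX (pre V))"
    using ring_hom_closed[OF pi_hom[OF C.U_open] f] by (simp add: Z_sec)
  show "u \<in> Units (sec Z (C.D f))"
    unfolding u_def using C'.loc_unit[OF fz] by (simp add: Z_sec Z_res pre_D[OF f])
  show "\<exists>a\<in>carrier (sec Z V). \<exists>n::nat.
    s \<otimes>\<^bsub>sec Z (C.D f)\<^esub> u [^]\<^bsub>sec Z (C.D f)\<^esub> n = res Z V (C.D f) a"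
    unfolding u_def using C'.loc_frac[OF fz] s by (simp add: Z_sec Z_res pre_D[OF f])
qed

lemma pi_degree_one: "Y.opn W \<Longrightarrow> g \<in> carrier (sec YY W) \<Longrightarrow> \<pi>s W g \<in> hsec W \<one>\<^bsub>\<Lambda>\<^esub>"
proof -
  assume W: "Y.opn W" "g \<in> carrier (sec YY W)"
  interpret W: graded_algebra \<Lambda> "sec Z W" k "struct_on XX (pre W)" "act W" by (rule graded[OF W(1)])
  have "\<pi>s W g \<in> {a \<in> carrier (sec Z W). act W a = ga_const \<Lambda> (sec Z W) a}"
    using pi_bij[OF W(1)] W(2) by (auto simp: bij_betw_def)
  then show ?thesis by (simp add: W.homog_def ga_const_monom)
qed

text \<open>A nonzero section of degree \<open>l\<close> exists over some open set. On a basic open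
  set D(f) of the chart, its product with a power of the invariant unit \<open>f\<close> is the
  restriction of a section over the whole chart; the component of degree \<open>l\<close> of that
  section restricts to the product and is therefore nonzero.\<close>

lemma chart_degrees:
  assumes l: "l \<in> carrier \<Lambda>" and "V \<noteq> {}"
  shows "\<exists>a\<in>carrier (sec Z V). act V a l \<noteq> \<zero>\<^bsub>sec Z V\<^esub>"
proof -
  obtain W s where W: "Y.opn W" "s \<in> hsec W l" "s \<noteq> \<zero>\<^bsub>sec Z W\<^esub>" using all_degrees[OF l] by blast
  interpret W: graded_algebra \<Lambda> "sec Z W" k "struct_on XX (pre W)" "act W" by (rule graded[OF W(1)])
  interpret V: graded_algebra \<Lambda> "sec Z V" k "struct_on XX (pre V)" "act V" by (rule graded[OF C.U_open])
  have "W \<noteq> {}" using sec_empty W.homogD(1)[OF W(2)] W(3) by blast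
  then have "W \<inter> V \<noteq> {}" by (rule Y.opens_meet[OF W(1) C.U_open _ \<open>V \<noteq> {}\<close>])
  then obtain z where z: "z \<in> W" "z \<in> V" by blast
  obtain f where f: "f \<in> carrier (sec YY V)" "z \<in> C.D f" "C.D f \<subseteq> W" using C.D_basis[OF W(1) z] by blast
  let ?D = "C.D f"
  have Do: "Y.opn ?D" "?D \<noteq> {}" using C.D_open[OF f(1)] f(2) by auto
  interpret D: graded_algebra \<Lambda> "sec Z ?D" k "struct_on XX (pre ?D)" "act ?D" by (rule graded[OF Do(1)])
  interpret d: domain "sec Z ?D" by (rule Z_domain[OF Do])
  interpret r: ring_hom_cring "sec Z V" "sec Z ?D" "res Z V ?D" by (rule Z_hom_cring[OF C.U_open Do(1) C.D_sub])
  let ?t = "res Z W ?D s" and ?u = "res Z V ?D (\<pi>s V f)"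
  have t: "?t \<in> hsec ?D l" by (rule hsec_res[OF W(1) Do(1) f(3) W(2)])
  have tc: "?t \<in> carrier (sec Z ?D)" by (rule D.homogD(1)[OF t])
  have tnz: "?t \<noteq> \<zero>\<^bsub>sec Z ?D\<^esub>" using Z_inj[OF W(1) Do(1) f(3) Do(2) W.homogD(1)[OF W(2)]] W(3) by blast
  have u: "?u \<in> hsec ?D \<one>\<^bsub>\<Lambda>\<^esub>" by (rule hsec_res[OF C.U_open Do(1) C.D_sub pi_degree_one[OF C.U_open f(1)]])
  obtain a n where a: "a \<in> carrier (sec Z V)" "?t \<otimes>\<^bsub>sec Z ?D\<^esub> ?u [^]\<^bsub>sec Z ?D\<^esub> (n::nat) = res Z V ?D a"
    using frac(1)[OF f(1) tc] by blast
  have uU: "?u [^]\<^bsub>sec Z ?D\<^esub> n \<in> Units (sec Z ?D)" using frac(2)[OF f(1) tc] by (rule D.R.Units_pow_closed)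
  have "?u [^]\<^bsub>sec Z ?D\<^esub> n \<in> hsec ?D (\<one>\<^bsub>\<Lambda>\<^esub> [^]\<^bsub>\<Lambda>\<^esub> n)" by (rule D.homog_pow[OF u]) simp
  then have un: "?u [^]\<^bsub>sec Z ?D\<^esub> n \<in> hsec ?D \<one>\<^bsub>\<Lambda>\<^esub>" by simp
  have h: "?t \<otimes>\<^bsub>sec Z ?D\<^esub> ?u [^]\<^bsub>sec Z ?D\<^esub> n \<in> hsec ?D l"
    using D.homog_mult[OF t un l] l by simp
  have "?u [^]\<^bsub>sec Z ?D\<^esub> n \<noteq> \<zero>\<^bsub>sec Z ?D\<^esub>"
  proof
    assume z: "?u [^]\<^bsub>sec Z ?D\<^esub> n = \<zero>\<^bsub>sec Z ?D\<^esub>"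
    have "\<one>\<^bsub>sec Z ?D\<^esub> = \<zero>\<^bsub>sec Z ?D\<^esub>"
      using D.R.Units_r_inv[OF uU] D.R.Units_inv_closed[OF uU] unfolding z by simp
    then show False by simp
  qed
  then have nz: "?t \<otimes>\<^bsub>sec Z ?D\<^esub> ?u [^]\<^bsub>sec Z ?D\<^esub> n \<noteq> \<zero>\<^bsub>sec Z ?D\<^esub>"
    using tnz d.integral tc D.homogD(1)[OF un] by blast
  have "res Z V ?D (act V a l) = act ?D (res Z V ?D a) l"
    by (rule act_res_comp[OF C.U_open Do(1) C.D_sub a(1) l, symmetric])
  also have "\<dots> = ?t \<otimes>\<^bsub>sec Z ?D\<^esub> ?u [^]\<^bsub>sec Z ?D\<^esub> n"
    unfolding a(2)[symmetric] using D.homogD(2)[OF h l] by simp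
  finally have "res Z V ?D (act V a l) \<noteq> \<zero>\<^bsub>sec Z ?D\<^esub>" using nz by simp
  then have "act V a l \<noteq> \<zero>\<^bsub>sec Z V\<^esub>" by auto
  with a(1) show ?thesis by blast
qed

end

section \<open>The grading on the stalk of the direct image and the prime of x\<close>

locale g_variety_fibre = g_variety k \<Lambda> XX YY \<pi> \<pi>s act
  for k :: "'k ring" and \<Lambda> :: "('l, 'n) monoid_scheme"
    and XX :: "('p, 'a, 'k) kscheme" and YY :: "('q, 'b, 'k) kscheme" and \<pi> \<pi>s act +
  fixes x :: 'p
  assumes x_space: "x \<in> topspace (top_of XX)"
begin

abbreviation "y \<equiv> \<pi> x"
abbreviation "B \<equiv> stalk YY y"
abbreviation "A \<equiv> stalk Z y"
abbreviation "\<nn> \<equiv> stalk_max_ideal YY y"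

lemma y_space: "y \<in> topspace (top_of YY)"
  using surj x_space by blast

sublocale x: presheaf_point XX x by unfold_locales (rule x_space)
sublocale y: presheaf_point YY y by unfold_locales (rule y_space)
sublocale z: presheaf_point Z y by unfold_locales (simp add: Z_top y_space)

lemma nbhd_iff: "z.nbhd V \<longleftrightarrow> y.nbhd V" by (simp add: Z_top)

lemma pre_nbhd: "y.nbhd V \<Longrightarrow> x.nbhd (pre V)"
  using pre_open x_space by (auto simp: preim_def)

sublocale A: cring A by (rule z.stalk_cring)
sublocale B: cring B by (rule y.stalk_cring)
sublocale AG: group_ring \<Lambda> A by unfold_locales

lemmas z_germ_hom_cring = z.germ_hom_cring[unfolded nbhd_iff]
lemmas z_germ_res = z.germ_res[unfolded nbhd_iff]
lemmas z_stalkE = z.stalkE[unfolded nbhd_iff]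
lemmas z_stalkE2 = z.stalkE2[unfolded nbhd_iff]
lemmas z_germ_closed = z.germ_closed[unfolded nbhd_iff]

definition psi where "psi = stalk_map Z y \<pi>s"

definition gr where "gr c = (\<lambda>l\<in>carrier \<Lambda>. stalk_map Z y (\<lambda>V s. act V s l) c)"

lemma pi_closed: "Y.opn V \<Longrightarrow> g \<in> carrier (sec YY V) \<Longrightarrow> \<pi>s V g \<in> carrier (sec Z V)"
  by (rule ring_hom_closed[OF pi_hom])

lemma psi_germ: "y.nbhd V \<Longrightarrow> g \<in> carrier (sec YY V) \<Longrightarrow> psi (germ YY y V g) = germ Z y V (\<pi>s V g)"
  unfolding psi_def by (rule y.stalk_map_germ[OF Z.ring_presheaf_axioms Z_top pi_closed pi_res])

lemma gr_germ:
  assumes V: "y.nbhd V" "f \<in> carrier (sec Z V)"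
  shows "gr (germ Z y V f) = ga_map \<Lambda> (germ Z y V) (act V f)"
  unfolding gr_def ga_map_def
proof (intro restrict_ext)
  fix l assume l: "l \<in> carrier \<Lambda>"
  show "stalk_map Z y (\<lambda>V s. act V s l) (germ Z y V f) = germ Z y V (act V f l)"
  proof (rule z.stalk_map_germ[OF Z.ring_presheaf_axioms refl, unfolded Z_top])
    fix U f assume U: "Y.opn U" "f \<in> carrier (sec Z U)"
    interpret U: graded_algebra \<Lambda> "sec Z U" k "struct_on XX (pre U)" "act U" by (rule graded[OF U(1)])
    show "act U f l \<in> carrier (sec Z U)" by (rule U.rho_closed[OF U(2) l])
  next
    show "act W (res Z U W g) l = res Z U W (act U g l)"
      if "Y.opn U" "Y.opn W" "W \<subseteq> U" "g \<in> carrier (sec Z U)" for U W g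
      by (rule act_res_comp[OF that l])
  qed (use V in auto)
qed

lemma gr_germ_comp:
  "y.nbhd V \<Longrightarrow> f \<in> carrier (sec Z V) \<Longrightarrow> l \<in> carrier \<Lambda> \<Longrightarrow> gr (germ Z y V f) l = germ Z y V (act V f l)"
  by (simp add: gr_germ ga_map_def)

lemma psi_hom: "psi \<in> ring_hom B A"
proof (rule ring_hom_memI)
  fix c assume "c \<in> carrier B"
  then obtain V g where V: "y.nbhd V" "g \<in> carrier (sec YY V)" "c = germ YY y V g" by (rule y.stalkE)
  show "psi c \<in> carrier A" unfolding V(3) psi_germ[OF V(1,2)] using V by (intro z_germ_closed pi_closed) auto
next
  fix c d assume "c \<in> carrier B" "d \<in> carrier B"
  then obtain V f g where V: "y.nbhd V" "f \<in> carrier (sec YY V)" "g \<in> carrier (sec YY V)"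
    "c = germ YY y V f" "d = germ YY y V g" by (rule y.stalkE2)
  have Vo: "Y.opn V" using V(1) by simp
  interpret g: ring_hom_cring "sec YY V" B "germ YY y V" by (rule y.germ_hom_cring[OF V(1)])
  interpret gz: ring_hom_cring "sec Z V" A "germ Z y V" by (rule z_germ_hom_cring[OF V(1)])
  note pc = pi_closed[OF Vo V(2)] pi_closed[OF Vo V(3)]
  show "psi (c \<otimes>\<^bsub>B\<^esub> d) = psi c \<otimes>\<^bsub>A\<^esub> psi d"
    unfolding V(4,5) g.hom_mult[OF V(2,3), symmetric] psi_germ[OF V(1) g.R.m_closed[OF V(2,3)]]
      psi_germ[OF V(1,2)] psi_germ[OF V(1,3)] ring_hom_mult[OF pi_hom[OF Vo] V(2,3)] by (rule gz.hom_mult[OF pc])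
  show "psi (c \<oplus>\<^bsub>B\<^esub> d) = psi c \<oplus>\<^bsub>A\<^esub> psi d"
    unfolding V(4,5) g.hom_add[OF V(2,3), symmetric] psi_germ[OF V(1) g.R.a_closed[OF V(2,3)]]
      psi_germ[OF V(1,2)] psi_germ[OF V(1,3)] ring_hom_add[OF pi_hom[OF Vo] V(2,3)] by (rule gz.hom_add[OF pc])
next
  let ?T = "topspace (top_of YY)"
  interpret g: ring_hom_cring "sec YY ?T" B "germ YY y ?T" by (rule y.germ_hom_cring[OF y.nbhd_space])
  interpret gz: ring_hom_cring "sec Z ?T" A "germ Z y ?T" by (rule z_germ_hom_cring[OF y.nbhd_space])
  show "psi \<one>\<^bsub>B\<^esub> = \<one>\<^bsub>A\<^esub>"
    unfolding g.hom_one[symmetric] psi_germ[OF y.nbhd_space g.R.one_closed]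
    using ring_hom_one[OF pi_hom[of ?T]] by simp
qed

lemma gr_hom: "gr \<in> ring_hom A AG.GA"
proof (rule ring_hom_memI)
  fix c assume "c \<in> carrier A"
  then obtain V f where V: "y.nbhd V" "f \<in> carrier (sec Z V)" "c = germ Z y V f" by (rule z_stalkE)
  interpret V: graded_algebra \<Lambda> "sec Z V" k "struct_on XX (pre V)" "act V" by (rule graded) (use V in simp)
  interpret gz: ring_hom_cring "sec Z V" A "germ Z y V" by (rule z_germ_hom_cring[OF V(1)])
  show "gr c \<in> carrier AG.GA"
    unfolding V(3) gr_germ[OF V(1,2)]
    by (rule ring_hom_closed[OF AG.ga_map_hom[OF gz.homh V.R.cring_axioms] V.rho_GA[OF V(2)]])
next
  fix c d assume "c \<in> carrier A" "d \<in> carrier A"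
  then obtain V f g where V: "y.nbhd V" "f \<in> carrier (sec Z V)" "g \<in> carrier (sec Z V)"
    "c = germ Z y V f" "d = germ Z y V g" by (rule z_stalkE2)
  interpret V: graded_algebra \<Lambda> "sec Z V" k "struct_on XX (pre V)" "act V" by (rule graded) (use V in simp)
  interpret gz: ring_hom_cring "sec Z V" A "germ Z y V" by (rule z_germ_hom_cring[OF V(1)])
  note m = AG.ga_map_hom[OF gz.homh V.R.cring_axioms]
  show "gr (c \<otimes>\<^bsub>A\<^esub> d) = gr c \<otimes>\<^bsub>AG.GA\<^esub> gr d"
    unfolding V(4,5) gz.hom_mult[OF V(2,3), symmetric] gr_germ[OF V(1) V.R.m_closed[OF V(2,3)]]
      gr_germ[OF V(1,2)] gr_germ[OF V(1,3)] V.rho.hom_mult[OF V(2,3)]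
    by (rule ring_hom_mult[OF m V.rho_GA[OF V(2)] V.rho_GA[OF V(3)]])
  show "gr (c \<oplus>\<^bsub>A\<^esub> d) = gr c \<oplus>\<^bsub>AG.GA\<^esub> gr d"
    unfolding V(4,5) gz.hom_add[OF V(2,3), symmetric] gr_germ[OF V(1) V.R.a_closed[OF V(2,3)]]
      gr_germ[OF V(1,2)] gr_germ[OF V(1,3)] V.rho.hom_add[OF V(2,3)]
    by (rule ring_hom_add[OF m V.rho_GA[OF V(2)] V.rho_GA[OF V(3)]])
next
  let ?T = "topspace (top_of YY)"
  interpret V: graded_algebra \<Lambda> "sec Z ?T" k "struct_on XX (pre ?T)" "act ?T" by (rule graded) simp
  interpret gz: ring_hom_cring "sec Z ?T" A "germ Z y ?T" by (rule z_germ_hom_cring[OF y.nbhd_space])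
  note m = AG.ga_map_hom[OF gz.homh V.R.cring_axioms]
  show "gr \<one>\<^bsub>A\<^esub> = \<one>\<^bsub>AG.GA\<^esub>"
    unfolding gz.hom_one[symmetric] gr_germ[OF y.nbhd_space V.R.one_closed] V.rho.hom_one
    by (rule ring_hom_one[OF m])
qed

lemma ga_map_const:
  "ring_hom_cring R S h \<Longrightarrow> ga_map \<Lambda> h (ga_const \<Lambda> R a) = ga_const \<Lambda> S (h a)"
  unfolding ga_map_def ga_const_def
  by (intro restrict_ext) (simp add: ring_hom_cring.hom_zero)

lemma pi_invariant: "Y.opn W \<Longrightarrow> g \<in> carrier (sec YY W) \<Longrightarrow> act W (\<pi>s W g) = ga_const \<Lambda> (sec Z W) (\<pi>s W g)"
  using pi_bij[of W] by (auto simp: bij_betw_def)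

lemma gr_coaction: "coaction B \<Lambda> A psi gr"
  unfolding coaction_def
proof (intro conjI ballI psi_hom gr_hom)
  fix c assume "c \<in> carrier B"
  then obtain V g where V: "y.nbhd V" "g \<in> carrier (sec YY V)" "c = germ YY y V g" by (rule y.stalkE)
  have Vo: "Y.opn V" using V(1) by simp
  show "gr (psi c) = ga_const \<Lambda> A (psi c)"
    unfolding V(3) psi_germ[OF V(1,2)] gr_germ[OF V(1) pi_closed[OF Vo V(2)]] pi_invariant[OF Vo V(2)]
    by (rule ga_map_const[OF z_germ_hom_cring[OF V(1)]])
next
  fix c assume "c \<in> carrier A"
  then obtain V f where V: "y.nbhd V" "f \<in> carrier (sec Z V)" "c = germ Z y V f" by (rule z_stalkE)
  interpret V: graded_algebra \<Lambda> "sec Z V" k "struct_on XX (pre V)" "act V" by (rule graded) (use V in simp)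
  interpret gz: ring_hom_cring "sec Z V" A "germ Z y V" by (rule z_germ_hom_cring[OF V(1)])
  have ac: "act V f l \<in> carrier (sec Z V)" if "l \<in> carrier \<Lambda>" for l by (rule V.rho_closed[OF V(2) that])
  have "finsum A (gr c) (carrier \<Lambda>) = finsum A (\<lambda>l. germ Z y V (act V f l)) (carrier \<Lambda>)"
    unfolding V(3) using gr_germ_comp[OF V(1,2)] gz.hom_closed[OF ac] by (intro A.finsum_cong') auto
  also have "\<dots> = germ Z y V (finsum (sec Z V) (act V f) (carrier \<Lambda>))"
    using ac by (subst gz.hom_finsum) (auto simp: o_def)
  also have "\<dots> = c" unfolding V.rho_sum[OF V(2)] V(3) ..
  finally show "finsum A (gr c) (carrier \<Lambda>) = c" .
  fix l m assume lm: "l \<in> carrier \<Lambda>" "m \<in> carrier \<Lambda>"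
  show "gr (gr c l) m = (if m = l then gr c l else \<zero>\<^bsub>A\<^esub>)"
    unfolding V(3) gr_germ_comp[OF V(1,2) lm(1)] gr_germ_comp[OF V(1) ac[OF lm(1)] lm(2)]
      V.rho_rho[OF V(2) lm] by simp
qed

sublocale gr: graded_algebra \<Lambda> A B psi gr
  by unfold_locales (rule gr_coaction)

lemma pi_surj_degree_one:
  assumes W: "Y.opn W" and s: "s \<in> hsec W \<one>\<^bsub>\<Lambda>\<^esub>"
  shows "s \<in> \<pi>s W ` carrier (sec YY W)"
proof -
  interpret W: graded_algebra \<Lambda> "sec Z W" k "struct_on XX (pre W)" "act W" by (rule graded[OF W])
  have "s \<in> {a \<in> carrier (sec Z W). act W a = ga_const \<Lambda> (sec Z W) a}"
    using s by (simp add: W.homog_def ga_const_monom)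
  then show ?thesis using pi_bij[OF W] by (simp add: bij_betw_def)
qed

text \<open>A germ of trivial degree is represented by the trivial component of any section
  representing it; this component is invariant, hence a function on Y because Y is the
  quotient.\<close>

lemma gr_degree_one: "gr.homog \<one>\<^bsub>\<Lambda>\<^esub> \<subseteq> psi ` carrier B"
proof
  fix c assume c: "c \<in> gr.homog \<one>\<^bsub>\<Lambda>\<^esub>"
  obtain V f where V: "y.nbhd V" "f \<in> carrier (sec Z V)" "c = germ Z y V f"
    using gr.homogD(1)[OF c] by (rule z_stalkE)
  have Vo: "Y.opn V" using V(1) by simp
  interpret V: graded_algebra \<Lambda> "sec Z V" k "struct_on XX (pre V)" "act V" by (rule graded[OF Vo])
  obtain g where g: "g \<in> carrier (sec YY V)" "act V f \<one>\<^bsub>\<Lambda>\<^esub> = \<pi>s V g"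
    using pi_surj_degree_one[OF Vo V.rho_homog[OF V(2) L.one_closed]] by blast
  have "c = gr c \<one>\<^bsub>\<Lambda>\<^esub>" using gr.homogD(2)[OF c L.one_closed] by simp
  also have "\<dots> = psi (germ YY y V g)"
    unfolding V(3) gr_germ_comp[OF V(1,2) L.one_closed] g(2) psi_germ[OF V(1) g(1)] ..
  finally show "c \<in> psi ` carrier B" using y.germ_closed[OF V(1) g(1)] by blast
qed

text \<open>Restriction from functions near the whole fibre over y to the local ring of X at the
  single point x.\<close>

definition at_x where "at_x c = (\<Union>(V, f)\<in>c. germ XX x (pre V) f)"

lemma at_x_germ:
  assumes V: "y.nbhd V" "f \<in> carrier (sec Z V)"
  shows "at_x (germ Z y V f) = germ XX x (pre V) f"
  unfolding at_x_def
proof (rule z.UN_germ[unfolded nbhd_iff, OF V])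
  fix W g assume W: "y.nbhd W" "g \<in> carrier (sec Z W)" and eq: "germ Z y W g = germ Z y V f"
  obtain U where U: "y.nbhd U" "U \<subseteq> W \<inter> V" "res Z W U g = res Z V U f"
    using eq z.germ_eq_iff[unfolded nbhd_iff, OF W V] by blast
  have "pre U \<subseteq> pre W \<inter> pre V" using U(2) by (auto simp: preim_def)
  then show "germ XX x (pre W) g = germ XX x (pre V) f"
    using W(2) V(2) U(3) unfolding Z_sec Z_res
    by (intro x.germ_eqI[OF pre_nbhd[OF W(1)] _ pre_nbhd[OF V(1)] _ pre_nbhd[OF U(1)]])
qed

sublocale at_x: ring_hom_cring A "stalk XX x" at_x
proof (intro ring_hom_cring.intro ring_hom_cring_axioms.intro A.cring_axioms x.stalk_cring ring_hom_memI)
  fix c assume "c \<in> carrier A"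
  then obtain V f where V: "y.nbhd V" "f \<in> carrier (sec Z V)" "c = germ Z y V f" by (rule z_stalkE)
  show "at_x c \<in> carrier (stalk XX x)"
    unfolding V(3) at_x_germ[OF V(1,2)] using V(2) by (intro x.germ_closed pre_nbhd[OF V(1)]) (simp add: Z_sec)
next
  fix c d assume "c \<in> carrier A" "d \<in> carrier A"
  then obtain V f g where V: "y.nbhd V" "f \<in> carrier (sec Z V)" "g \<in> carrier (sec Z V)"
    "c = germ Z y V f" "d = germ Z y V g" by (rule z_stalkE2)
  interpret gx: ring_hom_cring "sec XX (pre V)" "stalk XX x" "germ XX x (pre V)"
    by (rule x.germ_hom_cring[OF pre_nbhd[OF V(1)]])
  interpret gz: ring_hom_cring "sec Z V" A "germ Z y V" by (rule z_germ_hom_cring[OF V(1)])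
  note fg = V(2,3)[unfolded Z_sec]
  show "at_x (c \<otimes>\<^bsub>A\<^esub> d) = at_x c \<otimes>\<^bsub>stalk XX x\<^esub> at_x d"
    unfolding V(4,5) gz.hom_mult[OF V(2,3), symmetric] at_x_germ[OF V(1) gz.R.m_closed[OF V(2,3)]]
      at_x_germ[OF V(1,2)] at_x_germ[OF V(1,3)] unfolding Z_sec by (rule gx.hom_mult[OF fg])
  show "at_x (c \<oplus>\<^bsub>A\<^esub> d) = at_x c \<oplus>\<^bsub>stalk XX x\<^esub> at_x d"
    unfolding V(4,5) gz.hom_add[OF V(2,3), symmetric] at_x_germ[OF V(1) gz.R.a_closed[OF V(2,3)]]
      at_x_germ[OF V(1,2)] at_x_germ[OF V(1,3)] unfolding Z_sec by (rule gx.hom_add[OF fg])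
next
  let ?T = "topspace (top_of YY)"
  interpret gx: ring_hom_cring "sec XX (pre ?T)" "stalk XX x" "germ XX x (pre ?T)"
    by (rule x.germ_hom_cring[OF pre_nbhd[OF y.nbhd_space]])
  interpret gz: ring_hom_cring "sec Z ?T" A "germ Z y ?T" by (rule z_germ_hom_cring[OF y.nbhd_space])
  show "at_x \<one>\<^bsub>A\<^esub> = \<one>\<^bsub>stalk XX x\<^esub>"
    unfolding gz.hom_one[symmetric] at_x_germ[OF y.nbhd_space gz.R.one_closed]
    unfolding Z_sec by (rule gx.hom_one)
qed

text \<open>The contraction of the maximal ideal of the local ring at x; its image in the fibre ring
  is the ideal of the closed point x of the fibre.\<close>

definition P where "P = {c \<in> carrier A. at_x c \<in> stalk_max_ideal XX x}"

lemma P_prime: "primeideal P A"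
  unfolding P_def
  by (intro at_x.primeideal_vimage cring.maximalideal_prime[OF x.stalk_cring] scheme_stalk_max X.scheme x_space)

lemma n_max: "maximalideal \<nn> B"
  by (intro scheme_stalk_max Y.scheme y_space)

text \<open>The contrapositive of locality: a germ at y whose pullback is invertible at x is itself
  invertible.\<close>

lemma n_P: "psi ` \<nn> \<subseteq> P"
proof (rule image_subsetI)
  fix b assume b: "b \<in> \<nn>"
  then have bc: "b \<in> carrier B" "b \<notin> Units B" by (auto simp: stalk_max_ideal_def)
  obtain V g where V: "y.nbhd V" "g \<in> carrier (sec YY V)" "b = germ YY y V g" using bc(1) by (rule y.stalkE)
  have Vo: "Y.opn V" using V(1) by simp
  have eq: "at_x (psi b) = germ XX x (pre V) (\<pi>s V g)"
    unfolding V(3) psi_germ[OF V(1,2)] by (rule at_x_germ[OF V(1) pi_closed[OF Vo V(2)]])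
  have "at_x (psi b) \<notin> Units (stalk XX x)"
    unfolding eq using pi_local[OF x_space Vo _ V(2)] V(1) bc(2) unfolding V(3) by blast
  then show "psi b \<in> P"
    using ring_hom_closed[OF psi_hom bc(1)] at_x.hom_closed[of "psi b"] by (simp add: P_def stalk_max_ideal_def)
qed

sublocale red: graded_reduction \<Lambda> A B psi gr \<nn> P
  by (intro graded_reduction.intro graded_reduction_axioms.intro gr.graded_algebra_axioms n_max gr_degree_one P_prime n_P)

lemma one_minus_unit: "c \<in> \<nn> \<Longrightarrow> \<one>\<^bsub>B\<^esub> \<ominus>\<^bsub>B\<^esub> c \<in> Units B"
proof (rule ccontr)
  assume c: "c \<in> \<nn>" and u: "\<one>\<^bsub>B\<^esub> \<ominus>\<^bsub>B\<^esub> c \<notin> Units B"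
  have cc: "c \<in> carrier B" by (rule red.n.Icarr[OF c])
  then have "\<one>\<^bsub>B\<^esub> \<ominus>\<^bsub>B\<^esub> c \<in> \<nn>" using u by (simp add: stalk_max_ideal_def)
  then have "(\<one>\<^bsub>B\<^esub> \<ominus>\<^bsub>B\<^esub> c) \<oplus>\<^bsub>B\<^esub> c \<in> \<nn>" using c by (rule red.n.a_closed)
  then have "\<one>\<^bsub>B\<^esub> \<in> \<nn>" using cc by (simp add: a_minus_def B.a_assoc B.l_neg)
  then show False by (simp add: stalk_max_ideal_def)
qed

lemma finite_chart:
  obtains V h h' E where "y \<in> V" "g_variety_chart k \<Lambda> XX YY \<pi> \<pi>s act V h h'" "finite E" "E \<subseteq> carrier (sec Z V)"
    "\<And>a. a \<in> carrier (sec Z V) \<Longrightarrow>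
      \<exists>c\<in>E \<rightarrow> carrier (sec YY V). a = finsum (sec Z V) (\<lambda>e. \<pi>s V (c e) \<otimes>\<^bsub>sec Z V\<^esub> e) E"
proof -
  obtain V where V: "y \<in> V" "affine_open YY V" "affine_open XX (pre V)"
    "fin_gen_module (sec YY V) (sec XX (pre V)) (\<pi>s V)"
    using finite y_space unfolding finite_morphism_def by blast
  obtain h where h: "affine_chart YY V h" using V(2) by (rule Y.affine_openE)
  obtain h' where h': "affine_chart XX (pre V) h'" using V(3) by (rule X.affine_openE)
  have "g_variety_chart k \<Lambda> XX YY \<pi> \<pi>s act V h h'"
    by (intro g_variety_chart.intro g_variety_axioms h h')
  moreover obtain E where "finite E" "E \<subseteq> carrier (sec Z V)"
    "\<forall>a\<in>carrier (sec Z V). \<exists>c\<in>E \<rightarrow> carrier (sec YY V). a = finsum (sec Z V) (\<lambda>e. \<pi>s V (c e) \<otimes>\<^bsub>sec Z V\<^esub> e) E"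
    using V(4) unfolding fin_gen_module_def Z_sec by blast
  ultimately show thesis using that V(1) by blast
qed

text \<open>By \<open>frac\<close> a germ becomes the germ of a section over \<open>V\<close> after
  multiplication by a power of some \<open>f\<close>, and \<open>f\<close> is invertible in the
  local ring at y because y lies in D(f). So module generators over the chart generate the
  stalk.\<close>

lemma stalk_span:
  assumes "y \<in> V" "g_variety_chart k \<Lambda> XX YY \<pi> \<pi>s act V h h'" "finite E" "E \<subseteq> carrier (sec Z V)"
    and span: "\<And>a. a \<in> carrier (sec Z V) \<Longrightarrow>
      \<exists>c\<in>E \<rightarrow> carrier (sec YY V). a = finsum (sec Z V) (\<lambda>e. \<pi>s V (c e) \<otimes>\<^bsub>sec Z V\<^esub> e) E"
    and c: "c \<in> carrier A"
  shows "\<exists>b\<in>E \<rightarrow> carrier B. c = finsum A (\<lambda>e. psi (b e) \<otimes>\<^bsub>A\<^esub> germ Z y V e) E"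
proof -
  interpret C: g_variety_chart k \<Lambda> XX YY \<pi> \<pi>s act V h h' by fact
  interpret Cy: affine_point YY V h y by unfold_locales (rule assms(1))
  note nV = Cy.nU
  have Vo: "Y.opn V" using nV by simp
  interpret gV: ring_hom_cring "sec Z V" A "germ Z y V" by (rule z_germ_hom_cring[OF nV])
  have Ec: "e \<in> carrier (sec Z V)" if "e \<in> E" for e using assms(4) that by blast
  obtain W s where W: "y.nbhd W" "s \<in> carrier (sec Z W)" "c = germ Z y W s" using c by (rule z_stalkE)
  obtain f where f: "f \<in> carrier (sec YY V)" "y \<in> C.C.D f" "C.C.D f \<subseteq> W"
    using C.C.D_basis[of W y] W(1) assms(1) by blast
  let ?D = "C.C.D f"
  have nD: "y.nbhd ?D" using C.C.D_open[OF f(1)] f(2) by simp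
  have Do: "Y.opn ?D" and Wo: "Y.opn W" using nD W(1) by auto
  interpret gD: ring_hom_cring "sec Z ?D" A "germ Z y ?D" by (rule z_germ_hom_cring[OF nD])
  interpret r: ring_hom_cring "sec Z V" "sec Z ?D" "res Z V ?D" by (rule Z_hom_cring[OF Vo Do C.C.D_sub])
  interpret rW: ring_hom_cring "sec Z W" "sec Z ?D" "res Z W ?D" by (rule Z_hom_cring[OF Wo Do f(3)])
  let ?u = "res Z V ?D (\<pi>s V f)" and ?s = "res Z W ?D s"
  have sc: "?s \<in> carrier (sec Z ?D)" by (rule rW.hom_closed[OF W(2)])
  have uc: "?u \<in> carrier (sec Z ?D)" by (rule r.hom_closed[OF pi_closed[OF Vo f(1)]])
  obtain a n where a: "a \<in> carrier (sec Z V)" "?s \<otimes>\<^bsub>sec Z ?D\<^esub> ?u [^]\<^bsub>sec Z ?D\<^esub> (n::nat) = res Z V ?D a"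
    using C.frac(1)[OF f(1) sc] by blast
  let ?F = "germ YY y V f"
  have F: "?F \<in> Units B" by (rule Cy.germ_unit[OF f(1)]) (use f(2) in \<open>simp add: C.C.D_def\<close>)
  have Fc: "?F \<in> carrier B" by (rule B.Units_closed[OF F])
  have gs: "germ Z y ?D ?s = c" unfolding W(3) by (rule z_germ_res[OF W(1,2) nD f(3)])
  have gu: "germ Z y ?D ?u = psi ?F"
    unfolding psi_germ[OF nV f(1)] by (rule z_germ_res[OF nV pi_closed[OF Vo f(1)] nD C.C.D_sub])
  have ga: "germ Z y ?D (res Z V ?D a) = germ Z y V a" by (rule z_germ_res[OF nV a(1) nD C.C.D_sub])
  have "c \<otimes>\<^bsub>A\<^esub> psi ?F [^]\<^bsub>A\<^esub> n = germ Z y V a"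
    unfolding gs[symmetric] gu[symmetric] ga[symmetric] a(2)[symmetric]
    using sc uc by (simp add: gD.ring.hom_nat_pow)
  then have eq: "germ Z y V a = c \<otimes>\<^bsub>A\<^esub> psi (?F [^]\<^bsub>B\<^esub> n)" using Fc by (simp add: red.phi.ring.hom_nat_pow)
  let ?G = "?F [^]\<^bsub>B\<^esub> n"
  have G: "?G \<in> Units B" by (rule B.Units_pow_closed[OF F])
  have Gc: "?G \<in> carrier B" "inv\<^bsub>B\<^esub> ?G \<in> carrier B" using G by (auto intro: B.Units_closed B.Units_inv_closed)
  have "psi ?G \<otimes>\<^bsub>A\<^esub> psi (inv\<^bsub>B\<^esub> ?G) = \<one>\<^bsub>A\<^esub>"
    unfolding red.phi.hom_mult[OF Gc, symmetric] B.Units_r_inv[OF G] by (rule red.phi.hom_one)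
  moreover have "psi ?G \<in> carrier A" "psi (inv\<^bsub>B\<^esub> ?G) \<in> carrier A" by (rule red.phi.hom_closed[OF Gc(1)] red.phi.hom_closed[OF Gc(2)])+
  ultimately have c_eq: "c = psi (inv\<^bsub>B\<^esub> ?G) \<otimes>\<^bsub>A\<^esub> germ Z y V a"
    unfolding eq using c by (simp add: A.m_lcomm A.m_assoc A.m_comm[of "psi (inv\<^bsub>B\<^esub> ?G)"])
  obtain d where d: "d \<in> E \<rightarrow> carrier (sec YY V)" "a = finsum (sec Z V) (\<lambda>e. \<pi>s V (d e) \<otimes>\<^bsub>sec Z V\<^esub> e) E"
    using span[OF a(1)] by blast
  have dc: "d e \<in> carrier (sec YY V)" if "e \<in> E" for e using d(1) that by blast
  have pc: "\<pi>s V (d e) \<in> carrier (sec Z V)" if "e \<in> E" for e by (rule pi_closed[OF Vo dc[OF that]])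
  have gc: "germ YY y V (d e) \<in> carrier B" if "e \<in> E" for e by (rule y.germ_closed[OF nV dc[OF that]])
  let ?b = "\<lambda>e. inv\<^bsub>B\<^esub> ?G \<otimes>\<^bsub>B\<^esub> germ YY y V (d e)"
  have summand: "germ Z y V (\<pi>s V (d e) \<otimes>\<^bsub>sec Z V\<^esub> e) = psi (germ YY y V (d e)) \<otimes>\<^bsub>A\<^esub> germ Z y V e" if e: "e \<in> E" for e
    unfolding psi_germ[OF nV dc[OF e]] by (rule gV.hom_mult[OF pc[OF e] Ec[OF e]])
  have "germ Z y V a = finsum A (\<lambda>e. psi (germ YY y V (d e)) \<otimes>\<^bsub>A\<^esub> germ Z y V e) E"
  proof -
    have "germ Z y V a = finsum A (\<lambda>e. germ Z y V (\<pi>s V (d e) \<otimes>\<^bsub>sec Z V\<^esub> e)) E"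
      unfolding d(2) using pc Ec by (subst gV.hom_finsum) (auto simp: o_def)
    also have "\<dots> = finsum A (\<lambda>e. psi (germ YY y V (d e)) \<otimes>\<^bsub>A\<^esub> germ Z y V e) E"
      using summand red.phi.hom_closed[OF gc] gV.hom_closed[OF Ec] by (intro A.finsum_cong') auto
    finally show ?thesis .
  qed
  then have "c = psi (inv\<^bsub>B\<^esub> ?G) \<otimes>\<^bsub>A\<^esub> finsum A (\<lambda>e. psi (germ YY y V (d e)) \<otimes>\<^bsub>A\<^esub> germ Z y V e) E"
    using c_eq by simp
  also have "\<dots> = finsum A (\<lambda>e. psi (inv\<^bsub>B\<^esub> ?G) \<otimes>\<^bsub>A\<^esub> (psi (germ YY y V (d e)) \<otimes>\<^bsub>A\<^esub> germ Z y V e)) E"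
    using red.phi.hom_closed[OF gc] gV.hom_closed[OF Ec] red.phi.hom_closed[OF Gc(2)] assms(3)
    by (intro A.finsum_rdistr) auto
  also have "\<dots> = finsum A (\<lambda>e. psi (?b e) \<otimes>\<^bsub>A\<^esub> germ Z y V e) E"
  proof (rule A.finsum_cong')
    fix e assume e: "e \<in> E"
    show "psi (inv\<^bsub>B\<^esub> ?G) \<otimes>\<^bsub>A\<^esub> (psi (germ YY y V (d e)) \<otimes>\<^bsub>A\<^esub> germ Z y V e) = psi (?b e) \<otimes>\<^bsub>A\<^esub> germ Z y V e"
      unfolding red.phi.hom_mult[OF Gc(2) gc[OF e]]
      by (rule A.m_assoc[OF red.phi.hom_closed[OF Gc(2)] red.phi.hom_closed[OF gc[OF e]] gV.hom_closed[OF Ec[OF e]], symmetric])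
  next
    show "(\<lambda>e. psi (?b e) \<otimes>\<^bsub>A\<^esub> germ Z y V e) \<in> E \<rightarrow> carrier A"
      by (intro funcsetI A.m_closed red.phi.hom_closed B.m_closed Gc(2) gc gV.hom_closed Ec)
  qed simp
  finally show ?thesis by (intro bexI[of _ ?b] funcsetI B.m_closed Gc(2) gc)
qed

text \<open>The chart carries a section with nonzero component of degree \<open>l\<close>, and the
  germ of this component cannot vanish because restriction to a smaller nonempty open set is
  injective.\<close>

lemma gr_homog_nonzero:
  assumes "y \<in> V" "g_variety_chart k \<Lambda> XX YY \<pi> \<pi>s act V h h'" and l: "l \<in> carrier \<Lambda>"
  shows "gr.homog l \<noteq> {\<zero>\<^bsub>A\<^esub>}"
proof -
  interpret C: g_variety_chart k \<Lambda> XX YY \<pi> \<pi>s act V h h' by fact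
  interpret Cy: affine_point YY V h y by unfold_locales (rule assms(1))
  note nV = Cy.nU
  have Vo: "Y.opn V" "V \<noteq> {}" using nV by auto
  interpret V: graded_algebra \<Lambda> "sec Z V" k "struct_on XX (pre V)" "act V" by (rule graded[OF Vo(1)])
  obtain a where a: "a \<in> carrier (sec Z V)" "act V a l \<noteq> \<zero>\<^bsub>sec Z V\<^esub>" using C.chart_degrees[OF l Vo(2)] by blast
  have alc: "act V a l \<in> carrier (sec Z V)" by (rule V.rho_closed[OF a(1) l])
  have "germ Z y V (act V a l) \<noteq> \<zero>\<^bsub>A\<^esub>"
  proof
    assume "germ Z y V (act V a l) = \<zero>\<^bsub>A\<^esub>"
    then obtain W where W: "y.nbhd W" "W \<subseteq> V" "res Z V W (act V a l) = \<zero>\<^bsub>sec Z W\<^esub>"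
      using z.germ_eq_zero[unfolded nbhd_iff, OF nV alc] by blast
    have "Y.opn W" "W \<noteq> {}" using W(1) by auto
    from Z_inj[OF Vo(1) this(1) W(2) this(2) alc W(3)] a(2) show False by blast
  qed
  moreover have "germ Z y V (act V a l) \<in> gr.homog l"
    using gr.rho_homog[OF z_germ_closed[OF nV a(1)] l] unfolding gr_germ_comp[OF nV a(1) l] .
  ultimately show ?thesis by blast
qed

lemma fibre_homog_nonzero:
  assumes l: "l \<in> carrier \<Lambda>"
  shows "graded_algebra.homog \<Lambda> red.Abar (factor_coaction \<Lambda> A gr red.J) l \<noteq> {\<zero>\<^bsub>red.Abar\<^esub>}"
proof -
  obtain V h h' E where V: "y \<in> V" "g_variety_chart k \<Lambda> XX YY \<pi> \<pi>s act V h h'" "finite E" "E \<subseteq> carrier (sec Z V)"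
    "\<And>a. a \<in> carrier (sec Z V) \<Longrightarrow>
      \<exists>c\<in>E \<rightarrow> carrier (sec YY V). a = finsum (sec Z V) (\<lambda>e. \<pi>s V (c e) \<otimes>\<^bsub>sec Z V\<^esub> e) E"
    using finite_chart by blast
  interpret C: g_variety_chart k \<Lambda> XX YY \<pi> \<pi>s act V h h' by (rule V(2))
  have nV: "y.nbhd V" using C.C.U_open V(1) by simp
  show ?thesis
  proof (rule red.reduced_homog_nonzero[OF one_minus_unit V(3) _ _ l gr_homog_nonzero[OF V(1,2) l]])
    show "germ Z y V e \<in> carrier A" if "e \<in> E" for e by (rule z_germ_closed[OF nV]) (use that V(4) in blast)
    show "\<exists>b\<in>E \<rightarrow> carrier B. c = finsum A (\<lambda>e. psi (b e) \<otimes>\<^bsub>A\<^esub> germ Z y V e) E" if "c \<in> carrier A" for c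
      by (rule stalk_span[OF V that])
  qed
qed

section \<open>The fibre as a reduction modulo the maximal ideal of the local ring at y\<close>

lemma fibre_local_ideal_eq: "fibre_local_ideal XX YY \<pi> \<pi>s y = red.J"
  unfolding fibre_local_ideal_def fibre_local_ring_def red.J_def unfolding psi_def ..

lemma fibre_ring_eq: "fibre_ring XX YY \<pi> \<pi>s y = red.Abar"
  unfolding fibre_ring_def fibre_local_ideal_eq fibre_local_ring_def ..

lemma fibre_struct_eq: "fibre_struct XX YY \<pi> \<pi>s y = red.phibar"
  by (rule ext) (simp only: fibre_struct_def fibre_local_ideal_eq fibre_local_ring_def red.phibar_def,
      simp only: psi_def)

lemma fibre_coaction_eq: "fibre_coaction \<Lambda> XX YY \<pi> \<pi>s act y = factor_coaction \<Lambda> A gr red.J"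
  unfolding fibre_coaction_def fibre_local_ideal_eq fibre_local_ring_def
  by (rule ext) (simp add: factor_coaction_def gr_def cong: restrict_cong)

lemma residue_field_eq: "residue_field YY y = red.K"
  by (simp add: residue_field_def)

lemma fibre_point_ideal_eq: "fibre_point_ideal XX YY \<pi> \<pi>s x = a_r_coset A red.J ` P"
proof (rule Set.set_eqI)
  fix C
  have "C \<in> fibre_point_ideal XX YY \<pi> \<pi>s x \<longleftrightarrow>
      (\<exists>V f. y.nbhd V \<and> f \<in> carrier (sec Z V) \<and> germ XX x (pre V) f \<in> stalk_max_ideal XX x \<and>
        C = a_r_coset A red.J (germ Z y V f))"
    unfolding fibre_point_ideal_def fibre_local_ideal_eq fibre_local_ring_def mem_Collect_eq Z_sec by blast
  also have "\<dots> \<longleftrightarrow> C \<in> a_r_coset A red.J ` P"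
  proof
    assume "\<exists>V f. y.nbhd V \<and> f \<in> carrier (sec Z V) \<and> germ XX x (pre V) f \<in> stalk_max_ideal XX x \<and>
        C = a_r_coset A red.J (germ Z y V f)"
    then obtain V f where V: "y.nbhd V" "f \<in> carrier (sec Z V)" "germ XX x (pre V) f \<in> stalk_max_ideal XX x"
      "C = a_r_coset A red.J (germ Z y V f)" by blast
    have "germ Z y V f \<in> P"
      unfolding P_def mem_Collect_eq at_x_germ[OF V(1,2)] by (intro conjI z_germ_closed V)
    with V(4) show "C \<in> a_r_coset A red.J ` P" by (rule image_eqI)
  next
    assume "C \<in> a_r_coset A red.J ` P"
    then obtain c where c: "c \<in> P" "C = a_r_coset A red.J c" by blast
    have cc: "c \<in> carrier A" "at_x c \<in> stalk_max_ideal XX x" using c(1) unfolding P_def by blast+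
    obtain V f where V: "y.nbhd V" "f \<in> carrier (sec Z V)" "c = germ Z y V f" using cc(1) by (rule z_stalkE)
    have "germ XX x (pre V) f \<in> stalk_max_ideal XX x" using cc(2) unfolding V(3) at_x_germ[OF V(1,2)] .
    with V c(2) show "\<exists>V f. y.nbhd V \<and> f \<in> carrier (sec Z V) \<and> germ XX x (pre V) f \<in> stalk_max_ideal XX x \<and>
        C = a_r_coset A red.J (germ Z y V f)" by blast
  qed
  finally show "C \<in> fibre_point_ideal XX YY \<pi> \<pi>s x \<longleftrightarrow> C \<in> a_r_coset A red.J ` P" .
qed

lemma residue_struct_hom: "residue_struct YY y \<in> ring_hom k red.K"
proof -
  have s: "struct_map YY \<in> ring_hom k (sec YY (topspace (top_of YY)))"
    using Y_variety by (simp add: is_variety_def scheme_over_def)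
  have "(a_r_coset B \<nn> \<circ> germ YY y (topspace (top_of YY))) \<circ> struct_map YY \<in> ring_hom k red.K"
    by (intro ring_hom_trans[OF s] ring_hom_trans[OF y.germ_hom[OF y.nbhd_space]] red.n.rcos_ring_hom)
  also have "(a_r_coset B \<nn> \<circ> germ YY y (topspace (top_of YY))) \<circ> struct_map YY = residue_struct YY y"
    by (rule ext) (simp add: residue_struct_def)
  finally show ?thesis .
qed

end

theorem proposition5p1:
  fixes k :: "'k ring"
    and p :: nat
    and \<Lambda> :: "'l monoid"
    and XX :: "('p, 'a, 'k) kscheme"
    and YY :: "('q, 'b, 'k) kscheme"
    and \<pi> :: "'p \<Rightarrow> 'q"
    and \<pi>s :: "'q set \<Rightarrow> 'b \<Rightarrow> 'a"
    and act :: "'q set \<Rightarrow> 'a \<Rightarrow> 'l \<Rightarrow> 'a"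
    and D :: "'p set"
    and x :: 'p
    and y :: 'q
  assumes "field k"
    and "Factorial_Ring.prime p" and "[p] \<cdot>\<^bsub>k\<^esub> \<one>\<^bsub>k\<^esub> = \<zero>\<^bsub>k\<^esub>"
    and "comm_group \<Lambda>" and "finite (carrier \<Lambda>)"
    and "is_variety k YY" and "normal_scheme YY"
    and "G_variety_over k \<Lambda> XX YY \<pi> \<pi>s act"
    and "prime_divisor XX D" and "generic_point XX D x"
    and "y = \<pi> x"
  shows
    "let K = residue_field YY y;
         \<kappa> = residue_struct YY y;
         A = fibre_ring XX YY \<pi> \<pi>s y;
         \<phi> = fibre_struct XX YY \<pi> \<pi>s y;
         \<rho> = fibre_coaction \<Lambda> XX YY \<pi> \<pi>s act y;
         \<m> = fibre_point_ideal XX YY \<pi> \<pi>s x;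
         H\<^sub>K = (\<lambda>H. subgroup_base_change \<kappa> K \<Lambda> H);
         inv\<^sub>H = (\<lambda>H. invariants \<Lambda> A \<phi> \<rho> (H\<^sub>K H));
         A\<^sub>H = (\<lambda>H. A\<lparr>carrier := inv\<^sub>H H\<rparr>);
         Q\<^sub>K = (\<lambda>H. extend_coords \<Lambda> K \<kappa> (quotient_group_coords k \<Lambda> H))
     in \<exists>I. largest_proper_graded_ideal \<Lambda> A \<rho> I \<and>
          (\<exists>!H. subgroup_scheme k \<Lambda> H \<and>
             inv\<^sub>H H \<inter> I = {\<zero>\<^bsub>A\<^esub>} \<and> inv\<^sub>H H <+>\<^bsub>A\<^esub> I = carrier A) \<and>
          (\<forall>H. subgroup_scheme k \<Lambda> H \<and>
             inv\<^sub>H H \<inter> I = {\<zero>\<^bsub>A\<^esub>} \<and> inv\<^sub>H H <+>\<^bsub>A\<^esub> I = carrier A \<longrightarrow>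
             is_torsor K \<Lambda> (Q\<^sub>K H) (A\<^sub>H H) \<phi> \<rho> \<and>
             is_centralizer K \<Lambda> A \<phi> \<rho> \<m> (H\<^sub>K H) \<and>
             (\<exists>J. orbit_ideal \<Lambda> A \<rho> \<m> J \<and>
                equivariantly_isomorphic K \<Lambda> (Q\<^sub>K H)
                  (A\<^sub>H H) \<phi> \<rho>
                  (A Quot J) (\<lambda>r. a_r_coset A J (\<phi> r)) (factor_coaction \<Lambda> A \<rho> J)))"
proof -
  interpret k: field k by fact
  interpret \<Lambda>: comm_group \<Lambda> by fact
  interpret \<Lambda>: finite_comm_group \<Lambda> by unfold_locales fact
  interpret V: g_variety_fibre k \<Lambda> XX YY \<pi> \<pi>s act x
    by unfold_locales (use assms in \<open>auto simp: generic_point_def\<close>)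
  interpret F: graded_fibre \<Lambda> V.red.Abar V.red.K V.red.phibar "factor_coaction \<Lambda> V.A V.gr V.red.J"
    by (rule V.red.reduced_fibre)
  have full: "\<forall>l\<in>carrier \<Lambda>. F.homog l \<noteq> {\<zero>\<^bsub>V.red.Abar\<^esub>}" using V.fibre_homog_nonzero by blast
  note fibre_structure = F.graded_fibre_structure[OF assms(1) V.residue_struct_hom V.red.reduced_prime full]
  show ?thesis
    unfolding Let_def assms(11) V.residue_field_eq V.fibre_ring_eq V.fibre_struct_eq V.fibre_coaction_eq
      V.fibre_point_ideal_eq
  proof (intro exI[of _ F.nonunit_ideal] conjI allI, goal_cases)
    case 1
    show ?case by (rule F.largest_nonunit_ideal)
  next
    case 2
    show ?case by (rule fibre_structure(1))
  next
    case (3 H)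
    show ?case
    proof (rule impI, goal_cases)
      case 1
      \<comment> \<open>The decomposition forces \<open>H\<close> to belong to the unit degrees, so
        its base change, its invariants and the coordinates of the quotient are all known
        explicitly.\<close>
      note eqs = fibre_structure(2)[OF 1[THEN conjunct1] 1[THEN conjunct2, THEN conjunct1] 1[THEN conjunct2, THEN conjunct2]]
      show ?case
        unfolding eqs[THEN conjunct2, THEN conjunct1] unfolding eqs[THEN conjunct1] eqs[THEN conjunct2, THEN conjunct2]
        \<comment> \<open>The witness for the ideal of the orbit is the largest proper graded ideal
          itself.\<close>
        by (intro conjI exI[of _ F.nonunit_ideal] F.supported_torsor F.supported_equivariant_iso
            F.orbit_nonunit_ideal F.centralizer_unit_degrees V.red.reduced_prime)
    qed
  qed
qed

end
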